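(* Let $(M,g)$ be a $3$-dimensional compact Riemannian manifold without boundary and let $e,q>0$. Let $f:\mathbb{R}\to\mathbb{R}$ be a continuous function, let $F(s)=\int_0^s f(t)\,dt$, and assume that (i) there exist $C>0$ and $p\in(2,6)$ such that $|f(s)|\le C(1+|s|^{p-1})$ for all $s\in\mathbb{R}$; (ii) there exist $\eta>4$ and $\tau_0>0$ such that $0<\eta F(s)\le sf(s)$ for all $|s|\ge\tau_0$. Then there exists $\lambda_0>0$ such that for every $0<\lambda<\lambda_0$ the system $$\begin{cases}-\Delta_g u+u+eu\phi=\lambda f(u) & \text{in } M,\\ -\Delta_g\phi+\phi=qu^2 & \text{in } M\end{cases}$$ has at least two weak solutions in $H^1_g(M)\times H^1_g(M)$.
   Context: $H^1_g(M)$ is the usual Sobolev space on $(M,g)$, $dv_g$ is the Riemannian volume measure and $\Delta_g$ the Laplace–Beltrami operator. A pair $(u,\phi)\in H^1_g(M)\times H^1_g(M)$ is a weak solution of the system if $$\int_M(\langle\nabla_g u,\nabla_g v\rangle+uv+eu\phi v)\,dv_g=\int_M\lambda f(u)v\,dv_g\quad\text{for all }v\in H^1_g(M),$$ $$\int_M(\langle\nabla_g\phi,\nabla_g\psi\rangle+\phi\psi)\,dv_g=q\int_M u^2\psi\,dv_g\quad\text{for all }\psi\in H^1_g(M).$$ *)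

theory Defs
  imports "HOL-Analysis.Analysis"
begin

section \<open>Smooth functions on open subsets of a Euclidean space\<close>

primrec C_k_on :: "nat \<Rightarrow> 'e::euclidean_space set \<Rightarrow> ('e \<Rightarrow> 'b::real_normed_vector) \<Rightarrow> bool" where
  "C_k_on 0 S f \<longleftrightarrow> continuous_on S f"
| "C_k_on (Suc k) S f \<longleftrightarrow>
     (\<forall>x\<in>S. f differentiable (at x)) \<and>
     (\<forall>b\<in>Basis. C_k_on k S (\<lambda>x. frechet_derivative f (at x) b))"

definition smooth_on :: "'e::euclidean_space set \<Rightarrow> ('e \<Rightarrow> 'b::real_normed_vector) \<Rightarrow> bool" where
  "smooth_on S f \<longleftrightarrow> (\<forall>k. C_k_on k S f)"

section \<open>Compact Riemannian manifolds\<close>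

text \<open>
  The manifold is the whole type \<open>'a\<close>. A chart is a pair of an open domain and a coordinate map,
  whose values outside the domain are irrelevant. The atlas \<open>A\<close> need not be maximal. Charts map
  onto open subsets of \<open>real ^ 'n\<close>, so there is no boundary.
\<close>

type_synonym ('a, 'n) chart = "'a set \<times> ('a \<Rightarrow> real ^ 'n)"

abbreviation (input) dom_of :: "('a, 'n::finite) chart \<Rightarrow> 'a set" where
  "dom_of c \<equiv> fst c"

abbreviation (input) coords :: "('a, 'n::finite) chart \<Rightarrow> 'a \<Rightarrow> real ^ 'n" where
  "coords c \<equiv> snd c"

definition chart_inv :: "('a, 'n::finite) chart \<Rightarrow> real ^ 'n \<Rightarrow> 'a" where
  "chart_inv c = inv_into (dom_of c) (coords c)"

definition smooth_atlas :: "('a::topological_space, 'n::finite) chart set \<Rightarrow> bool" where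
  "smooth_atlas A \<longleftrightarrow>
     (\<Union>c\<in>A. dom_of c) = UNIV \<and>
     (\<forall>c\<in>A. open (dom_of c) \<and> open (coords c ` dom_of c) \<and>
        homeomorphism (dom_of c) (coords c ` dom_of c) (coords c) (chart_inv c)) \<and>
     (\<forall>c\<in>A. \<forall>d\<in>A. smooth_on (coords c ` (dom_of c \<inter> dom_of d)) (coords d \<circ> chart_inv c))"

definition transition_jacobian ::
    "('a, 'n::finite) chart \<Rightarrow> ('a, 'n) chart \<Rightarrow> 'a \<Rightarrow> real ^ 'n ^ 'n" where
  "transition_jacobian c d p =
     matrix (frechet_derivative (coords d \<circ> chart_inv c) (at (coords c p)))"

text \<open>
  A metric \<open>g\<close> assigns to a chart \<open>c\<close> and a point \<open>p\<close> of its domain the Gram matrix \<open>g\<^sub>i\<^sub>j\<close> at \<open>p\<close>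
  of the coordinate vector fields of \<open>c\<close>.
\<close>

definition riemannian_metric ::
    "('a, 'n::finite) chart set \<Rightarrow> (('a, 'n) chart \<Rightarrow> 'a \<Rightarrow> real ^ 'n ^ 'n) \<Rightarrow> bool" where
  "riemannian_metric A g \<longleftrightarrow>
     (\<forall>c\<in>A. smooth_on (coords c ` dom_of c) (g c \<circ> chart_inv c) \<and>
        (\<forall>p\<in>dom_of c. transpose (g c p) = g c p \<and> (\<forall>v. v \<noteq> 0 \<longrightarrow> v \<bullet> (g c p *v v) > 0))) \<and>
     (\<forall>c\<in>A. \<forall>d\<in>A. \<forall>p\<in>dom_of c \<inter> dom_of d.
        g c p = transpose (transition_jacobian c d p) ** g d p ** transition_jacobian c d p)"

locale compact_riemannian_manifold =
  fixes A :: "('a::{t2_space, second_countable_topology}, 'n::finite) chart set"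
    and g :: "('a, 'n) chart \<Rightarrow> 'a \<Rightarrow> real ^ 'n ^ 'n"
  assumes compact: "compact (UNIV :: 'a set)"
    and atlas: "smooth_atlas A"
    and metric: "riemannian_metric A g"

text \<open>
  The Riemannian volume is the unique Borel measure with density \<open>sqrt (det g\<^sub>i\<^sub>j)\<close> with respect to
  Lebesgue measure in every chart.
\<close>

definition volume_measure ::
    "('a::topological_space, 'n::finite) chart set \<Rightarrow> (('a, 'n) chart \<Rightarrow> 'a \<Rightarrow> real ^ 'n ^ 'n)
      \<Rightarrow> 'a measure" where
  "volume_measure A g =
     (THE \<mu>. sets \<mu> = sets borel \<and>
        (\<forall>c\<in>A. \<forall>B\<in>sets borel. B \<subseteq> dom_of c \<longrightarrow>
           emeasure \<mu> B =
             (\<integral>\<^sup>+x\<in>coords c ` B. ennreal (sqrt (det (g c (chart_inv c x)))) \<partial>lborel)))"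

section \<open>Vector fields and gradients\<close>

text \<open>
  A vector field is given by its components in every chart, subject to the transformation law.
\<close>

definition vector_field ::
    "('a, 'n::finite) chart set \<Rightarrow> (('a, 'n) chart \<Rightarrow> 'a \<Rightarrow> real ^ 'n) \<Rightarrow> bool" where
  "vector_field A X \<longleftrightarrow>
     (\<forall>c\<in>A. \<forall>d\<in>A. \<forall>p\<in>dom_of c \<inter> dom_of d. X d p = transition_jacobian c d p *v X c p)"

definition measurable_vector_field ::
    "('a::topological_space, 'n::finite) chart set \<Rightarrow> (('a, 'n) chart \<Rightarrow> 'a \<Rightarrow> real ^ 'n) \<Rightarrow> bool" where
  "measurable_vector_field A X \<longleftrightarrow>
     vector_field A X \<and> (\<forall>c\<in>A. X c \<in> borel_measurable (restrict_space borel (dom_of c)))"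

text \<open>
  For vector fields the value below does not depend on the chart that is chosen around \<open>p\<close>.
\<close>

definition riem_inner ::
    "('a, 'n::finite) chart set \<Rightarrow> (('a, 'n) chart \<Rightarrow> 'a \<Rightarrow> real ^ 'n ^ 'n)
      \<Rightarrow> (('a, 'n) chart \<Rightarrow> 'a \<Rightarrow> real ^ 'n) \<Rightarrow> (('a, 'n) chart \<Rightarrow> 'a \<Rightarrow> real ^ 'n) \<Rightarrow> 'a \<Rightarrow> real" where
  "riem_inner A g X Y p =
     (let c = (SOME c. c \<in> A \<and> p \<in> dom_of c) in X c p \<bullet> (g c p *v Y c p))"

definition smooth_fun :: "('a, 'n::finite) chart set \<Rightarrow> ('a \<Rightarrow> real) \<Rightarrow> bool" where
  "smooth_fun A u \<longleftrightarrow> (\<forall>c\<in>A. smooth_on (coords c ` dom_of c) (u \<circ> chart_inv c))"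

text \<open>In coordinates the gradient has the components \<open>\<Sum>j. g\<^sup>i\<^sup>j \<partial>\<^sub>j u\<close>.\<close>

definition gradient ::
    "(('a, 'n::finite) chart \<Rightarrow> 'a \<Rightarrow> real ^ 'n ^ 'n) \<Rightarrow> ('a \<Rightarrow> real)
      \<Rightarrow> ('a, 'n) chart \<Rightarrow> 'a \<Rightarrow> real ^ 'n" where
  "gradient g u c p =
     matrix_inv (g c p) *v
       (\<chi> j. frechet_derivative (u \<circ> chart_inv c) (at (coords c p)) (axis j 1))"

section \<open>The Sobolev space and weak solutions\<close>

text \<open>
  \<open>H1 A g\<close> is the completion of the smooth functions with respect to the norm whose square is
  \<open>\<integral> \<bar>\<nabla>u\<bar>\<^sup>2 + u\<^sup>2\<close>, realised inside \<open>L\<^sup>2\<close>: \<open>u\<close> and its weak gradient \<open>X\<close> are the \<open>L\<^sup>2\<close>-limits of smooth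
  functions and of their gradients. The elements are functions, not classes modulo null sets.
\<close>

definition has_weak_gradient ::
    "('a::topological_space, 'n::finite) chart set \<Rightarrow> (('a, 'n) chart \<Rightarrow> 'a \<Rightarrow> real ^ 'n ^ 'n)
      \<Rightarrow> ('a \<Rightarrow> real) \<Rightarrow> (('a, 'n) chart \<Rightarrow> 'a \<Rightarrow> real ^ 'n) \<Rightarrow> bool" where
  "has_weak_gradient A g u X \<longleftrightarrow>
     u \<in> borel_measurable borel \<and> integrable (volume_measure A g) (\<lambda>p. (u p)\<^sup>2) \<and>
     measurable_vector_field A X \<and> integrable (volume_measure A g) (riem_inner A g X X) \<and>
     (\<exists>U. (\<forall>n. smooth_fun A (U n)) \<and>
        (\<lambda>n::nat. LINT p|volume_measure A g. (U n p - u p)\<^sup>2) \<longlonglongrightarrow> 0 \<and>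
        (\<lambda>n. LINT p|volume_measure A g.
           (let D = (\<lambda>c p. gradient g (U n) c p - X c p) in riem_inner A g D D p)) \<longlonglongrightarrow> 0)"

definition H1 ::
    "('a::topological_space, 'n::finite) chart set \<Rightarrow> (('a, 'n) chart \<Rightarrow> 'a \<Rightarrow> real ^ 'n ^ 'n)
      \<Rightarrow> ('a \<Rightarrow> real) set" where
  "H1 A g = {u. \<exists>X. has_weak_gradient A g u X}"

text \<open>The choice is irrelevant: weak gradients are unique almost everywhere.\<close>

definition weak_gradient ::
    "('a::topological_space, 'n::finite) chart set \<Rightarrow> (('a, 'n) chart \<Rightarrow> 'a \<Rightarrow> real ^ 'n ^ 'n)
      \<Rightarrow> ('a \<Rightarrow> real) \<Rightarrow> ('a, 'n) chart \<Rightarrow> 'a \<Rightarrow> real ^ 'n" where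
  "weak_gradient A g u = (SOME X. has_weak_gradient A g u X)"

definition weak_solution ::
    "('a::topological_space, 'n::finite) chart set \<Rightarrow> (('a, 'n) chart \<Rightarrow> 'a \<Rightarrow> real ^ 'n ^ 'n)
      \<Rightarrow> real \<Rightarrow> real \<Rightarrow> (real \<Rightarrow> real) \<Rightarrow> real \<Rightarrow> ('a \<Rightarrow> real) \<Rightarrow> ('a \<Rightarrow> real) \<Rightarrow> bool" where
  "weak_solution A g e q f lam u \<phi> \<longleftrightarrow>
     u \<in> H1 A g \<and> \<phi> \<in> H1 A g \<and>
     (\<forall>v\<in>H1 A g.
        (LINT p|volume_measure A g.
           riem_inner A g (weak_gradient A g u) (weak_gradient A g v) p + u p * v p + e * u p * \<phi> p * v p)
        = (LINT p|volume_measure A g. lam * f (u p) * v p)) \<and>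
     (\<forall>\<psi>\<in>H1 A g.
        (LINT p|volume_measure A g.
           riem_inner A g (weak_gradient A g \<phi>) (weak_gradient A g \<psi>) p + \<phi> p * \<psi> p)
        = q * (LINT p|volume_measure A g. (u p)\<^sup>2 * \<psi> p))"

end

theory Submission
  imports Defs "HOL-Library.Diagonal_Subsequence" "HOL-Library.Function_Algebras"
begin

text \<open>
  The system is variational. For \<open>u\<close> in \<open>H1\<close> the second equation has a unique weak solution
  \<open>\<Phi>(u)\<close>, the Riesz representative of \<open>v \<mapsto> q \<integral> u\<^sup>2 v\<close>, and inserting it into the first equation
  leaves the Euler-Lagrange equation of
  \<open>J(u) = 1/2 |u|\<^sup>2 + e/(4q) |\<Phi>(u)|\<^sup>2 - lam \<integral> F(u)\<close>. The two solutions are critical points of \<open>J\<close> at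
  different levels. On the unit sphere \<open>J\<close> is at least \<open>1/4\<close> once \<open>lam\<close> is small, because
  \<open>\<integral> F(u)\<close> is bounded there and the middle term is nonnegative; \<open>J(0) \<le> 0\<close>; and along large constants
  \<open>J\<close> tends to minus infinity, since \<open>|\<Phi>(u)|\<^sup>2\<close> is homogeneous of degree 4 while \<open>F\<close> grows at least
  like the power \<open>\<eta> > 4\<close>. Hence the infimum over the unit ball gives a critical point with
  \<open>J \<le> 0\<close> (\<open>local_minimum\<close>) and the passage over the sphere gives one with \<open>J \<ge> 1/4\<close>
  (\<open>mountain_pass\<close>). A solution determines its own level almost everywhere
  (\<open>critical_energy_cong_AE\<close>), so the two solutions differ on a set of positive measure.

  Both existence principles follow from Ekeland's variational principle together with the
  Palais-Smale condition. The latter holds because the gradient of \<open>J\<close> is the identity plus a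
  map that is continuous from bounded sets with the \<open>L\<^sup>r\<close> distance, \<open>r < 6\<close>, to \<open>H1\<close>
  (\<open>compact_map\<close>), because bounded sequences of \<open>H1\<close> have subsequences that are Cauchy in \<open>L\<^sup>r\<close>,
  and because \<open>\<eta> > 4\<close> bounds every Palais-Smale sequence.

  What is needed about the manifold is that \<open>H1\<close> is complete, that weak gradients are unique, and
  that \<open>H1\<close> embeds compactly into \<open>L\<^sup>r\<close> for \<open>2 < r < 6\<close>. All of this is derived on dyadic cubes in
  coordinates. A \<open>C\<^sup>1\<close> function is compared with its averages over the dyadic cubes of side
  \<open>2\<^sup>-\<^sup>k\<close>; by the Poincare inequality, consecutive averages differ by the square root of
  \<open>2\<^sup>k\<close> times the energy of the cube, and these differences are summable in \<open>L\<^sup>r\<close> exactly when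
  \<open>r < 6\<close> (\<open>avg_error\<close>). Since only finitely many averages occur at a given scale, the same estimate
  yields boundedness and compactness. Compactness of the manifold provides finitely many cubes whose
  preimages cover it and on which metric and volume density are comparable with the Euclidean ones
  (\<open>patches\<close>).

  Elements of \<open>H1\<close> are functions, so its inner product is only semidefinite; the abstract part is
  therefore carried out for a complete semidefinite inner product (\<open>semi_hilbert\<close>), and vanishing of a
  vector is replaced by vanishing of its seminorm.
\<close>

notation scaleR (infixr "*R" 75)
notation LIMSEQ (infixr "---->" 60)

section \<open>Ekeland's principle and complete semidefinite inner products\<close>

text \<open>
  Starting at \<open>x0\<close>, each point of the sequence below nearly minimises \<open>\<Phi>\<close> over the points
  that violate the conclusion for its predecessor. The values decrease, hence the sequence is Cauchy, and
  its limit has no violating points left. The distance \<open>d\<close> may vanish between different points, as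
  the distance of a seminorm does.
\<close>

lemma ekeland:
 fixes d :: "'x => 'x => real" and \<Phi> :: "'x => real"
 assumes x0: "x0 : M" and eps: "eps > 0"
  and self: "!!x. x : M ==> d x x = 0"
  and nonneg: "!!x y. x : M ==> y : M ==> 0 <= d x y"
  and tri: "!!x y z. x : M ==> y : M ==> z : M ==> d x z <= d x y + d y z"
  and complete: "!!\<sigma>. (!!n::nat. \<sigma> n : M) ==> (!!e. e > 0 ==> EX N. ALL m>=N. ALL n>=m. d (\<sigma> m) (\<sigma> n) < e)
   ==> EX l:M. (%n. d (\<sigma> n) l) ----> 0"
  and lsc: "!!\<sigma> l c. (!!n::nat. \<sigma> n : M) ==> l : M ==> (%n. d (\<sigma> n) l) ----> 0
   ==> (%n. \<Phi> (\<sigma> n)) ----> c ==> \<Phi> l <= c"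
  and bdd: "!!x. x : M ==> b <= \<Phi> x"
 shows "EX x:M. \<Phi> x <= \<Phi> x0 & (ALL y:M. \<Phi> x <= \<Phi> y + eps * d x y)"
proof -
 define S where "S x = {y : M. \<Phi> y + eps * d x y <= \<Phi> x}" for x
 have near_inf: "EX y:S x. ALL z:S x. \<Phi> y <= \<Phi> z + (1/2)^n" if x: "x : M" for x and n :: nat
 proof -
  have ne: "x : S x" using x self by (simp add: S_def)
  have bb: "bdd_below (\<Phi> ` S x)" using bdd by (auto simp: bdd_below_def S_def)
  obtain y where y: "y : S x" "\<Phi> y < Inf (\<Phi> ` S x) + (1/2)^n"
   using cInf_lessD[of "\<Phi> ` S x" "Inf (\<Phi> ` S x) + (1/2)^n"] ne by auto
  have "\<Phi> y <= \<Phi> z + (1/2)^n" if "z : S x" for z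
   using y(2) cInf_lower[OF _ bb, of "\<Phi> z"] that by force
  then show ?thesis using y(1) by blast
 qed
 have "EX \<sigma>. ALL n. \<sigma> n : M & (n = 0 --> \<sigma> n = x0) &
   (\<sigma> (Suc n) : S (\<sigma> n) & (ALL z:S (\<sigma> n). \<Phi> (\<sigma> (Suc n)) <= \<Phi> z + (1/2)^n))"
 proof -
  have "EX \<sigma>. ALL n. (\<sigma> n : M & (n = 0 --> \<sigma> n = x0)) &
   (\<sigma> (Suc n) : S (\<sigma> n) & (ALL z:S (\<sigma> n). \<Phi> (\<sigma> (Suc n)) <= \<Phi> z + (1/2)^n))"
  proof (rule dependent_nat_choice)
   show "EX x. x : M & (0 = 0 --> x = x0)" using x0 by blast
  next
   fix x and n :: nat assume "x : M & (n = 0 --> x = x0)"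
   then have x: "x : M" by blast
   obtain y where y: "y\<in>S x" "ALL z:S x. \<Phi> y <= \<Phi> z + (1/2)^n" using near_inf[OF x] by blast
   have "y : M" using y(1) by (simp add: S_def)
   then show "EX y. (y : M & (Suc n = 0 --> y = x0)) & y : S x & (ALL z:S x. \<Phi> y <= \<Phi> z + (1/2)^n)"
    using y by blast
  qed
  then show ?thesis by simp
 qed
 then obtain \<sigma> where \<sigma>: "!!n. \<sigma> n : M" "\<sigma> 0 = x0" "!!n. \<sigma> (Suc n) : S (\<sigma> n)"
  "!!n z. z : S (\<sigma> n) ==> \<Phi> (\<sigma> (Suc n)) <= \<Phi> z + (1/2)^n" by blast
 have dist: "eps * d (\<sigma> m) (\<sigma> n) <= \<Phi> (\<sigma> m) - \<Phi> (\<sigma> n)" if "m <= n" for m n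
  using that
 proof (induction n rule: dec_induct)
  case base
  then show ?case using self[OF \<sigma>(1)] by simp
 next
  case (step n)
  have "eps * d (\<sigma> m) (\<sigma> (Suc n)) <= eps * (d (\<sigma> m) (\<sigma> n) + d (\<sigma> n) (\<sigma> (Suc n)))"
   using tri[OF \<sigma>(1) \<sigma>(1) \<sigma>(1)] eps by simp
  also have "... = eps * d (\<sigma> m) (\<sigma> n) + eps * d (\<sigma> n) (\<sigma> (Suc n))" by (simp add: algebra_simps)
  also have "... <= \<Phi> (\<sigma> m) - \<Phi> (\<sigma> (Suc n))" using step.IH \<sigma>(3)[of n] by (simp add: S_def)
  finally show ?case .
 qed
 have dec: "\<Phi> (\<sigma> n) <= \<Phi> (\<sigma> m)" if "m <= n" for m n
  using dist[OF that] nonneg[OF \<sigma>(1) \<sigma>(1), of m n] eps by (smt (verit) mult_nonneg_nonneg)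
 have "convergent (%n. \<Phi> (\<sigma> n))"
 proof (rule Bseq_monoseq_convergent)
  show "Bseq (%n. \<Phi> (\<sigma> n))"
  proof (rule BseqI'[where K = "abs b + abs (\<Phi> (\<sigma> 0))"])
   show "norm (\<Phi> (\<sigma> n)) <= abs b + abs (\<Phi> (\<sigma> 0))" for n using bdd[OF \<sigma>(1), of n] dec[of 0 n] by auto
  qed
  show "monoseq (%n. \<Phi> (\<sigma> n))" using dec by (auto simp: monoseq_def)
 qed
 then obtain L where L: "(%n. \<Phi> (\<sigma> n)) ----> L" by (auto simp: convergent_def)
 have "EX N. ALL m>=N. ALL n>=m. d (\<sigma> m) (\<sigma> n) < e" if e: "e > 0" for e
 proof -
  obtain N where N: "!!m n. m >= N ==> n >= N ==> abs (\<Phi> (\<sigma> m) - \<Phi> (\<sigma> n)) < eps * e"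
   using CauchyD[OF LIMSEQ_imp_Cauchy[OF L], of "eps * e"] e eps by auto
  have "d (\<sigma> m) (\<sigma> n) < e" if "m >= N" "n >= m" for m n
  proof -
   have "eps * d (\<sigma> m) (\<sigma> n) < eps * e" using dist[OF that(2)] N[of m n] that by linarith
   then show ?thesis using eps by simp
  qed
  then show ?thesis by blast
 qed
 then obtain l where l: "l : M" "(%n. d (\<sigma> n) l) ----> 0" using complete[of \<sigma>] \<sigma>(1) by blast
 have lL: "\<Phi> l <= L" by (rule lsc[OF \<sigma>(1) l L])
 have lS: "l : S (\<sigma> n)" for n
 proof -
  have "(%m. \<Phi> (\<sigma> n) - \<Phi> (\<sigma> m) + eps * d (\<sigma> m) l) ----> \<Phi> (\<sigma> n) - L + eps * 0"
   by (intro tendsto_intros L l(2))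
  moreover have "eventually (%m. eps * d (\<sigma> n) l <= \<Phi> (\<sigma> n) - \<Phi> (\<sigma> m) + eps * d (\<sigma> m) l) sequentially"
  proof (rule eventually_sequentiallyI[of n])
   fix m assume "n <= m"
   have "eps * d (\<sigma> n) l <= eps * (d (\<sigma> n) (\<sigma> m) + d (\<sigma> m) l)" using tri[OF \<sigma>(1) \<sigma>(1) l(1)] eps by simp
   then show "eps * d (\<sigma> n) l <= \<Phi> (\<sigma> n) - \<Phi> (\<sigma> m) + eps * d (\<sigma> m) l"
    using dist[OF \<open>n <= m\<close>] by (simp add: algebra_simps)
  qed
  ultimately have "eps * d (\<sigma> n) l <= \<Phi> (\<sigma> n) - L + eps * 0"
   by (intro tendsto_lowerbound[of _ _ sequentially]) auto
  then show ?thesis using lL l(1) by (simp add: S_def)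
 qed
 have "\<Phi> l <= \<Phi> y + eps * d l y" if y: "y : M" for y
 proof (rule ccontr)
  assume "\<not> ?thesis"
  then have lt: "\<Phi> y + eps * d l y < \<Phi> l" by simp
  have "y : S (\<sigma> n)" for n
  proof -
   have "eps * d (\<sigma> n) y <= eps * (d (\<sigma> n) l + d l y)" using tri[OF \<sigma>(1) l(1) y] eps by simp
   then show ?thesis using lt lS[of n] y by (simp add: S_def algebra_simps)
  qed
  then have "\<Phi> (\<sigma> (Suc n)) <= \<Phi> y + (1/2)^n" for n using \<sigma>(4) by blast
  then have "L <= \<Phi> y + 0"
   by (intro LIMSEQ_le[OF LIMSEQ_Suc[OF L], of "%n. \<Phi> y + (1/2)^n"] tendsto_intros LIMSEQ_realpow_zero) auto
  then show False using lL lt mult_nonneg_nonneg[OF less_imp_le[OF eps] nonneg[OF l(1) y]] by linarith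
 qed
 moreover have "\<Phi> l <= \<Phi> x0" using lL dec[of 0] \<sigma>(2) LIMSEQ_le_const2[OF L] by (metis order_trans zero_le)
 ultimately show ?thesis using l(1) by blast
qed

text \<open>
  The inner product lives on a subspace of an ambient vector space and may vanish on nonzero
  vectors. Completeness is stated for its seminorm.
\<close>

locale semi_hilbert =
 fixes H :: "'v::real_vector set" and ip :: "'v => 'v => real"
 assumes sub: "subspace H"
  and ip_commute: "u : H ==> v : H ==> ip u v = ip v u"
  and ip_add: "u : H ==> v : H ==> w : H ==> ip (u + v) w = ip u w + ip v w"
  and ip_scale: "u : H ==> w : H ==> ip (a *R u) w = a * ip u w"
  and ip_nonneg: "u : H ==> 0 <= ip u u"
  and complete: "(!!n::nat. \<sigma> n : H) ==>
   (!!e. e > 0 ==> EX N. ALL m>=N. ALL n>=N. sqrt (ip (\<sigma> m - \<sigma> n) (\<sigma> m - \<sigma> n)) < e) ==>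
   EX l:H. (%n. sqrt (ip (\<sigma> n - l) (\<sigma> n - l))) ----> 0"
begin

definition nrm :: "'v => real" where "nrm u = sqrt (ip u u)"

abbreviation tends :: "(nat => 'v) => 'v => bool" where
 "tends \<sigma> l \<equiv> (%n. nrm (\<sigma> n - l)) ----> 0"

definition cauchy :: "(nat => 'v) => bool" where
 "cauchy \<sigma> \<longleftrightarrow> (ALL e>0. EX N. ALL m>=N. ALL n>=N. nrm (\<sigma> m - \<sigma> n) < e)"

lemma cauchy_converges: "(!!n. \<sigma> n : H) ==> cauchy \<sigma> ==> EX l:H. tends \<sigma> l"
 using complete[of \<sigma>] unfolding cauchy_def nrm_def by auto

lemma H_intros [simp, intro]:
 "0 : H" "u : H ==> v : H ==> u + v : H" "u : H ==> v : H ==> u - v : H"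
 "u : H ==> a *R u : H" "u : H ==> - u : H"
 using sub by (auto simp: subspace_0 subspace_add subspace_diff subspace_scale subspace_neg)

lemma ip_add_right: "u : H ==> v : H ==> w : H ==> ip w (u + v) = ip w u + ip w v"
 using ip_add[of u v w] ip_commute by (metis H_intros(2))

lemma ip_scale_right: "u : H ==> w : H ==> ip w (a *R u) = a * ip w u"
 using ip_scale[of u w a] ip_commute by (metis H_intros(4))

lemma ip_minus: "u : H ==> w : H ==> ip (- u) w = - ip u w"
 using ip_scale[of u w "-1"] by simp

lemma ip_minus_right: "u : H ==> w : H ==> ip w (- u) = - ip w u"
 using ip_scale_right[of u w "-1"] by simp

lemma ip_diff: "u : H ==> v : H ==> w : H ==> ip (u - v) w = ip u w - ip v w"
 using ip_add[of u "-v" w] ip_minus[of v w] by simp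

lemma ip_diff_right: "u : H ==> v : H ==> w : H ==> ip w (u - v) = ip w u - ip w v"
 using ip_add_right[of u "-v" w] ip_minus_right[of v w] by simp

lemmas ip_simps = ip_add ip_add_right ip_diff ip_diff_right ip_scale ip_scale_right ip_minus ip_minus_right

lemma ip_zero [simp]: "w : H ==> ip 0 w = 0" "w : H ==> ip w 0 = 0"
 using ip_scale[of w w 0] ip_scale_right[of w w 0] by auto

lemma nrm_nonneg [simp]: "u : H ==> 0 <= nrm u"
 by (simp add: nrm_def ip_nonneg)

lemma nrm_sq: "u : H ==> (nrm u)^2 = ip u u"
 by (simp add: nrm_def ip_nonneg)

lemma nrm_zero [simp]: "nrm 0 = 0"
 by (simp add: nrm_def)

lemma cauchy_schwarz:
 assumes u: "u : H" and v: "v : H"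
 shows "abs (ip u v) <= nrm u * nrm v"
proof -
 have q: "0 <= ip u u - 2 * t * ip u v + t^2 * ip v v" for t
 proof -
  have "0 <= ip (u - t *R v) (u - t *R v)" using u v ip_nonneg by auto
  also have "... = ip u u - 2 * t * ip u v + t^2 * ip v v"
   using u v ip_commute[OF u v] by (simp add: ip_simps power2_eq_square algebra_simps)
  finally show ?thesis .
 qed
 have "(ip u v)^2 <= ip u u * ip v v"
 proof (cases "ip v v = 0")
  case True
  have "ip u v = 0"
  proof (rule ccontr)
   assume ne: "ip u v \<noteq> 0"
   show False using q[of "(ip u u + 1) / (2 * ip u v)"] True ne by (simp add: field_simps)
  qed
  then show ?thesis using True by simp
 next
  case False
  then have pos: "ip v v > 0" using ip_nonneg[OF v] by simp
  have "0 <= ip u u - (ip u v)^2 / ip v v"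
   using q[of "ip u v / ip v v"] pos by (simp add: field_simps power2_eq_square)
  then show ?thesis using pos by (simp add: field_simps)
 qed
 then have "abs (ip u v) <= sqrt (ip u u * ip v v)" by (simp add: real_le_rsqrt)
 then show ?thesis by (simp add: nrm_def real_sqrt_mult)
qed

lemma nrm_triangle:
 assumes u: "u : H" and v: "v : H"
 shows "nrm (u + v) <= nrm u + nrm v"
proof (rule power2_le_imp_le)
 have "(nrm (u + v))^2 = ip u u + 2 * ip u v + ip v v"
  using u v ip_commute[OF u v] by (simp add: nrm_sq ip_simps)
 also have "... <= (nrm u)^2 + 2 * (nrm u * nrm v) + (nrm v)^2"
  using cauchy_schwarz[OF u v] u v by (simp add: nrm_sq)
 also have "... = (nrm u + nrm v)^2" by (simp add: power2_sum)
 finally show "(nrm (u + v))^2 <= (nrm u + nrm v)^2" .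
qed (use u v in simp)

lemma nrm_scale: "u : H ==> nrm (a *R u) = abs a * nrm u"
 by (simp add: nrm_def ip_simps real_sqrt_mult flip: mult.assoc power2_eq_square)

lemma nrm_minus: "u : H ==> nrm (- u) = nrm u"
 using nrm_scale[of u "-1"] by simp

lemma nrm_diff_commute: "u : H ==> v : H ==> nrm (u - v) = nrm (v - u)"
 using nrm_minus[of "u - v"] by simp

lemma nrm_diff_triangle: "u : H ==> v : H ==> w : H ==> nrm (u - w) <= nrm (u - v) + nrm (v - w)"
 using nrm_triangle[of "u - v" "v - w"] by simp

lemma nrm_diff_le: "u : H ==> v : H ==> nrm (u - v) <= nrm u + nrm v"
 using nrm_triangle[of u "- v"] nrm_minus[of v] by simp

lemma nrm_reverse: "u : H ==> v : H ==> abs (nrm u - nrm v) <= nrm (u - v)"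
 using nrm_triangle[of "u - v" v] nrm_triangle[of "v - u" u] nrm_diff_commute[of u v] by simp

lemma tends_nrm:
 assumes "!!n. \<sigma> n : H" "u : H" "tends \<sigma> u"
 shows "(%n. nrm (\<sigma> n)) ----> nrm u"
proof -
 have "(%n. nrm (\<sigma> n) - nrm u) ----> 0"
  by (rule Lim_null_comparison[OF _ assms(3)]) (use nrm_reverse assms in auto)
 then show ?thesis by (simp add: LIM_zero_iff)
qed

lemma tends_const [simp]: "tends (%n. u) u"
 by simp

lemma tends_add:
 assumes "!!n. \<sigma> n : H" "!!n. \<tau> n : H" "u : H" "v : H" "tends \<sigma> u" "tends \<tau> v"
 shows "tends (%n. \<sigma> n + \<tau> n) (u + v)"
proof (rule Lim_null_comparison)
 show "(%n. nrm (\<sigma> n - u) + nrm (\<tau> n - v)) ----> 0" using tendsto_add[OF assms(5,6)] by simp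
 have "nrm (\<sigma> n + \<tau> n - (u + v)) <= nrm (\<sigma> n - u) + nrm (\<tau> n - v)" for n
  using nrm_triangle[of "\<sigma> n - u" "\<tau> n - v"] assms by (simp add: algebra_simps)
 then show "\<forall>\<^sub>F n in sequentially. norm (nrm (\<sigma> n + \<tau> n - (u + v))) <= nrm (\<sigma> n - u) + nrm (\<tau> n - v)"
  using assms by auto
qed

lemma tends_scale:
 assumes "!!n. \<sigma> n : H" "u : H" "tends \<sigma> u" "a ----> b"
 shows "tends (%n. a n *R \<sigma> n) (b *R u)"
proof (rule Lim_null_comparison)
 have "(%n. abs (a n) * nrm (\<sigma> n - u) + abs (a n - b) * nrm u) ----> (abs b) * 0 + abs (b - b) * nrm u"
  by (intro tendsto_intros assms)
 then show "(%n. abs (a n) * nrm (\<sigma> n - u) + abs (a n - b) * nrm u) ----> 0" by simp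
 have "nrm (a n *R \<sigma> n - b *R u) <= abs (a n) * nrm (\<sigma> n - u) + abs (a n - b) * nrm u" for n
  using nrm_triangle[of "a n *R (\<sigma> n - u)" "(a n - b) *R u"] assms
  by (simp add: nrm_scale) (simp add: algebra_simps)
 then show "\<forall>\<^sub>F n in sequentially. norm (nrm (a n *R \<sigma> n - b *R u)) <= abs (a n) * nrm (\<sigma> n - u) + abs (a n - b) * nrm u"
  using assms by auto
qed

lemma tends_ip:
 assumes "!!n. \<sigma> n : H" "!!n. \<tau> n : H" "u : H" "v : H" "tends \<sigma> u" "tends \<tau> v"
 shows "(%n. ip (\<sigma> n) (\<tau> n)) ----> ip u v"
proof -
 have "(%n. ip (\<sigma> n) (\<tau> n) - ip u v) ----> 0"
 proof (rule Lim_null_comparison)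
  have "(%n. nrm (\<sigma> n - u) * nrm (\<tau> n) + nrm u * nrm (\<tau> n - v)) ----> 0 * nrm v + nrm u * 0"
   by (intro tendsto_intros assms tends_nrm)
  then show "(%n. nrm (\<sigma> n - u) * nrm (\<tau> n) + nrm u * nrm (\<tau> n - v)) ----> 0" by simp
  have "abs (ip (\<sigma> n) (\<tau> n) - ip u v) <= nrm (\<sigma> n - u) * nrm (\<tau> n) + nrm u * nrm (\<tau> n - v)" for n
  proof -
   have "ip (\<sigma> n) (\<tau> n) - ip u v = ip (\<sigma> n - u) (\<tau> n) + ip u (\<tau> n - v)"
    using assms by (simp add: ip_simps)
   then show ?thesis
    using cauchy_schwarz[of "\<sigma> n - u" "\<tau> n"] cauchy_schwarz[of u "\<tau> n - v"] assms by (auto intro: order_trans[OF abs_triangle_ineq])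
  qed
  then show "\<forall>\<^sub>F n in sequentially. norm (ip (\<sigma> n) (\<tau> n) - ip u v) <= nrm (\<sigma> n - u) * nrm (\<tau> n) + nrm u * nrm (\<tau> n - v)"
   by simp
 qed
 then show ?thesis by (simp add: LIM_zero_iff)
qed

lemma cauchyI_le:
 assumes "!!e. e > 0 ==> EX N. ALL m>=N. ALL n>=N. nrm (\<sigma> m - \<sigma> n) <= e"
 shows "cauchy \<sigma>"
 unfolding cauchy_def
proof (intro allI impI)
 fix e :: real assume "e > 0"
 then obtain N where "ALL m>=N. ALL n>=N. nrm (\<sigma> m - \<sigma> n) <= e/2" using assms[of "e/2"] by auto
 then show "EX N. ALL m>=N. ALL n>=N. nrm (\<sigma> m - \<sigma> n) < e" using \<open>e > 0\<close> by (intro exI[of _ N]) force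
qed

lemma nrm_le_by_duality:
 assumes w: "w : H" and le: "!!v. v : H ==> nrm v <= 1 ==> ip w v <= C"
 shows "nrm w <= C"
proof (cases "nrm w = 0")
 case True then show ?thesis using le[of 0] w by simp
next
 case False
 then have pos: "nrm w > 0" using nrm_nonneg[OF w] by simp
 have "ip w ((1 / nrm w) *R w) <= C" using w pos by (intro le) (auto simp: nrm_scale)
 moreover have "ip w ((1 / nrm w) *R w) = nrm w"
  using w pos by (simp add: ip_simps nrm_sq[symmetric] power2_eq_square)
 ultimately show ?thesis by simp
qed

text \<open>
  The vector is the limit of a minimising sequence for \<open>ip v v - 2 * l v\<close>; the parallelogram
  identity makes that sequence Cauchy. It is unique only up to seminorm zero.
\<close>

lemma riesz:
 assumes add: "!!u v. u : H ==> v : H ==> l (u + v) = l u + l v"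
  and scale: "!!a u. u : H ==> l (a *R u) = a * l u"
  and bounded: "!!v. v : H ==> nrm v <= 1 ==> abs (l v) <= C"
 shows "EX w:H. ALL v:H. ip w v = l v"
proof -
 have C0: "0 <= C" using bounded[of 0] by simp
 have bd: "abs (l v) <= C * nrm v" if v: "v : H" for v
 proof (cases "nrm v = 0")
  case True
  have "l v = 0"
  proof (rule ccontr)
   assume ne: "l v \<noteq> 0"
   have "abs (l (((C + 1) / l v) *R v)) <= C" using v True by (intro bounded) (auto simp: nrm_scale)
   then show False using ne scale[OF v] C0 by simp
  qed
  then show ?thesis using True by simp
 next
  case False
  then have pos: "nrm v > 0" using nrm_nonneg[OF v] by simp
  have "abs (l ((1 / nrm v) *R v)) <= C" using v pos by (intro bounded) (auto simp: nrm_scale)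
  then show ?thesis using scale[OF v] pos by (simp add: field_simps)
 qed
 have ldiff: "l (u - v) = l u - l v" if "u : H" "v : H" for u v
  using add[of u "(-1) *R v"] scale[of v "-1"] that by simp
 (* Q v is the squared distance of v from the representative, up to a constant. *)
 define Q where "Q v = ip v v - 2 * l v" for v
 have Qlow: "- C\<^sup>2 <= Q v" if v: "v : H" for v
 proof -
  have "0 <= (nrm v - C)^2" by simp
  then have "2 * (C * nrm v) <= ip v v + C^2" using nrm_sq[OF v] by (simp add: power2_diff mult_ac)
  then show ?thesis using bd[OF v] unfolding Q_def by linarith
 qed
 define m where "m = Inf (Q ` H)"
 have bb: "bdd_below (Q ` H)" using Qlow by (auto simp: bdd_below_def)
 have m: "m <= Q v" if "v : H" for v unfolding m_def by (rule cInf_lower) (use that bb in auto)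
 have "EX v:H. Q v < m + inverse (real (Suc n))" for n
  using cInf_lessD[of "Q ` H" "m + inverse (real (Suc n))"] unfolding m_def by fastforce
 then obtain \<sigma> where \<sigma>: "!!n. \<sigma> n : H" "!!n. Q (\<sigma> n) < m + inverse (real (Suc n))" by metis
 have par: "(nrm (u - v))^2 = 2 * Q u + 2 * Q v - 4 * Q ((1/2) *R (u + v))" if "u : H" "v : H" for u v
  using that ip_commute[OF that] unfolding Q_def
  by (simp add: nrm_sq ip_simps add scale algebra_simps)
 have lim0: "(%n. inverse (real (Suc n))) ----> 0" by (rule LIMSEQ_inverse_real_of_nat)
 have "cauchy \<sigma>"
 proof (rule cauchyI_le)
  fix e :: real assume e: "e > 0"
  then have "eventually (%n. inverse (real (Suc n)) < e^2 / 4) sequentially"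
   using lim0 by (intro order_tendstoD(2)) auto
  then obtain N where N: "!!n. n >= N ==> inverse (real (Suc n)) < e^2 / 4" by (auto simp: eventually_sequentially)
  have "nrm (\<sigma> i - \<sigma> j) <= e" if "i >= N" "j >= N" for i j
  proof (rule power2_le_imp_le)
   show "(nrm (\<sigma> i - \<sigma> j))^2 <= e^2"
    using par[OF \<sigma>(1) \<sigma>(1), of i j] \<sigma>(2)[of i] \<sigma>(2)[of j] m[of "(1/2) *R (\<sigma> i + \<sigma> j)"] \<sigma>(1) N[OF that(1)] N[OF that(2)] by auto
  qed (use e in simp)
  then show "EX N. ALL m>=N. ALL n>=N. nrm (\<sigma> m - \<sigma> n) <= e" by blast
 qed
 then obtain w where w: "w : H" "tends \<sigma> w" using cauchy_converges[of \<sigma>] \<sigma>(1) by meson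
 have "(%n. l (\<sigma> n) - l w) ----> 0"
 proof (rule Lim_null_comparison)
  show "(%n. C * nrm (\<sigma> n - w)) ----> 0" using tendsto_mult_right_zero[OF w(2)] by simp
  have "norm (l (\<sigma> n) - l w) <= C * nrm (\<sigma> n - w)" for n
   using bd[of "\<sigma> n - w"] ldiff[OF \<sigma>(1) w(1), of n] \<sigma>(1) w(1) by simp
  then show "\<forall>\<^sub>F n in sequentially. norm (l (\<sigma> n) - l w) <= C * nrm (\<sigma> n - w)" by simp
 qed
 then have ll: "(%n. l (\<sigma> n)) ----> l w" by (simp add: LIM_zero_iff)
 have "(%n. Q (\<sigma> n)) ----> Q w"
  unfolding Q_def by (intro tendsto_intros ll tends_ip) (use \<sigma> w in auto)
 moreover have "(%n. m + inverse (real (Suc n))) ----> m + 0" by (intro tendsto_intros lim0)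
 ultimately have Qw: "Q w <= m + 0"
  by (rule LIMSEQ_le) (use \<sigma>(2) less_imp_le in blast)
 have "ip w v = l v" if v: "v : H" for v
 proof -
  define a where "a = ip w v - l v"
  have "0 <= t^2 * ip v v + 2 * t * a" for t
  proof -
   have "Q (w + t *R v) = Q w + t^2 * ip v v + 2 * t * a"
    using w v ip_commute[OF w(1) v] by (simp add: Q_def a_def ip_simps add scale power2_eq_square algebra_simps)
   then show ?thesis using Qw m[of "w + t *R v"] w v by auto
  qed
  from this[of "- a / (ip v v + 1)"]
  have "0 <= ((- a / (ip v v + 1))^2 * ip v v + 2 * (- a / (ip v v + 1)) * a) * (ip v v + 1)^2"
   by (intro mult_nonneg_nonneg) auto
  also have "... = - (a^2 * (ip v v + 2))"
   using ip_nonneg[OF v] by (simp add: field_simps power2_eq_square add_nonneg_eq_0_iff)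
  finally have "a^2 <= 0" using ip_nonneg[OF v] by (simp add: mult_le_0_iff)
  then show ?thesis by (simp add: a_def)
 qed
 then show ?thesis using w(1) by blast
qed

end

section \<open>Local minima and mountain passes\<close>

text \<open>
  \<open>G\<close> is a gradient for \<open>J\<close>: it represents the directional derivatives. Continuity and the
  Palais-Smale condition are phrased sequentially with respect to the seminorm.
\<close>

locale ps_functional = semi_hilbert +
 fixes J :: "'a => real" and G :: "'a => 'a"
 assumes G_in: "u : H ==> G u : H"
  and deriv: "u : H ==> w : H ==>
   ((%s. J (u + s *R w)) has_real_derivative ip (G (u + s *R w)) w) (at s)"
  and G_cont: "(!!n::nat. \<sigma> n : H) ==> u : H ==> tends \<sigma> u ==> tends (%n. G (\<sigma> n)) (G u)"
  and ps: "(!!n::nat. \<sigma> n : H) ==> (!!n. abs (J (\<sigma> n)) <= c) ==> (%n. nrm (G (\<sigma> n))) ----> 0 ==>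
   EX u:H. EX r. strict_mono (r :: nat => nat) & tends (%n. \<sigma> (r n)) u"
begin

lemma mean_value:
 assumes u: "u : H" and w: "w : H" and s: "s > 0"
 shows "EX t. 0 < t & t < s & J (u + s *R w) - J u = s * ip (G (u + t *R w)) w"
proof -
 have "EX t. 0 < t & t < s & J (u + s *R w) - J (u + 0 *R w) = (s - 0) * ip (G (u + t *R w)) w"
  by (rule MVT2[OF s]) (rule deriv[OF u w])
 then show ?thesis by simp
qed

lemma J_tends:
 assumes \<sigma>: "!!n. \<sigma> n : H" and u: "u : H" and lim: "tends \<sigma> u"
 shows "(%n. J (\<sigma> n)) ----> J u"
proof -
 have "EX t. 0 < t & t < 1 & J (\<sigma> n) - J u = ip (G (u + t *R (\<sigma> n - u))) (\<sigma> n - u)" for n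
  using mean_value[of u "\<sigma> n - u" 1] \<sigma> u by auto
 then obtain t where t: "!!n. 0 < t n" "!!n. t n < 1"
  "!!n. J (\<sigma> n) - J u = ip (G (u + t n *R (\<sigma> n - u))) (\<sigma> n - u)" by metis
 have "tends (%n. u + t n *R (\<sigma> n - u)) u"
 proof (rule Lim_null_comparison[OF _ lim])
  have "abs (t n) * nrm (\<sigma> n - u) <= 1 * nrm (\<sigma> n - u)" for n
   using t(1,2)[of n] \<sigma> u by (intro mult_right_mono) auto
  then show "\<forall>\<^sub>F n in sequentially. norm (nrm (u + t n *R (\<sigma> n - u) - u)) <= nrm (\<sigma> n - u)"
   using \<sigma> u by (simp add: nrm_scale)
 qed
 then have "tends (%n. G (u + t n *R (\<sigma> n - u))) (G u)"
  using G_cont[of "%n. u + t n *R (\<sigma> n - u)" u] \<sigma> u by simp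
 then have "(%n. ip (G (u + t n *R (\<sigma> n - u))) (\<sigma> n - u)) ----> ip (G u) 0"
  using lim \<sigma> u G_in by (intro tends_ip) auto
 then have "(%n. J (\<sigma> n) - J u) ----> 0" using t(3) u G_in by simp
 then show ?thesis by (simp add: LIM_zero_iff)
qed

lemma G_null_limit:
 assumes \<sigma>: "!!n. \<sigma> n : H" and u: "u : H" and lim: "tends \<sigma> u" and G0: "(%n. nrm (G (\<sigma> n))) ----> 0"
 shows "nrm (G u) = 0"
proof -
 have "(%n. nrm (G (\<sigma> n))) ----> nrm (G u)"
  by (rule tends_nrm) (use G_cont[OF \<sigma> u lim] \<sigma> u G_in in auto)
 then show ?thesis using G0 LIMSEQ_unique by blast
qed

text \<open>
  Moving from \<open>x\<close> in the direction \<open>- G x\<close> decreases \<open>J\<close> at the rate \<open>nrm (G x)\<close> per unit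
  length, which an almost minimality with slope \<open>\<epsilon>\<close> does not permit beyond \<open>\<epsilon>\<close>.
\<close>

lemma slope_le:
 assumes x: "x : H" and eps: "eps > 0" and \<delta>: "\<delta> > 0"
  and min: "!!y. y : H ==> nrm (x - y) < \<delta> ==> J x <= J y + eps * nrm (x - y)"
 shows "nrm (G x) <= eps"
proof (rule ccontr)
 assume "\<not> ?thesis"
 then have g: "nrm (G x) > eps" by simp
 have Gx: "G x : H" using G_in x by blast
 have "((%s. J (x + s *R (- G x)) + s * (eps * nrm (G x))) has_real_derivative
   ip (G (x + 0 *R (- G x))) (- G x) + eps * nrm (G x)) (at 0)"
  using x Gx by (intro DERIV_add deriv DERIV_cmult_Id[where c="eps * nrm (G x)", unfolded mult.commute[of "eps * nrm (G x)"]] H_intros)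
 then have "((%s. J (x + s *R (- G x)) + s * (eps * nrm (G x))) has_real_derivative
   - (nrm (G x))\<^sup>2 + eps * nrm (G x)) (at 0)"
  using x Gx by (simp add: ip_simps nrm_sq)
 moreover have "- (nrm (G x))\<^sup>2 + eps * nrm (G x) < 0"
  using g eps by (simp add: power2_eq_square)
 ultimately have "EX d>0. ALL h>0. h < d --> J (x + h *R (- G x)) + h * (eps * nrm (G x)) < J x"
  using DERIV_neg_dec_right[of "%s. J (x + s *R (- G x)) + s * (eps * nrm (G x))" _ 0] by fastforce
 then obtain d where d: "d > 0" "!!h. 0 < h ==> h < d ==>
   J (x + h *R (- G x)) + h * (eps * nrm (G x)) < J x" by blast
 define h where "h = min (d/2) (\<delta> / (2 * nrm (G x)))"
 have h: "0 < h" "h < d" using d(1) g eps \<delta> by (auto simp: h_def min_def)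
 have "h * nrm (G x) <= \<delta> / (2 * nrm (G x)) * nrm (G x)"
  using g eps by (intro mult_right_mono) (auto simp: h_def)
 then have hd: "h * nrm (G x) < \<delta>" using g eps \<delta> by simp
 have e: "nrm (x - (x + h *R (- G x))) = h * nrm (G x)" using h Gx by (simp add: nrm_scale)
 have "J x <= J (x + h *R (- G x)) + eps * (h * nrm (G x))"
  using min[of "x + h *R (- G x)"] e hd x Gx by simp
 then show False using d(2)[OF h] by (simp add: mult_ac)
qed

text \<open>
  Ekeland's principle on the closed ball gives almost minimisers at nonpositive level. They lie in
  the open ball because \<open>J\<close> is positive on the sphere, so \<open>slope_le\<close> applies to them and produces a
  Palais-Smale sequence.
\<close>

theorem local_minimum:
 assumes a: "a : H" "nrm a < \<rho>" "J a <= 0" and \<alpha>: "\<alpha> > 0"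
  and sphere: "!!u. u : H ==> nrm u = \<rho> ==> \<alpha> <= J u"
  and below: "!!u. u : H ==> nrm u <= \<rho> ==> b <= J u"
 shows "EX u:H. nrm (G u) = 0 & J u <= 0"
proof -
 define M where "M = {u : H. nrm u <= \<rho>}"
 have ex: "EX x:M. J x <= 0 & nrm (G x) <= eps" if eps: "eps > 0" for eps
 proof -
  have "EX x:M. J x <= J a & (ALL y:M. J x <= J y + eps * nrm (x - y))"
  proof (rule ekeland[of a M eps "%x y. nrm (x - y)" J b])
   fix \<sigma> :: "nat => 'a"
   assume \<sigma>: "!!n. \<sigma> n : M" and c: "!!e. e > 0 ==> EX N. ALL m>=N. ALL n>=m. nrm (\<sigma> m - \<sigma> n) < e"
   have \<sigma>H: "\<sigma> n : H" "nrm (\<sigma> n) <= \<rho>" for n using \<sigma>[of n] by (auto simp: M_def)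
   have "cauchy \<sigma>" unfolding cauchy_def
   proof (intro allI impI)
    fix e :: real assume "e > 0"
    then obtain N where "ALL m>=N. ALL n>=m. nrm (\<sigma> m - \<sigma> n) < e" using c by blast
    then have "nrm (\<sigma> m - \<sigma> n) < e" if "m >= N" "n >= N" for m n
     using that nrm_diff_commute[OF \<sigma>H(1) \<sigma>H(1), of m n] by (metis linear)
    then show "EX N. ALL m>=N. ALL n>=N. nrm (\<sigma> m - \<sigma> n) < e" by blast
   qed
   then obtain l where l: "l : H" "tends \<sigma> l" using cauchy_converges[of \<sigma>] \<sigma>H(1) by meson
   have "nrm l <= \<rho>"
    by (rule LIMSEQ_le_const2[OF tends_nrm[OF \<sigma>H(1) l]]) (use \<sigma>H in auto)
   then show "EX l:M. tends \<sigma> l" using l by (auto simp: M_def)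
  next
   fix \<sigma> :: "nat => 'a" and l c
   assume \<sigma>: "!!n. \<sigma> n : M" "l : M" "tends \<sigma> l" "(%n. J (\<sigma> n)) ----> c"
   then have "(%n. J (\<sigma> n)) ----> J l" by (intro J_tends) (auto simp: M_def)
   then show "J l <= c" using \<sigma>(4) LIMSEQ_unique by blast
  qed (use a eps below nrm_diff_triangle in \<open>auto simp: M_def\<close>)
  then obtain x where x: "x : M" "J x <= J a" "!!y. y : M ==> J x <= J y + eps * nrm (x - y)" by blast
  have xH: "x : H" "nrm x <= \<rho>" using x(1) by (auto simp: M_def)
  have "nrm x \<noteq> \<rho>" using sphere[OF xH(1)] x(2) a \<alpha> by auto
  then have lt: "0 < \<rho> - nrm x" using xH by simp
  have "nrm (G x) <= eps"
  proof (rule slope_le[OF xH(1) eps lt])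
   fix y assume y: "y : H" "nrm (x - y) < \<rho> - nrm x"
   have "nrm y <= \<rho>" using nrm_reverse[OF xH(1) y(1)] y(2) by linarith
   then show "J x <= J y + eps * nrm (x - y)" using x(3) y by (simp add: M_def)
  qed
  then show ?thesis using order_trans[OF x(2) a(3)] x(1) by blast
 qed
 have "EX x:M. J x <= 0 & nrm (G x) <= inverse (real (Suc n))" for n by (rule ex) simp
 then obtain \<sigma> where \<sigma>: "!!n. \<sigma> n : M" "!!n. J (\<sigma> n) <= 0" "!!n. nrm (G (\<sigma> n)) <= inverse (real (Suc n))"
  by metis
 have \<sigma>H: "\<sigma> n : H" "nrm (\<sigma> n) <= \<rho>" for n using \<sigma>(1)[of n] by (auto simp: M_def)
 have G0: "(%n. nrm (G (\<sigma> n))) ----> 0"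
  by (rule Lim_null_comparison[OF _ LIMSEQ_inverse_real_of_nat]) (use \<sigma>(3) \<sigma>H G_in in auto)
 have "abs (J (\<sigma> n)) <= abs b" for n using \<sigma>(2)[of n] below[OF \<sigma>H, of n] by auto
 then obtain u r where u: "u : H" "strict_mono r" "tends (%n. \<sigma> (r n)) u"
  using ps[of \<sigma>, OF \<sigma>H(1) _ G0] by blast
 have "nrm (G u) = 0"
  by (rule G_null_limit[OF \<sigma>H(1) u(1,3)]) (use LIMSEQ_subseq_LIMSEQ[OF G0 u(2)] in \<open>simp add: o_def\<close>)
 moreover have "J u <= 0"
  by (rule LIMSEQ_le_const2[OF J_tends[OF \<sigma>H(1) u(1,3)]]) (use \<sigma>(2) in auto)
 ultimately show ?thesis using u(1) by blast
qed

text \<open>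
  Continuity is required sequentially, since the seminorm does not induce a topology on the type.
\<close>

definition paths :: "'a => 'a => (real => 'a) set" where
 "paths a b = {\<gamma>. (ALL t:{0..1}. \<gamma> t : H) & \<gamma> 0 = a & \<gamma> 1 = b &
   (ALL t:{0..1}. ALL \<tau>. (ALL n. \<tau> n : {0..1}) --> \<tau> ----> t --> tends (%n. \<gamma> (\<tau> n)) (\<gamma> t))}"

definition path_dist :: "(real => 'a) => (real => 'a) => real" where
 "path_dist \<gamma> \<delta> = (SUP t\<in>{0..1}. nrm (\<gamma> t - \<delta> t))"

definition height :: "(real => 'a) => real" where
 "height \<gamma> = (SUP t\<in>{0..1}. J (\<gamma> t))"

lemma paths_in: "\<gamma> : paths a b ==> 0 <= t ==> t <= 1 ==> \<gamma> t : H"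
 by (auto simp: paths_def)

lemma paths_tends:
 "\<gamma> : paths a b ==> t : {0..1} ==> (!!n. \<tau> n : {0..1}) ==> \<tau> ----> t ==> tends (%n. \<gamma> (\<tau> n)) (\<gamma> t)"
 by (auto simp: paths_def)

lemma paths_dist_continuous:
 assumes "\<gamma> : paths a b" "\<delta> : paths a b"
 shows "continuous_on {0..1} (%t. nrm (\<gamma> t - \<delta> t))"
 unfolding continuous_on_sequentially
proof (intro allI ballI impI; elim conjE)
 fix \<tau> :: "nat => real" and t :: real
 assume t: "t : {0..1}" and \<tau>: "ALL n. \<tau> n : {0..1}" "\<tau> ----> t"
 have in': "\<gamma> (\<tau> n) : H" "\<delta> (\<tau> n) : H" "\<gamma> t : H" "\<delta> t : H" for n
  using assms \<tau>(1) t paths_in by auto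
 have "tends (%n. \<gamma> (\<tau> n) + (-1) *R \<delta> (\<tau> n)) (\<gamma> t + (-1) *R \<delta> t)"
  using assms \<tau> t in' by (intro tends_add tends_scale tendsto_const paths_tends) auto
 then have "tends (%n. \<gamma> (\<tau> n) - \<delta> (\<tau> n)) (\<gamma> t - \<delta> t)" by simp
 then show "((%t. nrm (\<gamma> t - \<delta> t)) \<circ> \<tau>) ----> nrm (\<gamma> t - \<delta> t)"
  unfolding o_def using in' by (intro tends_nrm) auto
qed

lemma paths_J_continuous:
 assumes "\<gamma> : paths a b"
 shows "continuous_on {0..1} (%t. J (\<gamma> t))"
 unfolding continuous_on_sequentially
proof (intro allI ballI impI; elim conjE)
 fix \<tau> :: "nat => real" and t :: real
 assume t: "t : {0..1}" and \<tau>: "ALL n. \<tau> n : {0..1}" "\<tau> ----> t"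
 show "((%t. J (\<gamma> t)) \<circ> \<tau>) ----> J (\<gamma> t)"
  unfolding o_def using assms \<tau> t paths_in by (intro J_tends paths_tends) auto
qed

lemma bdd_above_continuous_image:
 fixes h :: "real => real"
 shows "continuous_on {0..1} h ==> bdd_above (h ` {0..1})"
 by (intro bounded_imp_bdd_above compact_imp_bounded compact_continuous_image) auto

lemma path_dist_upper:
 "\<gamma> : paths a b ==> \<delta> : paths a b ==> 0 <= t ==> t <= 1 ==> nrm (\<gamma> t - \<delta> t) <= path_dist \<gamma> \<delta>"
 unfolding path_dist_def
 by (rule cSUP_upper) (auto intro: bdd_above_continuous_image paths_dist_continuous)

lemma path_dist_least:
 "(!!t. 0 <= t ==> t <= 1 ==> nrm (\<gamma> t - \<delta> t) <= c) ==> path_dist \<gamma> \<delta> <= c"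
 unfolding path_dist_def by (rule cSUP_least) auto

lemma height_upper:
 "\<gamma> : paths a b ==> 0 <= t ==> t <= 1 ==> J (\<gamma> t) <= height \<gamma>"
 unfolding height_def by (rule cSUP_upper) (auto intro: bdd_above_continuous_image paths_J_continuous)

lemma height_least: "(!!t. 0 <= t ==> t <= 1 ==> J (\<gamma> t) <= c) ==> height \<gamma> <= c"
 unfolding height_def by (rule cSUP_least) auto

lemma height_attained:
 assumes "\<gamma> : paths a b"
 shows "EX t:{0..1}. J (\<gamma> t) = height \<gamma>"
proof -
 obtain t where t: "t : {0..1}" "ALL s:{0..1}. J (\<gamma> s) <= J (\<gamma> t)"
  using continuous_attains_sup[OF _ _ paths_J_continuous[OF assms]] by auto
 then have "height \<gamma> = J (\<gamma> t)"
  using height_upper[OF assms] height_least[of \<gamma> "J (\<gamma> t)"] by (intro antisym) auto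
 then show ?thesis using t(1) by auto
qed

lemma paths_complete:
 assumes \<sigma>: "!!n::nat. \<sigma> n : paths a b" and a: "a : H" and b: "b : H"
  and c: "!!e. e > 0 ==> EX N. ALL m>=N. ALL n>=m. path_dist (\<sigma> m) (\<sigma> n) < e"
 shows "EX l:paths a b. (%n. path_dist (\<sigma> n) l) ----> 0"
proof -
 have in': "\<sigma> n t : H" if "t : {0..1}" for n t using paths_in[OF \<sigma>] that by auto
 have close: "EX N. ALL m>=N. ALL n>=m. ALL t:{0..1}. nrm (\<sigma> m t - \<sigma> n t) < e" if "e > 0" for e
 proof -
  obtain N where N: "ALL m>=N. ALL n>=m. path_dist (\<sigma> m) (\<sigma> n) < e" using c \<open>e > 0\<close> by blast
  show ?thesis
  proof (intro exI[of _ N] allI impI ballI)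
   fix m n t assume "N <= m" "m <= n" "t : {0..1::real}"
   then show "nrm (\<sigma> m t - \<sigma> n t) < e"
    using N path_dist_upper[OF \<sigma> \<sigma>, of t m n] by (auto intro: le_less_trans)
  qed
 qed
 have "EX l:H. tends (%n. \<sigma> n t) l" if t: "t : {0..1}" for t
 proof (rule cauchy_converges)
  show "cauchy (%n. \<sigma> n t)" unfolding cauchy_def
  proof (intro allI impI)
   fix e :: real assume "e > 0"
   then obtain N where N: "ALL m>=N. ALL n>=m. ALL t:{0..1}. nrm (\<sigma> m t - \<sigma> n t) < e" using close by blast
   then have "nrm (\<sigma> m t - \<sigma> n t) < e" if "m >= N" "n >= N" for m n
    using that nrm_diff_commute[OF in'[OF t] in'[OF t], of m n] t by (metis linear)
   then show "EX N. ALL m>=N. ALL n>=N. nrm (\<sigma> m t - \<sigma> n t) < e" by blast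
  qed
 qed (use in' t in auto)
 then obtain L where L: "!!t. t : {0..1} ==> L t : H" "!!t. t : {0..1} ==> tends (%n. \<sigma> n t) (L t)" by metis
 define \<gamma> where "\<gamma> t = (if t = 0 then a else if t = 1 then b else L t)" for t
 have \<gamma>H: "\<gamma> t : H" if "t : {0..1}" for t using L(1)[OF that] a b by (simp add: \<gamma>_def)
 have lim: "tends (%n. \<sigma> n t) (\<gamma> t)" if "t : {0..1}" for t
  using L(2)[OF that] \<sigma> by (simp add: \<gamma>_def paths_def)
 have unif: "EX N. ALL n>=N. ALL t:{0..1}. nrm (\<sigma> n t - \<gamma> t) <= e" if e: "e > 0" for e
 proof -
  obtain N where N: "ALL m>=N. ALL n>=m. ALL t:{0..1}. nrm (\<sigma> m t - \<sigma> n t) < e" using close e by blast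
  have "nrm (\<sigma> m t - \<gamma> t) <= e" if m: "m >= N" and t: "t : {0..1}" for m t
  proof (rule LIMSEQ_le_const)
   have "(%n. nrm (\<sigma> n t - \<gamma> t) + e) ----> 0 + e" by (intro tendsto_intros lim t)
   then show "(%n. nrm (\<sigma> n t - \<gamma> t) + e) ----> e" by simp
   have "nrm (\<sigma> m t - \<gamma> t) <= nrm (\<sigma> n t - \<gamma> t) + e" if "n >= m" for n
    using nrm_diff_triangle[OF in' in' \<gamma>H, OF t t t, of m n] N m t that by force
   then show "EX k. ALL n>=k. nrm (\<sigma> m t - \<gamma> t) <= nrm (\<sigma> n t - \<gamma> t) + e" by blast
  qed
  then show ?thesis by blast
 qed
 have "tends (%n. \<gamma> (\<tau> n)) (\<gamma> t)" if t: "t : {0..1}" and \<tau>: "ALL n. \<tau> n : {0..1}" "\<tau> ----> t" for t \<tau>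
 proof (rule LIMSEQ_I)
  fix e :: real assume e: "e > 0"
  then obtain m where m: "!!t. t\<in>{0..1} ==> nrm (\<sigma> m t - \<gamma> t) <= e/3" using unif[of "e/3"] by (metis divide_pos_pos order_refl zero_less_numeral)
  have "tends (%n. \<sigma> m (\<tau> n)) (\<sigma> m t)" by (rule paths_tends[OF \<sigma>]) (use t \<tau> in auto)
  then have "eventually (%n. nrm (\<sigma> m (\<tau> n) - \<sigma> m t) < e/3) sequentially"
   by (rule order_tendstoD) (use e in simp)
  then obtain N where N: "!!n. n >= N ==> nrm (\<sigma> m (\<tau> n) - \<sigma> m t) < e/3" by (auto simp: eventually_sequentially)
  have "nrm (\<gamma> (\<tau> n) - \<gamma> t) < e" if "n >= N" for n
  proof -
   have tn: "\<tau> n : {0..1}" using \<tau> by blast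
   have "nrm (\<gamma> (\<tau> n) - \<gamma> t) <= nrm (\<gamma> (\<tau> n) - \<sigma> m (\<tau> n)) + nrm (\<sigma> m (\<tau> n) - \<gamma> t)"
    by (intro nrm_diff_triangle \<gamma>H in' t tn)
   also have "nrm (\<sigma> m (\<tau> n) - \<gamma> t) <= nrm (\<sigma> m (\<tau> n) - \<sigma> m t) + nrm (\<sigma> m t - \<gamma> t)"
    by (intro nrm_diff_triangle \<gamma>H in' t tn)
   finally show ?thesis
    using m[OF tn] m[OF t] N[OF that] nrm_diff_commute[OF \<gamma>H[OF tn] in'[OF tn], of m] by linarith
  qed
  then show "EX N. ALL n>=N. norm (nrm (\<gamma> (\<tau> n) - \<gamma> t) - 0) < e" using \<gamma>H t \<tau>(1) by auto
 qed
 then have \<gamma>: "\<gamma> : paths a b" using \<gamma>H by (auto simp: paths_def \<gamma>_def)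
 have "(%n. path_dist (\<sigma> n) \<gamma>) ----> 0"
 proof (rule LIMSEQ_I)
  fix e :: real assume e: "e > 0"
  then obtain N where N: "ALL n>=N. ALL t:{0..1}. nrm (\<sigma> n t - \<gamma> t) <= e/2" using unif[of "e/2"] by auto
  have "norm (path_dist (\<sigma> n) \<gamma> - 0) < e" if "n >= N" for n
  proof -
   have "path_dist (\<sigma> n) \<gamma> <= e/2" by (rule path_dist_least) (use N that in auto)
   moreover have "0 <= path_dist (\<sigma> n) \<gamma>"
    using order_trans[OF nrm_nonneg[of "\<sigma> n 0 - \<gamma> 0"] path_dist_upper[OF \<sigma> \<gamma>, of 0 n]] in'[of 0 n] \<gamma>H[of 0] by auto
   ultimately show ?thesis using e by simp
  qed
  then show "EX N. ALL n>=N. norm (path_dist (\<sigma> n) \<gamma> - 0) < e" by blast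
 qed
 then show ?thesis using \<gamma> by blast
qed

text \<open>
  Ekeland's principle is applied to the maximal height of a path, in the space of paths
  with the uniform distance. Suppose the path \<open>\<gamma>\<close> cannot be lowered at a rate exceeding \<open>\<epsilon>\<close>. It is
  pushed along \<open>w\<close>, the normalised negative gradient, which is cut off where \<open>J \<le> 0\<close> so that the end
  points stay fixed. For small pushes the maximum is attained at parameters that accumulate at a maximum
  of \<open>J\<close> along \<open>\<gamma>\<close>, where the cut-off equals 1; comparing first-order terms there shows that the gradient
  at that point is of order \<open>\<epsilon>\<close>.
\<close>

theorem mountain_pass:
 assumes a: "a : H" "nrm a < \<rho>" "J a <= 0" and b: "b : H" "\<rho> < nrm b" "J b <= 0" and \<alpha>: "\<alpha> > 0"
  and sphere: "!!u. u : H ==> nrm u = \<rho> ==> \<alpha> <= J u"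
 shows "EX u:H. nrm (G u) = 0 & \<alpha> <= J u"
proof -
 have high: "\<alpha> <= height \<gamma>" if \<gamma>: "\<gamma> : paths a b" for \<gamma>
 proof -
  have e: "\<gamma> 0 = a" "\<gamma> 1 = b" using \<gamma> by (auto simp: paths_def)
  have "continuous_on {0..1} (%t. nrm (\<gamma> t))"
   unfolding continuous_on_sequentially o_def
   by (intro allI ballI impI tends_nrm paths_tends[OF \<gamma>]) (use paths_in[OF \<gamma>] in auto)
  then obtain t where "0 <= t" "t <= 1" "nrm (\<gamma> t) = \<rho>"
   using IVT'[of "%t. nrm (\<gamma> t)" 0 \<rho> 1] a b e by auto
  then show ?thesis using sphere[of "\<gamma> t"] height_upper[OF \<gamma>, of t] paths_in[OF \<gamma>, of t] by auto
 qed
 define \<gamma>0 where "\<gamma>0 t = a + t *R (b - a)" for t :: real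
 have \<gamma>0: "\<gamma>0 : paths a b"
  unfolding paths_def \<gamma>0_def using a b by (auto intro!: tends_add tends_scale)
 have crit: "EX u:H. \<alpha> <= J u & J u <= height \<gamma>0 & nrm (G u) <= eps" if eps: "eps > 0" for eps
 proof -
  have "\<exists>\<gamma>\<in>paths a b. height \<gamma> <= height \<gamma>0 & (ALL \<delta>:paths a b. height \<gamma> <= height \<delta> + eps * path_dist \<gamma> \<delta>)"
  proof (rule ekeland[of \<gamma>0 "paths a b" eps path_dist height \<alpha>])
   show "path_dist \<gamma> \<gamma> = 0" for \<gamma> by (simp add: path_dist_def)
   show "0 <= path_dist \<gamma> \<delta>" if "\<gamma> : paths a b" "\<delta> : paths a b" for \<gamma> \<delta>
    using order_trans[OF nrm_nonneg[of "\<gamma> 0 - \<delta> 0"] path_dist_upper[OF that, of 0]] paths_in[OF that(1), of 0] paths_in[OF that(2), of 0]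
    by auto
   show "path_dist \<gamma> \<eta> <= path_dist \<gamma> \<delta> + path_dist \<delta> \<eta>"
    if "\<gamma> : paths a b" "\<delta> : paths a b" "\<eta> : paths a b" for \<gamma> \<delta> \<eta>
   proof (rule path_dist_least)
    fix t :: real assume t: "0 <= t" "t <= 1"
    have "nrm (\<gamma> t - \<eta> t) <= nrm (\<gamma> t - \<delta> t) + nrm (\<delta> t - \<eta> t)"
     using that t paths_in by (intro nrm_diff_triangle) auto
    also have "... <= path_dist \<gamma> \<delta> + path_dist \<delta> \<eta>"
     using that t by (intro add_mono path_dist_upper)
    finally show "nrm (\<gamma> t - \<eta> t) <= path_dist \<gamma> \<delta> + path_dist \<delta> \<eta>" .
   qed
   show "height l <= c" if \<sigma>: "!!n. \<sigma> n : paths a b" and l: "l : paths a b"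
    and lim: "(%n. path_dist (\<sigma> n) l) ----> 0" and hc: "(%n. height (\<sigma> n)) ----> c"
    for \<sigma> :: "nat => real => 'a" and l c
   proof (rule height_least)
    fix t :: real assume t: "0 <= t" "t <= 1"
    have in': "\<sigma> n t : H" "l t : H" for n using paths_in[OF \<sigma> t] paths_in[OF l t] by auto
    have "tends (%n. \<sigma> n t) (l t)"
    proof (rule Lim_null_comparison[OF always_eventually lim], rule allI)
     show "norm (nrm (\<sigma> n t - l t)) <= path_dist (\<sigma> n) l" for n
      using path_dist_upper[OF \<sigma> l t, of n] in' by auto
    qed
    then have "(%n. J (\<sigma> n t)) ----> J (l t)" using in' by (intro J_tends) auto
    then show "J (l t) <= c"
     by (rule LIMSEQ_le[OF _ hc]) (use height_upper[OF \<sigma> t] in auto)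
   qed
  qed (use \<gamma>0 eps high paths_complete a b in auto)
  then obtain \<gamma> where \<gamma>: "\<gamma> : paths a b" "height \<gamma> <= height \<gamma>0"
   and opt: "!!\<delta>. \<delta> : paths a b ==> height \<gamma> <= height \<delta> + eps * path_dist \<gamma> \<delta>" by blast
  have \<gamma>H: "\<gamma> t : H" if "t : {0..1}" for t using paths_in[OF \<gamma>(1)] that by auto
  (* The cut-off vanishes at the end points and is 1 on the level set that matters; the maximum with
       eps in the next definition bounds the speed of the push. *)
    define cut where "cut t = min 1 (max 0 (J (\<gamma> t) / \<alpha>))" for t
  define k where "k t = - (cut t / max eps (nrm (G (\<gamma> t))))" for t
  define w where "w t = k t *R G (\<gamma> t)" for t
  have wH: "w t : H" if "t : {0..1}" for t using \<gamma>H[OF that] G_in by (simp add: w_def)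
  have w_le: "nrm (w t) <= 1" if t: "t : {0..1}" for t
  proof -
   have n: "0 <= nrm (G (\<gamma> t))" using \<gamma>H[OF t] G_in by simp
   have "nrm (w t) = cut t * (nrm (G (\<gamma> t)) / max eps (nrm (G (\<gamma> t))))"
    using nrm_scale[OF G_in[OF \<gamma>H[OF t]], of "k t"] n eps by (simp add: w_def k_def cut_def abs_mult)
   also have "... <= 1 * 1" using n eps by (intro mult_mono) (auto simp: cut_def)
   finally show ?thesis by simp
  qed
  have w_tends: "tends (%n. w (\<tau> n)) (w t)" if t: "t : {0..1}" and \<tau>: "!!n. \<tau> n : {0..1}" "\<tau> ----> t" for t \<tau>
  proof -
   have lim: "tends (%n. \<gamma> (\<tau> n)) (\<gamma> t)" by (rule paths_tends[OF \<gamma>(1) t \<tau>])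
   have Glim: "tends (%n. G (\<gamma> (\<tau> n))) (G (\<gamma> t))" using G_cont[OF _ _ lim] \<gamma>H t \<tau> by auto
   have "(%n. k (\<tau> n)) ----> k t"
    unfolding k_def cut_def using eps \<alpha> \<gamma>H t \<tau> G_in
    by (intro tendsto_intros J_tends tends_nrm lim Glim) auto
   then show ?thesis unfolding w_def using \<gamma>H t \<tau> G_in by (intro tends_scale Glim) auto
  qed
  have moved: "(%t. \<gamma> t + s *R w t) : paths a b" for s
  proof -
   have ends: "\<gamma> 0 = a" "\<gamma> 1 = b" using \<gamma>(1) by (auto simp: paths_def)
   have "cut 0 = 0" "cut 1 = 0"
    unfolding cut_def ends using divide_nonpos_pos[OF a(3) \<alpha>] divide_nonpos_pos[OF b(3) \<alpha>] by auto
   then have "w 0 = 0" "w 1 = 0" by (auto simp: w_def k_def)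
   moreover note ends
   ultimately show ?thesis
    using \<gamma>H wH paths_tends[OF \<gamma>(1)] w_tends unfolding paths_def
    by (auto intro!: tends_add tends_scale)
  qed
  define s where "s n = inverse (real (Suc n))" for n
  have s: "0 < s n" "s ----> 0" for n unfolding s_def using LIMSEQ_inverse_real_of_nat by auto
  have ex: "EX t:{0..1}. \<exists>\<theta>. 0 < \<theta> & \<theta> < s n & height \<gamma> - eps * s n <= J (\<gamma> t + s n *R w t)
    & - eps <= ip (G (\<gamma> t + \<theta> *R w t)) (w t)" for n
  proof -
   obtain t where t: "t : {0..1}" "J (\<gamma> t + s n *R w t) = height (%t. \<gamma> t + s n *R w t)"
    using height_attained[OF moved] by blast
   have "path_dist \<gamma> (%t. \<gamma> t + s n *R w t) <= s n"
   proof (rule path_dist_least)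
    fix t :: real assume "0 <= t" "t <= 1"
    then show "nrm (\<gamma> t - (\<gamma> t + s n *R w t)) <= s n"
     using w_le[of t] wH[of t] s(1)[of n] by (simp add: nrm_minus nrm_scale)
   qed
   then have "eps * path_dist \<gamma> (%t. \<gamma> t + s n *R w t) <= eps * s n" using eps by simp
   then have h: "height \<gamma> - eps * s n <= J (\<gamma> t + s n *R w t)"
    using opt[OF moved, of "s n"] t(2) by simp
   obtain \<theta> where \<theta>: "0 < \<theta>" "\<theta> < s n" "J (\<gamma> t + s n *R w t) - J (\<gamma> t) = s n * ip (G (\<gamma> t + \<theta> *R w t)) (w t)"
    using mean_value[OF \<gamma>H wH s(1), OF t(1) t(1)] by blast
   have "J (\<gamma> t) <= height \<gamma>" using height_upper[OF \<gamma>(1)] t(1) by simp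
   then have "s n * (- eps) <= s n * ip (G (\<gamma> t + \<theta> *R w t)) (w t)" using h \<theta>(3) by (simp add: mult.commute)
   then have "- eps <= ip (G (\<gamma> t + \<theta> *R w t)) (w t)" using s(1)[of n] by (simp only: mult_le_cancel_left_pos)
   then show ?thesis using t(1) \<theta> h by blast
  qed
  obtain t \<theta> where t: "!!n. t n : {0..1}" and \<theta>: "!!n. 0 < \<theta> n" "!!n. \<theta> n < s n"
   and h: "!!n. height \<gamma> - eps * s n <= J (\<gamma> (t n) + s n *R w (t n))"
   and d: "!!n. - eps <= ip (G (\<gamma> (t n) + \<theta> n *R w (t n))) (w (t n))"
   using ex by metis
  obtain t' r where t': "t' : {0..1}" and r: "strict_mono r" and tlim: "(%n. t (r n)) ----> t'"
   using compact_Icc[of 0 "1::real"] t unfolding compact_def o_def by blast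
  have slim: "(%n. s (r n)) ----> 0" using LIMSEQ_subseq_LIMSEQ[OF s(2) r] by (simp add: o_def)
  have \<theta>lim: "(%n. \<theta> (r n)) ----> 0"
   by (rule Lim_null_comparison[OF _ slim]) (use \<theta> less_imp_le in \<open>auto simp: abs_of_pos intro!: always_eventually\<close>)
  have gl: "tends (%n. \<gamma> (t (r n))) (\<gamma> t')" by (rule paths_tends[OF \<gamma>(1) t' t tlim])
  have wl: "tends (%n. w (t (r n))) (w t')" by (rule w_tends[OF t' t tlim])
  have move_lim: "tends (%n. \<gamma> (t (r n)) + q n *R w (t (r n))) (\<gamma> t')" if "q ----> 0" for q
  proof -
   have "tends (%n. \<gamma> (t (r n)) + q n *R w (t (r n))) (\<gamma> t' + 0 *R w t')"
    by (intro tends_add tends_scale gl wl that H_intros \<gamma>H wH t t')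
   then show ?thesis by simp
  qed
  have "(%n. ip (G (\<gamma> (t (r n)) + \<theta> (r n) *R w (t (r n)))) (w (t (r n)))) ----> ip (G (\<gamma> t')) (w t')"
   by (intro tends_ip G_cont move_lim \<theta>lim wl H_intros G_in \<gamma>H wH t t')
  then have e1: "- eps <= ip (G (\<gamma> t')) (w t')" by (rule LIMSEQ_le_const) (use d in auto)
  have "(%n. J (\<gamma> (t (r n)) + s (r n) *R w (t (r n)))) ----> J (\<gamma> t')"
   by (intro J_tends move_lim slim H_intros \<gamma>H wH t t')
  moreover have "(%n. height \<gamma> - eps * s (r n)) ----> height \<gamma> - eps * 0" by (intro tendsto_intros slim)
  ultimately have top: "height \<gamma> <= J (\<gamma> t')" using LIMSEQ_le h by (metis (no_types, lifting) diff_zero mult_zero_right)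
  then have Ja: "\<alpha> <= J (\<gamma> t')" using high[OF \<gamma>(1)] by linarith
  then have "cut t' = 1" using \<alpha> by (simp add: cut_def)
  then have "ip (G (\<gamma> t')) (w t') = - ((nrm (G (\<gamma> t')))^2 / max eps (nrm (G (\<gamma> t'))))"
   using \<gamma>H[OF t'] G_in by (simp add: w_def k_def ip_simps nrm_sq)
  then have "(nrm (G (\<gamma> t')))^2 / max eps (nrm (G (\<gamma> t'))) <= eps" using e1 by simp
  then have "nrm (G (\<gamma> t')) <= eps"
   using eps by (cases "nrm (G (\<gamma> t')) <= eps") (auto simp: max_def power2_eq_square)
  then show ?thesis using Ja height_upper[OF \<gamma>(1), of t'] \<gamma>(2) t' \<gamma>H by (intro bexI[of _ "\<gamma> t'"]) auto
 qed
 have "EX u:H. \<alpha> <= J u & J u <= height \<gamma>0 & nrm (G u) <= inverse (real (Suc n))" for n by (rule crit) simp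
 then obtain \<sigma> where \<sigma>: "!!n. \<sigma> n : H" "!!n. \<alpha> <= J (\<sigma> n)" "!!n. J (\<sigma> n) <= height \<gamma>0"
  "!!n. nrm (G (\<sigma> n)) <= inverse (real (Suc n))" by metis
 have G0: "(%n. nrm (G (\<sigma> n))) ----> 0"
  by (rule Lim_null_comparison[OF _ LIMSEQ_inverse_real_of_nat]) (use \<sigma> G_in in auto)
 have "abs (J (\<sigma> n)) <= abs \<alpha> + abs (height \<gamma>0)" for n using \<sigma>(2,3)[of n] by linarith
 then obtain u r where u: "u : H" "strict_mono r" "tends (%n. \<sigma> (r n)) u"
  using ps[of \<sigma>, OF \<sigma>(1) _ G0] by blast
 have "nrm (G u) = 0"
  by (rule G_null_limit[OF \<sigma>(1) u(1,3)]) (use LIMSEQ_subseq_LIMSEQ[OF G0 u(2)] in \<open>simp add: o_def\<close>)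
 moreover have "\<alpha> <= J u"
  by (rule LIMSEQ_le_const[OF J_tends[OF \<sigma>(1) u(1,3)]]) (use \<sigma>(2) in auto)
 ultimately show ?thesis using u(1) by blast
qed

end

section \<open>The Poincare inequality and dyadic cells\<close>

abbreviation lint :: "'b::euclidean_space set => ('b => ennreal) => ennreal" where
 "lint S h \<equiv> set_nn_integral lborel S h"

text \<open>
  Cauchy-Schwarz for the integral of the derivative, in the form of the nonnegativity of
  \<open>\<integral> (\<phi>' - c)\<^sup>2\<close> with \<open>c\<close> the increment.
\<close>

lemma square_increment_le:
 fixes \<phi> \<phi>' :: "real => real"
 assumes der: "!!t. 0 <= t ==> t <= 1 ==> (\<phi> has_real_derivative \<phi>' t) (at t within {0..1})"
  and cont: "continuous_on {0..1} \<phi>'"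
 shows "ennreal ((\<phi> 1 - \<phi> 0)^2) <= (lint {0..1} (%t. ennreal ((\<phi>' t)^2)))"
proof -
 define c where "c = \<phi> 1 - \<phi> 0"
 have i1: "(\<phi>' has_integral c) {0..1}"
  unfolding c_def by (rule fundamental_theorem_of_calculus)
   (use der in \<open>auto simp: has_real_derivative_iff_has_vector_derivative\<close>)
 have "(%t. (\<phi>' t)^2) integrable_on {0..1}"
  by (intro integrable_continuous_real continuous_intros cont)
 then obtain I where i2: "((%t. (\<phi>' t)^2) has_integral I) {0..1}" by blast
 have "((%t. (\<phi>' t)^2 - 2 * c * \<phi>' t + c^2) has_integral (I - 2 * c * c + c^2)) {0..1}"
  using has_integral_const_real[of "c^2" 0 1]
  by (intro has_integral_add has_integral_diff has_integral_mult_right i1 i2) auto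
 moreover have "(\<phi>' t)^2 - 2 * c * \<phi>' t + c^2 = (\<phi>' t - c)^2" for t
  by (simp add: power2_diff mult_ac)
 ultimately have "0 <= I - 2 * c * c + c^2" using has_integral_nonneg by (metis (no_types, lifting) zero_le_power2)
 then have le: "c^2 <= I" by (simp add: power2_eq_square)
 have "((%t. indicator {0..1} t * (\<phi>' t)^2) has_integral I) UNIV"
 proof -
  have "(%t. indicator {0..1} t * (\<phi>' t)^2) = (%t. if t : {0..1} then (\<phi>' t)^2 else 0)"
   by (auto simp: indicator_def)
  then show ?thesis using i2 by (simp only: has_integral_restrict_UNIV)
 qed
 moreover have "(%t. indicator {0..1} t * (\<phi>' t)^2) : borel_measurable borel"
  using borel_measurable_continuous_on_indicator[of "{0..1}" "%t. (\<phi>' t)^2"] cont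
  by (auto intro!: continuous_intros)
 ultimately have "(nn_integral lborel (%t. ennreal (indicator {0..1} t * (\<phi>' t)^2))) = ennreal I"
  by (intro nn_integral_has_integral_lborel) auto
 moreover have "(nn_integral lborel (%t. ennreal (indicator {0..1} t * (\<phi>' t)^2))) = (lint {0..1} (%t. ennreal ((\<phi>' t)^2)))"
  by (intro nn_integral_cong) (auto simp: indicator_def)
 ultimately show ?thesis using le by (simp add: c_def[symmetric] ennreal_leI)
qed

lemma nn_integral_affine:
 fixes h :: "real ^ 3 => ennreal"
 assumes [measurable]: "h : borel_measurable borel" and c: "c > 0"
 shows "(nn_integral lborel (%x. h (a + c *R x))) = ennreal (1 / c ^ 3) * (nn_integral lborel (%x. h x))"
proof -
 have "(nn_integral lborel (%x. h x)) = ennreal (c ^ 3) * (nn_integral lborel (%x. h (a + c *R x)))"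
  by (subst lborel_affine[of c a]) (use c in \<open>auto simp: nn_integral_density nn_integral_distr nn_integral_cmult\<close>)
 then have "ennreal (1 / c ^ 3) * (nn_integral lborel (%x. h x)) = ennreal (1 / c ^ 3) * ennreal (c ^ 3) * (nn_integral lborel (%x. h (a + c *R x)))"
  by (simp add: mult.assoc)
 also have "ennreal (1 / c ^ 3) * ennreal (c ^ 3) = 1" using c by (simp flip: ennreal_mult)
 finally show ?thesis by simp
qed

text \<open>
  One of the weights \<open>t\<close> and \<open>1 - t\<close> is at least \<open>1/2\<close>. The substitution in the variable that
  carries this weight is affine with Jacobian at least \<open>1/8\<close>, which accounts for the factor 8.
\<close>

lemma average_over_segments:
 fixes h :: "real ^ 3 => ennreal" and Q :: "(real ^ 3) set"
 assumes [measurable]: "h : borel_measurable borel" "Q : sets borel" and t: "0 <= t" "t <= 1"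
 shows "(lint Q (%x. (lint Q (%y. h (y + t *R (x - y))))))
  <= 8 * emeasure lborel Q * (nn_integral lborel (%x. h x))"
proof -
 have half: "(lint Q (%y. (lint Q (%x. h ((1 - s) *R y + s *R x)))))
  <= 8 * emeasure lborel Q * (nn_integral lborel (%x. h x))" if s: "1/2 <= s" "s <= 1" for s
 proof -
  have le: "1 / s ^ 3 <= 8"
  proof -
   have "(1/2) ^ 3 <= s ^ 3" using s by (intro power_mono) auto
   then show ?thesis using s by (simp add: field_simps power3_eq_cube)
  qed
  have "(lint Q (%x. h ((1 - s) *R y + s *R x))) <= 8 * (nn_integral lborel (%x. h x))" for y
  proof -
   have "(lint Q (%x. h ((1 - s) *R y + s *R x))) <= (nn_integral lborel (%x. h ((1 - s) *R y + s *R x)))"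
    by (intro nn_integral_mono) (auto simp: indicator_def)
   also have "... = ennreal (1 / s ^ 3) * (nn_integral lborel (%x. h x))"
    by (rule nn_integral_affine) (use s in auto)
   also have "... <= ennreal 8 * (nn_integral lborel (%x. h x))"
    by (intro mult_right_mono ennreal_leI le) auto
   finally show ?thesis by simp
  qed
  then have "(lint Q (%y. (lint Q (%x. h ((1 - s) *R y + s *R x)))))
   <= (lint Q (%y. 8 * (nn_integral lborel (%x. h x))))"
   by (intro nn_integral_mono mult_right_mono) auto
  also have "... = 8 * emeasure lborel Q * (nn_integral lborel (%x. h x))"
   by (subst nn_integral_cmult_indicator) (auto simp: mult_ac)
  finally show ?thesis .
 qed
 show ?thesis
 proof (cases "t >= 1/2")
  case True
  have "(lint Q (%x. (lint Q (%y. h (y + t *R (x - y))))))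
   = (nn_integral lborel (%x. (nn_integral lborel (%y. h ((1 - t) *R y + t *R x) * indicator Q y * indicator Q x))))"
  proof (intro nn_integral_cong)
   fix x
   have "(nn_integral lborel (%y. h (y + t *R (x - y)) * indicator Q y)) = (nn_integral lborel (%y. h ((1 - t) *R y + t *R x) * indicator Q y))"
    by (simp add: algebra_simps)
   then show "(lint Q (%y. h (y + t *R (x - y)))) * indicator Q x
    = (nn_integral lborel (%y. h ((1 - t) *R y + t *R x) * indicator Q y * indicator Q x))"
    by (simp add: nn_integral_multc)
  qed
  also have "... = (nn_integral lborel (%y. (nn_integral lborel (%x. h ((1 - t) *R y + t *R x) * indicator Q y * indicator Q x))))"
   by (rule lborel_pair.Fubini') measurable
  also have "... = (lint Q (%y. (lint Q (%x. h ((1 - t) *R y + t *R x)))))"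
   by (intro nn_integral_cong) (auto simp: nn_integral_multc mult_ac indicator_def)
  finally show ?thesis using half[of t] True t by simp
 next
  case False
  have "(lint Q (%x. (lint Q (%y. h (y + t *R (x - y))))))
   = (lint Q (%x. (lint Q (%y. h ((1 - (1 - t)) *R x + (1 - t) *R y)))))"
   by (simp add: algebra_simps)
  then show ?thesis using half[of "1 - t"] False t by simp
 qed
qed

text \<open>
  The increment of \<open>V\<close> between two points is bounded by the integral of \<open>|D|\<^sup>2\<close> over the segment
  that joins them, and \<open>average_over_segments\<close> integrates this bound over all pairs of points.
\<close>

lemma poincare_convex:
 fixes V :: "real ^ 3 => real" and D :: "real ^ 3 => real ^ 3"
 assumes cvx: "convex Q" and Q[measurable]: "Q : sets borel"
  and der: "!!x. x : Q ==> (V has_derivative (%h. D x \<bullet> h)) (at x)"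
  and cont: "continuous_on Q D"
  and diam: "!!x y. x : Q ==> y : Q ==> (norm (x - y))^2 <= d"
 shows "(lint Q (%x. (lint Q (%y. ennreal ((V x - V y)^2)))))
  <= ennreal (8 * d) * emeasure lborel Q * (lint Q (%y. ennreal ((norm (D y))^2)))"
proof -
 define h where "h y = ennreal ((norm (indicator Q y *R D y))^2)" for y
 have [measurable]: "(%y. indicator Q y *R D y) : borel_measurable borel"
  by (rule borel_measurable_continuous_on_indicator[OF Q cont])
 have h[measurable]: "h : borel_measurable borel" unfolding h_def by measurable
 have hQ: "(lint Q (%y. ennreal ((norm (D y))^2))) = (nn_integral lborel (%y. h y))"
  by (intro nn_integral_cong) (auto simp: h_def indicator_def)
 have seg: "ennreal ((V x - V y)^2) <= (lint {0..1} (%t. ennreal d * h (y + t *R (x - y))))"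
  if x: "x : Q" and y: "y : Q" for x y
 proof -
  have inQ: "y + t *R (x - y) : Q" if "0 <= t" "t <= 1" for t
   using convexD_alt[OF cvx y x that] by (simp add: algebra_simps)
  define \<phi> where "\<phi> t = V (y + t *R (x - y))" for t
  have "ennreal ((\<phi> 1 - \<phi> 0)^2) <= (lint {0..1} (%t. ennreal ((D (y + t *R (x - y)) \<bullet> (x - y))^2)))"
  proof (rule square_increment_le)
   fix t :: real assume t: "0 <= t" "t <= 1"
   have "((%t. y + t *R (x - y)) has_derivative (%s. s *R (x - y))) (at t within {0..1})"
    by (auto intro!: derivative_eq_intros)
   from has_derivative_compose[OF this der[OF inQ[OF t]]]
   show "(\<phi> has_real_derivative D (y + t *R (x - y)) \<bullet> (x - y)) (at t within {0..1})"
    unfolding \<phi>_def has_field_derivative_def by (simp add: mult.commute[of _ "D _ \<bullet> _"] mult_commute_abs)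
  next
   show "continuous_on {0..1} (%t. D (y + t *R (x - y)) \<bullet> (x - y))"
    by (intro continuous_intros continuous_on_compose2[OF cont]) (use inQ in auto)
  qed
  also have "... <= (lint {0..1} (%t. ennreal d * h (y + t *R (x - y))))"
  proof (intro nn_integral_mono)
   fix t :: real
   have "(D (y + t *R (x - y)) \<bullet> (x - y))^2 <= d * (norm (D (y + t *R (x - y))))^2"
   proof -
    have "abs (D (y + t *R (x - y)) \<bullet> (x - y))^2 <= (norm (D (y + t *R (x - y))) * norm (x - y))^2"
     by (intro power_mono Cauchy_Schwarz_ineq2) auto
    also have "... <= (norm (D (y + t *R (x - y))))^2 * d"
     unfolding power_mult_distrib by (intro mult_left_mono diam x y) auto
    finally show ?thesis by (simp add: mult.commute)
   qed
   then have "ennreal ((D (y + t *R (x - y)) \<bullet> (x - y))^2) <= ennreal d * ennreal ((norm (D (y + t *R (x - y))))^2)"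
    by (subst ennreal_mult''[symmetric]) (auto intro: ennreal_leI)
   then show "ennreal ((D (y + t *R (x - y)) \<bullet> (x - y))^2) * indicator {0..1} t
    <= ennreal d * h (y + t *R (x - y)) * indicator {0..1} t"
    using inQ[of t] by (auto simp: indicator_def h_def)
  qed
  finally show ?thesis by (simp add: \<phi>_def)
 qed
 have "(lint Q (%x. (lint Q (%y. ennreal ((V x - V y)^2)))))
  <= (lint Q (%x. (lint Q (%y. (lint {0..1::real} (%t. ennreal d * h (y + t *R (x - y))))))))"
 proof (intro nn_integral_mono)
  fix x
  show "(lint Q (%y. ennreal ((V x - V y)^2))) * indicator Q x
   <= (lint Q (%y. (lint {0..1::real} (%t. ennreal d * h (y + t *R (x - y)))))) * indicator Q x"
  proof (cases "x : Q")
   case True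
   have "(lint Q (%y. ennreal ((V x - V y)^2)))
    <= (lint Q (%y. (lint {0..1::real} (%t. ennreal d * h (y + t *R (x - y))))))"
   proof (intro nn_integral_mono)
    fix y show "ennreal ((V x - V y)^2) * indicator Q y
     <= (lint {0..1::real} (%t. ennreal d * h (y + t *R (x - y)))) * indicator Q y"
     using seg[OF True, of y] by (cases "y : Q") auto
   qed
   then show ?thesis using True by simp
  qed simp
 qed
 also have "... = (nn_integral lborel (%x. (nn_integral lborel (%y. (nn_integral lborel (%t. ennreal d * h (y + t *R (x - y)) * indicator {0..1::real} t * indicator Q y * indicator Q x))))))"
  by (intro nn_integral_cong) (simp add: nn_integral_multc)
 also have "... = (nn_integral lborel (%x. (nn_integral lborel (%t. (nn_integral lborel (%y. ennreal d * h (y + t *R (x - y)) * indicator {0..1::real} t * indicator Q y * indicator Q x))))))"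
  by (intro nn_integral_cong, rule lborel_pair.Fubini') measurable
 also have "... = (nn_integral lborel (%t. (nn_integral lborel (%x. (nn_integral lborel (%y. ennreal d * h (y + t *R (x - y)) * indicator {0..1::real} t * indicator Q y * indicator Q x))))))"
  by (rule lborel_pair.Fubini') measurable
 also have "... <= (lint {0..1::real} (%t. ennreal d * (8 * emeasure lborel Q * (nn_integral lborel (%y. h y)))))"
 proof (intro nn_integral_mono)
  fix t :: real
  show "(nn_integral lborel (%x. (nn_integral lborel (%y. ennreal d * h (y + t *R (x - y)) * indicator {0..1::real} t * indicator Q y * indicator Q x))))
   <= ennreal d * (8 * emeasure lborel Q * (nn_integral lborel (%y. h y))) * indicator {0..1} t"
  proof (cases "t : {0..1}")
   case True
   have "(nn_integral lborel (%x. (nn_integral lborel (%y. ennreal d * h (y + t *R (x - y)) * indicator {0..1::real} t * indicator Q y * indicator Q x))))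
    = ennreal d * (lint Q (%x. (lint Q (%y. h (y + t *R (x - y))))))"
    using True by (simp add: nn_integral_multc nn_integral_cmult mult.assoc)
     (simp add: nn_integral_multc flip: mult.assoc)
   also have "... <= ennreal d * (8 * emeasure lborel Q * (nn_integral lborel (%y. h y)))"
    by (intro mult_left_mono average_over_segments) (use True in auto)
   finally show ?thesis using True by simp
  qed simp
 qed
 also have "... = ennreal d * (8 * emeasure lborel Q * (nn_integral lborel (%y. h y)))"
  by (subst nn_integral_cmult_indicator) auto
 also have "... = ennreal (8 * d) * emeasure lborel Q * (nn_integral lborel (%y. h y))"
  by (subst ennreal_mult') (auto simp: mult_ac)
 finally show ?thesis unfolding hQ .
qed

text \<open>
  The half-open dyadic cube of side \<open>2\<^sup>-\<^sup>k\<close> that contains \<open>a\<close>. Cells of the same level partition the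
  space, and cells of increasing level are nested.
\<close>

definition cell :: "nat => real ^ 3 => (real ^ 3) set" where
 "cell k a = {y. ALL i. \<lfloor>2 ^ k * y $ i\<rfloor> = \<lfloor>2 ^ k * a $ i\<rfloor>}"

definition cell_low :: "nat => real ^ 3 => real ^ 3" where
 "cell_low k a = (\<chi> i. of_int \<lfloor>2 ^ k * a $ i\<rfloor> / 2 ^ k)"

definition closed_cell :: "nat => real ^ 3 => (real ^ 3) set" where
 "closed_cell k a = cbox (cell_low k a) (\<chi> i. cell_low k a $ i + 1 / 2 ^ k)"

lemma in_cell_iff: "y : cell k a \<longleftrightarrow> (ALL i. cell_low k a $ i <= y $ i & y $ i < cell_low k a $ i + 1 / 2 ^ k)"
proof -
 have "\<lfloor>2 ^ k * y $ i\<rfloor> = n \<longleftrightarrow> of_int n / 2 ^ k <= y $ i & y $ i < of_int n / 2 ^ k + 1 / 2 ^ k" for i and n :: int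
  unfolding floor_eq_iff by (simp add: field_simps)
 then show ?thesis unfolding cell_def cell_low_def by simp
qed

lemma in_closed_cell_iff:
 "y : closed_cell k a \<longleftrightarrow> (ALL i. cell_low k a $ i <= y $ i & y $ i <= cell_low k a $ i + 1 / 2 ^ k)"
 by (simp add: closed_cell_def mem_box_cart)

lemma cell_subset_closed_cell: "cell k a \<subseteq> closed_cell k a"
 by (auto simp: in_cell_iff in_closed_cell_iff less_imp_le)

lemma self_in_cell [simp]: "x : cell k x"
 by (simp add: cell_def)

lemma cell_eq: "y : cell k x ==> cell k y = cell k x"
 by (auto simp: cell_def)

lemma in_cell_commute: "y : cell k x \<longleftrightarrow> x : cell k y"
 by (auto simp: cell_def)

lemma cell_mono:
 assumes "k <= m"
 shows "cell m x \<subseteq> cell k x"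
proof
 fix y assume y: "y : cell m x"
 have f: "\<lfloor>2 ^ k * (z::real)\<rfloor> = \<lfloor>2 ^ m * z\<rfloor> div 2 ^ (m - k)" for z
 proof -
  have "(2::real) ^ m = 2 ^ k * 2 ^ (m - k)" using assms by (simp flip: power_add)
  then have "2 ^ k * z = (2 ^ m * z) / real_of_int (2 ^ (m - k))" by simp
  then show ?thesis by (metis floor_divide_real_eq_div zero_le_numeral zero_le_power)
 qed
 show "y : cell k x" using y by (simp add: cell_def f)
qed

lemma cell_measurable [measurable]: "cell k a : sets borel"
proof -
 have "cell k a = (\<Inter>i. {y. cell_low k a $ i <= y $ i} \<inter> {y. y $ i < cell_low k a $ i + 1 / 2 ^ k})"
  by (auto simp: in_cell_iff)
 also have "... : sets borel" by measurable
 finally show ?thesis .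
qed

lemma convex_cell: "convex (cell k a)"
proof -
 have "cell k a = (\<Inter>i. {y. cell_low k a $ i <= y $ i} \<inter> {y. y $ i < cell_low k a $ i + 1 / 2 ^ k})"
  by (auto simp: in_cell_iff)
 also have "convex ..."
 proof (intro convex_INT convex_Int)
  fix i :: 3
  have e: "y $ i = axis i 1 \<bullet> y" for y :: "real ^ 3" by (simp add: inner_axis inner_commute)
  show "convex {y :: real ^ 3. cell_low k a $ i <= y $ i}"
   unfolding e by (rule convex_halfspace_ge)
  show "convex {y :: real ^ 3. y $ i < cell_low k a $ i + 1 / 2 ^ k}"
  proof -
   have "{y :: real ^ 3. y $ i < c} = {y. axis i 1 \<bullet> y < c}" for c by (simp add: e)
   then show ?thesis by (simp only: convex_halfspace_lt)
  qed
 qed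
 finally show ?thesis .
qed

lemma emeasure_cell [simp]: "emeasure lborel (cell k a) = ennreal (1 / 8 ^ k)"
proof -
 let ?l = "cell_low k a" and ?u = "\<chi> i. cell_low k a $ i + 1 / 2 ^ k"
 have ul: "(?u - ?l) \<bullet> b = 1 / 2 ^ k" and le: "?l \<bullet> b <= ?u \<bullet> b" if b: "b : Basis" for b
 proof -
  obtain i where "b = axis i 1" using b by (auto simp: Basis_vec_def)
  then show "(?u - ?l) \<bullet> b = 1 / 2 ^ k" "?l \<bullet> b <= ?u \<bullet> b" by (auto simp: inner_axis)
 qed
 have p: "(\<Prod>b\<in>Basis. (?u - ?l) \<bullet> b) = 1 / 8 ^ k"
 proof -
  have "(\<Prod>b\<in>Basis. (?u - ?l) \<bullet> b) = (\<Prod>b\<in>(Basis :: (real ^ 3) set). 1 / 2 ^ k)" by (intro prod.cong ul) auto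
  also have "... = (1 / 2 ^ k) ^ 3" by simp
  also have "... = 1 / ((2 ^ 3) ^ k)" by (simp only: power_divide power_one power_mult[symmetric] mult.commute)
  finally show ?thesis by simp
 qed
 have 1: "box ?l ?u \<subseteq> cell k a" by (auto simp: in_cell_iff mem_box_cart less_imp_le)
 have 2: "cell k a \<subseteq> cbox ?l ?u" using cell_subset_closed_cell by (simp add: closed_cell_def)
 have "emeasure lborel (box ?l ?u) <= emeasure lborel (cell k a)" by (rule emeasure_mono[OF 1]) simp
 moreover have "emeasure lborel (cell k a) <= emeasure lborel (cbox ?l ?u)" by (rule emeasure_mono[OF 2]) simp
 ultimately show ?thesis using emeasure_lborel_box[OF le] emeasure_lborel_cbox[OF le] p by (intro antisym) auto
qed

lemma measure_cell [simp]: "measure lborel (cell k a) = 1 / 8 ^ k"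
 by (simp add: measure_def)

lemma diam_cell:
 assumes "x : cell k a" "y : cell k a"
 shows "(norm (x - y))^2 <= 3 / 4 ^ k"
proof -
 have "(x $ i - y $ i)^2 <= 1 / 4 ^ k" for i
 proof -
  have "abs (x $ i - y $ i) <= 1 / 2 ^ k" using assms by (auto simp: in_cell_iff abs_le_iff less_imp_le) (smt (verit))+
  then have "abs (x $ i - y $ i)^2 <= (1 / 2 ^ k)^2" by (intro power_mono) auto
  also have "... = 1 / ((2^2) ^ k)" by (simp only: power_divide power_one power_mult[symmetric] mult.commute)
  finally show ?thesis by simp
 qed
 then have "(\<Sum>i\<in>(UNIV :: 3 set). (x $ i - y $ i)^2) <= (\<Sum>i\<in>(UNIV :: 3 set). 1 / 4 ^ k)" by (intro sum_mono)
 moreover have "(norm (x - y))^2 = (\<Sum>i\<in>(UNIV :: 3 set). (x $ i - y $ i)^2)"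
  unfolding power2_norm_eq_inner inner_vec_def by (simp add: power2_eq_square)
 ultimately show ?thesis by simp
qed

lemma compact_closed_cell: "compact (closed_cell k a)"
 by (simp add: closed_cell_def compact_cbox)

lemma finite_cells_bounded:
 assumes "bounded S"
 shows "finite (cell m ` S)"
proof -
 obtain B where B: "!!x. x : S ==> norm x <= B" using assms unfolding bounded_iff by blast
 define N where "N = \<lceil>2 ^ m * B\<rceil> + 1"
 define F where "F = {n :: 3 => int. ALL i. n i : {- N..N}}"
 have "finite F" using finite_PiE[of "UNIV :: 3 set" "%_. {-N..N}"] by (simp add: F_def PiE_def Pi_def extensional_def)
 moreover have "cell m ` S \<subseteq> (%n. {y. ALL i. \<lfloor>2 ^ m * y $ i\<rfloor> = n i}) ` F"
 proof
  fix c assume "c : cell m ` S"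
  then obtain x where x: "x : S" "c = cell m x" by blast
  have "\<lfloor>2 ^ m * x $ i\<rfloor> : {- N..N}" for i
  proof -
   have "abs (x $ i) <= B" using component_le_norm_cart[of x i] B[OF x(1)] by linarith
   then have "abs (2 ^ m * x $ i) <= 2 ^ m * B" by (simp add: abs_mult)
   then show ?thesis unfolding N_def atLeastAtMost_iff by linarith
  qed
  then show "c : (%n. {y. ALL i. \<lfloor>2 ^ m * y $ i\<rfloor> = n i}) ` F"
   using x by (intro image_eqI[of _ _ "%i. \<lfloor>2 ^ m * x $ i\<rfloor>"]) (auto simp: cell_def F_def)
 qed
 ultimately show ?thesis by (meson finite_imageI finite_subset)
qed

lemma finite_cells: "finite (cell m ` cell k a)"
 by (intro finite_cells_bounded bounded_subset[OF compact_imp_bounded[OF compact_closed_cell] cell_subset_closed_cell])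

definition cell_avg :: "nat => (real ^ 3 => real) => real ^ 3 => real" where
 "cell_avg k V x = 8 ^ k * (LINT y:cell k x|lborel. V y)"

lemma set_integrable_bounded:
 fixes V :: "real ^ 3 => real"
 assumes Q: "Q : sets borel" "emeasure lborel Q < \<infinity>"
  and V: "(%x. indicator Q x *R V x) : borel_measurable borel" and B: "!!x. x : Q ==> abs (V x) <= B"
 shows "set_integrable lborel Q V"
 unfolding set_integrable_def
proof (rule Bochner_Integration.integrable_bound)
 show "integrable lborel (%x. indicator Q x *R (abs B))"
  using Q by (intro integrable_scaleR_left) (auto intro!: integrable_real_indicator)
 show "(%x. indicator Q x *R V x) : borel_measurable lborel" using V by simp
 show "AE x in lborel. norm (indicator Q x *R V x) <= norm (indicator Q x *R (abs B))"
  using order_trans[OF B abs_ge_self] by (intro AE_I2) (auto simp: indicator_def)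
qed

text \<open>
  Jensen's inequality for squares; \<open>8\<^sup>k\<close> is the inverse of the volume of the cell.
\<close>

lemma cell_avg_jensen:
 assumes V: "(%x. indicator (cell k a) x *R V x) : borel_measurable borel"
  and B: "!!x. x : cell k a ==> abs (V x) <= B"
 shows "ennreal ((cell_avg k V a - c)^2) <= ennreal (8 ^ k) * (lint (cell k a) (%x. ennreal ((V x - c)^2)))"
proof -
 let ?Q = "cell k a"
 have [measurable]: "(%x. indicator ?Q x *R V x) : borel_measurable borel" by (rule V)
 have iV: "set_integrable lborel ?Q V" by (rule set_integrable_bounded[OF _ _ V B]) auto
 have ic: "set_integrable lborel ?Q (%_. b)" for b :: real
  by (rule set_integrable_bounded[where B = "abs b"]) auto
 have i2: "set_integrable lborel ?Q (%x. (V x - c)^2)"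
 proof (rule set_integrable_bounded[where B = "(abs B + abs c)^2"])
  have "(%x. indicator ?Q x *R (indicator ?Q x *R V x - c)^2) : borel_measurable borel" by measurable
  moreover have "(%x. indicator ?Q x *R (indicator ?Q x *R V x - c)^2) = (%x. indicator ?Q x *R (V x - c)^2)"
   by (auto simp: indicator_def)
  ultimately show "(%x. indicator ?Q x *R (V x - c)^2) : borel_measurable borel" by simp
  show "abs ((V x - c)^2) <= (abs B + abs c)^2" if "x : ?Q" for x
   using B[OF that] by (simp add: power2_le_iff_abs_le)
 qed auto
 define m where "m = cell_avg k V a"
 have mI: "(LINT x:?Q|lborel. V x) = m / 8 ^ k" by (simp add: m_def cell_avg_def)
 have cI: "(LINT x:?Q|lborel. b) = b / 8 ^ k" for b :: real by (simp add: set_lebesgue_integral_def)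
 have e: "(V x - m)^2 = (V x - c)^2 - (2 * (m - c)) * V x + (m^2 - c^2)" for x
  by (simp add: power2_eq_square algebra_simps)
 have "0 <= (LINT x:?Q|lborel. (V x - m)^2)"
  unfolding set_lebesgue_integral_def by (intro integral_nonneg_AE) (auto simp: indicator_def)
 also have "... = (LINT x:?Q|lborel. (V x - c)^2) - (2 * (m - c)) * (m / 8 ^ k) + (m^2 - c^2) / 8 ^ k"
  unfolding e
  by (subst set_integral_add, (intro set_integral_diff i2 iV set_integrable_mult_right ic)+)
    (subst set_integral_diff, (intro i2 iV set_integrable_mult_right)+, simp add: mI cI)
 finally have "(2 * (m - c)) * (m / 8 ^ k) - (m^2 - c^2) / 8 ^ k <= (LINT x:?Q|lborel. (V x - c)^2)" by simp
 moreover have "(2 * (m - c)) * (m / 8 ^ k) - (m^2 - c^2) / 8 ^ k = (m - c)^2 / 8 ^ k"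
  by (simp add: field_simps power2_eq_square)
 ultimately have "(m - c)^2 / 8 ^ k <= (LINT x:?Q|lborel. (V x - c)^2)" by simp
 then have "(m - c)^2 <= 8 ^ k * (LINT x:?Q|lborel. (V x - c)^2)"
  by (simp only: pos_divide_le_eq[OF zero_less_power[of "8::real" k, OF zero_less_numeral]] mult.commute)
 then have "ennreal ((m - c)^2) <= ennreal (8 ^ k) * ennreal (LINT x:?Q|lborel. (V x - c)^2)"
  by (subst ennreal_mult'[symmetric]) (auto intro: ennreal_leI)
 also have "ennreal (LINT x:?Q|lborel. (V x - c)^2) = (nn_integral lborel (%x. ennreal (indicator ?Q x *R (V x - c)^2)))"
  unfolding set_lebesgue_integral_def
  by (rule nn_integral_eq_integral[symmetric]) (use i2 in \<open>auto simp: set_integrable_def\<close>)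
 also have "... = (lint ?Q (%x. ennreal ((V x - c)^2)))"
  by (intro nn_integral_cong) (auto simp: indicator_def)
 finally show ?thesis by (simp add: m_def)
qed

section \<open>Averages over shrinking cells\<close>

text \<open>
  A \<open>C\<^sup>1\<close> function on a closed cell with its gradient. This is what a smooth function on the
  manifold becomes in a chart.
\<close>

locale cell_function =
 fixes k0 :: nat and a :: "real ^ 3" and V :: "real ^ 3 => real" and D :: "real ^ 3 => real ^ 3"
 assumes der: "!!x. x : closed_cell k0 a ==> (V has_derivative (%h. D x \<bullet> h)) (at x)"
  and cont: "continuous_on (closed_cell k0 a) D"
begin

lemma contV: "continuous_on (closed_cell k0 a) V"
 using der has_derivative_continuous continuous_at_imp_continuous_on by blast

lemma V_bounded: "EX B. ALL x:cell k0 a. abs (V x) <= B"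
 using compact_imp_bounded[OF compact_continuous_image[OF contV compact_closed_cell]] cell_subset_closed_cell[of k0 a]
 unfolding bounded_iff by auto

lemma D_bounded: "EX B. ALL x:cell k0 a. norm (D x) <= B"
 using compact_imp_bounded[OF compact_continuous_image[OF cont compact_closed_cell]] cell_subset_closed_cell[of k0 a]
 unfolding bounded_iff by auto

lemma subcell:
 assumes "k0 <= k" "x : cell k0 a"
 shows "cell k x \<subseteq> cell k0 a"
 using cell_mono[OF assms(1), of x] cell_eq[OF assms(2)] by blast

lemma V_meas:
 assumes "Q \<subseteq> cell k0 a" "Q : sets borel"
 shows "(%x. indicator Q x *R V x) : borel_measurable borel"
 by (rule borel_measurable_continuous_on_indicator[OF assms(2) continuous_on_subset[OF contV]])
   (use assms cell_subset_closed_cell in blast)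

lemma D_meas:
 assumes "Q \<subseteq> cell k0 a" "Q : sets borel"
 shows "(%x. indicator Q x *R D x) : borel_measurable borel"
 by (rule borel_measurable_continuous_on_indicator[OF assms(2) continuous_on_subset[OF cont]])
   (use assms cell_subset_closed_cell in blast)

definition energy :: "nat => real ^ 3 => ennreal" where
 "energy k x = (lint (cell k x) (%y. ennreal ((norm (D y))^2)))"

text \<open>
  The Poincare inequality on a cell whose squared diameter is at most \<open>3 / 4\<^sup>k\<close>, with one of the
  two points averaged out.
\<close>

lemma oscillation:
 assumes k: "k0 <= k" and x: "x : cell k0 a"
 shows "(lint (cell k x) (%y. ennreal ((V y - cell_avg k V x)^2))) <= ennreal (24 / 4 ^ k) * energy k x"
proof -
 have sub: "cell k x \<subseteq> cell k0 a" by (rule subcell[OF k x])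
 obtain B where B: "!!x. x : cell k0 a ==> abs (V x) <= B" using V_bounded by blast
 have m: "(%y. indicator (cell k x) y *R V y) : borel_measurable borel" by (rule V_meas[OF sub]) simp
 have [measurable]: "(%y. indicator (cell k x) y *R V y) : borel_measurable borel" by (rule m)
 have "(lint (cell k x) (%y. ennreal ((V y - cell_avg k V x)^2)))
  <= (lint (cell k x) (%y. ennreal (8 ^ k) * (lint (cell k x) (%z. ennreal ((V y - V z)^2)))))"
 proof (intro nn_integral_mono mult_right_mono)
  fix y
  have "ennreal ((cell_avg k V x - V y)^2) <= ennreal (8 ^ k) * (lint (cell k x) (%z. ennreal ((V z - V y)^2)))"
   by (rule cell_avg_jensen[OF m B]) (use sub in auto)
  then show "ennreal ((V y - cell_avg k V x)^2) <= ennreal (8 ^ k) * (lint (cell k x) (%z. ennreal ((V y - V z)^2)))"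
   by (simp add: power2_commute)
 qed simp
 also have "... = ennreal (8 ^ k) * (lint (cell k x) (%y. (lint (cell k x) (%z. ennreal ((V y - V z)^2)))))"
 proof -
  define g where "g y = indicator (cell k x) y *R V y" for y
  have [measurable]: "g : borel_measurable borel" unfolding g_def by (rule m)
  have "(%y. (lint (cell k x) (%z. ennreal ((g y - g z)^2))) * indicator (cell k x) y) : borel_measurable lborel"
   by measurable
  moreover have "(%y. (lint (cell k x) (%z. ennreal ((g y - g z)^2))) * indicator (cell k x) y)
   = (%y. (lint (cell k x) (%z. ennreal ((V y - V z)^2))) * indicator (cell k x) y)"
  proof
   fix y
   have "y : cell k x ==> (lint (cell k x) (%z. ennreal ((g y - g z)^2))) = (lint (cell k x) (%z. ennreal ((V y - V z)^2)))"
    by (intro nn_integral_cong) (auto simp: g_def indicator_def)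
   then show "(lint (cell k x) (%z. ennreal ((g y - g z)^2))) * indicator (cell k x) y
    = (lint (cell k x) (%z. ennreal ((V y - V z)^2))) * indicator (cell k x) y" by (cases "y : cell k x") auto
  qed
  ultimately show ?thesis by (subst nn_integral_cmult[symmetric]) (auto simp: mult.assoc)
 qed
 also have "... <= ennreal (8 ^ k) * (ennreal (8 * (3 / 4 ^ k)) * emeasure lborel (cell k x) * energy k x)"
  unfolding energy_def
  by (intro mult_left_mono poincare_convex convex_cell der continuous_on_subset[OF cont])
    (use sub cell_subset_closed_cell[of k0 a] diam_cell in auto)
 also have "... = ennreal (24 / 4 ^ k) * energy k x"
  by (simp add: mult.assoc[symmetric] flip: ennreal_mult)
 finally show ?thesis .
qed

text \<open>
  By Jensen's inequality on the subcell, whose volume is \<open>8\<^sup>-\<^sup>k\<^sup>-\<^sup>1\<close>, the step is controlled by the oscillation on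
  the cell; \<open>192\<close> is \<open>8 * 24\<close>, and \<open>8\<^sup>k / 4\<^sup>k = 2\<^sup>k\<close>.
\<close>

lemma avg_step:
 assumes k: "k0 <= k" and x: "x : cell k0 a"
 shows "ennreal ((cell_avg (Suc k) V x - cell_avg k V x)^2) <= ennreal (192 * 2 ^ k) * energy k x"
proof -
 have sub: "cell (Suc k) x \<subseteq> cell k0 a" by (rule subcell) (use k x in auto)
 obtain B where B: "!!x. x : cell k0 a ==> abs (V x) <= B" using V_bounded by blast
 have "ennreal ((cell_avg (Suc k) V x - cell_avg k V x)^2)
  <= ennreal (8 ^ Suc k) * (lint (cell (Suc k) x) (%y. ennreal ((V y - cell_avg k V x)^2)))"
  by (rule cell_avg_jensen[OF V_meas[OF sub] B]) (use sub in auto)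
 also have "... <= ennreal (8 ^ Suc k) * (lint (cell k x) (%y. ennreal ((V y - cell_avg k V x)^2)))"
  using cell_mono[of k "Suc k" x]
  by (intro mult_left_mono nn_integral_mono) (auto simp: indicator_def)
 also have "... <= ennreal (8 ^ Suc k) * (ennreal (24 / 4 ^ k) * energy k x)"
  by (intro mult_left_mono oscillation[OF k x]) auto
 also have "... = ennreal (192 * 2 ^ k) * energy k x"
 proof -
  have "(8::real) ^ k = 4 ^ k * 2 ^ k" by (simp flip: power_mult_distrib)
  then have "8 ^ Suc k * (24 / 4 ^ k) = 192 * (2::real) ^ k" by simp
  then show ?thesis by (simp add: mult.assoc[symmetric] flip: ennreal_mult)
 qed
 finally show ?thesis .
qed

lemma energy_mono: "k0 <= k ==> x : cell k0 a ==> energy k x <= energy k0 a"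
 unfolding energy_def using subcell by (intro nn_integral_mono) (auto simp: indicator_def)

lemma energy_finite: "energy k0 a < \<infinity>"
proof -
 obtain B where B: "!!x. x : cell k0 a ==> norm (D x) <= B" using D_bounded by blast
 have "energy k0 a <= (lint (cell k0 a) (%y. ennreal (B^2)))"
  unfolding energy_def using B
  by (intro nn_integral_mono) (auto simp: indicator_def intro!: ennreal_leI power_mono)
 also have "... < \<infinity>" by (subst nn_integral_cmult_indicator) (auto simp: ennreal_mult_less_top)
 finally show ?thesis .
qed

lemma cell_relation_measurable: "{p. snd p : cell k (fst p)} : sets (borel \<Otimes>\<^sub>M borel)"
proof -
 have "{p :: (real ^ 3) \<times> (real ^ 3). snd p : cell k (fst p)}
  = (\<Inter>i. {p : space (borel \<Otimes>\<^sub>M borel). \<lfloor>2 ^ k * snd p $ i\<rfloor> = \<lfloor>2 ^ k * fst p $ i\<rfloor>})"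
  by (auto simp: cell_def space_pair_measure)
 also have "... : sets (borel \<Otimes>\<^sub>M borel)"
 proof -
  have nth: "(%x :: real ^ 3. x $ i) : borel_measurable borel" for i
   by (intro borel_measurable_continuous_onI continuous_intros)
  have [measurable]: "(%p :: (real ^ 3) \<times> (real ^ 3). fst p $ i) : borel_measurable (borel \<Otimes>\<^sub>M borel)"
   "(%p :: (real ^ 3) \<times> (real ^ 3). snd p $ i) : borel_measurable (borel \<Otimes>\<^sub>M borel)" for i
   by (rule measurable_compose[OF measurable_fst nth], rule measurable_compose[OF measurable_snd nth])
  show ?thesis by measurable
 qed
 finally show ?thesis .
qed

text \<open>
  Every point of the big cell lies in exactly one cell of level \<open>k\<close>, so Fubini's theorem weighs
  each point with the volume of its own cell.
\<close>

lemma energy_integral: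
 assumes k: "k0 <= k"
 shows "(lint (cell k0 a) (%x. energy k x)) = ennreal (1 / 8 ^ k) * energy k0 a"
proof -
 let ?q = "cell k0 a"
 define h where "h y = ennreal ((norm (indicator ?q y *R D y))^2)" for y
 have [measurable]: "(%y. indicator ?q y *R D y) : borel_measurable borel" by (rule D_meas) auto
 have [measurable]: "h : borel_measurable borel" unfolding h_def by measurable
 let ?R = "{p. snd p : cell k (fst p)}"
 have R[measurable]: "?R : sets (borel \<Otimes>\<^sub>M borel)" by (rule cell_relation_measurable)
 have "(lint ?q (%x. energy k x)) = (nn_integral lborel (%x. (nn_integral lborel (%y. h y * indicator ?R (x, y) * indicator ?q x))))"
 proof (intro nn_integral_cong)
  fix x
  show "energy k x * indicator ?q x = (nn_integral lborel (%y. h y * indicator ?R (x, y) * indicator ?q x))"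
  proof (cases "x : ?q")
   case True
   have "energy k x = (nn_integral lborel (%y. h y * indicator ?R (x, y)))"
    unfolding energy_def using subcell[OF k True] by (intro nn_integral_cong) (auto simp: h_def indicator_def)
   then show ?thesis using True by simp
  qed simp
 qed
 also have "... = (nn_integral lborel (%y. (nn_integral lborel (%x. h y * indicator ?R (x, y) * indicator ?q x))))"
  by (rule lborel_pair.Fubini') measurable
 also have "... = (lint ?q (%y. ennreal (1 / 8 ^ k) * ennreal ((norm (D y))^2)))"
 proof (intro nn_integral_cong)
  fix y
  show "(nn_integral lborel (%x. h y * indicator ?R (x, y) * indicator ?q x)) = ennreal (1 / 8 ^ k) * ennreal ((norm (D y))^2) * indicator ?q y"
  proof (cases "y : ?q")
   case True
   have "(nn_integral lborel (%x. h y * indicator ?R (x, y) * indicator ?q x)) = (nn_integral lborel (%x. h y * indicator (cell k y) x))"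
    using subcell[OF k True] in_cell_commute by (intro nn_integral_cong) (auto simp: indicator_def)
   also have "... = h y * ennreal (1 / 8 ^ k)" by (subst nn_integral_cmult_indicator) auto
   finally show ?thesis using True by (simp add: h_def mult.commute)
  qed (simp add: h_def)
 qed
 also have "... = ennreal (1 / 8 ^ k) * energy k0 a"
 proof -
  have "(%y. ennreal ((norm (D y))^2) * indicator ?q y) = h" by (auto simp: h_def indicator_def)
  then have "(%y. ennreal ((norm (D y))^2) * indicator ?q y) : borel_measurable lborel" by simp
  then show ?thesis unfolding energy_def by (subst nn_integral_cmult[symmetric]) (auto simp: mult.assoc)
 qed
 finally show ?thesis .
qed

lemma cell_avg_measurable:
 assumes k: "k0 <= k"
 shows "(%x. indicator (cell k0 a) x * cell_avg k V x) : borel_measurable borel"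
proof -
 let ?q = "cell k0 a"
 define h where "h y = indicator ?q y *R V y" for y
 have [measurable]: "h : borel_measurable borel" unfolding h_def by (rule V_meas) auto
 let ?R = "{p. snd p : cell k (fst p)}"
 have R[measurable]: "?R : sets (borel \<Otimes>\<^sub>M borel)" by (rule cell_relation_measurable)
 have "(%x. indicator ?q x * (8 ^ k * (\<integral>y. indicator ?R (x, y) * h y \<partial>lborel))) : borel_measurable borel"
  by measurable
 moreover have "(%x. indicator ?q x * (8 ^ k * (\<integral>y. indicator ?R (x, y) * h y \<partial>lborel))) = (%x. indicator ?q x * cell_avg k V x)"
 proof
  fix x
  show "indicator ?q x * (8 ^ k * (\<integral>y. indicator ?R (x, y) * h y \<partial>lborel)) = indicator ?q x * cell_avg k V x"
  proof (cases "x : ?q")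
   case True
   have "(\<integral>y. indicator ?R (x, y) * h y \<partial>lborel) = (LINT y:cell k x|lborel. V y)"
    unfolding set_lebesgue_integral_def using subcell[OF k True]
    by (intro Bochner_Integration.integral_cong) (auto simp: h_def indicator_def)
   then show ?thesis by (simp add: cell_avg_def)
  qed simp
 qed
 ultimately show ?thesis by simp
qed

lemma cell_avg_tendsto:
 assumes x: "x : cell k0 a"
 shows "(%k. cell_avg k V x) ----> V x"
proof (rule LIMSEQ_I)
 fix e :: real assume e: "e > 0"
 have "isCont V x" using der x cell_subset_closed_cell has_derivative_continuous by blast
 then obtain d where d: "d > 0" "!!y. dist y x < d ==> dist (V y) (V x) < e/2"
  unfolding continuous_at_eps_delta using e half_gt_zero by metis
 have "(%k. 3 * (1/4::real) ^ k) ----> 3 * 0" by (intro tendsto_intros LIMSEQ_realpow_zero) auto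
 from order_tendstoD(2)[OF this, of "d^2"]
 have "eventually (%k. 3 * (1/4::real) ^ k < d^2) sequentially" using d(1) by simp
 then obtain N where N: "!!k. k >= N ==> 3 * (1/4::real) ^ k < d^2" by (auto simp: eventually_sequentially)
 have "abs (cell_avg k V x - V x) < e" if k: "k >= max N k0" for k
 proof -
  have sub: "cell k x \<subseteq> cell k0 a" by (rule subcell) (use k x in auto)
  obtain B where B: "!!x. x : cell k0 a ==> abs (V x) <= B" using V_bounded by blast
  have close: "abs (V y - V x) <= e/2" if y: "y : cell k x" for y
  proof -
   have "(norm (y - x))^2 <= 3 / 4 ^ k" by (rule diam_cell[OF y]) simp
   also have "... < d^2" using N[of k] k by (simp add: power_one_over field_simps)
   finally have "norm (y - x) < d" using d(1) by (simp add: power2_less_imp_less)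
   then show ?thesis using d(2)[of y] by (simp add: dist_norm)
  qed
  have "ennreal ((cell_avg k V x - V x)^2) <= ennreal (8 ^ k) * (lint (cell k x) (%y. ennreal ((V y - V x)^2)))"
   by (rule cell_avg_jensen[OF V_meas[OF sub] B]) (use sub in auto)
  also have "... <= ennreal (8 ^ k) * (lint (cell k x) (%y. ennreal ((e/2)^2)))"
   using close by (intro mult_left_mono nn_integral_mono) (auto simp: indicator_def power2_le_iff_abs_le e less_imp_le intro!: ennreal_leI)
  also have "... = ennreal ((e/2)^2)"
   by (subst nn_integral_cmult_indicator) (auto simp flip: ennreal_mult)
  finally have "(cell_avg k V x - V x)^2 <= (e/2)^2" by simp
  then have "abs (cell_avg k V x - V x) <= e/2" using e by (simp add: power2_le_iff_abs_le)
  then show ?thesis using e by linarith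
 qed
 then show "EX N. ALL k>=N. norm (cell_avg k V x - V x) < e" by (intro exI[of _ "max N k0"]) auto
qed

end

lemma geometric_sum_le:
 fixes x :: real
 assumes "0 <= x" "x < 1"
 shows "(\<Sum>k\<in>{m..<n}. x ^ k) <= x ^ m / (1 - x)"
proof (cases "m <= n")
 case True
 then have "(1 - x) * (\<Sum>k\<in>{m..<n}. x ^ k) = x ^ m - x ^ n"
 proof (induction n rule: dec_induct)
  case (step n)
  have "(1 - x) * (\<Sum>k\<in>{m..<Suc n}. x ^ k) = (1 - x) * (\<Sum>k\<in>{m..<n}. x ^ k) + (1 - x) * x ^ n"
   using step.hyps by (simp add: distrib_left)
  then show ?case unfolding step.IH by (simp add: algebra_simps)
 qed simp
 then have "(\<Sum>k\<in>{m..<n}. x ^ k) = (x ^ m - x ^ n) / (1 - x)" using assms by (simp add: field_simps)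
 then show ?thesis using assms by (simp add: divide_right_mono)
next
 case False then show ?thesis using assms by simp
qed

text \<open>
  The geometric weights sum to less than \<open>1 / (1 - x)\<close>, and the largest \<open>b\<close> is bounded by the
  sum of the powers. This replaces Hoelder's inequality for sums.
\<close>

lemma weighted_sum_powr_le:
 fixes b :: "nat => real"
 assumes x: "0 < x" "x < 1" and b: "!!k. 0 <= b k" and r: "r > 0"
 shows "(\<Sum>k\<in>{m..<n}. x ^ k * b k) powr r <= (1 / (1 - x)) powr r * (\<Sum>k\<in>{m..<n}. b k powr r)"
proof (cases "m < n")
 case True
 define M where "M = Max (b ` {m..<n})"
 have M: "b k <= M" if "k : {m..<n}" for k unfolding M_def using that by (intro Max_ge) auto
 have "M : b ` {m..<n}" unfolding M_def using True by (intro Max_in) auto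
 then obtain j where j: "j : {m..<n}" "M = b j" by auto
 have M0: "0 <= M" using j b by simp
 have "(\<Sum>k\<in>{m..<n}. x ^ k * b k) <= (\<Sum>k\<in>{m..<n}. x ^ k * M)"
  using x M by (intro sum_mono mult_left_mono) auto
 also have "... = (\<Sum>k\<in>{m..<n}. x ^ k) * M" by (simp add: sum_distrib_right)
 also have "... <= (x ^ m / (1 - x)) * M" using x M0 by (intro mult_right_mono geometric_sum_le) auto
 also have "... <= (1 / (1 - x)) * M" using x M0 by (intro mult_right_mono divide_right_mono) (auto simp: power_le_one)
 finally have "(\<Sum>k\<in>{m..<n}. x ^ k * b k) powr r <= ((1 / (1 - x)) * M) powr r"
  using x b r by (intro powr_mono2 sum_nonneg) auto
 also have "... = (1 / (1 - x)) powr r * M powr r" using x M0 by (intro powr_mult)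
 also have "M powr r <= (\<Sum>k\<in>{m..<n}. b k powr r)"
  unfolding j(2) by (rule member_le_sum[OF j(1)]) auto
 finally show ?thesis by (simp add: mult_left_mono)
qed auto

context cell_function begin

text \<open>
  \<open>V\<close> is the limit of its averages, so \<open>|V - avg|\<close> is at most the sum of the steps
  from level \<open>m\<close> on. The \<open>r\<close>-th power of step \<open>k\<close> is bounded through \<open>avg_step\<close> by \<open>(192 * 2\<^sup>k)\<^sup>r\<^sup>/\<^sup>2\<close> times
  \<open>E\<^sup>r\<^sup>/\<^sup>2\<^sup>-\<^sup>1\<close> times the energy of the cell of level \<open>k\<close>, where \<open>E\<close> is the total energy, and the integral of that
  energy is \<open>8\<^sup>-\<^sup>k E\<close>. Hence step \<open>k\<close> contributes \<open>2\<close> to the power \<open>- k (3 - r/2)\<close>, which is where \<open>r < 6\<close>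
  enters. One half of this exponent, spread by \<open>\<delta>\<close>, pays for the geometric weights that separate the steps
  under the power \<open>r\<close>; the other half, \<open>\<theta>\<close>, remains for the summation over \<open>k\<close>.
\<close>

lemma avg_error:
 assumes r: "2 < r" "r < 6" and m: "k0 <= m"
 defines "\<delta> \<equiv> (3 - r / 2) / (2 * r)" and "\<theta> \<equiv> (3 - r / 2) / 2"
 shows "(lint (cell k0 a) (%x. ennreal (abs (V x - cell_avg m V x) powr r)))
  <= ennreal ((1 / (1 - 2 powr - \<delta>)) powr r * 192 powr (r / 2) * ((2 powr - \<theta>) ^ m / (1 - 2 powr - \<theta>))
    * enn2real (energy k0 a) powr (r / 2))"
proof -
 let ?q = "cell k0 a"
 define x\<delta> where "x\<delta> = 2 powr - \<delta>"
 define x\<theta> where "x\<theta> = 2 powr - \<theta>"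
 have dpos: "\<delta> > 0" "\<theta> > 0" using r by (auto simp: \<delta>_def \<theta>_def)
 have xd: "0 < x\<delta>" "x\<delta> < 1" "0 < x\<theta>" "x\<theta> < 1"
  using dpos by (auto simp: x\<delta>_def x\<theta>_def powr_minus field_simps)
 define G where "G = enn2real (energy k0 a)"
 define g where "g k x = enn2real (energy k x)" for k x
 have G0: "0 <= G" by (simp add: G_def)
 have gG: "0 <= g k x" "g k x <= G" "energy k x = ennreal (g k x)" if "k0 <= k" "x : ?q" for k x
  using energy_mono[OF that] energy_finite
  by (auto simp: g_def G_def enn2real_mono ennreal_enn2real_if top_unique)
 define b where "b k x = (1 / x\<delta>) ^ k * sqrt (192 * 2 ^ k * g k x)" for k x
 define c where "c = 192 powr (r / 2) * G powr (r / 2 - 1)"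
 have one_step: "abs (cell_avg (Suc k) V x - cell_avg k V x) <= x\<delta> ^ k * b k x" if "k0 <= k" "x : ?q" for k x
 proof -
  have "ennreal ((cell_avg (Suc k) V x - cell_avg k V x)^2) <= ennreal (192 * 2 ^ k * g k x)"
   using avg_step[OF that] gG[OF that] by (simp add: ennreal_mult)
  then have "(cell_avg (Suc k) V x - cell_avg k V x)^2 <= 192 * 2 ^ k * g k x" using gG[OF that] by simp
  then have "abs (cell_avg (Suc k) V x - cell_avg k V x) <= sqrt (192 * 2 ^ k * g k x)" by (rule real_le_rsqrt[of "abs _", simplified])
  also have "... = x\<delta> ^ k * b k x" using xd by (simp add: b_def power_one_over)
  finally show ?thesis .
 qed
 have diff: "abs (cell_avg n V x - cell_avg m V x) <= (\<Sum>k\<in>{m..<n}. x\<delta> ^ k * b k x)" if "m <= n" "x : ?q" for n x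
  using that(1)
 proof (induction n rule: dec_induct)
  case (step n)
  have "abs (cell_avg (Suc n) V x - cell_avg m V x) <= abs (cell_avg (Suc n) V x - cell_avg n V x) + abs (cell_avg n V x - cell_avg m V x)" by linarith
  moreover have "abs (cell_avg (Suc n) V x - cell_avg n V x) <= x\<delta> ^ n * b n x"
   by (rule one_step) (use step.hyps m that in auto)
  ultimately show ?case using step.IH step.hyps by (simp add: sum.atLeastLessThan_Suc)
 qed simp
 have bpow: "b k x powr r <= c * (8 * x\<theta>) ^ k * g k x" if "k0 <= k" "x : ?q" for k x
 proof -
  have g: "0 <= g k x" "g k x <= G" using gG[OF that] by auto
  have e: "b k x = 2 powr (\<delta> * k) * (192 powr (1/2) * 2 powr (k / 2) * g k x powr (1/2))"
  proof -
   have "(1 / x\<delta>) ^ k = 2 powr (\<delta> * k)" by (simp add: x\<delta>_def powr_minus field_simps powr_powr flip: powr_realpow)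
   moreover have "sqrt (192 * 2 ^ k * g k x) = 192 powr (1/2) * 2 powr (k / 2) * g k x powr (1/2)"
    using g by (simp add: real_sqrt_mult powr_half_sqrt powr_half_sqrt_powr flip: powr_realpow)
   ultimately show ?thesis by (simp add: b_def)
  qed
  have "b k x powr r = 2 powr (\<delta> * k * r) * (192 powr (r / 2) * 2 powr (k / 2 * r) * g k x powr (r / 2))"
   unfolding e by (simp add: powr_mult powr_powr)
  also have "g k x powr (r / 2) <= G powr (r / 2 - 1) * g k x"
  proof (cases "g k x = 0")
   case False
   then have "g k x powr (r / 2) = g k x powr (r / 2 - 1) * g k x" using g by (simp add: powr_mult_base[symmetric] mult.commute powr_diff)
   also have "... <= G powr (r / 2 - 1) * g k x" using g r by (intro mult_right_mono powr_mono2) auto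
   finally show ?thesis .
  qed simp
  also have "2 powr (\<delta> * k * r) * (192 powr (r / 2) * 2 powr (k / 2 * r) * (G powr (r / 2 - 1) * g k x))
   = c * (2 powr (\<delta> * k * r) * 2 powr (k / 2 * r)) * g k x" by (simp add: c_def mult_ac)
  also have "2 powr (\<delta> * k * r) * 2 powr (k / 2 * r) = (8 * x\<theta>) ^ k"
  proof -
   have "\<delta> * k * r + k / 2 * r = 3 * real k + - \<theta> * k" using r by (simp add: \<delta>_def \<theta>_def field_simps)
   then have "2 powr (\<delta> * k * r) * 2 powr (k / 2 * r) = 2 powr (3 * real k) * 2 powr (- \<theta> * k)" by (simp flip: powr_add)
   also have "2 powr (3 * real k) = (8::real) ^ k" using powr_powr[of 2 3 "real k"] by (simp add: powr_realpow)
   also have "2 powr (- \<theta> * k) = x\<theta> ^ k" using powr_powr[of 2 "- \<theta>" "real k"] by (simp add: x\<theta>_def powr_realpow)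
   finally show ?thesis by (simp add: power_mult_distrib)
  qed
  finally show ?thesis by (simp add: mult_left_mono)
 qed
 define C1 where "C1 = (1 / (1 - x\<delta>)) powr r"
 have gm: "(%x. ennreal (g k x) * indicator ?q x) : borel_measurable lborel" if "k0 <= k" for k
 proof -
  define h where "h y = ennreal ((norm (indicator ?q y *R D y))^2)" for y
  have [measurable]: "(%y. indicator ?q y *R D y) : borel_measurable borel" by (rule D_meas) auto
  have [measurable]: "h : borel_measurable borel" unfolding h_def by measurable
  let ?R = "{p. snd p : cell k (fst p)}"
  have R[measurable]: "?R : sets (borel \<Otimes>\<^sub>M borel)" by (rule cell_relation_measurable)
  have "(%x. (nn_integral lborel (%y. h y * indicator ?R (x, y))) * indicator ?q x) : borel_measurable lborel" by measurable
  moreover have "(%x. (nn_integral lborel (%y. h y * indicator ?R (x, y))) * indicator ?q x) = (%x. ennreal (g k x) * indicator ?q x)"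
  proof
   fix x
   have "energy k x = (nn_integral lborel (%y. h y * indicator ?R (x, y)))" if "x : ?q"
    unfolding energy_def using subcell[OF \<open>k0 <= k\<close> that] by (intro nn_integral_cong) (auto simp: h_def indicator_def)
   then show "(nn_integral lborel (%y. h y * indicator ?R (x, y))) * indicator ?q x = ennreal (g k x) * indicator ?q x"
    using gG(3)[OF \<open>k0 <= k\<close>, of x] by (cases "x : ?q") auto
  qed
  ultimately show ?thesis by simp
 qed
 have fin: "(lint ?q (%x. ennreal (abs (cell_avg n V x - cell_avg m V x) powr r)))
   <= ennreal (C1 * 192 powr (r / 2) * (x\<theta> ^ m / (1 - x\<theta>)) * G powr (r / 2))" if n: "m <= n" for n
 proof -
  have c0: "0 <= c" by (simp add: c_def)
  have "(lint ?q (%x. ennreal (abs (cell_avg n V x - cell_avg m V x) powr r)))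
   <= (nn_integral lborel (%x. (\<Sum>k\<in>{m..<n}. ennreal (C1 * (c * (8 * x\<theta>) ^ k)) * (ennreal (g k x) * indicator ?q x))))"
  proof (intro nn_integral_mono)
   fix x
   show "ennreal (abs (cell_avg n V x - cell_avg m V x) powr r) * indicator ?q x
    <= (\<Sum>k\<in>{m..<n}. ennreal (C1 * (c * (8 * x\<theta>) ^ k)) * (ennreal (g k x) * indicator ?q x))"
   proof (cases "x : ?q")
    case True
    have "abs (cell_avg n V x - cell_avg m V x) powr r <= (\<Sum>k\<in>{m..<n}. x\<delta> ^ k * b k x) powr r"
     using diff[OF n True] r by (intro powr_mono2) auto
    also have "... <= C1 * (\<Sum>k\<in>{m..<n}. (if k0 <= k then b k x else 0) powr r)"
    proof -
     have "(\<Sum>k\<in>{m..<n}. x\<delta> ^ k * b k x) = (\<Sum>k\<in>{m..<n}. x\<delta> ^ k * (if k0 <= k then b k x else 0))"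
      using m by (intro sum.cong) auto
     then show ?thesis unfolding C1_def using xd r gG True
      by (auto intro!: weighted_sum_powr_le simp: b_def)
    qed
    also have "... <= C1 * (\<Sum>k\<in>{m..<n}. c * (8 * x\<theta>) ^ k * g k x)"
     using bpow True m by (intro mult_left_mono sum_mono) (auto simp: C1_def)
    finally have "ennreal (abs (cell_avg n V x - cell_avg m V x) powr r) <= ennreal (\<Sum>k\<in>{m..<n}. C1 * (c * (8 * x\<theta>) ^ k) * g k x)"
     by (intro ennreal_leI) (simp add: sum_distrib_left mult.assoc)
    also have "... = (\<Sum>k\<in>{m..<n}. ennreal (C1 * (c * (8 * x\<theta>) ^ k) * g k x))"
     using gG True m c0 xd by (subst sum_ennreal) (auto simp: C1_def intro!: mult_nonneg_nonneg)
    also have "... = (\<Sum>k\<in>{m..<n}. ennreal (C1 * (c * (8 * x\<theta>) ^ k)) * ennreal (g k x))"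
     using c0 xd by (intro sum.cong refl ennreal_mult') (auto simp: C1_def intro!: mult_nonneg_nonneg)
    finally show ?thesis using True by simp
   qed simp
  qed
  also have "... = (\<Sum>k\<in>{m..<n}. ennreal (C1 * (c * (8 * x\<theta>) ^ k)) * (lint ?q (%x. ennreal (g k x))))"
   using gm m by (subst nn_integral_sum) (auto simp: nn_integral_cmult intro!: borel_measurable_times_ennreal)
  also have "... = (\<Sum>k\<in>{m..<n}. ennreal (C1 * (c * x\<theta> ^ k) * G))"
  proof (intro sum.cong refl)
   fix k assume k: "k : {m..<n}"
   have "(lint ?q (%x. ennreal (g k x))) = (lint ?q (%x. energy k x))"
    using gG(3) k m by (intro nn_integral_cong) (auto simp: indicator_def)
   also have "... = ennreal (1 / 8 ^ k * G)"
   proof -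
    have eG: "energy k0 a = ennreal G" using energy_finite by (simp add: G_def)
    have "(lint ?q (%x. energy k x)) = ennreal (1 / 8 ^ k) * ennreal G"
     using energy_integral[of k] k m eG by simp
    also have "... = ennreal (1 / 8 ^ k * G)" by (rule ennreal_mult[symmetric]) (use G0 in auto)
    finally show ?thesis .
   qed
   finally show "ennreal (C1 * (c * (8 * x\<theta>) ^ k)) * (lint ?q (%x. ennreal (g k x))) = ennreal (C1 * (c * x\<theta> ^ k) * G)"
    using c0 G0 xd by (simp add: C1_def power_mult_distrib flip: ennreal_mult)
  qed
  also have "... = ennreal (\<Sum>k\<in>{m..<n}. C1 * (c * x\<theta> ^ k) * G)"
   using c0 G0 xd by (subst sum_ennreal) (auto simp: C1_def intro!: mult_nonneg_nonneg)
  also have "(\<Sum>k\<in>{m..<n}. C1 * (c * x\<theta> ^ k) * G) = C1 * c * G * (\<Sum>k\<in>{m..<n}. x\<theta> ^ k)"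
   unfolding sum_distrib_left by (intro sum.cong refl) (simp add: mult_ac)
  also have "... <= ennreal (C1 * c * G * (x\<theta> ^ m / (1 - x\<theta>)))"
   using c0 G0 xd by (intro ennreal_leI mult_left_mono geometric_sum_le) (auto simp: C1_def)
  also have "c * G = 192 powr (r / 2) * G powr (r / 2)"
  proof (cases "G = 0")
   case False
   then have "G powr (r / 2 - 1) * G = G powr (r / 2)" using G0 by (simp add: powr_diff)
   then show ?thesis by (simp add: c_def)
  qed (use r in simp)
  then have "C1 * c * G * (x\<theta> ^ m / (1 - x\<theta>)) = C1 * 192 powr (r / 2) * (x\<theta> ^ m / (1 - x\<theta>)) * G powr (r / 2)"
   by (simp add: mult_ac)
  finally show ?thesis .
 qed
 have mn: "(%x. indicator ?q x * cell_avg n V x) : borel_measurable borel" if "k0 <= n" for n by (rule cell_avg_measurable[OF that])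
 have meas: "(%x. ennreal (abs (cell_avg n V x - cell_avg m V x) powr r) * indicator ?q x) : borel_measurable lborel" if "m <= n" for n
 proof -
  have [measurable]: "(%x. indicator ?q x * cell_avg n V x) : borel_measurable borel" "(%x. indicator ?q x * cell_avg m V x) : borel_measurable borel"
   using mn m that by auto
  have "(%x. ennreal (abs (indicator ?q x * cell_avg n V x - indicator ?q x * cell_avg m V x) powr r)) : borel_measurable lborel" by measurable
  moreover have "(%x. ennreal (abs (indicator ?q x * cell_avg n V x - indicator ?q x * cell_avg m V x) powr r))
   = (%x. ennreal (abs (cell_avg n V x - cell_avg m V x) powr r) * indicator ?q x)" using r by (auto simp: indicator_def)
  ultimately show ?thesis by simp
 qed
 have lim: "(%n. ennreal (abs (cell_avg (n + m) V x - cell_avg m V x) powr r) * indicator ?q x)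
   ----> ennreal (abs (V x - cell_avg m V x) powr r) * indicator ?q x" for x
 proof (cases "x : ?q")
  case True
  have "(%n. cell_avg (n + m) V x) ----> V x" by (rule LIMSEQ_ignore_initial_segment[OF cell_avg_tendsto[OF True]])
  then have "(%n. ennreal (abs (cell_avg (n + m) V x - cell_avg m V x) powr r)) ----> ennreal (abs (V x - cell_avg m V x) powr r)"
   using r by (intro tendsto_ennrealI tendsto_powr' tendsto_intros) auto
  then show ?thesis using True by simp
 qed simp
 have "(lint ?q (%x. ennreal (abs (V x - cell_avg m V x) powr r)))
  = (nn_integral lborel (%x. liminf (%n. ennreal (abs (cell_avg (n + m) V x - cell_avg m V x) powr r) * indicator ?q x)))"
  by (intro nn_integral_cong lim_imp_Liminf[symmetric] lim) auto
 also have "... <= liminf (%n. (lint ?q (%x. ennreal (abs (cell_avg (n + m) V x - cell_avg m V x) powr r))))"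
  by (intro nn_integral_liminf meas) auto
 also have "... <= ennreal (C1 * 192 powr (r / 2) * (x\<theta> ^ m / (1 - x\<theta>)) * G powr (r / 2))"
  by (intro Liminf_le always_eventually allI fin) auto
 finally show ?thesis by (simp add: C1_def x\<delta>_def x\<theta>_def G_def)
qed

end

section \<open>Embedding, compactness and closability on a cell\<close>

lemma cell_function_diff:
 assumes "cell_function k a V D" "cell_function k a W E"
 shows "cell_function k a (%x. V x - W x) (%x. D x - E x)"
proof -
 interpret V: cell_function k a V D by fact
 interpret W: cell_function k a W E by fact
 show ?thesis
 proof
  show "((%x. V x - W x) has_derivative (%h. (D x - E x) \<bullet> h)) (at x)" if "x : closed_cell k a" for x
   unfolding inner_diff_left by (intro has_derivative_diff V.der W.der that)
  show "continuous_on (closed_cell k a) (%x. D x - E x)" by (intro continuous_intros V.cont W.cont)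
 qed
qed

context cell_function begin

lemma set_integrable_V:
 assumes "Q \<subseteq> cell k0 a" "Q : sets borel"
 shows "set_integrable lborel Q V"
proof -
 obtain B where "!!x. x : cell k0 a ==> abs (V x) <= B" using V_bounded by blast
 moreover have "emeasure lborel Q < \<infinity>"
  using emeasure_mono[OF assms(1), of lborel] by (auto simp: less_top[symmetric] top_unique)
 ultimately show ?thesis using assms by (intro set_integrable_bounded V_meas) auto
qed

lemma cell_avg_sq_le:
 assumes "k0 <= m" "x : cell k0 a"
 shows "ennreal ((cell_avg m V x)^2) <= ennreal (8 ^ m) * (lint (cell k0 a) (%y. ennreal ((V y)^2)))"
proof -
 have sub: "cell m x \<subseteq> cell k0 a" by (rule subcell[OF assms])
 obtain B where B: "!!x. x : cell k0 a ==> abs (V x) <= B" using V_bounded by blast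
 have "ennreal ((cell_avg m V x - 0)^2) <= ennreal (8 ^ m) * (lint (cell m x) (%y. ennreal ((V y - 0)^2)))"
  by (rule cell_avg_jensen[OF V_meas[OF sub] B]) (use sub in auto)
 also have "... <= ennreal (8 ^ m) * (lint (cell k0 a) (%y. ennreal ((V y)^2)))"
  using sub by (intro mult_left_mono nn_integral_mono) (auto simp: indicator_def)
 finally show ?thesis by simp
qed

lemma Lr_split:
 assumes r: "r > 0" and m: "k0 <= m" and E: "!!x. x : cell k0 a ==> abs (cell_avg m V x) <= c"
 shows "(lint (cell k0 a) (%x. ennreal (abs (V x) powr r)))
  <= ennreal (2 powr r) * (lint (cell k0 a) (%x. ennreal (abs (V x - cell_avg m V x) powr r))) + ennreal (2 powr r * c powr r)"
proof -
 let ?q = "cell k0 a"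
 have [measurable]: "(%x. indicator ?q x *R V x) : borel_measurable borel" "(%x. indicator ?q x * cell_avg m V x) : borel_measurable borel"
  using V_meas[of ?q] cell_avg_measurable[OF m] by auto
 have "(%x. ennreal (abs (indicator ?q x *R V x - indicator ?q x * cell_avg m V x) powr r)) : borel_measurable lborel" by measurable
 moreover have "(%x. ennreal (abs (indicator ?q x *R V x - indicator ?q x * cell_avg m V x) powr r))
  = (%x. ennreal (abs (V x - cell_avg m V x) powr r) * indicator ?q x)" using r by (auto simp: indicator_def)
 ultimately have [measurable]: "(%x. ennreal (abs (V x - cell_avg m V x) powr r) * indicator ?q x) : borel_measurable lborel" by (simp only:)
 have "(lint ?q (%x. ennreal (abs (V x) powr r)))
  <= (nn_integral lborel (%x. ennreal (2 powr r) * (ennreal (abs (V x - cell_avg m V x) powr r) * indicator ?q x) + ennreal (2 powr r * c powr r) * indicator ?q x))"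
 proof (intro nn_integral_mono)
  fix x
  show "ennreal (abs (V x) powr r) * indicator ?q x <= ennreal (2 powr r) * (ennreal (abs (V x - cell_avg m V x) powr r) * indicator ?q x) + ennreal (2 powr r * c powr r) * indicator ?q x"
  proof (cases "x : ?q")
   case True
   let ?a = "abs (V x - cell_avg m V x)"
   have c: "0 <= c" using E[OF True] by linarith
   have "abs (V x) <= ?a + c" using E[OF True] by linarith
   also have "... <= 2 * max ?a c" by (auto simp: max_def)
   finally have "abs (V x) powr r <= (2 * max ?a c) powr r" using r by (intro powr_mono2) auto
   also have "... <= 2 powr r * (?a powr r) + 2 powr r * c powr r"
    using c by (cases "?a <= c") (auto simp: powr_mult max_def)
   finally have "ennreal (abs (V x) powr r) <= ennreal (2 powr r * (?a powr r) + 2 powr r * c powr r)" by (rule ennreal_leI)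
   then show ?thesis using True by (simp add: ennreal_mult)
  qed simp
 qed
 also have "... = ennreal (2 powr r) * (lint ?q (%x. ennreal (abs (V x - cell_avg m V x) powr r))) + ennreal (2 powr r * c powr r) * ennreal (1 / 8 ^ k0)"
  by (subst nn_integral_add) (auto simp: nn_integral_cmult)
 also have "ennreal (2 powr r * c powr r) * ennreal (1 / 8 ^ k0) <= ennreal (2 powr r * c powr r)"
  by (subst ennreal_mult[symmetric]) (auto intro!: ennreal_leI mult_left_le simp del: times_divide_eq_right)
 finally show ?thesis by (simp add: add_left_mono)
qed

end

text \<open>
  Up to the error of \<open>avg_error\<close> the function equals its average over the whole cell, and that
  average is bounded by the \<open>L\<^sup>2\<close> norm.
\<close>

lemma cell_embedding:
 assumes r: "2 < r" "r < 6"
 shows "EX C>=0. ALL V D. cell_function k0 a V D -->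
  (ALL B>=0. (lint (cell k0 a) (%x. ennreal ((V x)^2))) <= ennreal B -->
   (lint (cell k0 a) (%x. ennreal ((norm (D x))^2))) <= ennreal B -->
   (lint (cell k0 a) (%x. ennreal (abs (V x) powr r))) <= ennreal (C * B powr (r / 2)))"
proof -
 define \<delta> where "\<delta> = (3 - r / 2) / (2 * r)"
 define \<theta> where "\<theta> = (3 - r / 2) / 2"
 define K where "K = (1 / (1 - 2 powr - \<delta>)) powr r * 192 powr (r / 2) * ((2 powr - \<theta>) ^ k0 / (1 - 2 powr - \<theta>))"
 have "\<theta> > 0" using r by (simp add: \<theta>_def)
 then have x1: "2 powr - \<theta> < 1" by (simp add: powr_minus field_simps)
 then have K0: "0 <= K" unfolding K_def by (intro mult_nonneg_nonneg divide_nonneg_nonneg) auto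
 define C where "C = 2 powr r * K + 2 powr r * (8 ^ k0) powr (r / 2)"
 have "(lint (cell k0 a) (%x. ennreal (abs (V x) powr r))) <= ennreal (C * B powr (r / 2))"
  if cf: "cell_function k0 a V D" and B: "0 <= B" and V: "(lint (cell k0 a) (%x. ennreal ((V x)^2))) <= ennreal B"
   and D: "(lint (cell k0 a) (%x. ennreal ((norm (D x))^2))) <= ennreal B" for V D B
 proof -
  interpret cell_function k0 a V D by fact
  have "enn2real (energy k0 a) <= B" using D B unfolding energy_def by (simp add: enn2real_leI)
  then have G: "enn2real (energy k0 a) powr (r / 2) <= B powr (r / 2)" using r by (intro powr_mono2) auto
  have E: "abs (cell_avg k0 V x) <= sqrt (8 ^ k0 * B)" if "x : cell k0 a" for x
  proof -
   have "ennreal ((cell_avg k0 V x)^2) <= ennreal (8 ^ k0) * ennreal B"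
    using cell_avg_sq_le[of k0 x] that V by (meson dual_order.refl mult_left_mono order_trans zero_le)
   then have "(cell_avg k0 V x)^2 <= 8 ^ k0 * B" using B by (simp flip: ennreal_mult)
   then show ?thesis by (rule real_le_rsqrt[of "abs _", simplified])
  qed
  have pw: "sqrt (8 ^ k0 * B) powr r = (8 ^ k0) powr (r / 2) * B powr (r / 2)"
   using B by (simp add: powr_half_sqrt[symmetric] powr_powr powr_mult)
  have "(lint (cell k0 a) (%x. ennreal (abs (V x) powr r)))
   <= ennreal (2 powr r) * (lint (cell k0 a) (%x. ennreal (abs (V x - cell_avg k0 V x) powr r))) + ennreal (2 powr r * sqrt (8 ^ k0 * B) powr r)"
   by (rule Lr_split[OF _ _ E]) (use r in auto)
  also have "... <= ennreal (2 powr r) * ennreal (K * B powr (r / 2)) + ennreal (2 powr r * sqrt (8 ^ k0 * B) powr r)"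
  proof (intro add_mono mult_left_mono order_refl)
   have "(lint (cell k0 a) (%x. ennreal (abs (V x - cell_avg k0 V x) powr r))) <= ennreal (K * enn2real (energy k0 a) powr (r / 2))"
    using avg_error[OF r order_refl] unfolding K_def \<delta>_def \<theta>_def .
   also have "... <= ennreal (K * B powr (r / 2))" by (intro ennreal_leI mult_left_mono G K0)
   finally show "(lint (cell k0 a) (%x. ennreal (abs (V x - cell_avg k0 V x) powr r))) <= ennreal (K * B powr (r / 2))" .
  qed auto
  also have "... = ennreal (C * B powr (r / 2))"
   using K0 unfolding pw by (simp add: C_def algebra_simps flip: ennreal_mult ennreal_plus)
  finally show ?thesis .
 qed
 moreover have "0 <= C" using K0 by (simp add: C_def)
 ultimately show ?thesis by blast
qed

text \<open>
  The error of the averages at level \<open>m\<close> is uniformly small for large \<open>m\<close>. At a fixed level only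
  finitely many averages occur, so their convergence is uniform over the cell.
\<close>

lemma cell_compactness:
 assumes r: "2 < r" "r < 6" and cf: "!!n::nat. cell_function k0 a (V n) (D n)"
  and B: "!!n. (lint (cell k0 a) (%x. ennreal ((norm (D n x))^2))) <= ennreal B" "0 <= B"
  and conv: "!!m x. k0 <= m ==> x : cell k0 a ==> convergent (%n. cell_avg m (V n) x)"
  and eps: "eps > 0"
 shows "EX N. ALL i>=N. ALL j>=N. (lint (cell k0 a) (%x. ennreal (abs (V i x - V j x) powr r))) <= ennreal eps"
proof -
 define \<delta> where "\<delta> = (3 - r / 2) / (2 * r)"
 define \<theta> where "\<theta> = (3 - r / 2) / 2"
 define K where "K = (1 / (1 - 2 powr - \<delta>)) powr r * 192 powr (r / 2) / (1 - 2 powr - \<theta>) * (4 * B) powr (r / 2)"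
 have "\<theta> > 0" using r by (simp add: \<theta>_def)
 then have x1: "2 powr - \<theta> < 1" by (simp add: powr_minus field_simps)
 then have K0: "0 <= K" unfolding K_def by (intro mult_nonneg_nonneg divide_nonneg_nonneg) auto
 have "(%m. 2 powr r * (K * (2 powr - \<theta>) ^ m)) ----> 2 powr r * (K * 0)"
  by (intro tendsto_intros LIMSEQ_realpow_zero) (use x1 in auto)
 from order_tendstoD(2)[OF this, of "eps / 2"] obtain m0 where
  "!!m. m >= m0 ==> 2 powr r * (K * (2 powr - \<theta>) ^ m) < eps / 2" using eps by (auto simp: eventually_sequentially)
 then obtain m where m: "k0 <= m" "2 powr r * (K * (2 powr - \<theta>) ^ m) < eps / 2"
  by (metis max.cobounded1 max.cobounded2)
 define c where "c = (eps / 2 / 2 powr r) powr (1 / r)"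
 have c: "c > 0" "2 powr r * c powr r = eps / 2" using eps r by (auto simp: c_def powr_powr)
 have "EX N. ALL i>=N. ALL j>=N. ALL x:cell k0 a. abs (cell_avg m (V i) x - cell_avg m (V j) x) <= c"
 proof -
  have "EX N. ALL i>=N. ALL j>=N. abs (cell_avg m (V i) x - cell_avg m (V j) x) < c" if "x : cell k0 a" for x
   using CauchyD[OF convergent_Cauchy[OF conv[OF m(1) that]] c(1)] by auto
  then obtain N where N: "!!x i j. x : cell k0 a ==> i >= N x ==> j >= N x ==> abs (cell_avg m (V i) x - cell_avg m (V j) x) < c"
   by metis
  obtain F where F: "finite F" "F \<subseteq> cell k0 a" "cell m ` cell k0 a = cell m ` F"
   using finite_subset_image[OF finite_cells order_refl] by metis
  have "abs (cell_avg m (V i) x - cell_avg m (V j) x) <= c"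
   if ij: "i >= Max (N ` F)" "j >= Max (N ` F)" and x: "x : cell k0 a" for i j x
  proof -
   obtain y where y: "y : F" "cell m x = cell m y" using F(3) x by (metis imageE imageI)
   have "N y <= Max (N ` F)" using F(1) y(1) by simp
   then have "abs (cell_avg m (V i) y - cell_avg m (V j) y) < c" using N[of y i j] y(1) F(2) ij by auto
   then show ?thesis using y(2) by (simp add: cell_avg_def)
  qed
  then show ?thesis by blast
 qed
 then obtain N where N: "!!i j x. i >= N ==> j >= N ==> x : cell k0 a ==> abs (cell_avg m (V i) x - cell_avg m (V j) x) <= c" by blast
 have "(lint (cell k0 a) (%x. ennreal (abs (V i x - V j x) powr r))) <= ennreal eps" if ij: "i >= N" "j >= N" for i j
 proof -
  interpret I: cell_function k0 a "V i" "D i" by (rule cf)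
  interpret J: cell_function k0 a "V j" "D j" by (rule cf)
  interpret W: cell_function k0 a "%x. V i x - V j x" "%x. D i x - D j x" by (rule cell_function_diff[OF cf cf])
  have avg: "cell_avg m (%x. V i x - V j x) x = cell_avg m (V i) x - cell_avg m (V j) x" if "x : cell k0 a" for x
   unfolding cell_avg_def using I.subcell[OF m(1) that]
   by (subst set_integral_diff) (auto intro: I.set_integrable_V J.set_integrable_V simp: algebra_simps)
  have [measurable]: "(%x. indicator (cell k0 a) x *R D n x) : borel_measurable borel" for n
  proof -
   interpret cell_function k0 a "V n" "D n" by (rule cf)
   show ?thesis by (rule D_meas) auto
  qed
  have nD: "(%x. ennreal ((norm (D n x))^2) * indicator (cell k0 a) x) : borel_measurable lborel" for n
  proof -
   have "(%x. ennreal ((norm (indicator (cell k0 a) x *R D n x))^2)) : borel_measurable lborel" by measurable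
   moreover have "(%x. ennreal ((norm (indicator (cell k0 a) x *R D n x))^2)) = (%x. ennreal ((norm (D n x))^2) * indicator (cell k0 a) x)"
    by (auto simp: indicator_def)
   ultimately show ?thesis by (simp only:)
  qed
  have "W.energy k0 a <= (nn_integral lborel (%x. 2 * (ennreal ((norm (D i x))^2) * indicator (cell k0 a) x) + 2 * (ennreal ((norm (D j x))^2) * indicator (cell k0 a) x)))"
   unfolding W.energy_def
  proof (intro nn_integral_mono)
   fix x
   have "(norm (D i x - D j x))^2 <= (norm (D i x) + norm (D j x))^2" by (intro power_mono norm_triangle_ineq4) auto
   also have "... <= 2 * (norm (D i x))^2 + 2 * (norm (D j x))^2"
    using sum_squares_bound[of "norm (D i x)" "norm (D j x)"] by (simp add: power2_sum)
   finally have "ennreal ((norm (D i x - D j x))^2) <= ennreal (2 * (norm (D i x))^2 + 2 * (norm (D j x))^2)" by (rule ennreal_leI)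
   also have "... = 2 * ennreal ((norm (D i x))^2) + 2 * ennreal ((norm (D j x))^2)" by (simp add: ennreal_mult)
   finally show "ennreal ((norm (D i x - D j x))^2) * indicator (cell k0 a) x
    <= 2 * (ennreal ((norm (D i x))^2) * indicator (cell k0 a) x) + 2 * (ennreal ((norm (D j x))^2) * indicator (cell k0 a) x)"
    by (auto simp: indicator_def)
  qed
  also have "... = 2 * (lint (cell k0 a) (%x. ennreal ((norm (D i x))^2))) + 2 * (lint (cell k0 a) (%x. ennreal ((norm (D j x))^2)))"
  proof -
   have nD2: "(%x. 2 * (ennreal ((norm (D n x))^2) * indicator (cell k0 a) x)) : borel_measurable lborel" for n
    by (intro borel_measurable_times_ennreal borel_measurable_const nD)
   show ?thesis unfolding nn_integral_add[OF nD2 nD2] nn_integral_cmult[OF nD] ..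
  qed
  also have "... <= 2 * ennreal B + 2 * ennreal B" by (intro add_mono mult_left_mono B) auto
  also have "... = ennreal (4 * B)" using B(2) by (simp add: ennreal_mult flip: mult.assoc distrib_right)
  finally have "enn2real (W.energy k0 a) <= 4 * B" using B(2) by (intro enn2real_leI) auto
  then have G: "enn2real (W.energy k0 a) powr (r / 2) <= (4 * B) powr (r / 2)" using r by (intro powr_mono2) auto
  have "(lint (cell k0 a) (%x. ennreal (abs (V i x - V j x) powr r)))
   <= ennreal (2 powr r) * (lint (cell k0 a) (%x. ennreal (abs ((V i x - V j x) - cell_avg m (%x. V i x - V j x) x) powr r))) + ennreal (2 powr r * c powr r)"
   by (rule W.Lr_split) (use r m avg N[OF ij] in auto)
  also have "... <= ennreal (2 powr r) * ennreal (K * (2 powr - \<theta>) ^ m) + ennreal (2 powr r * c powr r)"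
  proof (intro add_mono mult_left_mono order_refl order_trans[OF W.avg_error[OF r m(1)]] ennreal_leI)
   have "K * (2 powr - \<theta>) ^ m = (1 / (1 - 2 powr - \<delta>)) powr r * 192 powr (r / 2) * ((2 powr - \<theta>) ^ m / (1 - 2 powr - \<theta>)) * (4 * B) powr (r / 2)"
    by (simp add: K_def)
   moreover have "0 <= (1 / (1 - 2 powr - \<delta>)) powr r * 192 powr (r / 2) * ((2 powr - \<theta>) ^ m / (1 - 2 powr - \<theta>))"
    using x1 by (intro mult_nonneg_nonneg divide_nonneg_nonneg) auto
   ultimately show "(1 / (1 - 2 powr - ((3 - r / 2) / (2 * r)))) powr r * 192 powr (r / 2) * ((2 powr - ((3 - r / 2) / 2)) ^ m / (1 - 2 powr - ((3 - r / 2) / 2))) *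
    enn2real (W.energy k0 a) powr (r / 2) <= K * (2 powr - \<theta>) ^ m"
    using G by (simp add: \<delta>_def \<theta>_def mult_left_mono del: times_divide_eq_right)
  qed auto
  also have "... = ennreal (2 powr r * (K * (2 powr - \<theta>) ^ m) + eps / 2)"
   using K0 eps unfolding c(2) by (simp flip: ennreal_mult ennreal_plus)
  also have "... <= ennreal eps" using m(2) by (intro ennreal_leI) auto
  finally show ?thesis .
 qed
 then show ?thesis by blast
qed

lemma tendsto_0_if_eventually_le:
 fixes f :: "nat => ennreal"
 assumes "!!eps. eps > 0 ==> \<forall>\<^sub>F n in sequentially. f n <= ennreal eps"
 shows "f ----> 0"
proof (rule order_tendstoI)
 fix y :: ennreal assume "0 < y"
 then obtain z where z: "0 < z" "z < y" using dense by blast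
 then have "z < top" using order_less_le_trans top_greatest by blast
 then obtain e where e: "z = ennreal e" "0 <= e" by (cases z) auto
 then have "e > 0" using z(1) by simp
 from assms[OF this] show "\<forall>\<^sub>F n in sequentially. f n < y"
  by eventually_elim (use z e in auto)
qed auto

text \<open>
  A difference quotient of \<open>V\<close> with step \<open>t\<close> approximates the partial derivative of \<open>V\<close>. The error is
  controlled by comparing \<open>D\<close> with the gradient \<open>D'\<close> of another function, whose oscillation at scale \<open>t\<close> is
  \<open>\<omega>\<close>. The integral extends only over the points whose translates by \<open>2\<^sup>-\<^sup>k\<close> stay in the cell.
\<close>

lemma shift_estimate:
 fixes i :: 3 and k :: nat
 assumes cf: "cell_function k0 a V D" and cf': "cell_function k0 a V' D'"
  and t: "0 < t" "t <= 1 / 2 ^ k" and \<omega>: "0 <= \<omega>"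
   "!!x y. x : cell k0 a ==> y : cell k0 a ==> dist x y <= t ==> norm (D' x - D' y) <= \<omega>"
 defines "R \<equiv> {x : cell k0 a. x + (1 / 2 ^ k) *R axis i 1 : cell k0 a}"
 shows "(lint R (%x. ennreal ((D x $ i)^2))) \<le>
  ennreal (8 / t^2) * (lint (cell k0 a) (%x. ennreal ((V x)^2)))
  + ennreal 12 * (lint (cell k0 a) (%x. ennreal ((norm (D x - D' x))^2))) + ennreal (6 * \<omega>^2)"
proof -
 interpret V: cell_function k0 a V D by fact
 interpret V': cell_function k0 a V' D' by fact
 interpret W: cell_function k0 a "%x. V x - V' x" "%x. D x - D' x" by (rule cell_function_diff[OF cf cf'])
 let ?q = "cell k0 a"
 let ?e = "axis i 1 :: real ^ 3"
 have R[measurable]: "R : sets borel"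
 proof -
  have "R = ?q \<inter> ((%x. x + (1 / 2 ^ k) *R ?e) -` ?q \<inter> space borel)" by (auto simp: R_def)
  also have "... : sets borel" by (intro sets.Int measurable_sets[of _ borel borel]) auto
  finally show ?thesis .
 qed
 have Rq: "R \<subseteq> ?q" by (auto simp: R_def)
 define hV where "hV x = ennreal ((indicator ?q x *R V x)^2)" for x
 define hE where "hE x = ennreal ((norm (indicator ?q x *R (D x - D' x)))^2)" for x
 have [measurable]: "(%x. indicator ?q x *R V x) : borel_measurable borel" "(%x. indicator ?q x *R (D x - D' x)) : borel_measurable borel"
  using V.V_meas[of ?q] W.D_meas[of ?q] by auto
 have [measurable]: "hV : borel_measurable borel" "hE : borel_measurable borel" unfolding hV_def hE_def by measurable
 have iV: "(lint ?q (%x. ennreal ((V x)^2))) = (nn_integral lborel (%x. hV x))"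
  by (intro nn_integral_cong) (auto simp: hV_def indicator_def)
 have iE: "(lint ?q (%x. ennreal ((norm (D x - D' x))^2))) = (nn_integral lborel (%x. hE x))"
  by (intro nn_integral_cong) (auto simp: hE_def indicator_def)
 have inq: "x + (s * t) *R ?e : ?q" if x: "x : R" and s: "0 <= s" "s <= 1" for x s
 proof -
  have st: "0 <= s * t" "s * t * 2 ^ k <= 1"
  proof -
   show "0 <= s * t" using s t by simp
   have "s * t <= 1 * (1 / 2 ^ k)" using s t by (intro mult_mono) auto
   then show "s * t * 2 ^ k <= 1" by (simp add: field_simps)
  qed
  have "(1 - s * t * 2 ^ k) *R x + (s * t * 2 ^ k) *R (x + (1 / 2 ^ k) *R ?e) : ?q"
   using x st by (intro convexD_alt[OF convex_cell]) (auto simp: R_def)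
  moreover have "(1 - s * t * 2 ^ k) *R x + (s * t * 2 ^ k) *R (x + (1 / 2 ^ k) *R ?e) = x + (s * t) *R ?e"
   by (simp add: algebra_simps)
  ultimately show ?thesis by simp
 qed
 have pt: "ennreal ((D x $ i)^2) <= ennreal (4 / t^2) * (hV (t *R ?e + 1 *R x) + hV x)
   + (lint {0..1} (%s. ennreal 6 * (hE x + ennreal (\<omega>^2) + hE ((s * t) *R ?e + 1 *R x))))" if x: "x : R" for x
 proof -
  define \<phi> where "\<phi> s = s * (D x $ i) - V (x + (s * t) *R ?e) / t" for s
  have xq: "x : ?q" using x Rq by blast
  have "ennreal ((\<phi> 1 - \<phi> 0)^2) <= (lint {0..1} (%s. ennreal ((D x $ i - D (x + (s * t) *R ?e) $ i)^2)))"
  proof (rule square_increment_le)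
   fix s :: real assume s: "0 <= s" "s <= 1"
   have "((%s. x + (s * t) *R ?e) has_derivative (%h. (h * t) *R ?e)) (at s within {0..1})"
    by (auto intro!: derivative_eq_intros)
   from has_derivative_compose[OF this V.der[of "x + (s * t) *R ?e"]]
   have "((%s. V (x + (s * t) *R ?e)) has_derivative (%h. D (x + (s * t) *R ?e) \<bullet> ((h * t) *R ?e))) (at s within {0..1})"
    using inq[OF x s] cell_subset_closed_cell by blast
   then have "((%s. V (x + (s * t) *R ?e)) has_real_derivative t * (D (x + (s * t) *R ?e) $ i)) (at s within {0..1})"
    unfolding has_field_derivative_def by (rule has_derivative_eq_rhs) (simp add: inner_axis fun_eq_iff)
   then show "(\<phi> has_real_derivative D x $ i - D (x + (s * t) *R ?e) $ i) (at s within {0..1})"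
    unfolding \<phi>_def using t by (auto intro!: derivative_eq_intros)
  next
   show "continuous_on {0..1} (%s. D x $ i - D (x + (s * t) *R ?e) $ i)"
    using inq[OF x] cell_subset_closed_cell[of k0 a]
    by (intro continuous_intros continuous_on_compose2[OF V.cont]) auto
  qed
  also have "... <= (lint {0..1} (%s. ennreal 3 * (hE x + ennreal (\<omega>^2) + hE ((s * t) *R ?e + 1 *R x))))"
  proof (intro nn_integral_mono)
   fix s :: real
   show "ennreal ((D x $ i - D (x + (s * t) *R ?e) $ i)^2) * indicator {0..1} s
    <= ennreal 3 * (hE x + ennreal (\<omega>^2) + hE ((s * t) *R ?e + 1 *R x)) * indicator {0..1} s"
   proof (cases "s : {0..1}")
    case True
    define y where "y = x + (s * t) *R ?e"
    have yq: "y : ?q" using inq[OF x] True by (simp add: y_def)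
    have "dist x y = abs s * t" using t by (simp add: y_def dist_norm abs_mult)
    also have "... <= 1 * t" using True t by (intro mult_right_mono) auto
    finally have om: "norm (D' x - D' y) <= \<omega>" using \<omega>(2)[OF xq yq] by simp
    have "abs (D x $ i - D y $ i) <= norm (D x - D y)" using component_le_norm_cart[of "D x - D y" i] by simp
    also have "... <= norm (D x - D' x) + norm (D' x - D' y) + norm (D y - D' y)"
     using norm_triangle_ineq[of "D x - D' x" "(D' x - D' y) + (D' y - D y)"] norm_triangle_ineq[of "D' x - D' y" "D' y - D y"]
     by (simp add: norm_minus_commute)
    finally have "abs (D x $ i - D y $ i) <= norm (D x - D' x) + \<omega> + norm (D y - D' y)" using om by linarith
    then have "abs (D x $ i - D y $ i)^2 <= (norm (D x - D' x) + \<omega> + norm (D y - D' y))^2" by (intro power_mono) auto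
    also have "... <= 3 * ((norm (D x - D' x))^2 + \<omega>^2 + (norm (D y - D' y))^2)"
    proof -
     have "0 <= (p - w)^2 + (w - z)^2 + (p - z)^2" for p w z :: real by simp
     then have "(p + w + z)^2 <= 3 * (p^2 + w^2 + z^2)" for p w z :: real
      by (simp add: power2_eq_square algebra_simps)
     then show ?thesis .
    qed
    finally have "ennreal ((D x $ i - D y $ i)^2) <= ennreal (3 * ((norm (D x - D' x))^2 + \<omega>^2 + (norm (D y - D' y))^2))"
     by (intro ennreal_leI) simp
    also have "... = ennreal 3 * (hE x + ennreal (\<omega>^2) + hE y)"
     using xq yq by (simp add: hE_def ennreal_mult ennreal_plus)
    finally show ?thesis using True by (simp add: y_def add.commute)
   qed simp
  qed
  finally have A: "ennreal ((\<phi> 1 - \<phi> 0)^2) <= (lint {0..1} (%s. ennreal 3 * (hE x + ennreal (\<omega>^2) + hE ((s * t) *R ?e + 1 *R x))))" .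
  define y where "y = x + t *R ?e"
  have yq: "y : ?q" using inq[OF x, of 1] by (simp add: y_def)
  have "D x $ i = (\<phi> 1 - \<phi> 0) + (V y - V x) / t" by (simp add: \<phi>_def y_def diff_divide_distrib)
  then have "(D x $ i)^2 <= 2 * (\<phi> 1 - \<phi> 0)^2 + 2 * ((V y - V x) / t)^2"
   using sum_squares_bound[of "\<phi> 1 - \<phi> 0" "(V y - V x) / t"] by (simp add: power2_sum)
  also have "2 * ((V y - V x) / t)^2 <= 4 / t^2 * ((V y)^2 + (V x)^2)"
  proof -
   have "(V y - V x)^2 <= 2 * ((V y)^2 + (V x)^2)"
    using sum_squares_bound[of "V y" "- V x"] by (simp add: power2_diff)
   then show ?thesis using t by (simp add: power_divide field_simps)
  qed
  finally have "ennreal ((D x $ i)^2) <= ennreal (4 / t^2 * ((V y)^2 + (V x)^2) + 2 * (\<phi> 1 - \<phi> 0)^2)" by (intro ennreal_leI) simp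
  also have "... = ennreal (4 / t^2) * (hV y + hV x) + 2 * ennreal ((\<phi> 1 - \<phi> 0)^2)"
  proof -
   have "ennreal (4 / t^2 * (A + B) + 2 * C) = ennreal (4 / t^2) * (ennreal A + ennreal B) + 2 * ennreal C"
    if "0 <= A" "0 <= B" "0 <= C" for A B C
    using that by (subst ennreal_plus, simp, simp, subst ennreal_mult, simp, simp, subst ennreal_plus, simp, simp, subst ennreal_mult, simp, simp, simp)
   then show ?thesis using xq yq by (simp add: hV_def)
  qed
  also have "... <= ennreal (4 / t^2) * (hV y + hV x) + 2 * (lint {0..1} (%s. ennreal 3 * (hE x + ennreal (\<omega>^2) + hE ((s * t) *R ?e + 1 *R x))))"
   by (intro add_left_mono mult_left_mono A) auto
  also have "2 * (lint {0..1} (%s. ennreal 3 * (hE x + ennreal (\<omega>^2) + hE ((s * t) *R ?e + 1 *R x))))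
   = (lint {0..1} (%s. ennreal 6 * (hE x + ennreal (\<omega>^2) + hE ((s * t) *R ?e + 1 *R x))))"
   by (subst nn_integral_cmult[symmetric]) (auto simp flip: mult.assoc)
  finally show ?thesis by (simp add: y_def add.commute)
 qed
 have shift: "(nn_integral lborel (%x. h (v + 1 *R x))) = (nn_integral lborel (%x. h x))" if "h : borel_measurable borel" for h :: "real ^ 3 => ennreal" and v
  using nn_integral_affine[OF that, of 1 v] by simp
 have qle: "emeasure lborel R <= 1"
  using emeasure_mono[OF Rq, of lborel] by (simp add: order_trans[OF _ ennreal_leI[of "1 / 8 ^ k0" 1, unfolded ennreal_1]])
 have "(lint R (%x. ennreal ((D x $ i)^2)))
  <= (nn_integral lborel (%x. ennreal (4 / t^2) * (hV (t *R ?e + 1 *R x) + hV x)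
   + (lint {0..1} (%s. ennreal 6 * (hE x + ennreal (\<omega>^2) * indicator R x + hE ((s * t) *R ?e + 1 *R x))))))"
 proof (intro nn_integral_mono)
  fix x
  show "ennreal ((D x $ i)^2) * indicator R x <= ennreal (4 / t^2) * (hV (t *R ?e + 1 *R x) + hV x)
   + (lint {0..1} (%s. ennreal 6 * (hE x + ennreal (\<omega>^2) * indicator R x + hE ((s * t) *R ?e + 1 *R x))))"
   using pt[of x] by (cases "x : R") simp_all
 qed
 also have "... = ennreal (4 / t^2) * ((nn_integral lborel (%x. hV x)) + (nn_integral lborel (%x. hV x)))
   + (nn_integral lborel (%x. (lint {0..1} (%s. ennreal 6 * (hE x + ennreal (\<omega>^2) * indicator R x + hE ((s * t) *R ?e + 1 *R x))))))"
 proof -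
  have m0: "(%x. hV (t *R ?e + 1 *R x)) : borel_measurable lborel" "hV : borel_measurable lborel" by measurable
  have m1: "(%x. hV (t *R ?e + 1 *R x) + hV x) : borel_measurable lborel" by measurable
  have m2: "(%x. ennreal (4 / t^2) * (hV (t *R ?e + 1 *R x) + hV x)) : borel_measurable lborel" by measurable
  have m3: "(%x. \<integral>\<^sup>+s\<in>{0..1}. ennreal 6 * (hE x + ennreal (\<omega>^2) * indicator R x + hE ((s * t) *R ?e + 1 *R x)) \<partial>lborel) : borel_measurable lborel" by measurable
  have sV: "(nn_integral lborel (%x. hV (t *R ?e + 1 *R x))) = (nn_integral lborel (%x. hV x))" by (rule shift) measurable
  show ?thesis unfolding nn_integral_add[OF m2 m3] nn_integral_cmult[OF m1] nn_integral_add[OF m0] sV ..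
 qed
 also have "(nn_integral lborel (%x. (lint {0..1} (%s. ennreal 6 * (hE x + ennreal (\<omega>^2) * indicator R x + hE ((s * t) *R ?e + 1 *R x))))))
  = (nn_integral lborel (%s. (nn_integral lborel (%x. ennreal 6 * (hE x + ennreal (\<omega>^2) * indicator R x + hE ((s * t) *R ?e + 1 *R x)) * indicator {0..1} s))))"
  by (rule lborel_pair.Fubini') measurable
 also have "... <= (lint {0..1::real} (%s. ennreal 6 * ((nn_integral lborel (%x. hE x)) + ennreal (\<omega>^2) + (nn_integral lborel (%x. hE x)))))"
 proof (intro nn_integral_mono)
  fix s :: real
  have "(nn_integral lborel (%x. ennreal 6 * (hE x + ennreal (\<omega>^2) * indicator R x + hE ((s * t) *R ?e + 1 *R x)) * indicator {0..1} s))
   = ennreal 6 * ((nn_integral lborel (%x. hE x)) + ennreal (\<omega>^2) * emeasure lborel R + (nn_integral lborel (%x. hE ((s * t) *R ?e + 1 *R x)))) * indicator {0..1} s"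
  proof -
   have m0: "hE : borel_measurable lborel" "(%x. ennreal (\<omega>^2) * indicator R x) : borel_measurable lborel"
    "(%x. hE ((s * t) *R ?e + 1 *R x)) : borel_measurable lborel" by measurable
   have m1: "(%x. hE x + ennreal (\<omega>^2) * indicator R x) : borel_measurable lborel" by measurable
   have m2: "(%x. hE x + ennreal (\<omega>^2) * indicator R x + hE ((s * t) *R ?e + 1 *R x)) : borel_measurable lborel" by measurable
   have m3: "(%x. ennreal 6 * (hE x + ennreal (\<omega>^2) * indicator R x + hE ((s * t) *R ?e + 1 *R x))) : borel_measurable lborel" by measurable
   have mR: "R : sets lborel" by simp
   show ?thesis
    unfolding nn_integral_multc[OF m3] nn_integral_cmult[OF m2] nn_integral_add[OF m1 m0(3)] nn_integral_add[OF m0(1,2)]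
     nn_integral_cmult_indicator[OF mR] ..
  qed
  also have "... <= ennreal 6 * ((nn_integral lborel (%x. hE x)) + ennreal (\<omega>^2) * 1 + (nn_integral lborel (%x. hE x))) * indicator {0..1} s"
  proof -
   have sE: "(nn_integral lborel (%x. hE ((s * t) *R ?e + 1 *R x))) = (nn_integral lborel (%x. hE x))" by (rule shift) measurable
   show ?thesis unfolding sE by (intro mult_right_mono mult_left_mono add_mono qle order_refl) auto
  qed
  finally show "(nn_integral lborel (%x. ennreal 6 * (hE x + ennreal (\<omega>^2) * indicator R x + hE ((s * t) *R ?e + 1 *R x)) * indicator {0..1} s))
   <= ennreal 6 * ((nn_integral lborel (%x. hE x)) + ennreal (\<omega>^2) + (nn_integral lborel (%x. hE x))) * indicator {0..1} s" by simp
 qed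
 also have "... = ennreal 6 * ((nn_integral lborel (%x. hE x)) + ennreal (\<omega>^2) + (nn_integral lborel (%x. hE x)))"
  by (subst nn_integral_cmult_indicator) auto
 also have "ennreal (4 / t^2) * ((nn_integral lborel (%x. hV x)) + (nn_integral lborel (%x. hV x))) + ...
  = ennreal (8 / t^2) * (nn_integral lborel (%x. hV x)) + ennreal 12 * (nn_integral lborel (%x. hE x)) + ennreal (6 * \<omega>^2)"
 proof -
  have a1: "ennreal (8 / t^2) = ennreal (4 / t^2) + ennreal (4 / t^2)" by (simp flip: ennreal_plus)
  have a2: "ennreal 12 = ennreal 6 + ennreal 6" by (simp flip: ennreal_plus)
  have a3: "ennreal (6 * \<omega>^2) = ennreal 6 * ennreal (\<omega>^2)" by (simp add: ennreal_mult)
  show ?thesis unfolding a1 a2 a3 by (simp only: distrib_left distrib_right ac_simps)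
 qed
 finally show ?thesis unfolding iV iE by (simp add: add_left_mono add.assoc)
qed

text \<open>
  If \<open>V n\<close> tends to 0 in \<open>L\<^sup>2\<close> and the gradients are Cauchy, then the gradients tend to 0 away
  from the upper face of the cell: first a late member of the sequence is taken as \<open>D'\<close> in
  \<open>shift_estimate\<close>, then \<open>t\<close> is chosen by its uniform continuity, and finally \<open>n\<close> is let tend to infinity.
\<close>

lemma cell_closability:
 assumes cf: "!!n::nat. cell_function k0 a (V n) (D n)"
  and L2: "(%n. \<integral>\<^sup>+x\<in>cell k0 a. ennreal ((V n x)^2) \<partial>lborel) ----> 0"
  and cauchy: "!!eps. eps > 0 ==> EX N. ALL m>=N. ALL n>=N.
   (lint (cell k0 a) (%x. ennreal ((norm (D n x - D m x))^2))) <= ennreal eps"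
 shows "(%n. \<integral>\<^sup>+x\<in>{x : cell k0 a. x + (1 / 2 ^ k) *R axis i 1 : cell k0 a}. ennreal ((D n x $ i)^2) \<partial>lborel) ----> 0"
proof (rule tendsto_0_if_eventually_le)
 fix eps :: real assume eps: "eps > 0"
 obtain N where N: "!!m n. m >= N ==> n >= N ==>
   (lint (cell k0 a) (%x. ennreal ((norm (D n x - D m x))^2))) <= ennreal (eps / 36)"
  using cauchy[of "eps / 36"] eps by auto
 interpret M: cell_function k0 a "V N" "D N" by (rule cf)
 define \<omega> where "\<omega> = sqrt (eps / 18)"
 have \<omega>: "\<omega> > 0" "6 * \<omega>^2 = eps / 3" using eps by (auto simp: \<omega>_def)
 have "uniformly_continuous_on (closed_cell k0 a) (D N)"
  by (rule compact_uniformly_continuous[OF M.cont compact_closed_cell])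
 then obtain d where d: "d > 0" "!!x y. x : closed_cell k0 a ==> y : closed_cell k0 a ==> dist y x < d ==> dist (D N y) (D N x) < \<omega>"
  unfolding uniformly_continuous_on_def using \<omega>(1) by metis
 define t where "t = min (d / 2) (1 / 2 ^ k)"
 have t: "0 < t" "t <= 1 / 2 ^ k" "t < d" using d(1) by (auto simp: t_def)
 have osc: "norm (D N x - D N y) <= \<omega>" if "x : cell k0 a" "y : cell k0 a" "dist x y <= t" for x y
  using d(2)[of y x] that t(3) cell_subset_closed_cell[of k0 a] by (force simp: dist_norm)
 have lim: "eventually (%n. (lint (cell k0 a) (%x. ennreal ((V n x)^2))) < ennreal (eps / 3 * t^2 / 8)) sequentially"
  using eps t(1) by (intro order_tendstoD(2)[OF L2]) auto
 show "\<forall>\<^sub>F n in sequentially. (lint {x : cell k0 a. x + (1 / 2 ^ k) *R axis i 1 : cell k0 a} (%x. ennreal ((D n x $ i)^2))) <= ennreal eps"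
  using lim eventually_ge_at_top[of N]
 proof eventually_elim
  case (elim n)
  have "(lint {x : cell k0 a. x + (1 / 2 ^ k) *R axis i 1 : cell k0 a} (%x. ennreal ((D n x $ i)^2)))
   <= ennreal (8 / t^2) * (lint (cell k0 a) (%x. ennreal ((V n x)^2)))
  + ennreal 12 * (lint (cell k0 a) (%x. ennreal ((norm (D n x - D N x))^2))) + ennreal (6 * \<omega>^2)"
   by (rule shift_estimate[OF cf cf t(1,2) less_imp_le[OF \<omega>(1)] osc])
  also have "... <= ennreal (8 / t^2) * ennreal (eps / 3 * t^2 / 8) + ennreal 12 * ennreal (eps / 36) + ennreal (eps / 3)"
   unfolding \<omega>(2) by (intro add_mono mult_left_mono order_refl less_imp_le[OF elim(1)] N) (use elim in auto)
  also have "ennreal (8 / t^2) * ennreal (eps / 3 * t^2 / 8) = ennreal (eps / 3)"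
   using eps t(1) by (subst ennreal_mult[symmetric]) auto
  also have "ennreal 12 * ennreal (eps / 36) = ennreal (eps / 3)"
   using eps by (subst ennreal_mult[symmetric]) auto
  also have "ennreal (eps / 3) + ennreal (eps / 3) + ennreal (eps / 3) = ennreal eps"
   using eps by (simp flip: ennreal_plus)
  finally show ?case .
 qed
qed

section \<open>Charts, metric and gradients\<close>

lemma C_k_on_cong:
 assumes "open S" "!!x. x : S ==> f x = h x" "C_k_on k S f"
 shows "C_k_on k S h"
 using assms(2,3)
proof (induction k arbitrary: f h)
 case 0
 then show ?case using continuous_on_eq[of S f h] by simp
next
 case (Suc k)
 have d: "(h has_derivative frechet_derivative f (at x)) (at x)" if x: "x : S" for x
 proof -
  have "(f has_derivative frechet_derivative f (at x)) (at x)"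
   using Suc.prems(2) x by (simp add: frechet_derivative_works)
  then show ?thesis by (rule has_derivative_transform_within_open[OF _ assms(1) x Suc.prems(1)])
 qed
 have e: "frechet_derivative f (at x) = frechet_derivative h (at x)" if x: "x : S" for x
  using frechet_derivative_at[OF d[OF x]] .
 have "h differentiable at x" if "x : S" for x using d[OF that] by (auto simp: differentiable_def)
 moreover have "C_k_on k S (%x. frechet_derivative h (at x) b)" if "b : Basis" for b
  by (rule Suc.IH[where f = "%x. frechet_derivative f (at x) b"]) (use e Suc.prems(2) that in auto)
 ultimately show ?case by simp
qed

lemma C_k_on_lincomb:
 assumes "open S" "C_k_on k S f" "C_k_on k S h"
 shows "C_k_on k S (%x. a *R f x + b *R h x)"
 using assms(2,3)
proof (induction k arbitrary: f h)
 case 0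
 then show ?case by (auto intro!: continuous_intros)
next
 case (Suc k)
 have d: "((%x. a *R f x + b *R h x) has_derivative
   (%v. a *R frechet_derivative f (at x) v + b *R frechet_derivative h (at x) v)) (at x)" if "x : S" for x
  using Suc.prems that by (intro has_derivative_add has_derivative_scaleR_right) (auto simp: frechet_derivative_works)
 have "C_k_on k S (%x. frechet_derivative (%x. a *R f x + b *R h x) (at x) v)" if v: "v : Basis" for v
 proof (rule C_k_on_cong[OF assms(1)])
  show "C_k_on k S (%x. a *R frechet_derivative f (at x) v + b *R frechet_derivative h (at x) v)"
   by (rule Suc.IH) (use Suc.prems v in auto)
  show "a *R frechet_derivative f (at x) v + b *R frechet_derivative h (at x) v = frechet_derivative (%x. a *R f x + b *R h x) (at x) v"
   if "x : S" for x using frechet_derivative_at[OF d[OF that]] by metis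
 qed
 moreover have "(%x. a *R f x + b *R h x) differentiable at x" if "x : S" for x
  using d[OF that] by (auto simp: differentiable_def)
 ultimately show ?case by simp
qed

lemma C_k_on_const: "C_k_on k S (%_. c)"
proof (induction k arbitrary: c)
 case (Suc k)
 have "frechet_derivative (%_. c) (at x) = (%_. 0)" for x :: 'a
  by (rule frechet_derivative_at[OF has_derivative_const, symmetric])
 then show ?case using Suc.IH[of 0] by simp
qed simp

lemma smooth_on_differentiable: "smooth_on S f ==> x : S ==> f differentiable at x"
 unfolding smooth_on_def by (metis C_k_on.simps(2))

lemma smooth_on_continuous: "smooth_on S f ==> continuous_on S f"
 unfolding smooth_on_def by (metis C_k_on.simps(1))

lemma smooth_on_continuous_derivative:
 assumes "smooth_on S f" "b : Basis"
 shows "continuous_on S (%x. frechet_derivative f (at x) b)"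
proof -
 have "C_k_on (Suc 0) S f" using assms(1) unfolding smooth_on_def by blast
 then show ?thesis using assms(2) by simp
qed

lemma pos_def_inj:
 fixes G :: "real ^ 'n ^ 'n"
 assumes "!!v. v \<noteq> 0 ==> v \<bullet> (G *v v) > 0" "G *v v = G *v w"
 shows "v = w"
proof (rule ccontr)
 assume "v \<noteq> w"
 then have "(v - w) \<bullet> (G *v (v - w)) > 0" by (intro assms(1)) simp
 then show False using assms(2) by (simp add: matrix_vector_mult_diff_distrib)
qed

lemma pos_def_det_nz:
 fixes G :: "real ^ 'n ^ 'n"
 assumes "!!v. v \<noteq> 0 ==> v \<bullet> (G *v v) > 0"
 shows "det G \<noteq> 0" "invertible G"
proof -
 have "EX B. B ** G = mat 1"
  unfolding matrix_left_invertible_ker using pos_def_inj[OF assms, of _ 0] by (metis matrix_vector_mult_0_right)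
 then show "invertible G" by (simp add: invertible_left_inverse)
 then show "det G \<noteq> 0" by (simp add: invertible_det_nz)
qed

lemma pos_def_det_pos:
 fixes G :: "real ^ 'n ^ 'n"
 assumes pd: "!!v. v \<noteq> 0 ==> v \<bullet> (G *v v) > 0"
 shows "det G > 0"
proof (rule ccontr)
 assume neg: "\<not> det G > 0"
 define f where "f t = det (t *R G + (1 - t) *R mat 1)" for t :: real
 have cont: "continuous_on {0..1} f"
  unfolding f_def det_def by (intro continuous_intros)
 have "f 1 <= 0" "0 <= f 0" using neg by (auto simp: f_def det_I)
 then obtain t where t: "0 <= t" "t <= 1" "f t = 0" using IVT2'[of f 1 0 0] cont by auto
 have "v \<bullet> ((t *R G + (1 - t) *R mat 1) *v v) > 0" if v: "v \<noteq> 0" for v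
 proof -
  have "v \<bullet> ((t *R G + (1 - t) *R mat 1) *v v) = t * (v \<bullet> (G *v v)) + (1 - t) * (v \<bullet> v)"
   by (simp add: matrix_vector_mult_add_rdistrib scaleR_matrix_vector_assoc[symmetric] inner_add_right)
  moreover have "t * (v \<bullet> (G *v v)) + (1 - t) * (v \<bullet> v) > 0"
   using t pd[OF v] v by (cases "t = 0") (auto intro!: add_pos_nonneg mult_pos_pos)
  ultimately show ?thesis by simp
 qed
 from pos_def_det_nz(1)[OF this] show False using t(3) by (simp add: f_def)
qed

text \<open>
  The dimension enters through the volume of dyadic cells, hence through the range of exponents.
\<close>

locale riemannian3 = compact_riemannian_manifold A g
 for A :: "('a::{t2_space, second_countable_topology}, 3) chart set"
  and g :: "('a, 3) chart => 'a => real ^ 3 ^ 3"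
begin

abbreviation im :: "('a, 3) chart => (real ^ 3) set" where "im c \<equiv> snd c ` fst c"

lemma chart_open: "c : A ==> open (fst c)" "c : A ==> open (im c)"
 using atlas by (auto simp: smooth_atlas_def)

lemma chart_homeo: "c : A ==> homeomorphism (fst c) (im c) (snd c) (chart_inv c)"
 using atlas by (auto simp: smooth_atlas_def)

lemma chart_cover: "EX c:A. p : fst c"
 using atlas by (auto simp: smooth_atlas_def)

lemma chart_cont: "c : A ==> continuous_on (fst c) (snd c)" "c : A ==> continuous_on (im c) (chart_inv c)"
 using chart_homeo by (auto simp: homeomorphism_def)

lemma inv_coords [simp]: "c : A ==> p : fst c ==> chart_inv c (snd c p) = p"
 using chart_homeo by (auto simp: homeomorphism_def)

lemma coords_inv [simp]: "c : A ==> x : im c ==> snd c (chart_inv c x) = x"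
 using chart_homeo[of c] by (auto simp: homeomorphism_def)

lemma inv_in: "c : A ==> x : im c ==> chart_inv c x : fst c"
 using chart_homeo[of c] by (auto simp: homeomorphism_def)

lemma open_coords_image:
 assumes c: "c : A" and W: "open W" "W \<subseteq> fst c"
 shows "open (snd c ` W)"
proof -
 have "snd c ` W = chart_inv c -` W \<inter> im c"
 proof (intro set_eqI iffI)
  fix x assume "x : snd c ` W"
  then obtain p where "p : W" "x = snd c p" by blast
  then show "x : chart_inv c -` W \<inter> im c" using c W(2) by auto
 next
  fix x assume x: "x : chart_inv c -` W \<inter> im c"
  then have "x = snd c (chart_inv c x)" using c by simp
  then show "x : snd c ` W" using x by blast
 qed
 then show ?thesis using continuous_open_preimage[OF chart_cont(2)[OF c] chart_open(2)[OF c] W(1)] by (simp add: Int_commute)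
qed

abbreviation transit :: "('a, 3) chart => ('a, 3) chart => real ^ 3 => real ^ 3" where
 "transit c d \<equiv> snd d \<circ> chart_inv c"

lemma trans_smooth: "c : A ==> d : A ==> smooth_on (snd c ` (fst c \<inter> fst d)) (transit c d)"
 using atlas by (auto simp: smooth_atlas_def)

lemma trans_derivative:
 assumes "c : A" "d : A" "p : fst c" "p : fst d"
 shows "(transit c d has_derivative (%h. transition_jacobian c d p *v h)) (at (snd c p))"
proof -
 have "transit c d differentiable at (snd c p)"
  by (rule smooth_on_differentiable[OF trans_smooth]) (use assms in auto)
 then have d: "(transit c d has_derivative frechet_derivative (transit c d) (at (snd c p))) (at (snd c p))"
  by (simp add: frechet_derivative_works)
 have "linear (frechet_derivative (transit c d) (at (snd c p)))" using has_derivative_linear[OF d] .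
 then show ?thesis using d unfolding transition_jacobian_def by (simp add: matrix_works)
qed

lemma matrix_eq_of_derivative:
 assumes "(f has_derivative (%h. M *v h)) (at x)" "(f has_derivative (%h. N *v h)) (at x)"
 shows "M = (N :: real ^ 3 ^ 3)"
 using has_derivative_unique[OF assms] by (metis matrix_eq)

lemma jacobian_chain:
 assumes c: "c : A" "d : A" "e : A" and p: "p : fst c" "p : fst d" "p : fst e"
 shows "transition_jacobian d e p ** transition_jacobian c d p = transition_jacobian c e p"
proof (rule matrix_eq_of_derivative)
 show "(transit c e has_derivative (%h. transition_jacobian c e p *v h)) (at (snd c p))"
  by (rule trans_derivative) (use assms in auto)
 have "transit c d (snd c p) = snd d p" using c p by simp
 then have "(transit d e \<circ> transit c d has_derivative (%h. transition_jacobian d e p *v h) \<circ> (%h. transition_jacobian c d p *v h)) (at (snd c p))"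
  using trans_derivative[OF c(2,3) p(2,3)] by (intro diff_chain_at trans_derivative c p) simp
 moreover have "open (snd c ` (fst c \<inter> fst d))" by (intro open_coords_image open_Int chart_open c Int_lower1)
 moreover have "transit d e (transit c d x) = transit c e x" if "x : snd c ` (fst c \<inter> fst d)" for x
  using that c by auto
 ultimately have "(transit c e has_derivative (%h. transition_jacobian d e p *v h) \<circ> (%h. transition_jacobian c d p *v h)) (at (snd c p))"
  using p by (elim has_derivative_transform_within_open) auto
 then show "(transit c e has_derivative (%h. (transition_jacobian d e p ** transition_jacobian c d p) *v h)) (at (snd c p))"
  by (simp add: o_def matrix_vector_mul_assoc)
qed

lemma jacobian_self:
 assumes c: "c : A" and p: "p : fst c"
 shows "transition_jacobian c c p = mat 1"
proof (rule matrix_eq_of_derivative)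
 show "(transit c c has_derivative (%h. transition_jacobian c c p *v h)) (at (snd c p))"
  by (rule trans_derivative) (use assms in auto)
 have "((%x. x) has_derivative (%h. h)) (at (snd c p))" by simp
 then have "(transit c c has_derivative (%h. h)) (at (snd c p))"
  by (rule has_derivative_transform_within_open[OF _ chart_open(2)[OF c]]) (use c p in auto)
 then show "(transit c c has_derivative (%h. mat 1 *v h)) (at (snd c p))" by simp
qed

lemma jacobian_inverse:
 assumes "c : A" "d : A" "p : fst c" "p : fst d"
 shows "transition_jacobian d c p ** transition_jacobian c d p = mat 1"
 using jacobian_chain[of c d c p] jacobian_self[of c p] assms by simp

lemma jacobian_continuous:
 assumes c: "c : A" "d : A"
 shows "continuous_on (fst c \<inter> fst d) (transition_jacobian c d)"
proof -
 let ?S = "snd c ` (fst c \<inter> fst d)"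
 have "continuous_on ?S (%x. frechet_derivative (transit c d) (at x) (axis j 1))" for j
  by (rule smooth_on_continuous_derivative[OF trans_smooth[OF c]]) simp
 then have "continuous_on (fst c \<inter> fst d) (%p. frechet_derivative (transit c d) (at (snd c p)) (axis j 1))" for j
  by (rule continuous_on_compose2[OF _ continuous_on_subset[OF chart_cont(1)[OF c(1)]]]) auto
 then show ?thesis unfolding transition_jacobian_def matrix_def
  by (intro continuous_on_vec_lambda continuous_on_component)
qed

lemmas metric_local = metric[unfolded riemannian_metric_def, THEN conjunct1]

lemma metric_pos: "c : A ==> p : fst c ==> v \<noteq> 0 ==> v \<bullet> (g c p *v v) > 0"
 using metric_local by blast

lemma metric_nonneg: "c : A ==> p : fst c ==> v \<bullet> (g c p *v v) >= 0"
 using metric_pos[of c p v] by (cases "v = 0") auto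

lemma metric_sym: "c : A ==> p : fst c ==> transpose (g c p) = g c p"
 using metric_local by blast

lemma metric_commute: "c : A ==> p : fst c ==> v \<bullet> (g c p *v w) = w \<bullet> (g c p *v v)"
 using metric_sym[of c p] by (metis dot_lmul_matrix inner_commute transpose_matrix_vector)

lemma metric_change:
 "c : A ==> d : A ==> p : fst c ==> p : fst d ==>
  g c p = transpose (transition_jacobian c d p) ** g d p ** transition_jacobian c d p"
 using metric[unfolded riemannian_metric_def, THEN conjunct2] by blast

lemma metric_smooth_coords: "c : A ==> continuous_on (im c) (g c \<circ> chart_inv c)"
 using metric_local smooth_on_continuous by blast

lemma metric_continuous:
 assumes "c : A"
 shows "continuous_on (fst c) (g c)"
proof -
 have "continuous_on (fst c) (%p. (g c \<circ> chart_inv c) (snd c p))"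
  by (rule continuous_on_compose2[OF metric_smooth_coords[OF assms] chart_cont(1)[OF assms]]) auto
 then show ?thesis by (rule continuous_on_eq) (use assms in auto)
qed

lemma metric_det_pos: "c : A ==> p : fst c ==> det (g c p) > 0"
 by (intro pos_def_det_pos metric_pos)

lemma metric_inv: "c : A ==> p : fst c ==> g c p *v (matrix_inv (g c p) *v v) = v"
proof -
 assume "c : A" "p : fst c"
 then have "invertible (g c p)" by (intro pos_def_det_nz(2) metric_pos)
 then have "g c p ** matrix_inv (g c p) = mat 1"
  unfolding invertible_def matrix_inv_def by (rule someI2_ex) blast
 then show ?thesis by (simp add: matrix_vector_mul_assoc)
qed

lemma metric_inj: "c : A ==> p : fst c ==> g c p *v v = g c p *v w ==> v = w"
 by (rule pos_def_inj[OF metric_pos])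

text \<open>
  Determinants of the transformation law of the metric.
\<close>

lemma density_change:
 assumes "c : A" "d : A" "p : fst c" "p : fst d"
 shows "sqrt (det (g c p)) = abs (det (transition_jacobian c d p)) * sqrt (det (g d p))"
proof -
 have "det (g c p) = (det (transition_jacobian c d p))^2 * det (g d p)"
  using metric_change[OF assms] by (simp add: det_mul power2_eq_square)
 then show ?thesis by (simp add: real_sqrt_mult)
qed

lemma dot_transpose:
 fixes M :: "real ^ 3 ^ 3"
 shows "v \<bullet> (transpose M *v w) = (M *v v) \<bullet> w"
proof -
 have "v \<bullet> (transpose M *v w) = (w v* M) \<bullet> v" by (simp add: transpose_matrix_vector inner_commute)
 also have "... = w \<bullet> (M *v v)" by (rule dot_lmul_matrix)
 finally show ?thesis by (simp add: inner_commute)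
qed

lemma vector_fieldD:
 "vector_field A X ==> c : A ==> d : A ==> p : fst c ==> p : fst d ==>
  X d p = transition_jacobian c d p *v X c p"
 unfolding vector_field_def by blast

lemma riem_inner_eq:
 assumes X: "vector_field A X" and Y: "vector_field A Y" and c: "c : A" "p : fst c"
 shows "riem_inner A g X Y p = X c p \<bullet> (g c p *v Y c p)"
proof -
 define d where "d = (SOME d. d : A & p : fst d)"
 have d: "d : A" "p : fst d" using someI[of "%d. d : A & p : fst d" c] c by (auto simp: d_def)
 let ?J = "transition_jacobian c d p"
 have XY: "X d p = ?J *v X c p" "Y d p = ?J *v Y c p"
  by (rule vector_fieldD[OF X c(1) d(1) c(2) d(2)], rule vector_fieldD[OF Y c(1) d(1) c(2) d(2)])
 have "X c p \<bullet> (g c p *v Y c p) = X c p \<bullet> (transpose ?J *v (g d p *v (?J *v Y c p)))"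
  unfolding metric_change[OF c(1) d(1) c(2) d(2)] by (simp add: matrix_vector_mul_assoc matrix_mul_assoc)
 also have "... = (?J *v X c p) \<bullet> (g d p *v (?J *v Y c p))"
  by (rule dot_transpose)
 finally show ?thesis unfolding riem_inner_def d_def[symmetric] Let_def XY by simp
qed

lemma smooth_chart_derivative:
 assumes U: "smooth_fun A U" and c: "c : A" and x: "x : im c"
 shows "((U \<circ> chart_inv c) has_derivative
  (%h. (\<chi> j. frechet_derivative (U \<circ> chart_inv c) (at x) (axis j 1)) \<bullet> h)) (at x)"
proof -
 have s: "smooth_on (im c) (U \<circ> chart_inv c)" using U c by (simp add: smooth_fun_def)
 let ?f = "frechet_derivative (U \<circ> chart_inv c) (at x)"
 have d: "((U \<circ> chart_inv c) has_derivative ?f) (at x)"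
  using smooth_on_differentiable[OF s x] by (simp add: frechet_derivative_works)
 have "?f h = (\<chi> j. ?f (axis j 1)) \<bullet> h" for h
 proof -
  have "?f h = ?f (\<Sum>j\<in>UNIV. (h $ j) *s axis j 1)" by (simp add: basis_expansion)
  also have "... = (\<Sum>j\<in>UNIV. h $ j * ?f (axis j 1))"
   using has_derivative_linear[OF d] by (simp add: linear_sum scalar_mult_eq_scaleR linear_scale)
  finally show ?thesis by (simp add: inner_vec_def mult.commute)
 qed
 then have "?f = (%h. (\<chi> j. ?f (axis j 1)) \<bullet> h)" by (rule ext)
 then show ?thesis using d by metis
qed

lemma smooth_chart_derivative_continuous:
 assumes U: "smooth_fun A U" and c: "c : A"
 shows "continuous_on (im c) (%x. \<chi> j. frechet_derivative (U \<circ> chart_inv c) (at x) (axis j 1))"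
proof (rule continuous_on_vec_lambda)
 fix j
 show "continuous_on (im c) (%x. frechet_derivative (U \<circ> chart_inv c) (at x) (axis j 1))"
  by (rule smooth_on_continuous_derivative) (use U c in \<open>auto simp: smooth_fun_def\<close>)
qed

lemma metric_gradient:
 "c : A ==> p : fst c ==>
  g c p *v gradient g U c p = (\<chi> j. frechet_derivative (U \<circ> chart_inv c) (at (snd c p)) (axis j 1))"
 unfolding gradient_def by (rule metric_inv)

lemma gradient_vector_field:
 assumes U: "smooth_fun A U"
 shows "vector_field A (gradient g U)"
 unfolding vector_field_def
proof (intro ballI)
 fix d c p assume d: "d : A" and c: "c : A" and p: "p : fst d \<inter> fst c"
 let ?J = "transition_jacobian c d p"
 let ?dc = "\<chi> j. frechet_derivative (U \<circ> chart_inv c) (at (snd c p)) (axis j 1)"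
 let ?dd = "\<chi> j. frechet_derivative (U \<circ> chart_inv d) (at (snd d p)) (axis j 1)"
 have e: "transit c d (snd c p) = snd d p" using c p by simp
 have "((U \<circ> chart_inv d) \<circ> transit c d has_derivative (%h. ?dd \<bullet> h) \<circ> (%h. ?J *v h)) (at (snd c p))"
  using smooth_chart_derivative[OF U d, of "snd d p"] p e by (intro diff_chain_at trans_derivative c d) auto
 moreover have "open (snd c ` (fst c \<inter> fst d))" by (intro open_coords_image open_Int chart_open c d Int_lower1)
 moreover have "(U \<circ> chart_inv d) (transit c d x) = (U \<circ> chart_inv c) x" if "x : snd c ` (fst c \<inter> fst d)" for x
  using that c d by auto
 ultimately have "((U \<circ> chart_inv c) has_derivative (%h. ?dd \<bullet> h) \<circ> (%h. ?J *v h)) (at (snd c p))"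
  using p by (elim has_derivative_transform_within_open) auto
 then have "(%h. ?dd \<bullet> h) \<circ> (%h. ?J *v h) = (%h. ?dc \<bullet> h)"
  using smooth_chart_derivative[OF U c, of "snd c p"] p by (intro has_derivative_unique) auto
 then have "?dd \<bullet> (?J *v h) = ?dc \<bullet> h" for h by (simp add: fun_eq_iff)
 then have "h \<bullet> (transpose ?J *v ?dd) = h \<bullet> ?dc" for h
  unfolding dot_transpose by (simp only: inner_commute[of _ ?dd] inner_commute[of h])
 then have dc: "?dc = transpose ?J *v ?dd" using vector_eq_ldot[of ?dc "transpose ?J *v ?dd"] by auto
 let ?K = "transition_jacobian d c p"
 have JK: "?J ** ?K = mat 1" using jacobian_inverse[OF d c] p by simp
 have "g c p *v (?K *v gradient g U d p) = (transpose ?J ** g d p ** (?J ** ?K)) *v gradient g U d p"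
  unfolding metric_change[OF c d IntD2[OF p] IntD1[OF p]] by (simp add: matrix_vector_mul_assoc matrix_mul_assoc)
 also have "... = transpose ?J *v (g d p *v gradient g U d p)"
  unfolding JK by (simp add: matrix_vector_mul_assoc)
 also have "... = g c p *v gradient g U c p"
  using metric_gradient[OF d, of p U] metric_gradient[OF c, of p U] p dc by simp
 finally show "gradient g U c p = ?K *v gradient g U d p"
  by (rule metric_inj[OF c IntD2[OF p], symmetric])
qed

lemma smooth_fun_lincomb:
 assumes "smooth_fun A U" "smooth_fun A V"
 shows "smooth_fun A (%p. a * U p + b * V p)"
 unfolding smooth_fun_def smooth_on_def
proof (intro ballI allI)
 fix c k assume c: "c : A"
 have u: "C_k_on k (im c) (U \<circ> chart_inv c)" and v: "C_k_on k (im c) (V \<circ> chart_inv c)"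
  using assms c unfolding smooth_fun_def smooth_on_def by blast+
 show "C_k_on k (im c) ((%p. a * U p + b * V p) \<circ> chart_inv c)"
  using C_k_on_lincomb[OF chart_open(2)[OF c] u v, of a b] by (simp add: o_def)
qed

lemma smooth_fun_const: "smooth_fun A (%_. a)"
 by (simp add: smooth_fun_def smooth_on_def o_def C_k_on_const)

lemma gradient_lincomb:
 assumes U: "smooth_fun A U" and V: "smooth_fun A V" and c: "c : A" "p : fst c"
 shows "gradient g (%p. a * U p + b * V p) c p = a *R gradient g U c p + b *R gradient g V c p"
proof -
 let ?f = "%U. frechet_derivative (U \<circ> chart_inv c) (at (snd c p))"
 have d: "((W \<circ> chart_inv c) has_derivative ?f W) (at (snd c p))" if "smooth_fun A W" for W
  using smooth_on_differentiable[of "im c" "W \<circ> chart_inv c" "snd c p"] that c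
  by (simp add: frechet_derivative_works smooth_fun_def)
 have "((%x. a * (U \<circ> chart_inv c) x + b * (V \<circ> chart_inv c) x) has_derivative (%h. a * ?f U h + b * ?f V h)) (at (snd c p))"
  by (intro has_derivative_add has_derivative_mult_right d U V)
 then have "?f (%p. a * U p + b * V p) = (%h. a * ?f U h + b * ?f V h)"
  using frechet_derivative_at by (fastforce simp: o_def)
 then have "(\<chi> j. ?f (%p. a * U p + b * V p) (axis j 1)) = a *R (\<chi> j. ?f U (axis j 1)) + b *R (\<chi> j. ?f V (axis j 1))"
  by (simp add: vec_eq_iff)
 then show ?thesis
  unfolding gradient_def by (simp add: matrix_vector_right_distrib matrix_vector_mult_scaleR)
qed

end

section \<open>The Riemannian volume\<close>

lemma absolutely_integrable_iff_nn_integral: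
 fixes h :: "'b::euclidean_space => real"
 assumes m: "(%x. indicator S x * h x) : borel_measurable borel" and nn: "!!x. x : S ==> 0 <= h x"
 shows "h absolutely_integrable_on S & integral S h = b \<longleftrightarrow> (lint S (%x. ennreal (h x))) = ennreal b & 0 <= b"
proof -
 let ?f = "%x. indicator S x * h x"
 have nnf: "0 <= ?f x" for x using nn by (auto simp: indicator_def)
 have e: "(lint S (%x. ennreal (h x))) = (nn_integral lborel (%x. ennreal (?f x)))"
  by (intro nn_integral_cong) (auto simp: indicator_def)
 have r: "?f = (%x. if x : S then h x else 0)" by (auto simp: indicator_def)
 have hi: "(h has_integral b) S \<longleftrightarrow> (?f has_integral b) UNIV" for b
  unfolding r by (simp only: has_integral_restrict_UNIV)
 show ?thesis
 proof
  assume "h absolutely_integrable_on S & integral S h = b"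
  then have "(h has_integral b) S" using set_lebesgue_integral_eq_integral(1) integrable_integral by blast
  then have "(?f has_integral b) UNIV" "0 <= b" using hi has_integral_nonneg nn by auto
  then show "(lint S (%x. ennreal (h x))) = ennreal b & 0 <= b"
   unfolding e using nn_integral_has_integral_lborel[OF m nnf] by blast
 next
  assume "(lint S (%x. ennreal (h x))) = ennreal b & 0 <= b"
  then have "(?f has_integral b) UNIV" unfolding e using nn_integral_has_integral[OF m nnf] by blast
  then have "(h has_integral b) S" using hi by blast
  then show "h absolutely_integrable_on S & integral S h = b"
   using nonnegative_absolutely_integrable_1[of h S] nn by (auto simp: has_integral_iff)
 qed
qed

text \<open>
  Substitution preserves absolute integrability, so for nonnegative functions the two sides
  are finite together and infinite together; where they are finite, the rule for integrable functions applies.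
\<close>

lemma nn_integral_change_of_variables:
 fixes \<tau> :: "real ^ 3 => real ^ 3" and f :: "real ^ 3 => real"
 assumes S: "S : sets borel"
  and der: "!!x. x : S ==> (\<tau> has_derivative \<tau>' x) (at x within S)"
  and inj: "inj_on \<tau> S"
  and m1: "(%y. indicator (\<tau> ` S) y * f y) : borel_measurable borel"
  and m2: "(%x. indicator S x * (abs (det (matrix (\<tau>' x))) * f (\<tau> x))) : borel_measurable borel"
  and nn: "!!y. y : \<tau> ` S ==> 0 <= f y"
 shows "(lint (\<tau> ` S) (%y. ennreal (f y))) = (lint S (%x. ennreal (abs (det (matrix (\<tau>' x))) * f (\<tau> x))))"
proof -
 let ?F = "%y. vec (f y) :: real ^ 1"
 have "S : sets lebesgue" using S by simp
 note cv = has_absolute_integral_change_of_variables[OF this der inj, of ?F]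
 have cv': "(%x. abs (det (matrix (\<tau>' x))) * f (\<tau> x)) absolutely_integrable_on S & integral S (%x. abs (det (matrix (\<tau>' x))) * f (\<tau> x)) = b
   \<longleftrightarrow> f absolutely_integrable_on (\<tau> ` S) & integral (\<tau> ` S) f = b" for b
  using cv[of "vec b"] by (simp add: absolutely_integrable_on_1_iff integral_on_1_eq)
 have key: "(lint (\<tau> ` S) (%y. ennreal (f y))) = ennreal b & 0 <= b \<longleftrightarrow>
   (lint S (%x. ennreal (abs (det (matrix (\<tau>' x))) * f (\<tau> x)))) = ennreal b & 0 <= b" for b
  using cv'[of b] absolutely_integrable_iff_nn_integral[OF m1 nn, of b] absolutely_integrable_iff_nn_integral[OF m2, of b] nn
  by simp
 show ?thesis
 proof (cases "(lint (\<tau> ` S) (%y. ennreal (f y))) = top")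
  case True
  have "(lint S (%x. ennreal (abs (det (matrix (\<tau>' x))) * f (\<tau> x)))) = top"
  proof (rule ccontr)
   assume "(lint S (%x. ennreal (abs (det (matrix (\<tau>' x))) * f (\<tau> x)))) \<noteq> top"
   then obtain b where "(lint S (%x. ennreal (abs (det (matrix (\<tau>' x))) * f (\<tau> x)))) = ennreal b" "0 <= b"
    by (cases rule: ennreal_cases) auto
   then show False using key[of b] True by simp
  qed
  then show ?thesis using True by simp
 next
  case False
  then obtain b where "(lint (\<tau> ` S) (%y. ennreal (f y))) = ennreal b" "0 <= b"
   by (cases rule: ennreal_cases) auto
  then show ?thesis using key[of b] by simp
 qed
qed

context riemannian3 begin

definition density_on :: "('a, 3) chart => real ^ 3 => real" where
 "density_on c x = sqrt (det (g c (chart_inv c x)))"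

lemma density_continuous:
 assumes c: "c : A"
 shows "continuous_on (im c) (density_on c)"
 unfolding density_on_def det_def
 using metric_smooth_coords[OF c] by (intro continuous_intros) (auto simp: o_def)

lemma density_pos: "c : A ==> x : im c ==> density_on c x > 0"
 unfolding density_on_def using metric_det_pos inv_in by auto

text \<open>
  The volume on the domain of one chart, extended by zero. The volume measure is glued from these.
\<close>

definition loc_measure :: "('a, 3) chart => 'a measure" where
 "loc_measure c = distr (density (restrict_space lborel (im c)) (%x. ennreal (density_on c x))) borel (chart_inv c)"

lemma im_borel [simp]: "c : A ==> im c : sets borel"
 using chart_open(2) by (simp add: borel_open)

lemma dom_borel [simp]: "c : A ==> fst c : sets borel"
 using chart_open(1) by (simp add: borel_open)

lemma chart_inv_measurable: "c : A ==> chart_inv c : measurable (restrict_space borel (im c)) borel"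
 using chart_cont(2) by (intro borel_measurable_continuous_on_restrict)

lemma restrict_lborel_measurable: "measurable (restrict_space lborel X) N = measurable (restrict_space borel X) N"
 by (rule measurable_cong_sets) (auto simp: sets_restrict_space)

lemma density_measurable: "c : A ==> density_on c : borel_measurable (restrict_space borel (im c))"
 using density_continuous by (intro borel_measurable_continuous_on_restrict)

lemma nn_integral_loc_measure:
 assumes c: "c : A" and h: "h : borel_measurable borel"
 shows "(nn_integral (loc_measure c) (%p. h p)) = (lint (im c) (%x. ennreal (density_on c x) * h (chart_inv c x)))"
proof -
 have d: "(%x. ennreal (density_on c x)) : borel_measurable (restrict_space lborel (im c))"
  unfolding restrict_lborel_measurable using density_measurable[OF c] by measurable
 have i: "chart_inv c : measurable (restrict_space lborel (im c)) borel"
  unfolding restrict_lborel_measurable by (rule chart_inv_measurable[OF c])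
 have hi: "(%x. h (chart_inv c x)) : borel_measurable (restrict_space lborel (im c))"
  using measurable_compose[OF i h] .
 have "(nn_integral (loc_measure c) (%p. h p)) = (nn_integral (restrict_space lborel (im c)) (%x. ennreal (density_on c x) * h (chart_inv c x)))"
  unfolding loc_measure_def using d i hi h
  by (subst nn_integral_distr) (auto simp: nn_integral_density)
 also have "... = (lint (im c) (%x. ennreal (density_on c x) * h (chart_inv c x)))"
  by (rule nn_integral_restrict_space) (use c in auto)
 finally show ?thesis .
qed

lemma sets_loc_measure [simp, measurable_cong]: "sets (loc_measure c) = sets borel"
 by (simp add: loc_measure_def)

lemma emeasure_loc_measure:
 assumes c: "c : A" and B: "B : sets borel" "B \<subseteq> fst c"
 shows "emeasure (loc_measure c) B = (lint (snd c ` B) (%x. ennreal (density_on c x)))"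
proof -
 have "emeasure (loc_measure c) B = (nn_integral (loc_measure c) (%p. indicator B p))" using B by simp
 also have "... = (lint (im c) (%x. ennreal (density_on c x) * indicator B (chart_inv c x)))"
  by (rule nn_integral_loc_measure[OF c]) (use B in simp)
 also have "... = (lint (snd c ` B) (%x. ennreal (density_on c x)))"
 proof (intro nn_integral_cong)
  fix x
  have "x : im c & chart_inv c x : B \<longleftrightarrow> x : snd c ` B"
  proof
   assume h: "x : im c & chart_inv c x : B"
   then have "x = snd c (chart_inv c x)" using c by simp
   then show "x : snd c ` B" using h by blast
  next
   assume "x : snd c ` B"
   then show "x : im c & chart_inv c x : B" using c B(2) by auto
  qed
  then show "ennreal (density_on c x) * indicator B (chart_inv c x) * indicator (im c) x
   = ennreal (density_on c x) * indicator (snd c ` B) x"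
   by (auto simp: indicator_def)
 qed
 finally show ?thesis .
qed

lemma coords_image_borel:
 assumes c: "c : A" and B: "B : sets borel" "B \<subseteq> fst c"
 shows "snd c ` B : sets borel"
proof -
 have "snd c ` B = chart_inv c -` B \<inter> space (restrict_space borel (im c))"
 proof (intro set_eqI iffI)
  fix x assume "x : snd c ` B"
  then obtain p where "p : B" "x = snd c p" by blast
  then show "x : chart_inv c -` B \<inter> space (restrict_space borel (im c))" using c B(2) by (auto simp: space_restrict_space)
 next
  fix x assume x: "x : chart_inv c -` B \<inter> space (restrict_space borel (im c))"
  then have "x = snd c (chart_inv c x)" using c by (simp add: space_restrict_space)
  then show "x : snd c ` B" using x by blast
 qed
 also have "... : sets (restrict_space borel (im c))"
  by (rule measurable_sets[OF chart_inv_measurable[OF c] B(1)])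
 finally show ?thesis using c by (auto simp: sets_restrict_space_iff)
qed

text \<open>
  The Jacobian of the change of coordinates cancels against \<open>density_change\<close>.
\<close>

lemma loc_measure_agree:
 assumes c: "c : A" "d : A" and B: "B : sets borel" "B \<subseteq> fst c" "B \<subseteq> fst d"
 shows "emeasure (loc_measure c) B = emeasure (loc_measure d) B"
proof -
 let ?S = "snd c ` B" and ?\<tau> = "transit c d"
 have img: "?\<tau> ` ?S = snd d ` B" using B(2) c by (force simp: image_image)
 have Sb: "?S : sets borel" "snd d ` B : sets borel" using coords_image_borel c B by auto
 have ind: "(%y. indicator T y * h y) : borel_measurable borel"
  if "T : sets borel" "T \<subseteq> im e" "e : A" "continuous_on (im e) h" for T e and h :: "real ^ 3 => real"
  using borel_measurable_continuous_on_indicator[OF that(1) continuous_on_subset[OF that(4,2)]] by simp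
 have eq: "abs (det (matrix ((*v) (transition_jacobian c d (chart_inv c x))))) * density_on d (?\<tau> x) = density_on c x" if x: "x : ?S" for x
 proof -
  obtain p where p: "p : B" "x = snd c p" using x by blast
  then have pp: "p : fst c" "p : fst d" using B by auto
  then show ?thesis using p c density_change[OF c pp] by (simp add: density_on_def)
 qed
 have "(lint (?\<tau> ` ?S) (%y. ennreal (density_on d y)))
  = (lint ?S (%x. ennreal (abs (det (matrix ((*v) (transition_jacobian c d (chart_inv c x))))) * density_on d (?\<tau> x))))"
 proof (rule nn_integral_change_of_variables)
  show "(?\<tau> has_derivative (*v) (transition_jacobian c d (chart_inv c x))) (at x within ?S)" if x: "x : ?S" for x
  proof -
   obtain p where p: "p : B" "x = snd c p" using x by blast
   then have pp: "p : fst c" "p : fst d" using B by auto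
   then show ?thesis using trans_derivative[OF c pp] p c by (auto intro: has_derivative_at_withinI)
  qed
  show "inj_on ?\<tau> ?S"
  proof (rule inj_onI)
   fix x y assume "x : ?S" "y : ?S" and e: "?\<tau> x = ?\<tau> y"
   then obtain p q where p: "p : B" "x = snd c p" and q: "q : B" "y = snd c q" by blast
   have pq: "p : fst c" "q : fst c" "p : fst d" "q : fst d" using p q B by auto
   have "snd d p = snd d q" using e pq p(2) q(2) c by simp
   then have "chart_inv d (snd d p) = chart_inv d (snd d q)" by simp
   then have "p = q" using pq c by simp
   then show "x = y" using p q by simp
  qed
  show "(%y. indicator (?\<tau> ` ?S) y * density_on d y) : borel_measurable borel"
   unfolding img by (rule ind[OF Sb(2) _ c(2) density_continuous[OF c(2)]]) (use B in auto)
  have "(%x. indicator ?S x * density_on c x) : borel_measurable borel"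
   by (rule ind[OF Sb(1) _ c(1) density_continuous[OF c(1)]]) (use B in auto)
  moreover have "(%x. indicator ?S x * density_on c x) =
   (%x. indicator ?S x * (abs (det (matrix ((*v) (transition_jacobian c d (chart_inv c x))))) * density_on d (?\<tau> x)))"
   using eq by (auto simp: indicator_def)
  ultimately show "(%x. indicator ?S x * (abs (det (matrix ((*v) (transition_jacobian c d (chart_inv c x))))) * density_on d (?\<tau> x))) : borel_measurable borel"
   by (simp only:)
  show "0 <= density_on d y" if "y : ?\<tau> ` ?S" for y
  proof -
   have "y : im d" using that B(3) unfolding img by blast
   then show ?thesis using density_pos[OF c(2)] less_imp_le by blast
  qed
 qed (rule Sb)
 also have "... = (lint ?S (%x. ennreal (density_on c x)))"
  using eq by (intro nn_integral_cong) (auto simp: indicator_def)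
 finally show ?thesis unfolding img using emeasure_loc_measure c B by simp
qed

lemma finite_chart_cover: "EX cs :: nat => ('a, 3) chart. EX N. (ALL i<N. cs i : A) & (\<Union>i<N. fst (cs i)) = UNIV"
proof -
 have "EX F. finite F & F \<subseteq> A & UNIV \<subseteq> (\<Union>c\<in>F. fst c)"
  using compactE_image[OF compact, of A fst] chart_open(1) chart_cover by (metis UNIV_eq_I UN_iff subset_UNIV)
 then obtain F where F: "finite F" "F \<subseteq> A" "UNIV \<subseteq> (\<Union>c\<in>F. fst c)" by blast
 obtain h :: "nat => ('a, 3) chart" and N where h: "F = h ` {i. i < N}"
  using finite_imp_nat_seg_image_inj_on[OF F(1)] by blast
 have "(ALL i<N. h i : A) & (\<Union>i<N. fst (h i)) = UNIV" using F(2,3) h by auto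
 then show ?thesis by blast
qed

definition is_volume :: "'a measure => bool" where
 "is_volume \<mu> \<longleftrightarrow> sets \<mu> = sets borel &
  (ALL c:A. ALL B:sets borel. B \<subseteq> fst c --> emeasure \<mu> B = emeasure (loc_measure c) B)"

lemma is_volume_unique:
 assumes "is_volume \<mu>" "is_volume \<nu>"
 shows "\<mu> = \<nu>"
proof (rule measure_eqI)
 show "sets \<mu> = sets \<nu>" using assms by (simp add: is_volume_def)
 fix B assume "B : sets \<mu>"
 then have B: "B : sets borel" using assms by (simp add: is_volume_def)
 obtain cs :: "nat => ('a, 3) chart" and N :: nat
  where cs: "!!i. i < N ==> cs i : A" "(\<Union>i<N. fst (cs i)) = UNIV"
  using finite_chart_cover by blast
 define D where "D i = (if i < N then fst (cs i) \<inter> B else {})" for i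
 have D: "range D \<subseteq> sets borel" using cs(1) B by (auto simp: D_def)
 have dD: "disjointed D i \<subseteq> D i" for i by (auto simp: disjointed_def)
 have dDb: "disjointed D i : sets borel" for i using sets.range_disjointed_sets[OF D] by blast
 have B_eq: "B = (\<Union>i. disjointed D i)"
  unfolding UN_disjointed_eq using cs(2) by (auto simp: D_def)
 have sum: "emeasure \<rho> B = (\<Sum>i. emeasure \<rho> (disjointed D i))" if "is_volume \<rho>" for \<rho>
 proof -
  have "range (disjointed D) \<subseteq> sets \<rho>" using dDb that by (auto simp: is_volume_def)
  from suminf_emeasure[OF this disjoint_family_disjointed] show ?thesis by (simp add: B_eq)
 qed
 have "emeasure \<mu> (disjointed D i) = emeasure \<nu> (disjointed D i)" for i
 proof (cases "i < N")
  case True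
  have "disjointed D i \<subseteq> fst (cs i)" using dD[of i] True by (auto simp: D_def)
  then show ?thesis using assms cs(1)[OF True] dDb by (simp add: is_volume_def)
 next
  case False
  then have "disjointed D i = {}" using dD[of i] by (simp add: D_def)
  then show ?thesis by simp
 qed
 then show "emeasure \<mu> B = emeasure \<nu> B" using sum assms by simp
qed

text \<open>
  Finitely many charts cover the manifold. Their domains are made disjoint by removing the earlier ones,
  and the local volumes of the resulting pieces are added up.
\<close>

lemma is_volume_exists: "\<exists>\<mu>. is_volume \<mu>"
proof -
 obtain cs :: "nat => ('a, 3) chart" and N :: nat
  where cs: "!!i. i < N ==> cs i : A" "(\<Union>i<N. fst (cs i)) = UNIV"
  using finite_chart_cover by blast
 define D where "D i = (if i < N then fst (cs i) else {})" for i
 have D: "range D \<subseteq> sets borel" using cs(1) by (auto simp: D_def)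
 define E where "E = disjointed D"
 have dD: "E i \<subseteq> D i" for i by (auto simp: E_def disjointed_def)
 have Eb: "E i : sets borel" for i unfolding E_def using sets.range_disjointed_sets[OF D] by blast
 have Edis: "disjoint_family E" by (simp add: E_def disjoint_family_disjointed)
 have Eall: "(\<Union>i. E i) = UNIV" unfolding E_def UN_disjointed_eq using cs(2) by (auto simp: D_def)
 define f where "f B = (\<Sum>i<N. emeasure (loc_measure (cs i)) (B \<inter> E i))" for B
 define \<mu> where "\<mu> = measure_of UNIV (sets borel) f"
 have sa: "sigma_algebra UNIV (sets (borel :: 'a measure))" by (metis sets.sigma_algebra_axioms space_borel)
 have pos: "positive (sets \<mu>) f" by (simp add: positive_def f_def)
 have sets\<mu>: "sets \<mu> = sets borel" unfolding \<mu>_def by (simp add: sigma_algebra.sigma_sets_eq[OF sa])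
 have ca: "countably_additive (sets \<mu>) f"
 proof (rule countably_additiveI)
  fix B :: "nat => 'a set" assume B: "range B \<subseteq> sets \<mu>" "disjoint_family B"
  have "(\<Sum>n. f (B n)) = (\<Sum>i<N. (\<Sum>n. emeasure (loc_measure (cs i)) (B n \<inter> E i)))"
   unfolding f_def by (subst suminf_sum) auto
  also have "... = (\<Sum>i<N. emeasure (loc_measure (cs i)) ((\<Union>n. B n) \<inter> E i))"
  proof (intro sum.cong refl)
   fix i
   have "(\<Sum>n. emeasure (loc_measure (cs i)) (B n \<inter> E i)) = emeasure (loc_measure (cs i)) (\<Union>n. B n \<inter> E i)"
   proof (rule suminf_emeasure)
    show "range (%n. B n \<inter> E i) \<subseteq> sets (loc_measure (cs i))" using B(1) Eb sets\<mu> by auto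
    show "disjoint_family (%n. B n \<inter> E i)" using B(2) unfolding disjoint_family_on_def by blast
   qed
   then show "(\<Sum>n. emeasure (loc_measure (cs i)) (B n \<inter> E i)) = emeasure (loc_measure (cs i)) ((\<Union>n. B n) \<inter> E i)"
    by simp
  qed
  finally show "(\<Sum>n. f (B n)) = f (\<Union> (range B))" by (simp add: f_def)
 qed
 have em: "emeasure \<mu> B = f B" if "B : sets borel" for B
  by (rule emeasure_measure_of[OF \<mu>_def _ pos ca]) (use that sets\<mu> in auto)
 have "emeasure \<mu> B = emeasure (loc_measure c) B" if c: "c : A" and B: "B : sets borel" "B \<subseteq> fst c" for c B
 proof -
  have "emeasure \<mu> B = (\<Sum>i<N. emeasure (loc_measure c) (B \<inter> E i))"
   unfolding em[OF B(1)] f_def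
  proof (intro sum.cong refl)
   fix i assume "i : {..<N}"
   then have i: "i < N" by simp
   have "B \<inter> E i \<subseteq> fst (cs i)" using dD[of i] i by (auto simp: D_def)
   then show "emeasure (loc_measure (cs i)) (B \<inter> E i) = emeasure (loc_measure c) (B \<inter> E i)"
    using cs(1)[OF i] c B Eb by (intro loc_measure_agree) auto
  qed
  also have "... = emeasure (loc_measure c) (\<Union>i<N. B \<inter> E i)"
  proof (rule sum_emeasure)
   show "(%i. B \<inter> E i) ` {..<N} \<subseteq> sets (loc_measure c)" using B Eb by auto
   show "disjoint_family_on (%i. B \<inter> E i) {..<N}" using Edis unfolding disjoint_family_on_def by blast
  qed simp
  also have "(\<Union>i<N. B \<inter> E i) = B"
  proof -
   have "E i = {}" if "\<not> i < N" for i using dD[of i] that by (simp add: D_def)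
   then have "x : (\<Union>i<N. B \<inter> E i)" if "x : B" for x
    using that UNIV_I[of x] unfolding Eall[symmetric] by (metis IntI UN_E UN_I empty_iff lessThan_iff)
   then show ?thesis by blast
  qed
  finally show ?thesis .
 qed
 then show ?thesis using sets\<mu> unfolding is_volume_def by blast
qed

abbreviation vol :: "'a measure" where "vol \<equiv> volume_measure A g"

lemma vol_is_volume: "is_volume vol"
proof -
 have "vol = (THE \<mu>. is_volume \<mu>)"
 proof -
  have "(sets \<mu> = sets borel &
    (ALL c:A. ALL B:sets borel. B \<subseteq> fst c -->
      emeasure \<mu> B = (lint (snd c ` B) (%x. ennreal (sqrt (det (g c (chart_inv c x)))))))) \<longleftrightarrow> is_volume \<mu>" for \<mu>
   unfolding is_volume_def using emeasure_loc_measure unfolding density_on_def by (intro conj_cong refl ball_cong) auto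
  then show ?thesis unfolding volume_measure_def by simp
 qed
 then show ?thesis using theI'[of is_volume] is_volume_exists is_volume_unique by metis
qed

lemma sets_vol [simp, measurable_cong]: "sets vol = sets borel"
 using vol_is_volume by (simp add: is_volume_def)

lemma space_vol [simp]: "space vol = UNIV"
 using sets_eq_imp_space_eq[OF sets_vol] by simp

lemma nn_integral_vol_chart:
 assumes c: "c : A" and B: "B : sets borel" "B \<subseteq> fst c" and h: "h : borel_measurable borel"
 shows "(\<integral>\<^sup>+p\<in>B. h p \<partial>vol) = (lint (snd c ` B) (%x. ennreal (density_on c x) * h (chart_inv c x)))"
proof -
 have eq: "density vol (indicator B) = density (loc_measure c) (indicator B)"
 proof (rule measure_eqI)
  fix E assume "E : sets (density vol (indicator B))"
  then have E: "E : sets borel" by simp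
  have "emeasure vol (B \<inter> E) = emeasure (loc_measure c) (B \<inter> E)"
   using vol_is_volume c B E unfolding is_volume_def by (meson inf.coboundedI1 sets.Int)
  then show "emeasure (density vol (indicator B)) E = emeasure (density (loc_measure c) (indicator B)) E"
   using E B by (simp add: emeasure_density indicator_inter_arith[symmetric])
 qed simp
 have "(\<integral>\<^sup>+p\<in>B. h p \<partial>vol) = (nn_integral (density vol (indicator B)) (%p. h p))"
  using B h by (subst nn_integral_density) (auto simp: mult.commute)
 also have "... = (nn_integral (loc_measure c) (%p. h p * indicator B p))"
  unfolding eq using B h by (subst nn_integral_density) (auto simp: mult.commute)
 also have "... = (lint (im c) (%x. ennreal (density_on c x) * (h (chart_inv c x) * indicator B (chart_inv c x))))"
  by (rule nn_integral_loc_measure[OF c]) (use h B in measurable)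
 also have "... = (lint (snd c ` B) (%x. ennreal (density_on c x) * h (chart_inv c x)))"
 proof (intro nn_integral_cong)
  fix x
  have "x : im c & chart_inv c x : B \<longleftrightarrow> x : snd c ` B"
  proof
   assume h: "x : im c & chart_inv c x : B"
   then have "x = snd c (chart_inv c x)" using c by simp
   then show "x : snd c ` B" using h by blast
  next
   assume "x : snd c ` B"
   then show "x : im c & chart_inv c x : B" using c B(2) by auto
  qed
  then show "ennreal (density_on c x) * (h (chart_inv c x) * indicator B (chart_inv c x)) * indicator (im c) x
   = ennreal (density_on c x) * h (chart_inv c x) * indicator (snd c ` B) x"
   by (auto simp: indicator_def)
 qed
 finally show ?thesis .
qed

end

section \<open>Covering by finitely many cells\<close>

lemma closed_cell_diam:
 assumes "x : closed_cell k a" "y : closed_cell k a"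
 shows "norm (x - y) <= 3 / 2 ^ k"
proof -
 have "norm (x - y) <= (\<Sum>i\<in>UNIV. abs ((x - y) $ i))" by (rule norm_le_l1_cart)
 also have "... <= (\<Sum>i\<in>(UNIV :: 3 set). 1 / 2 ^ k)"
 proof (rule sum_mono)
  fix i
  show "abs ((x - y) $ i) <= 1 / 2 ^ k"
   using assms unfolding in_closed_cell_iff by (auto simp: abs_le_iff) (smt (verit))+
 qed
 finally show ?thesis by simp
qed

lemma continuous_on_det:
 fixes M :: "'b::topological_space => real ^ 3 ^ 3"
 assumes "!!i j. continuous_on S (%p. M p $ i $ j)"
 shows "continuous_on S (%p. det (M p))"
 unfolding det_def by (intro continuous_intros assms)

lemma continuous_on_matrix_vector:
 fixes M :: "'b::topological_space => real ^ 3 ^ 3"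
 assumes "continuous_on S M" "continuous_on S v"
 shows "continuous_on S (%p. M p *v v p)"
 unfolding matrix_vector_mult_def by (intro continuous_intros assms)

lemma borel_measurable_matrix_vector:
 fixes M :: "'b => real ^ 3 ^ 3" and v :: "'b => real ^ 3"
 assumes "M : borel_measurable N" "v : borel_measurable N"
 shows "(%p. M p *v v p) : borel_measurable N"
proof -
 have "continuous_on UNIV (%x. fst x *v (snd x :: real ^ 3) :: real ^ 3)"
  by (intro continuous_on_matrix_vector continuous_on_fst continuous_on_snd continuous_on_id)
 from borel_measurable_continuous_Pair[OF assms this] show ?thesis .
qed

type_synonym 'b patch = "('b, 3) chart \<times> nat \<times> (real ^ 3)"

context riemannian3 begin

definition region :: "'a patch => 'a set" where
 "region P = (case P of (c, k, a) => {p : fst c. snd c p : cell k a})"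

text \<open>
  A patch is a chart with a cell in its image. The constant \<open>\<kappa>\<close> bounds the volume density and the metric
  above and below on the closed cell, so that coordinate integrals and integrals over the manifold are comparable
  up to powers of \<open>\<kappa>\<close>.
\<close>

definition good_patch :: "real => 'a patch => bool" where
 "good_patch \<kappa> P = (case P of (c, k, a) => c : A & closed_cell k a \<subseteq> im c &
   (ALL x:closed_cell k a. 1 / \<kappa> <= density_on c x & density_on c x <= \<kappa> &
    (ALL v. (norm v)^2 <= \<kappa> * (v \<bullet> (g c (chart_inv c x) *v v)) &
      (norm (g c (chart_inv c x) *v v))^2 <= \<kappa> * (norm v)^2)))"

lemma good_patchD:
 assumes "good_patch \<kappa> (c, k, a)"
 shows "c : A" "closed_cell k a \<subseteq> im c"
  and "x : closed_cell k a ==> 1 / \<kappa> <= density_on c x" "x : closed_cell k a ==> density_on c x <= \<kappa>"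
  and "x : closed_cell k a ==> (norm v)^2 <= \<kappa> * (v \<bullet> (g c (chart_inv c x) *v v))"
  and "x : closed_cell k a ==> (norm (g c (chart_inv c x) *v v))^2 <= \<kappa> * (norm v)^2"
 using assms unfolding good_patch_def prod.case by blast+

text \<open>
  Density and metric are continuous, and positive definite forms are bounded below on the product of
  the compact cell and the unit sphere.
\<close>

lemma good_patch_exists:
 assumes c: "c : A" and K: "closed_cell k a \<subseteq> im c"
 shows "\<exists>\<kappa>>0. good_patch \<kappa> (c, k, a)"
proof -
 let ?K = "closed_cell k a"
 have ne: "?K \<noteq> {}" using self_in_cell[of a k] cell_subset_closed_cell by blast
 have cd: "continuous_on ?K (density_on c)" by (rule continuous_on_subset[OF density_continuous[OF c] K])
 obtain x1 where x1: "x1 : ?K" "!!x. x : ?K ==> density_on c x1 <= density_on c x"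
  using continuous_attains_inf[OF compact_closed_cell ne cd] by blast
 obtain x2 where x2: "x2 : ?K" "!!x. x : ?K ==> density_on c x <= density_on c x2"
  using continuous_attains_sup[OF compact_closed_cell ne cd] by blast
 have d1: "density_on c x1 > 0" using density_pos[OF c] x1(1) K by blast
 let ?G = "%x. g c (chart_inv c x)"
 let ?T = "?K \<times> sphere (0 :: real ^ 3) 1"
 have cT: "compact ?T" by (intro compact_Times compact_closed_cell compact_sphere)
 have "axis 1 1 : sphere (0 :: real ^ 3) 1" by simp
 then have neT: "?T \<noteq> {}" using ne by blast
 have cG: "continuous_on ?T (%z. ?G (fst z))"
  using continuous_on_compose2[OF continuous_on_subset[OF metric_smooth_coords[OF c] K] continuous_on_fst[OF continuous_on_id], of ?T]
  by (auto simp: o_def)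
 have cGv: "continuous_on ?T (%z. ?G (fst z) *v snd z)"
  by (intro continuous_on_matrix_vector cG continuous_on_snd continuous_on_id)
 have cq: "continuous_on ?T (%z. snd z \<bullet> (?G (fst z) *v snd z))"
  by (intro continuous_intros cGv)
 have cn: "continuous_on ?T (%z. norm (?G (fst z) *v snd z))"
  by (intro continuous_intros cGv)
 obtain z1 where z1: "z1 : ?T" "!!z. z : ?T ==> snd z1 \<bullet> (?G (fst z1) *v snd z1) <= snd z \<bullet> (?G (fst z) *v snd z)"
  using continuous_attains_inf[OF cT neT cq] by blast
 obtain z2 where z2: "z2 : ?T" "!!z. z : ?T ==> norm (?G (fst z) *v snd z) <= norm (?G (fst z2) *v snd z2)"
  using continuous_attains_sup[OF cT neT cn] by blast
 define m where "m = snd z1 \<bullet> (?G (fst z1) *v snd z1)"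
 define M where "M = norm (?G (fst z2) *v snd z2)"
 have mpos: "m > 0" unfolding m_def
  using z1(1) K inv_in[OF c] by (intro metric_pos[OF c]) auto
 have lower: "m * (norm v)^2 <= v \<bullet> (?G x *v v)" and upper: "norm (?G x *v v) <= M * norm v" if x: "x : ?K" for x v
 proof -
  have "m * (norm v)^2 <= v \<bullet> (?G x *v v) & norm (?G x *v v) <= M * norm v"
  proof (cases "v = 0")
   case False
   define w where "w = (1 / norm v) *R v"
   have w: "(x, w) : ?T" using x False by (simp add: w_def)
   have v: "v = norm v *R w" using False by (simp add: w_def)
   have Gv: "?G x *v v = norm v *R (?G x *v w)" by (subst v) (simp add: matrix_vector_mult_scaleR)
   have "v \<bullet> (?G x *v v) = (norm v)^2 * (w \<bullet> (?G x *v w))"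
    unfolding Gv by (subst v) (simp add: power2_eq_square)
   moreover have "m <= w \<bullet> (?G x *v w)" using z1(2)[OF w] by (simp add: m_def)
   ultimately have a: "m * (norm v)^2 <= v \<bullet> (?G x *v v)" by (simp add: mult.commute[of m] mult_left_mono)
   have "norm (?G x *v w) <= M" using z2(2)[OF w] by (simp add: M_def)
   then have "norm (?G x *v v) <= M * norm v" unfolding Gv by (simp add: mult.commute[of M] mult_left_mono)
   then show ?thesis using a by blast
  qed simp
  then show "m * (norm v)^2 <= v \<bullet> (?G x *v v)" "norm (?G x *v v) <= M * norm v" by auto
 qed
 define \<kappa> where "\<kappa> = Max {1 / density_on c x1, density_on c x2, 1 / m, M^2}"
 have \<kappa>: "1 / density_on c x1 <= \<kappa>" "density_on c x2 <= \<kappa>" "1 / m <= \<kappa>" "M^2 <= \<kappa>"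
  unfolding \<kappa>_def by (intro Max_ge; simp)+
 have \<kappa>0: "\<kappa> > 0" using \<kappa>(3) mpos by (meson less_le_trans zero_less_divide_1_iff)
 have "1 / \<kappa> <= density_on c x1" using \<kappa>(1) \<kappa>0 d1 by (simp add: field_simps)
 moreover have "(norm v)^2 <= \<kappa> * (v \<bullet> (?G x *v v))" if x: "x : ?K" for x v
 proof -
  have "(norm v)^2 = (1 / m) * (m * (norm v)^2)" using mpos by simp
  also have "... <= \<kappa> * (v \<bullet> (?G x *v v))" using \<kappa>(3) \<kappa>0 mpos lower[OF x] by (intro mult_mono) auto
  finally show ?thesis .
 qed
 moreover have "(norm (?G x *v v))^2 <= \<kappa> * (norm v)^2" if x: "x : ?K" for x v
 proof -
  have "(norm (?G x *v v))^2 <= (M * norm v)^2" by (intro power_mono upper[OF x]) auto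
  also have "... <= \<kappa> * (norm v)^2" unfolding power_mult_distrib by (intro mult_right_mono \<kappa>(4)) auto
  finally show ?thesis .
 qed
 ultimately have "good_patch \<kappa> (c, k, a)"
  unfolding good_patch_def prod.case using c K order_trans[OF _ x1(2)] order_trans[OF x2(2) \<kappa>(2)] by blast
 then show ?thesis using \<kappa>0 by blast
qed

lemma good_patch_mono: "good_patch \<kappa> P ==> 0 < \<kappa> ==> \<kappa> <= \<kappa>' ==> good_patch \<kappa>' P"
proof -
 assume gp: "good_patch \<kappa> P" and k: "0 < \<kappa>" "\<kappa> <= \<kappa>'"
 obtain c j a where P: "P = (c, j, a)" by (cases P)
 have le: "1 / \<kappa>' <= 1 / \<kappa>" using k by (simp add: frac_le)
 have c: "c : A" and K: "closed_cell j a \<subseteq> im c" using good_patchD(1,2)[OF gp[unfolded P]] by blast+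
 have "(norm v)^2 <= \<kappa>' * (v \<bullet> (g c (chart_inv c x) *v v)) & (norm (g c (chart_inv c x) *v v))^2 <= \<kappa>' * (norm v)^2"
  if x: "x : closed_cell j a" for x v
 proof -
  have "0 <= v \<bullet> (g c (chart_inv c x) *v v)" using metric_nonneg[OF c inv_in[OF c]] x K by blast
  then have "\<kappa> * (v \<bullet> (g c (chart_inv c x) *v v)) <= \<kappa>' * (v \<bullet> (g c (chart_inv c x) *v v))"
   "\<kappa> * (norm v)^2 <= \<kappa>' * (norm v)^2" using k by (auto intro: mult_right_mono)
  moreover have "(norm v)^2 <= \<kappa> * (v \<bullet> (g c (chart_inv c x) *v v))" "(norm (g c (chart_inv c x) *v v))^2 <= \<kappa> * (norm v)^2"
   using good_patchD(5,6)[OF gp[unfolded P] x] by blast+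
  ultimately show ?thesis by linarith
 qed
 moreover have "1 / \<kappa>' <= density_on c x & density_on c x <= \<kappa>'" if "x : closed_cell j a" for x
  using good_patchD(3,4)[OF gp[unfolded P] that] le k by linarith
 ultimately show ?thesis using c K unfolding good_patch_def P prod.case by blast
qed

text \<open>
  In a ball around the coordinates of a point finitely many small cells have their closures inside the
  chart and cover a neighbourhood; compactness reduces the neighbourhoods to finitely many.
\<close>

lemma patches_exist: "\<exists>I \<kappa>. finite I & \<kappa> > 0 & (ALL P:I. good_patch \<kappa> P) & (\<Union>P\<in>I. region P) = UNIV"
proof -
 have local_patches: "EX W F. open W & p : W & finite F & (ALL P:F. \<exists>\<kappa>>0. good_patch \<kappa> P) & W \<subseteq> (\<Union>P\<in>F. region P)" for p
 proof -
  obtain c where c: "c : A" "p : fst c" using chart_cover by blast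
  define x where "x = snd c p"
  have "x : im c" using c by (simp add: x_def)
  then obtain r where r: "r > 0" "ball x r \<subseteq> im c" using chart_open(2)[OF c(1)] open_contains_ball by blast
  obtain k :: nat where "4 / r < 2 ^ k" using real_arch_pow[of 2 "4 / r"] by auto
  then have k: "4 / 2 ^ k < r" using r(1) by (simp add: field_simps)
  define b where "b = ball x (1 / 2 ^ k)"
  define F0 where "F0 = cell k ` b"
  have "finite F0" unfolding F0_def b_def by (intro finite_cells_bounded bounded_ball)
  then obtain Y where Y: "finite Y" "Y \<subseteq> b" "F0 = cell k ` Y"
   using finite_subset_image[of F0 "cell k" b] unfolding F0_def by blast
  define F where "F = (%y. (c, k, y)) ` Y"
  define W where "W = fst c \<inter> snd c -` b"
  have "open W" unfolding W_def b_def
   by (rule continuous_open_preimage[OF chart_cont(1)[OF c(1)] chart_open(1)[OF c(1)]]) simp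
  moreover have "p : W" using c by (simp add: W_def b_def x_def)
  moreover have "finite F" using Y(1) by (simp add: F_def)
  moreover have "\<exists>\<kappa>>0. good_patch \<kappa> P" if PF: "P : F" for P
  proof -
   obtain y where y: "y : Y" "P = (c, k, y)" using PF unfolding F_def by blast
   have "closed_cell k y \<subseteq> im c"
   proof
    fix z assume "z : closed_cell k y"
    then have "norm (z - y) <= 3 / 2 ^ k"
     by (rule closed_cell_diam) (use cell_subset_closed_cell self_in_cell in blast)
    moreover have "norm (y - x) < 1 / 2 ^ k" using y(1) Y(2) by (auto simp: b_def dist_norm norm_minus_commute)
    moreover have "norm (z - x) <= norm (z - y) + norm (y - x)" using norm_triangle_ineq[of "z - y" "y - x"] by simp
    ultimately have "norm (z - x) < 3 / 2 ^ k + 1 / 2 ^ k" by linarith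
    also have "... = 4 / 2 ^ k" by simp
    finally have "z : ball x r" using k by (simp add: dist_norm norm_minus_commute)
    then show "z : im c" using r(2) by blast
   qed
   then show ?thesis unfolding y(2) by (rule good_patch_exists[OF c(1)])
  qed
  moreover have "W \<subseteq> (\<Union>P\<in>F. region P)"
  proof
   fix q assume q: "q : W"
   then have "cell k (snd c q) : F0" by (simp add: F0_def W_def)
   then obtain y where y: "y : Y" "cell k (snd c q) = cell k y" using Y(3) by auto
   then have "snd c q : cell k y" using self_in_cell by blast
   then show "q : (\<Union>P\<in>F. region P)" using y(1) q by (auto simp: F_def region_def W_def)
  qed
  ultimately show ?thesis by blast
 qed
 then obtain W F where WF: "!!p. open (W p)" "!!p. p : W p" "!!p. finite (F p)"
  "!!p P. P : F p ==> \<exists>\<kappa>>0. good_patch \<kappa> P" "!!p. W p \<subseteq> (\<Union>P\<in>F p. region P)" by metis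
 have "UNIV \<subseteq> \<Union> (W ` UNIV)" using WF(2) by auto
 then obtain S where S: "finite S" "UNIV \<subseteq> \<Union> (W ` S)"
  using compactE_image[OF compact, of UNIV W] WF(1) by (metis subset_UNIV)
 define I where "I = \<Union> (F ` S)"
 have finI: "finite I" using S(1) WF(3) by (simp add: I_def)
 have "ALL P:I. \<exists>\<kappa>>0. good_patch \<kappa> P" using WF(4) by (auto simp: I_def)
 then obtain \<kappa> where \<kappa>: "!!P. P : I ==> \<kappa> P > 0" "!!P. P : I ==> good_patch (\<kappa> P) P" by metis
 define K where "K = Max (insert 1 (\<kappa> ` I))"
 have K: "\<kappa> P <= K" if "P : I" for P unfolding K_def using finI that by (intro Max_ge) auto
 have "1 <= K" unfolding K_def using finI by (intro Max_ge) auto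
 moreover have "good_patch K P" if "P : I" for P using good_patch_mono[OF \<kappa>(2,1) K] that by blast
 moreover have "(\<Union>P\<in>I. region P) = UNIV"
 proof (rule UNIV_eq_I[symmetric])
  fix p
  obtain q where "q : S" "p : W q" using S(2) by blast
  then show "p : (\<Union>P\<in>I. region P)" using WF(5)[of q] unfolding I_def by blast
 qed
 ultimately show ?thesis using finI by (intro exI[of _ I] exI[of _ K]) auto
qed

text \<open>
  One finite family of patches and one constant are fixed for all estimates.
\<close>

definition patches :: "'a patch set" where
 "patches = fst (SOME (I, \<kappa>). finite I & \<kappa> > 0 & (ALL P:I. good_patch \<kappa> P) & (\<Union>P\<in>I. region P) = UNIV)"

definition distortion :: real where
 "distortion = snd (SOME (I, \<kappa>). finite I & \<kappa> > 0 & (ALL P:I. good_patch \<kappa> P) & (\<Union>P\<in>I. region P) = UNIV)"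

lemma patches_spec: "finite patches" "distortion > 0" "P : patches ==> good_patch distortion P" "(\<Union>P\<in>patches. region P) = UNIV"
proof -
 let ?Q = "%(I, \<kappa>). finite I & \<kappa> > 0 & (ALL P:I. good_patch \<kappa> P) & (\<Union>P\<in>I. region P) = UNIV"
 have "EX z. ?Q z" using patches_exist by auto
 from someI_ex[OF this] have "?Q (patches, distortion)" unfolding patches_def distortion_def prod.collapse .
 then show "finite patches" "distortion > 0" "P : patches ==> good_patch distortion P" "(\<Union>P\<in>patches. region P) = UNIV"
  by auto
qed

lemma patch_chart: "(c, k, a) : patches ==> c : A" "(c, k, a) : patches ==> closed_cell k a \<subseteq> im c"
 using good_patchD(1,2)[OF patches_spec(3)] by blast+

lemma region_image: "(c, k, a) : patches ==> snd c ` region (c, k, a) = cell k a"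
proof (intro set_eqI iffI)
 fix x assume P: "(c, k, a) : patches" and x: "x : cell k a"
 then have "x : im c" using patch_chart(2) cell_subset_closed_cell by blast
 then have "chart_inv c x : region (c, k, a)" "x = snd c (chart_inv c x)"
  using inv_in patch_chart(1)[OF P] x by (auto simp: region_def)
 then show "x : snd c ` region (c, k, a)" by blast
qed (auto simp: region_def)

lemma region_borel: "P : patches ==> region P : sets borel"
proof -
 assume P: "P : patches"
 obtain c k a where [simp]: "P = (c, k, a)" by (cases P)
 have c: "c : A" using patch_chart P by simp
 have "snd c : measurable (restrict_space borel (fst c)) borel"
  using chart_cont(1)[OF c] by (intro borel_measurable_continuous_on_restrict)
 then have "snd c -` cell k a \<inter> space (restrict_space borel (fst c)) : sets (restrict_space borel (fst c))"
  by (rule measurable_sets) simp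
 then show ?thesis using c by (simp add: sets_restrict_space_iff space_restrict_space region_def Collect_conj_eq Int_commute vimage_def)
qed

lemma nn_integral_region:
 assumes P: "(c, k, a) : patches" and h: "h : borel_measurable borel"
 shows "(\<integral>\<^sup>+p\<in>region (c, k, a). h p \<partial>vol) = (lint (cell k a) (%x. ennreal (density_on c x) * h (chart_inv c x)))"
 using nn_integral_vol_chart[OF patch_chart(1)[OF P] region_borel[OF P] _ h] region_image[OF P]
 by (auto simp: region_def)

lemma cell_pullback_measurable:
 fixes h :: "'a => ennreal"
 assumes P: "(c, k, a) : patches" and h: "h : borel_measurable borel"
 shows "(%x. h (chart_inv c x) * indicator (cell k a) x) : borel_measurable (borel :: (real ^ 3) measure)"
  (is "?f : _")
proof -
 have c: "c : A" by (rule patch_chart(1)[OF P])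
 have sub: "cell k a \<subseteq> im c" using patch_chart(2)[OF P] cell_subset_closed_cell by blast
 have "(%x. h (chart_inv c x)) : borel_measurable (restrict_space borel (im c))"
  by (rule measurable_compose[OF chart_inv_measurable[OF c] h])
 then have m: "(%x. h (chart_inv c x) * indicator (im c) x) : borel_measurable borel"
  using c by (subst (asm) borel_measurable_restrict_space_iff_ennreal) auto
 have "(%x. h (chart_inv c x) * indicator (im c) x * indicator (cell k a) x) : borel_measurable borel"
  using m by measurable
 moreover have "(%x. h (chart_inv c x) * indicator (im c) x * indicator (cell k a) x) = ?f"
 proof
  fix x show "h (chart_inv c x) * indicator (im c) x * indicator (cell k a) x = h (chart_inv c x) * indicator (cell k a) x"
   using sub by (cases "x : cell k a") (auto simp: subset_iff)
 qed
 ultimately show ?thesis by simp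
qed

lemma cell_le_region:
 assumes P: "(c, k, a) : patches" and h: "h : borel_measurable borel"
 shows "(lint (cell k a) (%x. h (chart_inv c x))) <= ennreal distortion * (\<integral>\<^sup>+p\<in>region (c, k, a). h p \<partial>vol)"
proof -
 have gp: "good_patch distortion (c, k, a)" by (rule patches_spec(3)[OF P])
 have "(lint (cell k a) (%x. h (chart_inv c x)))
  <= (nn_integral lborel (%x. ennreal distortion * (ennreal (density_on c x) * h (chart_inv c x) * indicator (cell k a) x)))"
 proof (intro nn_integral_mono)
  fix x
  show "h (chart_inv c x) * indicator (cell k a) x <= ennreal distortion * (ennreal (density_on c x) * h (chart_inv c x) * indicator (cell k a) x)"
  proof (cases "x : cell k a")
   case True
   then have "1 / distortion <= density_on c x" using good_patchD(3)[OF gp] cell_subset_closed_cell by blast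
   then have "1 <= distortion * density_on c x" using patches_spec(2) by (simp add: field_simps)
   then have "ennreal 1 <= ennreal distortion * ennreal (density_on c x)"
    using patches_spec(2) by (subst ennreal_mult'[symmetric]) (auto intro: ennreal_leI simp: less_imp_le)
   then have "1 * h (chart_inv c x) <= ennreal distortion * ennreal (density_on c x) * h (chart_inv c x)"
    by (intro mult_right_mono) auto
   then show ?thesis using True by (simp add: mult.assoc)
  qed simp
 qed
 also have "... = ennreal distortion * (lint (cell k a) (%x. ennreal (density_on c x) * h (chart_inv c x)))"
 proof (rule nn_integral_cmult)
  have c: "c : A" by (rule patch_chart(1)[OF P])
  have sub: "cell k a \<subseteq> im c" using patch_chart(2)[OF P] cell_subset_closed_cell by blast
  have "(%x. indicator (cell k a) x *R density_on c x) : borel_measurable borel"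
   by (rule borel_measurable_continuous_on_indicator[OF _ continuous_on_subset[OF density_continuous[OF c] sub]]) simp
  then have "(%x. ennreal (indicator (cell k a) x *R density_on c x) * (h (chart_inv c x) * indicator (cell k a) x)) : borel_measurable lborel"
   using cell_pullback_measurable[OF P h] by simp
  moreover have "(%x. ennreal (indicator (cell k a) x *R density_on c x) * (h (chart_inv c x) * indicator (cell k a) x))
   = (%x. ennreal (density_on c x) * h (chart_inv c x) * indicator (cell k a) x)" by (auto simp: indicator_def)
  ultimately show "(%x. ennreal (density_on c x) * h (chart_inv c x) * indicator (cell k a) x) : borel_measurable lborel" by (simp only:)
 qed
 finally show ?thesis unfolding nn_integral_region[OF P h] .
qed

lemma region_le_cell:
 assumes P: "(c, k, a) : patches" and h: "h : borel_measurable borel"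
 shows "(\<integral>\<^sup>+p\<in>region (c, k, a). h p \<partial>vol) <= ennreal distortion * (lint (cell k a) (%x. h (chart_inv c x)))"
proof -
 have gp: "good_patch distortion (c, k, a)" by (rule patches_spec(3)[OF P])
 have "(lint (cell k a) (%x. ennreal (density_on c x) * h (chart_inv c x)))
  <= (nn_integral lborel (%x. ennreal distortion * (h (chart_inv c x) * indicator (cell k a) x)))"
 proof (intro nn_integral_mono)
  fix x
  show "ennreal (density_on c x) * h (chart_inv c x) * indicator (cell k a) x <= ennreal distortion * (h (chart_inv c x) * indicator (cell k a) x)"
  proof (cases "x : cell k a")
   case True
   then have "density_on c x <= distortion" using good_patchD(4)[OF gp] cell_subset_closed_cell by blast
   then show ?thesis using True by (auto intro!: mult_right_mono ennreal_leI)
  qed simp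
 qed
 also have "... = ennreal distortion * (lint (cell k a) (%x. h (chart_inv c x)))"
  by (rule nn_integral_cmult) (use cell_pullback_measurable[OF P h] in simp)
 finally show ?thesis unfolding nn_integral_region[OF P h] .
qed

lemma nn_integral_le_regions:
 assumes h: "h : borel_measurable borel"
 shows "(nn_integral vol (%p. h p)) <= (\<Sum>P\<in>patches. \<integral>\<^sup>+p\<in>region P. h p \<partial>vol)"
proof -
 have "(nn_integral vol (%p. h p)) <= (nn_integral vol (%p. (\<Sum>P\<in>patches. h p * indicator (region P) p)))"
 proof (intro nn_integral_mono)
  fix p
  obtain P where P: "P : patches" "p : region P" using UNIV_I[of p] unfolding patches_spec(4)[symmetric] by blast
  have "h p * indicator (region P) p <= (\<Sum>P\<in>patches. h p * indicator (region P) p)"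
   by (rule member_le_sum) (use P patches_spec(1) in auto)
  then show "h p <= (\<Sum>P\<in>patches. h p * indicator (region P) p)" using P by simp
 qed
 also have "... = (\<Sum>P\<in>patches. \<integral>\<^sup>+p\<in>region P. h p \<partial>vol)"
 proof (rule nn_integral_sum)
  fix P assume "P : patches"
  then have "region P : sets borel" by (rule region_borel)
  then show "(%p. h p * indicator (region P) p) : borel_measurable vol" using h by measurable
 qed
 finally show ?thesis .
qed

lemma region_le_vol: "(\<integral>\<^sup>+p\<in>region P. h p \<partial>vol) <= (nn_integral vol (%p. h p))"
 by (intro nn_integral_mono) (auto simp: indicator_def)

lemma vol_finite: "finite_measure vol"
proof
 have "emeasure vol (space vol) = (nn_integral vol (%p. 1))" by simp
 also have "... <= (\<Sum>P\<in>patches. \<integral>\<^sup>+p\<in>region P. 1 \<partial>vol)" by (rule nn_integral_le_regions) simp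
 also have "... < top"
 proof (subst ennreal_sum_less_top, rule patches_spec(1), rule ballI)
  fix P assume P: "P : patches"
  obtain c k a where P': "P = (c, k, a)" by (cases P)
  have "(\<integral>\<^sup>+p\<in>region P. 1 \<partial>vol) <= ennreal distortion * (lint (cell k a) (%x. 1))"
   unfolding P' by (rule region_le_cell) (use P P' in auto)
  also have "... < top" by (simp add: ennreal_mult_less_top)
  finally show "(\<integral>\<^sup>+p\<in>region P. 1 \<partial>vol) < top" .
 qed
 finally show "emeasure vol (space vol) \<noteq> \<infinity>" by simp
qed

lemma vol_pos: "measure vol (space vol) > 0"
proof -
 obtain P where P: "P : patches" using patches_spec(4) by blast
 obtain c k a where P': "P = (c, k, a)" by (cases P)
 have "ennreal (1 / 8 ^ k) = (lint (cell k a) (%x. 1))" by simp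
 also have "... <= ennreal distortion * (\<integral>\<^sup>+p\<in>region (c, k, a). 1 \<partial>vol)"
  by (rule cell_le_region) (use P P' in auto)
 also have "... <= ennreal distortion * (nn_integral vol (%p. 1))" by (intro mult_left_mono region_le_vol) auto
 finally have "ennreal (1 / 8 ^ k) <= ennreal distortion * emeasure vol (space vol)" by simp
 then have "emeasure vol (space vol) \<noteq> 0" by (auto simp: le_zero_eq)
 then show ?thesis
  using finite_measure.emeasure_eq_measure[OF vol_finite, of "space vol"] by (simp add: zero_less_measure_iff)
qed

lemma borel_measurable_by_charts:
 fixes h :: "'a => 'b::topological_space"
 assumes "!!c. c : A ==> h : borel_measurable (restrict_space borel (fst c))"
 shows "h : borel_measurable borel"
proof (rule measurable_piecewise_restrict[of "(%P. fst (fst P)) ` patches"])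
 show "countable ((%P. fst (fst P)) ` patches)" using patches_spec(1) by (simp add: countable_finite)
 show "\<Omega> \<inter> space borel : sets borel" "h : borel_measurable (restrict_space borel \<Omega>)" if \<Omega>: "\<Omega> : (%P. fst (fst P)) ` patches" for \<Omega>
 proof -
  obtain c k a where P: "(c, k, a) : patches" "\<Omega> = fst c" using \<Omega> by auto
  note c = patch_chart(1)[OF P(1)]
  show "\<Omega> \<inter> space borel : sets borel" "h : borel_measurable (restrict_space borel \<Omega>)"
   using dom_borel[OF c] assms[OF c] P(2) by simp_all
 qed
 show "space borel \<subseteq> \<Union> ((%P. fst (fst P)) ` patches)"
 proof
  fix p :: 'a
  obtain c k a where "(c, k, a) : patches" "p : region (c, k, a)"
   using UNIV_I[of p] unfolding patches_spec(4)[symmetric] by auto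
  then show "p : \<Union> ((%P. fst (fst P)) ` patches)" by (force simp: region_def)
 qed
qed

lemma vector_field_lincomb:
 assumes "vector_field A X" "vector_field A Y"
 shows "vector_field A (%c p. a *R X c p + b *R Y c p)"
 unfolding vector_field_def
proof (intro ballI)
 fix c d p assume c: "c : A" "d : A" and p: "p : fst c \<inter> fst d"
 show "a *R X d p + b *R Y d p = transition_jacobian c d p *v (a *R X c p + b *R Y c p)"
  unfolding vector_fieldD[OF assms(1) c IntD1[OF p] IntD2[OF p]] vector_fieldD[OF assms(2) c IntD1[OF p] IntD2[OF p]]
  by (simp add: matrix_vector_right_distrib matrix_vector_mult_scaleR)
qed

lemma measurable_vector_field_lincomb:
 assumes "measurable_vector_field A X" "measurable_vector_field A Y"
 shows "measurable_vector_field A (%c p. a *R X c p + b *R Y c p)"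
 using assms vector_field_lincomb[of X Y a b] unfolding measurable_vector_field_def
 by (auto intro!: borel_measurable_add borel_measurable_scaleR)

lemma mvf_vf: "measurable_vector_field A X ==> vector_field A X"
 by (simp add: measurable_vector_field_def)

lemma riem_inner_measurable:
 assumes X: "measurable_vector_field A X" and Y: "measurable_vector_field A Y"
 shows "riem_inner A g X Y : borel_measurable borel"
proof (rule borel_measurable_by_charts)
 fix c assume c: "c : A"
 have gm: "g c : borel_measurable (restrict_space borel (fst c))"
  using metric_continuous[OF c] by (intro borel_measurable_continuous_on_restrict)
 have "(%p. X c p \<bullet> (g c p *v Y c p)) : borel_measurable (restrict_space borel (fst c))"
  using X Y c by (intro borel_measurable_inner borel_measurable_matrix_vector gm) (auto simp: measurable_vector_field_def)
 moreover have "riem_inner A g X Y : borel_measurable (restrict_space borel (fst c)) \<longleftrightarrow>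
   (%p. X c p \<bullet> (g c p *v Y c p)) : borel_measurable (restrict_space borel (fst c))"
  by (rule measurable_cong) (use riem_inner_eq[OF mvf_vf[OF X] mvf_vf[OF Y] c] in \<open>auto simp: space_restrict_space\<close>)
 ultimately show "riem_inner A g X Y : borel_measurable (restrict_space borel (fst c))" by blast
qed

lemma riem_inner_lincomb:
 assumes "vector_field A X" "vector_field A Y" "vector_field A Z"
 shows "riem_inner A g (%c p. a *R X c p + b *R Y c p) Z p = a * riem_inner A g X Z p + b * riem_inner A g Y Z p"
proof -
 obtain c where c: "c : A" "p : fst c" using chart_cover by blast
 show ?thesis
  using assms c by (simp add: riem_inner_eq[OF _ _ c] vector_field_lincomb inner_add_left)
qed

lemma riem_inner_commute:
 assumes "vector_field A X" "vector_field A Y"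
 shows "riem_inner A g X Y p = riem_inner A g Y X p"
proof -
 obtain c where c: "c : A" "p : fst c" using chart_cover by blast
 show ?thesis using assms c by (simp add: riem_inner_eq[OF _ _ c] metric_commute[OF c])
qed

lemma riem_inner_nonneg:
 assumes "vector_field A X"
 shows "0 <= riem_inner A g X X p"
proof -
 obtain c where c: "c : A" "p : fst c" using chart_cover by blast
 show ?thesis using assms c by (simp add: riem_inner_eq[OF _ _ c] metric_nonneg[OF c])
qed

lemma riem_inner_lincomb_sq:
 assumes X: "vector_field A X" and Y: "vector_field A Y"
 shows "riem_inner A g (%c p. a *R X c p + b *R Y c p) (%c p. a *R X c p + b *R Y c p) p
  = a^2 * riem_inner A g X X p + 2 * a * b * riem_inner A g X Y p + b^2 * riem_inner A g Y Y p"
proof -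
 let ?Z = "%c p. a *R X c p + b *R Y c p"
 have Z: "vector_field A ?Z" by (rule vector_field_lincomb[OF X Y])
 have "riem_inner A g ?Z ?Z p = a * riem_inner A g X ?Z p + b * riem_inner A g Y ?Z p"
  by (rule riem_inner_lincomb[OF X Y Z])
 also have "riem_inner A g X ?Z p = a * riem_inner A g X X p + b * riem_inner A g X Y p"
  using riem_inner_commute[OF X Z] riem_inner_lincomb[OF X Y X] riem_inner_commute[OF Y X] by simp
 also have "riem_inner A g Y ?Z p = a * riem_inner A g X Y p + b * riem_inner A g Y Y p"
  using riem_inner_commute[OF Y Z] riem_inner_lincomb[OF X Y Y] by simp
 finally show ?thesis by (simp add: power2_eq_square algebra_simps)
qed

lemma riem_inner_young:
 assumes X: "vector_field A X" and Y: "vector_field A Y"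
 shows "2 * abs (riem_inner A g X Y p) <= riem_inner A g X X p + riem_inner A g Y Y p"
 using riem_inner_nonneg[OF vector_field_lincomb[OF X Y, of 1 1], of p]
  riem_inner_nonneg[OF vector_field_lincomb[OF X Y, of 1 "-1"], of p]
  riem_inner_lincomb_sq[OF X Y, of 1 1 p] riem_inner_lincomb_sq[OF X Y, of 1 "-1" p]
 by (simp add: abs_le_iff)

lemma riem_inner_sum_sq:
 assumes X: "vector_field A X" and Y: "vector_field A Y"
 shows "riem_inner A g (%c p. a *R X c p + b *R Y c p) (%c p. a *R X c p + b *R Y c p) p
  <= 2 * a^2 * riem_inner A g X X p + 2 * b^2 * riem_inner A g Y Y p"
 using riem_inner_nonneg[OF vector_field_lincomb[OF X Y, of a "-b"], of p]
  riem_inner_lincomb_sq[OF X Y, of a b p] riem_inner_lincomb_sq[OF X Y, of a "-b" p]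
 by simp

lemma continuous_by_charts:
 fixes h :: "'a => 'b::topological_space"
 assumes "!!c. c : A ==> continuous_on (fst c) h"
 shows "continuous_on UNIV h"
proof -
 have "continuous_on (\<Union>c\<in>A. fst c) h" by (rule continuous_on_open_UN) (use chart_open assms in auto)
 moreover have "(\<Union>c\<in>A. fst c) = UNIV" using chart_cover by blast
 ultimately show ?thesis by simp
qed

lemma continuous_bounded:
 fixes h :: "'a => real"
 assumes "continuous_on UNIV h"
 shows "EX B. ALL p. abs (h p) <= B"
 using compact_imp_bounded[OF compact_continuous_image[OF assms compact]] unfolding bounded_iff by auto

lemma continuous_integrable:
 fixes h :: "'a => real"
 assumes "continuous_on UNIV h"
 shows "integrable vol h"
proof -
 interpret finite_measure vol by (rule vol_finite)
 obtain B where "!!p. abs (h p) <= B" using continuous_bounded[OF assms] by blast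
 moreover have "h : borel_measurable vol" using borel_measurable_continuous_onI[OF assms] by measurable
 ultimately show ?thesis by (intro integrable_const_bound[of _ B]) auto
qed

lemma smooth_fun_continuous:
 assumes U: "smooth_fun A U"
 shows "continuous_on UNIV U"
proof (rule continuous_by_charts)
 fix c assume c: "c : A"
 have "continuous_on (im c) (U \<circ> chart_inv c)" using U c by (intro smooth_on_continuous) (simp add: smooth_fun_def)
 from continuous_on_compose2[OF this chart_cont(1)[OF c]]
 have "continuous_on (fst c) (%p. (U \<circ> chart_inv c) (snd c p))" by auto
 then show "continuous_on (fst c) U" by (rule continuous_on_eq) (use c in auto)
qed

lemma gradient_continuous:
 assumes U: "smooth_fun A U" and c: "c : A"
 shows "continuous_on (fst c) (gradient g U c)"
proof -
 let ?d = "%p. \<chi> j. frechet_derivative (U \<circ> chart_inv c) (at (snd c p)) (axis j 1)"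
 have cd: "continuous_on (fst c) ?d"
  by (rule continuous_on_compose2[OF smooth_chart_derivative_continuous[OF U c] chart_cont(1)[OF c]]) auto
 have cg: "continuous_on (fst c) (g c)" by (rule metric_continuous[OF c])
 have eq: "gradient g U c p = (\<chi> k. det (\<chi> i j. if j = k then ?d p $ i else g c p $ i $ j) / det (g c p))" if p: "p : fst c" for p
  using cramer[of "g c p" "gradient g U c p" "?d p"] metric_gradient[OF c p] metric_det_pos[OF c p] by auto
 have "continuous_on (fst c) (%p. \<chi> k. det (\<chi> i j. if j = k then ?d p $ i else g c p $ i $ j) / det (g c p))"
 proof (intro continuous_on_vec_lambda continuous_on_divide continuous_on_det)
  fix k i j :: 3
  have "continuous_on (fst c) (%p. if j = k then ?d p $ i else g c p $ i $ j)"
   by (cases "j = k") (auto intro!: continuous_on_component cg cd simp del: vec_lambda_beta)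
  then show "continuous_on (fst c) (%p. (\<chi> i j. if j = k then ?d p $ i else g c p $ i $ j) $ i $ j)" by simp
  show "continuous_on (fst c) (%p. g c p $ i $ j)" by (intro continuous_on_component cg)
 qed (use metric_det_pos[OF c] in force)
 then show ?thesis by (rule continuous_on_eq) (use eq in auto)
qed

lemma gradient_mvf: "smooth_fun A U ==> measurable_vector_field A (gradient g U)"
 unfolding measurable_vector_field_def
 using gradient_vector_field gradient_continuous borel_measurable_continuous_on_restrict by blast

lemma gradient_energy_continuous:
 assumes U: "smooth_fun A U"
 shows "continuous_on UNIV (riem_inner A g (gradient g U) (gradient g U))"
proof (rule continuous_by_charts)
 fix c assume c: "c : A"
 have "continuous_on (fst c) (%p. gradient g U c p \<bullet> (g c p *v gradient g U c p))"
  by (intro continuous_on_inner continuous_on_matrix_vector gradient_continuous U c metric_continuous)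
 then show "continuous_on (fst c) (riem_inner A g (gradient g U) (gradient g U))"
  by (rule continuous_on_eq) (use riem_inner_eq[OF gradient_vector_field[OF U] gradient_vector_field[OF U] c] in auto)
qed

end

section \<open>Weak gradients\<close>

context riemannian3 begin

abbreviation energy_density :: "(('a, 3) chart => 'a => real ^ 3) => 'a => real" where
 "energy_density X \<equiv> riem_inner A g X X"

abbreviation lincomb :: "real => (('a, 3) chart => 'a => real ^ 3) => real => (('a, 3) chart => 'a => real ^ 3) =>
  ('a, 3) chart => 'a => real ^ 3" where
 "lincomb a X b Y \<equiv> (%c p. a *R X c p + b *R Y c p)"

abbreviation weak_grad where "weak_grad \<equiv> has_weak_gradient A g"

lemma riem_inner_cong:
 assumes "!!c. c : A ==> p : fst c ==> X c p = X' c p" "!!c. c : A ==> p : fst c ==> Y c p = Y' c p"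
 shows "riem_inner A g X Y p = riem_inner A g X' Y' p"
proof -
 define d where "d = (SOME d. d : A & p : fst d)"
 have "EX d. d : A & p : fst d" using chart_cover by blast
 from someI_ex[OF this] have d: "d : A" "p : fst d" unfolding d_def by auto
 show ?thesis unfolding riem_inner_def d_def[symmetric] Let_def assms(1)[OF d] assms(2)[OF d] ..
qed

lemma energy_lincomb_integrable:
 assumes X: "measurable_vector_field A X" "integrable vol (energy_density X)"
  and Y: "measurable_vector_field A Y" "integrable vol (energy_density Y)"
 shows "integrable vol (energy_density (lincomb a X b Y))"
  and "(LINT p|vol. energy_density (lincomb a X b Y) p)
   <= 2 * a^2 * (LINT p|vol. energy_density X p) + 2 * b^2 * (LINT p|vol. energy_density Y p)"
  and "integrable vol (riem_inner A g X Y)"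
proof -
 note v = mvf_vf[OF X(1)] mvf_vf[OF Y(1)]
 have i: "integrable vol (%p. 2 * a^2 * energy_density X p + 2 * b^2 * energy_density Y p)"
  using X(2) Y(2) by auto
 have m: "energy_density (lincomb a X b Y) : borel_measurable vol"
  using riem_inner_measurable[OF measurable_vector_field_lincomb[OF X(1) Y(1)] measurable_vector_field_lincomb[OF X(1) Y(1)]]
  by (simp cong: measurable_cong_sets)
 show "integrable vol (energy_density (lincomb a X b Y))"
  by (rule Bochner_Integration.integrable_bound[OF i m])
    (use riem_inner_sum_sq[OF v, of a b] riem_inner_nonneg[OF vector_field_lincomb[OF v]] in \<open>auto intro!: AE_I2 intro: order_trans[OF _ abs_ge_self]\<close>)
 then show "(LINT p|vol. energy_density (lincomb a X b Y) p)
   <= 2 * a^2 * (LINT p|vol. energy_density X p) + 2 * b^2 * (LINT p|vol. energy_density Y p)"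
  using integral_mono[OF _ i riem_inner_sum_sq[OF v, of a b]] X(2) Y(2) by simp
 have i2: "integrable vol (%p. energy_density X p + energy_density Y p)" using X(2) Y(2) by auto
 have m2: "riem_inner A g X Y : borel_measurable vol"
  using riem_inner_measurable[OF X(1) Y(1)] by (simp cong: measurable_cong_sets)
 show "integrable vol (riem_inner A g X Y)"
 proof (rule Bochner_Integration.integrable_bound[OF i2 m2], rule AE_I2)
  fix p
  show "norm (riem_inner A g X Y p) <= norm (energy_density X p + energy_density Y p)"
   using riem_inner_young[OF v, of p] by simp
 qed
qed

lemma square_lincomb_integrable:
 fixes u v :: "'a => real"
 assumes u: "u : borel_measurable borel" "integrable vol (%p. (u p)^2)"
  and v: "v : borel_measurable borel" "integrable vol (%p. (v p)^2)"
 shows "integrable vol (%p. (a * u p + b * v p)^2)"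
  and "(LINT p|vol. (a * u p + b * v p)^2) <= 2 * a^2 * (LINT p|vol. (u p)^2) + 2 * b^2 * (LINT p|vol. (v p)^2)"
  and "integrable vol (%p. u p * v p)"
proof -
 have i: "integrable vol (%p. 2 * a^2 * (u p)^2 + 2 * b^2 * (v p)^2)" using u(2) v(2) by auto
 have m: "(%p. (a * u p + b * v p)^2) : borel_measurable vol" using u(1) v(1) by measurable
 have le: "(a * u p + b * v p)^2 <= 2 * a^2 * (u p)^2 + 2 * b^2 * (v p)^2" for p
  using sum_squares_bound[of "a * u p" "b * v p"] by (simp add: power2_sum power_mult_distrib)
 show "integrable vol (%p. (a * u p + b * v p)^2)"
  by (rule Bochner_Integration.integrable_bound[OF i m]) (use le in \<open>auto intro!: AE_I2 intro: order_trans[OF _ abs_ge_self]\<close>)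
 then show "(LINT p|vol. (a * u p + b * v p)^2) <= 2 * a^2 * (LINT p|vol. (u p)^2) + 2 * b^2 * (LINT p|vol. (v p)^2)"
  using integral_mono[OF _ i le] u(2) v(2) by simp
 have i2: "integrable vol (%p. (u p)^2 + (v p)^2)" using u(2) v(2) by auto
 have m2: "(%p. u p * v p) : borel_measurable vol" using u(1) v(1) by measurable
 show "integrable vol (%p. u p * v p)"
 proof (rule Bochner_Integration.integrable_bound[OF i2 m2], rule AE_I2)
  fix p
  have "2 * abs (u p * v p) <= (u p)^2 + (v p)^2"
   using sum_squares_bound[of "abs (u p)" "abs (v p)"] by (simp add: abs_mult)
  then show "norm (u p * v p) <= norm ((u p)^2 + (v p)^2)" by simp
 qed
qed

lemma smooth_borel: "smooth_fun A U ==> U : borel_measurable borel"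
 using smooth_fun_continuous by (intro borel_measurable_continuous_onI)

lemma smooth_integrable:
 assumes U: "smooth_fun A U"
 shows "integrable vol (%p. (U p)^2)" "integrable vol (energy_density (gradient g U))"
 using smooth_fun_continuous[OF U] gradient_energy_continuous[OF U]
 by (auto intro!: continuous_integrable continuous_intros)

definition sobolev_sq :: "('a => real) => (('a, 3) chart => 'a => real ^ 3) => real" where
 "sobolev_sq u X = (LINT p|vol. (u p)^2) + (LINT p|vol. energy_density X p)"

abbreviation sdist where "sdist u X v Y \<equiv> sobolev_sq (%p. 1 * u p + -1 * v p) (lincomb 1 X (-1) Y)"

definition pre_sobolev :: "('a => real) => (('a, 3) chart => 'a => real ^ 3) => bool" where
 "pre_sobolev u X \<longleftrightarrow> u : borel_measurable borel & integrable vol (%p. (u p)^2) &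
   measurable_vector_field A X & integrable vol (energy_density X)"

lemma sobolev_sq_parts_nonneg:
 assumes "pre_sobolev u X"
 shows "0 <= (LINT p|vol. (u p)^2)" "0 <= (LINT p|vol. energy_density X p)"
 using assms riem_inner_nonneg mvf_vf unfolding pre_sobolev_def
 by (auto intro!: integral_nonneg_AE AE_I2)

lemma sobolev_sq_nonneg: "pre_sobolev u X ==> 0 <= sobolev_sq u X"
 using sobolev_sq_parts_nonneg[of u X] by (simp add: sobolev_sq_def)

lemma pre_sobolev_lincomb:
 assumes "pre_sobolev u X" "pre_sobolev v Y"
 shows "pre_sobolev (%p. a * u p + b * v p) (lincomb a X b Y)"
  and "sobolev_sq (%p. a * u p + b * v p) (lincomb a X b Y) <= 2 * a^2 * sobolev_sq u X + 2 * b^2 * sobolev_sq v Y"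
proof -
 note a = assms[unfolded pre_sobolev_def]
 show "pre_sobolev (%p. a * u p + b * v p) (lincomb a X b Y)"
  unfolding pre_sobolev_def
  using a square_lincomb_integrable(1)[of u v a b] energy_lincomb_integrable(1)[of X Y a b] measurable_vector_field_lincomb[of X Y a b]
  by auto
 show "sobolev_sq (%p. a * u p + b * v p) (lincomb a X b Y) <= 2 * a^2 * sobolev_sq u X + 2 * b^2 * sobolev_sq v Y"
  unfolding sobolev_sq_def
  using a square_lincomb_integrable(2)[of u v a b] energy_lincomb_integrable(2)[of X Y a b]
  by (simp add: algebra_simps)
qed

lemma pre_sobolev_smooth: "smooth_fun A U ==> pre_sobolev U (gradient g U)"
 unfolding pre_sobolev_def using smooth_borel smooth_integrable gradient_mvf by auto

text \<open>
  The two limits of the definition are equivalent to one limit for the Sobolev distance.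
\<close>

lemma weak_grad_iff:
 "weak_grad u X \<longleftrightarrow> pre_sobolev u X &
  (EX U. (ALL n. smooth_fun A (U n)) & (%n::nat. sdist (U n) (gradient g (U n)) u X) ----> 0)"
proof -
 have "((%n::nat. LINT p|vol. (U n p - u p)^2) ----> 0 &
    (%n. LINT p|vol. (let D = (%c p. gradient g (U n) c p - X c p) in riem_inner A g D D p)) ----> 0)
   \<longleftrightarrow> (%n::nat. sdist (U n) (gradient g (U n)) u X) ----> 0"
  (is "?a ----> 0 & ?b ----> 0 \<longleftrightarrow> ?s ----> 0")
  if U: "ALL n. smooth_fun A (U n)" and pre: "pre_sobolev u X" for U
 proof -
  have s: "?s n = ?a n + ?b n" for n by (simp add: sobolev_sq_def Let_def)
  have nn: "0 <= ?a n" "0 <= ?b n" for n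
   using sobolev_sq_parts_nonneg[OF pre_sobolev_lincomb(1)[OF pre_sobolev_smooth[OF U[rule_format, of n]] pre, of 1 "-1"]]
   by (simp_all add: Let_def)
  show ?thesis
  proof
   assume "?a ----> 0 & ?b ----> 0"
   then have "(%n. ?a n + ?b n) ----> 0 + 0" by (intro tendsto_add) auto
   then show "?s ----> 0" unfolding s by simp
  next
   assume lim: "?s ----> 0"
   have "?a ----> 0"
    by (rule tendsto_sandwich[OF _ _ tendsto_const lim]) (use s nn in \<open>auto intro!: always_eventually\<close>)
   moreover have "?b ----> 0"
    by (rule tendsto_sandwich[OF _ _ tendsto_const lim]) (use s nn in \<open>auto intro!: always_eventually\<close>)
   ultimately show "?a ----> 0 & ?b ----> 0" by blast
  qed
 qed
 then have "(EX U. (ALL n. smooth_fun A (U n)) & (%n::nat. LINT p|vol. (U n p - u p)^2) ----> 0 &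
    (%n. LINT p|vol. (let D = (%c p. gradient g (U n) c p - X c p) in riem_inner A g D D p)) ----> 0)
   \<longleftrightarrow> (EX U. (ALL n. smooth_fun A (U n)) & (%n::nat. sdist (U n) (gradient g (U n)) u X) ----> 0)"
  if "pre_sobolev u X" using that by meson
 then show ?thesis unfolding has_weak_gradient_def pre_sobolev_def by (intro iffI) (elim conjE, simp)+
qed

lemma weak_gradE:
 assumes "weak_grad u X"
 obtains U where "!!n. smooth_fun A (U n)"
  "(%n::nat. sdist (U n) (gradient g (U n)) u X) ----> 0"
 using assms unfolding weak_grad_iff by blast

lemma weak_grad_pre: "weak_grad u X ==> pre_sobolev u X"
 by (simp add: weak_grad_iff)

lemma energy_density_cong:
 assumes "!!c. c : A ==> p : fst c ==> X c p = Y c p"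
 shows "energy_density X p = energy_density Y p"
 by (rule riem_inner_cong) (use assms in auto)

lemma weak_grad_lincomb:
 assumes "weak_grad u X" "weak_grad v Y"
 shows "weak_grad (%p. a * u p + b * v p) (lincomb a X b Y)"
proof -
 obtain U where U: "!!n. smooth_fun A (U n)"
  "(%n::nat. sdist (U n) (gradient g (U n)) u X) ----> 0"
  using weak_gradE[OF assms(1)] by blast
 obtain V where V: "!!n. smooth_fun A (V n)"
  "(%n::nat. sdist (V n) (gradient g (V n)) v Y) ----> 0"
  using weak_gradE[OF assms(2)] by blast
 note pre = weak_grad_pre[OF assms(1)] weak_grad_pre[OF assms(2)]
 define W where "W n = (%p. a * U n p + b * V n p)" for n
 have W: "smooth_fun A (W n)" for n unfolding W_def by (rule smooth_fun_lincomb[OF U(1) V(1)])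
 let ?w = "%p. a * u p + b * v p" and ?Z = "lincomb a X b Y"
 let ?s = "%n. sdist (W n) (gradient g (W n)) ?w ?Z"
 let ?su = "%n. sdist (U n) (gradient g (U n)) u X"
 let ?sv = "%n. sdist (V n) (gradient g (V n)) v Y"
 have preW: "pre_sobolev ?w ?Z" by (rule pre_sobolev_lincomb(1)[OF pre])
 have le: "?s n <= 2 * a^2 * ?su n + 2 * b^2 * ?sv n" for n
 proof -
  have "?s n = sobolev_sq (%p. a * (1 * U n p + -1 * u p) + b * (1 * V n p + -1 * v p))
    (lincomb a (lincomb 1 (gradient g (U n)) (-1) X) b (lincomb 1 (gradient g (V n)) (-1) Y))"
  proof -
   have e1: "1 * W n p + -1 * ?w p = a * (1 * U n p + -1 * u p) + b * (1 * V n p + -1 * v p)" for p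
    by (simp add: W_def algebra_simps)
   have "energy_density (lincomb 1 (gradient g (W n)) (-1) ?Z) p
    = energy_density (lincomb a (lincomb 1 (gradient g (U n)) (-1) X) b (lincomb 1 (gradient g (V n)) (-1) Y)) p" for p
    unfolding W_def
    by (rule energy_density_cong) (simp add: gradient_lincomb[OF U(1) V(1)] algebra_simps)
   then have e2: "energy_density (lincomb 1 (gradient g (W n)) (-1) ?Z)
    = energy_density (lincomb a (lincomb 1 (gradient g (U n)) (-1) X) b (lincomb 1 (gradient g (V n)) (-1) Y))" by (rule ext)
   show ?thesis unfolding sobolev_sq_def e1 e2 ..
  qed
  also have "... <= 2 * a^2 * ?su n + 2 * b^2 * ?sv n"
   by (intro pre_sobolev_lincomb pre_sobolev_smooth U V pre)
  finally show ?thesis .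
 qed
 have "(%n. 2 * a^2 * ?su n + 2 * b^2 * ?sv n) ----> 2 * a^2 * 0 + 2 * b^2 * 0"
  by (intro tendsto_intros U V)
 then have lim: "(%n. 2 * a^2 * ?su n + 2 * b^2 * ?sv n) ----> 0" by simp
 have "?s ----> 0"
 proof (rule tendsto_sandwich[OF _ _ tendsto_const lim])
  show "\<forall>\<^sub>F n in sequentially. 0 <= ?s n"
   by (intro always_eventually allI sobolev_sq_nonneg pre_sobolev_lincomb(1) pre_sobolev_smooth W preW)
  show "\<forall>\<^sub>F n in sequentially. ?s n <= 2 * a^2 * ?su n + 2 * b^2 * ?sv n"
   by (intro always_eventually allI le)
 qed
 then show ?thesis unfolding weak_grad_iff using preW W by blast
qed

lemma weak_grad_smooth:
 assumes U: "smooth_fun A U"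
 shows "weak_grad U (gradient g U)"
proof -
 have "sdist U (gradient g U) U (gradient g U) = 0"
  by (simp add: sobolev_sq_def riem_inner_def)
 then show ?thesis unfolding weak_grad_iff using pre_sobolev_smooth[OF U] U by (intro conjI exI[of _ "%_. U"]) auto
qed

lemma nn_integral_square:
 assumes "pre_sobolev u X"
 shows "(nn_integral vol (%p. ennreal ((u p)^2))) = ennreal (LINT p|vol. (u p)^2)"
  and "(nn_integral vol (%p. ennreal (energy_density X p))) = ennreal (LINT p|vol. energy_density X p)"
 using assms riem_inner_nonneg mvf_vf unfolding pre_sobolev_def
 by (auto intro!: nn_integral_eq_integral AE_I2)

abbreviation chart_grad :: "('a => real) => ('a, 3) chart => real ^ 3 => real ^ 3" where
 "chart_grad U c x \<equiv> \<chi> j. frechet_derivative (U \<circ> chart_inv c) (at x) (axis j 1)"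

lemma smooth_cell_function:
 assumes U: "smooth_fun A U" and P: "(c, k, a) : patches"
 shows "cell_function k a (U \<circ> chart_inv c) (chart_grad U c)"
proof
 note c = patch_chart[OF P]
 show "((U \<circ> chart_inv c) has_derivative (%h. chart_grad U c x \<bullet> h)) (at x)" if "x : closed_cell k a" for x
  by (rule smooth_chart_derivative[OF U c(1)]) (use that c(2) in blast)
 show "continuous_on (closed_cell k a) (chart_grad U c)"
  by (rule continuous_on_subset[OF smooth_chart_derivative_continuous[OF U c(1)] c(2)])
qed

lemma chart_grad_eq:
 assumes "(c, k, a) : patches" "x : closed_cell k a"
 shows "chart_grad U c x = g c (chart_inv c x) *v gradient g U c (chart_inv c x)"
proof -
 note c = patch_chart[OF assms(1)]
 have x: "x : im c" using assms(2) c(2) by blast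
 show ?thesis using metric_gradient[OF c(1) inv_in[OF c(1) x], of U] coords_inv[OF c(1) x] by simp
qed

text \<open>
  The coordinate partial derivatives of a function are the components of its gradient lowered by the
  metric, so bounds for coordinate gradients come from the upper bound for the metric.
\<close>

lemma lowered_field_le:
 assumes P: "(c, k, a) : patches" and x: "x : closed_cell k a" and X: "vector_field A X"
 shows "(norm (g c (chart_inv c x) *v X c (chart_inv c x)))^2 <= distortion^2 * energy_density X (chart_inv c x)"
proof -
 note c = patch_chart[OF P]
 note gp = good_patchD[OF patches_spec(3)[OF P]]
 have "chart_inv c x : fst c" using inv_in[OF c(1)] x c(2) by blast
 then have e: "energy_density X (chart_inv c x) = X c (chart_inv c x) \<bullet> (g c (chart_inv c x) *v X c (chart_inv c x))"
  by (rule riem_inner_eq[OF X X c(1)])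
 have "(norm (g c (chart_inv c x) *v X c (chart_inv c x)))^2 <= distortion * (norm (X c (chart_inv c x)))^2" by (rule gp(6)[OF x])
 also have "... <= distortion * (distortion * energy_density X (chart_inv c x))"
  unfolding e by (intro mult_left_mono gp(5)[OF x]) (use patches_spec(2) in simp)
 finally show ?thesis by (simp add: power2_eq_square mult.assoc)
qed

lemma cell_le_vol:
 assumes P: "(c, k, a) : patches" and h: "h : borel_measurable borel" "!!p. 0 <= h p" "integrable vol h" and \<kappa>: "0 <= \<kappa>"
  and le: "!!x. x : cell k a ==> q x <= \<kappa> * h (chart_inv c x)"
 shows "(lint (cell k a) (%x. ennreal (q x))) <= ennreal (\<kappa> * distortion * (LINT p|vol. h p))"
proof -
 have "(lint (cell k a) (%x. ennreal (q x))) <= (lint (cell k a) (%x. ennreal (\<kappa> * h (chart_inv c x))))"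
  using le by (intro nn_integral_mono) (auto simp: indicator_def intro!: ennreal_leI)
 also have "... <= ennreal distortion * (\<integral>\<^sup>+p\<in>region (c, k, a). ennreal (\<kappa> * h p) \<partial>vol)"
  by (rule cell_le_region[OF P]) (use h in measurable)
 also have "... <= ennreal distortion * (nn_integral vol (%p. ennreal (\<kappa> * h p)))"
  by (intro mult_left_mono region_le_vol) auto
 also have "(nn_integral vol (%p. ennreal (\<kappa> * h p))) = ennreal (\<kappa> * (LINT p|vol. h p))"
  using h \<kappa> by (subst nn_integral_eq_integral) auto
 also have "ennreal distortion * ... = ennreal (\<kappa> * distortion * (LINT p|vol. h p))"
  using patches_spec(2) \<kappa> h(2) by (subst ennreal_mult[symmetric]) (auto simp: mult_ac intro!: mult_nonneg_nonneg)
 finally show ?thesis .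
qed

lemma pre_sobolev_borel:
 assumes "pre_sobolev u X"
 shows "(%p. (u p)^2) : borel_measurable borel" "energy_density X : borel_measurable borel"
  "!!p. 0 <= energy_density X p" "integrable vol (%p. (u p)^2)" "integrable vol (energy_density X)" "vector_field A X"
 using assms unfolding pre_sobolev_def
 by (auto intro: riem_inner_measurable riem_inner_nonneg mvf_vf)

lemma cell_square_le:
 assumes P: "(c, k, a) : patches" and u: "pre_sobolev u X"
 shows "(lint (cell k a) (%x. ennreal ((u (chart_inv c x))^2))) <= ennreal (distortion * (LINT p|vol. (u p)^2))"
 using cell_le_vol[OF P pre_sobolev_borel(1)[OF u] _ pre_sobolev_borel(4)[OF u], of 1 "%x. (u (chart_inv c x))^2"] by simp

lemma cell_field_le:
 assumes P: "(c, k, a) : patches" and u: "pre_sobolev u X"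
 shows "(lint (cell k a) (%x. ennreal ((norm (g c (chart_inv c x) *v X c (chart_inv c x)))^2)))
  <= ennreal (distortion ^ 3 * (LINT p|vol. energy_density X p))"
proof -
 have "(lint (cell k a) (%x. ennreal ((norm (g c (chart_inv c x) *v X c (chart_inv c x)))^2)))
  <= ennreal (distortion^2 * distortion * (LINT p|vol. energy_density X p))"
  by (rule cell_le_vol[OF P pre_sobolev_borel(2,3,5)[OF u]])
    (use lowered_field_le[OF P _ pre_sobolev_borel(6)[OF u]] cell_subset_closed_cell in auto)
 then show ?thesis by (simp add: power2_eq_square power3_eq_cube)
qed

text \<open>
  Since cells are half-open, each of their points can be moved a little in every coordinate direction.
  Thus the sets of \<open>cell_closability\<close> exhaust the cell.
\<close>

lemma cell_shrunk_union:
 assumes x: "x : cell k a"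
 shows "EX m. x + (1 / 2 ^ m) *R axis i 1 : cell k a"
proof -
 have lt: "x $ i < cell_low k a $ i + 1 / 2 ^ k" using x by (simp add: in_cell_iff)
 define d where "d = cell_low k a $ i + 1 / 2 ^ k - x $ i"
 have "d > 0" using lt by (simp add: d_def)
 obtain m :: nat where "1 / d < 2 ^ m" using real_arch_pow[of 2 "1 / d"] by auto
 then have m: "1 / 2 ^ m < d" using \<open>d > 0\<close> by (simp add: field_simps)
 have "x + (1 / 2 ^ m) *R axis i 1 : cell k a"
  unfolding in_cell_iff
 proof (intro allI)
  fix j
  show "cell_low k a $ j <= (x + (1 / 2 ^ m) *R axis i 1) $ j & (x + (1 / 2 ^ m) *R axis i 1) $ j < cell_low k a $ j + 1 / 2 ^ k"
  proof (cases "j = i")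
   case True
   then show ?thesis using x m by (auto simp: in_cell_iff d_def intro: add_increasing2)
  next
   case False
   then show ?thesis using x by (simp add: in_cell_iff axis_def)
  qed
 qed
 then show ?thesis by blast
qed

text \<open>
  In a patch the approximating functions tend to 0 in \<open>L\<^sup>2\<close> and their coordinate gradients converge
  to the lowered field \<open>\<zeta>\<close>. By \<open>cell_closability\<close> the limit \<open>\<zeta>\<close> vanishes almost everywhere, and so does \<open>Z\<close>.
\<close>

lemma weak_gradient_zero:
 assumes w: "weak_grad w Z" and w0: "AE p in vol. w p = 0"
 shows "AE p in vol. energy_density Z p = 0"
proof -
 obtain W where W: "!!n. smooth_fun A (W n)"
  "(%n::nat. sdist (W n) (gradient g (W n)) w Z) ----> 0"
  using weak_gradE[OF w] by blast
 note pw = weak_grad_pre[OF w]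
 let ?s = "%n. sdist (W n) (gradient g (W n)) w Z"
 have preW: "pre_sobolev (W n) (gradient g (W n))" for n by (rule pre_sobolev_smooth[OF W(1)])
 have preD: "pre_sobolev (%p. 1 * W n p + -1 * w p) (lincomb 1 (gradient g (W n)) (-1) Z)" for n
  by (rule pre_sobolev_lincomb(1)[OF preW pw])
 have W2: "(LINT p|vol. (W n p)^2) <= ?s n" for n
 proof -
  have "(LINT p|vol. (W n p)^2) = (LINT p|vol. (1 * W n p + -1 * w p)^2)"
  proof (rule integral_cong_AE)
   show "(%p. (W n p)^2) : borel_measurable vol" "(%p. (1 * W n p + -1 * w p)^2) : borel_measurable vol"
    using pre_sobolev_borel(1)[OF preW[of n]] pre_sobolev_borel(1)[OF preD[of n]] by measurable
   show "AE p in vol. (W n p)^2 = (1 * W n p + -1 * w p)^2" using w0 by eventually_elim simp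
  qed
  then show ?thesis using sobolev_sq_parts_nonneg[OF preD[of n]] by (simp add: sobolev_sq_def)
 qed
 have G2: "(LINT p|vol. energy_density (lincomb 1 (gradient g (W n)) (-1) Z) p) <= ?s n" for n
  using sobolev_sq_parts_nonneg[OF preD[of n]] by (simp add: sobolev_sq_def)
 have patch: "(\<integral>\<^sup>+p\<in>region (c, k, a). ennreal (energy_density Z p) \<partial>vol) = 0" if P: "(c, k, a) : patches" for c k a
 proof -
  note c = patch_chart[OF P]
  let ?V = "%n. W n \<circ> chart_inv c" and ?D = "%n. chart_grad (W n) c"
  define \<zeta> where "\<zeta> x = g c (chart_inv c x) *v Z c (chart_inv c x)" for x
  have cf: "cell_function k a (?V n) (?D n)" for n by (rule smooth_cell_function[OF W(1) P])
  have L2: "(%n. \<integral>\<^sup>+x\<in>cell k a. ennreal ((?V n x)^2) \<partial>lborel) ----> 0"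
  proof (rule tendsto_sandwich[OF _ _ tendsto_const])
   have "(%n. ennreal (distortion * ?s n)) ----> ennreal (distortion * 0)"
    by (intro tendsto_ennrealI tendsto_intros W(2))
   then show "(%n. ennreal (distortion * ?s n)) ----> 0" by simp
   have "(lint (cell k a) (%x. ennreal ((?V n x)^2))) <= ennreal (distortion * ?s n)" for n
   proof -
    have "(lint (cell k a) (%x. ennreal ((?V n x)^2))) <= ennreal (distortion * (LINT p|vol. (W n p)^2))"
     using cell_square_le[OF P preW[of n]] by (simp add: o_def)
    also have "... <= ennreal (distortion * ?s n)"
     using W2[of n] patches_spec(2) by (intro ennreal_leI mult_left_mono) auto
    finally show ?thesis .
   qed
   then show "\<forall>\<^sub>F n in sequentially. (lint (cell k a) (%x. ennreal ((?V n x)^2))) <= ennreal (distortion * ?s n)" by simp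
  qed simp
  have near: "(lint (cell k a) (%x. ennreal ((norm (?D n x - \<zeta> x))^2))) <= ennreal (distortion ^ 3 * ?s n)" for n
  proof -
   have "(lint (cell k a) (%x. ennreal ((norm (?D n x - \<zeta> x))^2)))
    = (lint (cell k a) (%x. ennreal ((norm (g c (chart_inv c x) *v lincomb 1 (gradient g (W n)) (-1) Z c (chart_inv c x)))^2)))"
   proof (intro nn_integral_cong)
    fix x
    show "ennreal ((norm (?D n x - \<zeta> x))^2) * indicator (cell k a) x =
     ennreal ((norm (g c (chart_inv c x) *v lincomb 1 (gradient g (W n)) (-1) Z c (chart_inv c x)))^2) * indicator (cell k a) x"
    proof (cases "x : cell k a")
     case True
     then have "x : closed_cell k a" using cell_subset_closed_cell by blast
     then have "?D n x = g c (chart_inv c x) *v gradient g (W n) c (chart_inv c x)" by (rule chart_grad_eq[OF P])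
     then show ?thesis by (simp add: \<zeta>_def matrix_vector_mult_diff_distrib)
    qed simp
   qed
   also have "... <= ennreal (distortion ^ 3 * (LINT p|vol. energy_density (lincomb 1 (gradient g (W n)) (-1) Z) p))"
    by (rule cell_field_le[OF P preD])
   also have "... <= ennreal (distortion ^ 3 * ?s n)"
    using G2[of n] patches_spec(2) by (intro ennreal_leI mult_left_mono) auto
   finally show ?thesis .
  qed
  define \<zeta>' where "\<zeta>' p = indicator (fst c) p *R (g c p *v Z c p)" for p
  have \<zeta>'b: "\<zeta>' : borel_measurable borel"
  proof -
   have "(%p. g c p *v Z c p) : borel_measurable (restrict_space borel (fst c))"
   proof (rule borel_measurable_matrix_vector)
    show "g c : borel_measurable (restrict_space borel (fst c))"
     by (rule borel_measurable_continuous_on_restrict[OF metric_continuous[OF c(1)]])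
    show "Z c : borel_measurable (restrict_space borel (fst c))"
     using pw c(1) unfolding pre_sobolev_def measurable_vector_field_def by blast
   qed
   then show ?thesis unfolding \<zeta>'_def using c(1) by (simp add: borel_measurable_restrict_space_iff)
  qed
  have \<zeta>\<zeta>': "\<zeta>' (chart_inv c x) = \<zeta> x" if "x : cell k a" for x
   using that cell_subset_closed_cell c inv_in[OF c(1), of x] by (auto simp: \<zeta>_def \<zeta>'_def subset_iff)
  have Dm: "(%x. indicator (cell k a) x *R ?D n x) : borel_measurable borel" for n
   using cell_function.D_meas[OF cf] by simp
  have \<zeta>m: "(%x. indicator (cell k a) x *R \<zeta> x) : borel_measurable borel"
  proof -
   have sub: "cell k a \<subseteq> im c" using c(2) cell_subset_closed_cell by blast
   have "(%x. \<zeta>' (chart_inv c x)) : borel_measurable (restrict_space borel (im c))"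
    by (rule measurable_compose[OF chart_inv_measurable[OF c(1)] \<zeta>'b])
   then have [measurable]: "(%x. indicator (im c) x *R \<zeta>' (chart_inv c x)) : borel_measurable borel"
    using c(1) by (simp add: borel_measurable_restrict_space_iff)
   have "(%x. indicator (cell k a) x *R (indicator (im c) x *R \<zeta>' (chart_inv c x))) : borel_measurable borel" by measurable
   moreover have "(%x. indicator (cell k a) x *R (indicator (im c) x *R \<zeta>' (chart_inv c x))) = (%x. indicator (cell k a) x *R \<zeta> x)"
   proof
    fix x show "indicator (cell k a) x *R (indicator (im c) x *R \<zeta>' (chart_inv c x)) = indicator (cell k a) x *R \<zeta> x"
     using sub \<zeta>\<zeta>'[of x] by (cases "x : cell k a") (auto simp: subset_iff)
   qed
   ultimately show ?thesis by (simp only:)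
  qed
  have nm: "(%x. ennreal ((norm (?D n x - \<zeta> x))^2) * indicator (cell k a) x) : borel_measurable lborel" for n
  proof -
   have [measurable]: "(%x. indicator (cell k a) x *R ?D n x) : borel_measurable borel" "(%x. indicator (cell k a) x *R \<zeta> x) : borel_measurable borel"
    by (rule Dm \<zeta>m)+
   have "(%x. ennreal ((norm (indicator (cell k a) x *R ?D n x - indicator (cell k a) x *R \<zeta> x))^2)) : borel_measurable lborel" by measurable
   moreover have "(%x. ennreal ((norm (indicator (cell k a) x *R ?D n x - indicator (cell k a) x *R \<zeta> x))^2))
    = (%x. ennreal ((norm (?D n x - \<zeta> x))^2) * indicator (cell k a) x)" by (auto simp: indicator_def)
   ultimately show ?thesis by (simp only:)
  qed
  have split: "ennreal ((norm (v - w))^2) <= 2 * ennreal ((norm (v - z))^2) + 2 * ennreal ((norm (w - z))^2)" for v w z :: "real ^ 3"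
  proof -
   have "norm (v - w) <= norm (v - z) + norm (w - z)"
    using norm_triangle_ineq4[of "v - z" "w - z"] by simp
   then have "(norm (v - w))^2 <= (norm (v - z) + norm (w - z))^2" by (intro power_mono) auto
   also have "... <= 2 * (norm (v - z))^2 + 2 * (norm (w - z))^2"
    using sum_squares_bound[of "norm (v - z)" "norm (w - z)"] by (simp add: power2_sum)
   finally have "ennreal ((norm (v - w))^2) <= ennreal (2 * (norm (v - z))^2 + 2 * (norm (w - z))^2)" by (rule ennreal_leI)
   also have "... = 2 * ennreal ((norm (v - z))^2) + 2 * ennreal ((norm (w - z))^2)" by (simp add: ennreal_mult)
   finally show ?thesis .
  qed
  have cau: "EX N. ALL m>=N. ALL n>=N. (lint (cell k a) (%x. ennreal ((norm (?D n x - ?D m x))^2))) <= ennreal eps" if eps: "eps > 0" for eps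
  proof -
   have "(%n. distortion ^ 3 * ?s n) ----> distortion ^ 3 * 0" by (intro tendsto_intros W(2))
   from order_tendstoD(2)[OF this, of "eps / 4"] obtain N where N: "!!n. n >= N ==> distortion ^ 3 * ?s n < eps / 4"
    using eps by (auto simp: eventually_sequentially)
   have "(lint (cell k a) (%x. ennreal ((norm (?D n x - ?D m x))^2))) <= ennreal eps" if "m >= N" "n >= N" for m n
   proof -
    have "(lint (cell k a) (%x. ennreal ((norm (?D n x - ?D m x))^2)))
     <= (nn_integral lborel (%x. 2 * (ennreal ((norm (?D n x - \<zeta> x))^2) * indicator (cell k a) x) + 2 * (ennreal ((norm (?D m x - \<zeta> x))^2) * indicator (cell k a) x)))"
    proof (intro nn_integral_mono)
     fix x
     show "ennreal ((norm (?D n x - ?D m x))^2) * indicator (cell k a) x <= 2 * (ennreal ((norm (?D n x - \<zeta> x))^2) * indicator (cell k a) x) + 2 * (ennreal ((norm (?D m x - \<zeta> x))^2) * indicator (cell k a) x)"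
      using split[of "?D n x" "?D m x" "\<zeta> x"] by (cases "x : cell k a") simp_all
    qed
    also have "... = 2 * (lint (cell k a) (%x. ennreal ((norm (?D n x - \<zeta> x))^2))) + 2 * (lint (cell k a) (%x. ennreal ((norm (?D m x - \<zeta> x))^2)))"
    proof -
     have nm2: "(%x. 2 * (ennreal ((norm (?D n x - \<zeta> x))^2) * indicator (cell k a) x)) : borel_measurable lborel" for n
      by (intro borel_measurable_times_ennreal borel_measurable_const nm)
     show ?thesis unfolding nn_integral_add[OF nm2 nm2] nn_integral_cmult[OF nm] ..
    qed
    also have "... <= 2 * ennreal (eps / 4) + 2 * ennreal (eps / 4)"
     by (intro add_mono mult_left_mono order_trans[OF near] ennreal_leI less_imp_le[OF N] that) auto
    also have "... = ennreal eps"
    proof -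
     have "2 * ennreal (eps / 4) = ennreal (eps / 2)" using eps ennreal_mult[of 2 "eps / 4"] by simp
     then show ?thesis using eps by (simp flip: ennreal_plus)
    qed
    finally show ?thesis .
   qed
   then show ?thesis by blast
  qed
  let ?R = "%m i. {x : cell k a. x + (1 / 2 ^ m) *R axis i 1 : cell k a}"
  have clo: "(%n. \<integral>\<^sup>+x\<in>?R m i. ennreal ((?D n x $ i)^2) \<partial>lborel) ----> 0" for m i
   by (rule cell_closability[OF cf L2 cau])
  have Rb: "?R m i : sets borel" for m i
  proof -
   have "?R m i = cell k a \<inter> ((%x. x + (1 / 2 ^ m) *R axis i 1) -` cell k a \<inter> space borel)" by auto
   also have "... : sets borel" by (intro sets.Int measurable_sets[of _ borel borel]) auto
   finally show ?thesis .
  qed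
  have zero: "(lint (?R m i) (%x. ennreal ((\<zeta> x $ i)^2))) = 0" for m i
  proof -
   have le: "(lint (?R m i) (%x. ennreal ((\<zeta> x $ i)^2)))
    <= 2 * (lint (?R m i) (%x. ennreal ((?D n x $ i)^2))) + 2 * ennreal (distortion ^ 3 * ?s n)" for n
   proof -
    have Dim: "(%x. ennreal ((?D n x $ i)^2) * indicator (?R m i) x) : borel_measurable lborel"
    proof -
     have nth: "(%x :: real ^ 3. x $ i) : borel_measurable borel" by (intro borel_measurable_continuous_onI continuous_intros)
     have [measurable]: "(%x. (indicator (cell k a) x *R ?D n x) $ i) : borel_measurable borel"
      by (rule measurable_compose[OF Dm nth])
     have [measurable]: "?R m i : sets borel" by (rule Rb)
     have "(%x. ennreal (((indicator (cell k a) x *R ?D n x) $ i)^2) * indicator (?R m i) x) : borel_measurable lborel" by measurable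
     moreover have "(%x. ennreal (((indicator (cell k a) x *R ?D n x) $ i)^2) * indicator (?R m i) x) = (%x. ennreal ((?D n x $ i)^2) * indicator (?R m i) x)"
      by (auto simp: indicator_def)
     ultimately show ?thesis by (simp only:)
    qed
    have "(lint (?R m i) (%x. ennreal ((\<zeta> x $ i)^2)))
     <= (nn_integral lborel (%x. 2 * (ennreal ((?D n x $ i)^2) * indicator (?R m i) x) + 2 * (ennreal ((norm (?D n x - \<zeta> x))^2) * indicator (cell k a) x)))"
    proof (intro nn_integral_mono)
     fix x
     show "ennreal ((\<zeta> x $ i)^2) * indicator (?R m i) x
      <= 2 * (ennreal ((?D n x $ i)^2) * indicator (?R m i) x) + 2 * (ennreal ((norm (?D n x - \<zeta> x))^2) * indicator (cell k a) x)"
     proof (cases "x : ?R m i")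
      case True
      have "(\<zeta> x $ i)^2 <= 2 * (?D n x $ i)^2 + 2 * (?D n x $ i - \<zeta> x $ i)^2"
       using sum_squares_bound[of "?D n x $ i" "\<zeta> x $ i - ?D n x $ i"]
       by (simp add: power2_eq_square algebra_simps del: vec_lambda_beta)
      moreover have "(?D n x $ i - \<zeta> x $ i)^2 <= (norm (?D n x - \<zeta> x))^2"
      proof -
       have "abs ((?D n x - \<zeta> x) $ i)^2 <= (norm (?D n x - \<zeta> x))^2" by (intro power_mono component_le_norm_cart) auto
       then show ?thesis by (simp del: vec_lambda_beta)
      qed
      ultimately have "(\<zeta> x $ i)^2 <= 2 * (?D n x $ i)^2 + 2 * (norm (?D n x - \<zeta> x))^2" by linarith
      then have "ennreal ((\<zeta> x $ i)^2) <= ennreal (2 * (?D n x $ i)^2 + 2 * (norm (?D n x - \<zeta> x))^2)" by (rule ennreal_leI)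
      also have "... = 2 * ennreal ((?D n x $ i)^2) + 2 * ennreal ((norm (?D n x - \<zeta> x))^2)"
       by (simp add: ennreal_mult del: vec_lambda_beta)
      finally show ?thesis using True by (simp del: vec_lambda_beta)
     qed simp
    qed
    also have "... = 2 * (lint (?R m i) (%x. ennreal ((?D n x $ i)^2))) + 2 * (lint (cell k a) (%x. ennreal ((norm (?D n x - \<zeta> x))^2)))"
    proof -
     have nm2: "(%x. 2 * (ennreal ((norm (?D n x - \<zeta> x))^2) * indicator (cell k a) x)) : borel_measurable lborel"
      "(%x. 2 * (ennreal ((?D n x $ i)^2) * indicator (?R m i) x)) : borel_measurable lborel"
      by (intro borel_measurable_times_ennreal borel_measurable_const nm Dim)+
     show ?thesis unfolding nn_integral_add[OF nm2(2,1)] nn_integral_cmult[OF nm] nn_integral_cmult[OF Dim] ..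
    qed
    also have "... <= 2 * (lint (?R m i) (%x. ennreal ((?D n x $ i)^2))) + 2 * ennreal (distortion ^ 3 * ?s n)"
     by (intro add_left_mono mult_left_mono near) auto
    finally show ?thesis .
   qed
   have "(%n. ennreal (distortion ^ 3 * ?s n)) ----> ennreal (distortion ^ 3 * 0)"
    by (intro tendsto_ennrealI tendsto_intros W(2))
   then have l2: "(%n. 2 * ennreal (distortion ^ 3 * ?s n)) ----> 2 * 0" by (intro ennreal_tendsto_cmult) auto
   have l1: "(%n. 2 * (lint (?R m i) (%x. ennreal ((?D n x $ i)^2)))) ----> 2 * 0"
    by (intro ennreal_tendsto_cmult clo) simp
   have "(lint (?R m i) (%x. ennreal ((\<zeta> x $ i)^2))) <= 2 * 0 + 2 * 0"
    by (rule tendsto_lowerbound[OF tendsto_add[OF l1 l2]]) (use le in auto)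
   then show ?thesis by simp
  qed
  have "AE x in lborel. x : ?R m i --> \<zeta> x $ i = 0" for m i
  proof -
   have nth: "(%x :: real ^ 3. x $ i) : borel_measurable borel" by (intro borel_measurable_continuous_onI continuous_intros)
   have [measurable]: "(%x. (indicator (cell k a) x *R \<zeta> x) $ i) : borel_measurable borel"
    by (rule measurable_compose[OF \<zeta>m nth])
   have [measurable]: "?R m i : sets borel" by (rule Rb)
   have "(%x. ennreal (((indicator (cell k a) x *R \<zeta> x) $ i)^2) * indicator (?R m i) x) : borel_measurable lborel" by measurable
   moreover have "(%x. ennreal (((indicator (cell k a) x *R \<zeta> x) $ i)^2) * indicator (?R m i) x) = (%x. ennreal ((\<zeta> x $ i)^2) * indicator (?R m i) x)"
    by (auto simp: indicator_def)
   ultimately have "(%x. ennreal ((\<zeta> x $ i)^2) * indicator (?R m i) x) : borel_measurable lborel" by (simp only:)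
   then have "AE x in lborel. ennreal ((\<zeta> x $ i)^2) * indicator (?R m i) x = 0"
    using zero[of i m] nn_integral_0_iff_AE by blast
   then show ?thesis by eventually_elim (auto simp: indicator_def)
  qed
  then have "AE x in lborel. ALL m. ALL i:UNIV. x : ?R m i --> \<zeta> x $ i = 0"
   by (subst AE_all_countable, intro allI) (subst AE_ball_countable, auto)
  then have ae: "AE x in lborel. x : cell k a --> \<zeta> x = 0"
  proof eventually_elim
   case (elim x)
   show ?case
   proof
    assume x: "x : cell k a"
    have "\<zeta> x $ i = 0" for i
    proof -
     obtain m where "x + (1 / 2 ^ m) *R axis i 1 : cell k a" using cell_shrunk_union[OF x] by blast
     then show ?thesis using elim x by blast
    qed
    then show "\<zeta> x = 0" by (simp add: vec_eq_iff)
   qed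
  qed
  have ae2: "AE x in lborel. ennreal (energy_density Z (chart_inv c x)) * indicator (cell k a) x = 0"
   using ae
  proof eventually_elim
   case (elim x)
   show ?case
   proof (cases "x : cell k a")
    case True
    have "chart_inv c x : fst c" using True c(2) cell_subset_closed_cell[of k a] inv_in[OF c(1)] by blast
    then have "energy_density Z (chart_inv c x) = Z c (chart_inv c x) \<bullet> \<zeta> x"
     unfolding \<zeta>_def by (rule riem_inner_eq[OF pre_sobolev_borel(6)[OF pw] pre_sobolev_borel(6)[OF pw] c(1)])
    then show ?thesis using elim True by simp
   qed simp
  qed
  have "(\<integral>\<^sup>+p\<in>region (c, k, a). ennreal (energy_density Z p) \<partial>vol) <= ennreal distortion * (lint (cell k a) (%x. ennreal (energy_density Z (chart_inv c x))))"
   by (rule region_le_cell[OF P]) (use pre_sobolev_borel(2)[OF pw] in measurable)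
  also have "(lint (cell k a) (%x. ennreal (energy_density Z (chart_inv c x)))) = (\<integral>\<^sup>+(x :: real ^ 3). 0 \<partial>lborel)"
   by (rule nn_integral_cong_AE[OF ae2])
  finally show ?thesis by simp
 qed
 have mZ: "(%p. ennreal (energy_density Z p)) : borel_measurable borel" using pre_sobolev_borel(2)[OF pw] by measurable
 have "(nn_integral vol (%p. ennreal (energy_density Z p))) <= (\<Sum>P\<in>patches. \<integral>\<^sup>+p\<in>region P. ennreal (energy_density Z p) \<partial>vol)"
  by (rule nn_integral_le_regions[OF mZ])
 also have "... = 0"
 proof (rule sum.neutral, rule ballI)
  fix P assume "P : patches"
  then show "(\<integral>\<^sup>+p\<in>region P. ennreal (energy_density Z p) \<partial>vol) = 0" using patch by (cases P) blast
 qed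
 finally have "(nn_integral vol (%p. ennreal (energy_density Z p))) = 0" by simp
 then have "AE p in vol. ennreal (energy_density Z p) = 0"
  using mZ by (subst (asm) nn_integral_0_iff_AE) (auto cong: measurable_cong_sets)
 then show ?thesis
 proof eventually_elim
  case (elim p)
  then show ?case using pre_sobolev_borel(3)[OF pw, of p] by (simp add: ennreal_eq_0_iff)
 qed
qed

lemma weak_gradient_unique:
 assumes "weak_grad u X" "weak_grad v Y" "AE p in vol. u p = v p"
 shows "AE p in vol. energy_density (lincomb 1 X (-1) Y) p = 0"
proof (rule weak_gradient_zero)
 show "weak_grad (%p. 1 * u p + -1 * v p) (lincomb 1 X (-1) Y)" by (rule weak_grad_lincomb[OF assms(1,2)])
 show "AE p in vol. 1 * u p + -1 * v p = 0" using assms(3) by eventually_elim simp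
qed

end

section \<open>Compact Sobolev embedding\<close>

text \<open>
  Later \<open>J\<close> indexes the cell averages over all patches, levels and cells.
\<close>

lemma bounded_diagonal_subsequence:
 fixes \<phi> :: "nat => 'i => real"
 assumes J: "countable J" and bd: "!!j. j : J ==> EX B. ALL n. abs (\<phi> n j) <= B"
 shows "EX s. strict_mono (s :: nat => nat) & (ALL j:J. convergent (%n. \<phi> (s n) j))"
proof (cases "J = {}")
 case True
 then show ?thesis by (intro exI[of _ "%n. n"]) (simp add: strict_mono_def)
next
 case False
 define j where "j k = from_nat_into J k" for k
 have jJ: "j k : J" for k unfolding j_def by (rule from_nat_into[OF False])
 define P where "P k s \<longleftrightarrow> convergent (%n. \<phi> (s n) (j k))" for k and s :: "nat => nat"
 interpret subseqs P
 proof
  fix k and s :: "nat => nat" assume "strict_mono s"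
  obtain B where B: "!!n. abs (\<phi> n (j k)) <= B" using bd[OF jJ] by blast
  have "ALL n. \<phi> (s n) (j k) : {-B..B}" using B by (auto simp: abs_le_iff minus_le_iff)
  then obtain l r where "strict_mono r" "((%n. \<phi> (s n) (j k)) \<circ> r) ----> l"
   using compact_Icc[of "-B" B] unfolding compact_def by meson
  then show "EX r'. strict_mono r' & P k (s \<circ> r')"
   unfolding P_def convergent_def o_def by blast
 qed
 have stable: "P n (s \<circ> r)" if "strict_mono r" "P n s" for r s n
  using that convergent_subseq_convergent[of "%i. \<phi> (s i) (j n)" r] by (simp add: P_def o_def)
 have "convergent (%n. \<phi> (diagseq n) (j k))" for k
 proof -
  have "P k (diagseq \<circ> ((+) (Suc k)))" by (rule diagseq_holds[OF stable])
  then have "convergent (%n. \<phi> (diagseq (n + Suc k)) (j k))" by (simp add: P_def o_def add.commute)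
  then show ?thesis unfolding convergent_def using LIMSEQ_offset[of "%n. \<phi> (diagseq n) (j k)" "Suc k"] by blast
 qed
 moreover have "EX k. i = j k" if "i : J" for i
  using from_nat_into_surj[OF J that] unfolding j_def by metis
 ultimately show ?thesis using subseq_diagseq by (intro exI[of _ diagseq]) metis
qed

context riemannian3 begin

lemma cell_norms_le:
 assumes U: "smooth_fun A U" and B: "sobolev_sq U (gradient g U) <= B" and P: "(c, k, a) : patches"
 shows "(lint (cell k a) (%x. ennreal (((U \<circ> chart_inv c) x)^2))) <= ennreal ((distortion + distortion ^ 3) * B)"
  and "(lint (cell k a) (%x. ennreal ((norm (chart_grad U c x))^2))) <= ennreal ((distortion + distortion ^ 3) * B)"
  and "0 <= B"
proof -
 note pre = pre_sobolev_smooth[OF U]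
 note nn = sobolev_sq_parts_nonneg[OF pre]
 have d: "0 <= distortion" "0 <= distortion ^ 3" using patches_spec(2) by auto
 show B0: "0 <= B" using nn B unfolding sobolev_sq_def by linarith
 have le: "(LINT p|vol. (U p)^2) <= B" "(LINT p|vol. energy_density (gradient g U) p) <= B"
  using nn B unfolding sobolev_sq_def by linarith+
 have "(lint (cell k a) (%x. ennreal (((U \<circ> chart_inv c) x)^2))) <= ennreal (distortion * (LINT p|vol. (U p)^2))"
  using cell_square_le[OF P pre] by (simp add: o_def)
 also have "... <= ennreal ((distortion + distortion ^ 3) * B)"
  using d le nn B0 by (intro ennreal_leI mult_mono) auto
 finally show "(lint (cell k a) (%x. ennreal (((U \<circ> chart_inv c) x)^2))) <= ennreal ((distortion + distortion ^ 3) * B)" .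
 have "(lint (cell k a) (%x. ennreal ((norm (chart_grad U c x))^2)))
  = (lint (cell k a) (%x. ennreal ((norm (g c (chart_inv c x) *v gradient g U c (chart_inv c x)))^2)))"
 proof (intro nn_integral_cong)
  fix x
  show "ennreal ((norm (chart_grad U c x))^2) * indicator (cell k a) x
   = ennreal ((norm (g c (chart_inv c x) *v gradient g U c (chart_inv c x)))^2) * indicator (cell k a) x"
  proof (cases "x : cell k a")
   case True
   then have "x : closed_cell k a" using cell_subset_closed_cell by blast
   from chart_grad_eq[OF P this, of U] show ?thesis by (simp only:)
  qed simp
 qed
 also have "... <= ennreal (distortion ^ 3 * (LINT p|vol. energy_density (gradient g U) p))"
  by (rule cell_field_le[OF P pre])
 also have "... <= ennreal ((distortion + distortion ^ 3) * B)"
  using d le nn B0 by (intro ennreal_leI mult_mono) auto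
 finally show "(lint (cell k a) (%x. ennreal ((norm (chart_grad U c x))^2))) <= ennreal ((distortion + distortion ^ 3) * B)" .
qed

text \<open>
  The estimates of \<open>cell_embedding\<close> for the finitely many patches are added.
\<close>

lemma smooth_embedding:
 assumes r: "2 < r" "r < 6"
 shows "EX C>=0. ALL U B. smooth_fun A U --> sobolev_sq U (gradient g U) <= B -->
  (nn_integral vol (%p. ennreal (abs (U p) powr r))) <= ennreal (C * B powr (r / 2))"
proof -
 define good where "good k a C \<longleftrightarrow> 0 <= C & (ALL V D B. cell_function k a V D --> 0 <= B -->
   (lint (cell k a) (%x. ennreal ((V x)^2))) <= ennreal B -->
   (lint (cell k a) (%x. ennreal ((norm (D x))^2))) <= ennreal B -->
   (lint (cell k a) (%x. ennreal (abs (V x) powr r))) <= ennreal (C * B powr (r / 2)))" for k a C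
 have "EX C. good k a C" for k a using cell_embedding[OF r, of k a] unfolding good_def by blast
 then obtain C where "!!k a. good k a (C k a)" by metis
 then have C: "0 <= C k a" "cell_function k a V D ==> 0 <= B ==> (lint (cell k a) (%x. ennreal ((V x)^2))) <= ennreal B ==>
   (lint (cell k a) (%x. ennreal ((norm (D x))^2))) <= ennreal B ==>
   (lint (cell k a) (%x. ennreal (abs (V x) powr r))) <= ennreal (C k a * B powr (r / 2))" for k a V D B
  unfolding good_def by blast+
 define K where "K = distortion + distortion ^ 3"
 have K0: "0 <= K" using patches_spec(2) by (simp add: K_def)
 define C' where "C' = (\<Sum>P\<in>patches. distortion * (C (fst (snd P)) (snd (snd P)) * K powr (r / 2)))"
 have "(nn_integral vol (%p. ennreal (abs (U p) powr r))) <= ennreal (C' * B powr (r / 2))"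
  if U: "smooth_fun A U" and B: "sobolev_sq U (gradient g U) <= B" for U B
 proof -
  have m: "(%p. ennreal (abs (U p) powr r)) : borel_measurable borel" using smooth_borel[OF U] by measurable
  have "(nn_integral vol (%p. ennreal (abs (U p) powr r))) <= (\<Sum>P\<in>patches. \<integral>\<^sup>+p\<in>region P. ennreal (abs (U p) powr r) \<partial>vol)"
   by (rule nn_integral_le_regions[OF m])
  also have "... <= (\<Sum>P\<in>patches. ennreal (distortion * (C (fst (snd P)) (snd (snd P)) * K powr (r / 2)) * B powr (r / 2)))"
  proof (rule sum_mono)
   fix P assume P: "P : patches"
   obtain c k a where [simp]: "P = (c, k, a)" by (cases P)
   have P': "(c, k, a) : patches" using P by simp
   note n = cell_norms_le[OF U B P', folded K_def]
   have "(\<integral>\<^sup>+p\<in>region P. ennreal (abs (U p) powr r) \<partial>vol) <= ennreal distortion * (lint (cell k a) (%x. ennreal (abs ((U \<circ> chart_inv c) x) powr r)))"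
    using region_le_cell[OF P' m] by (simp add: o_def)
   also have "... <= ennreal distortion * ennreal (C k a * (K * B) powr (r / 2))"
    unfolding \<open>P = (c, k, a)\<close> using K0 n
    by (intro mult_left_mono C(2)[OF smooth_cell_function[OF U P']]) auto
   also have "... = ennreal (distortion * (C (fst (snd P)) (snd (snd P)) * K powr (r / 2)) * B powr (r / 2))"
    using patches_spec(2) K0 n(3) by (subst ennreal_mult'[symmetric]) (auto simp: powr_mult mult_ac)
   finally show "(\<integral>\<^sup>+p\<in>region P. ennreal (abs (U p) powr r) \<partial>vol) <= ennreal (distortion * (C (fst (snd P)) (snd (snd P)) * K powr (r / 2)) * B powr (r / 2))" .
  qed
  also have "... = ennreal (C' * B powr (r / 2))"
   unfolding C'_def sum_distrib_right using patches_spec(2) C(1) by (intro sum_ennreal) auto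
  finally show ?thesis .
 qed
 moreover have "0 <= C'" unfolding C'_def using patches_spec(2) C(1) by (intro sum_nonneg) auto
 ultimately show ?thesis by blast
qed

text \<open>
  A diagonal subsequence makes all cell averages in all patches converge; then \<open>cell_compactness\<close>
  applies in each of the finitely many patches.
\<close>

lemma smooth_compactness:
 assumes r: "2 < r" "r < 6" and U: "!!n::nat. smooth_fun A (U n)" and B: "!!n. sobolev_sq (U n) (gradient g (U n)) <= B"
 shows "EX s. strict_mono (s :: nat => nat) &
  (ALL eps>0. EX N. ALL i>=N. ALL j>=N. (nn_integral vol (%p. ennreal (abs (U (s i) p - U (s j) p) powr r))) <= ennreal eps)"
proof -
 define K where "K = (distortion + distortion ^ 3) * B"
 have n: "(lint (cell k a) (%x. ennreal (((U n \<circ> chart_inv c) x)^2))) <= ennreal K"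
  "(lint (cell k a) (%x. ennreal ((norm (chart_grad (U n) c x))^2))) <= ennreal K" "0 <= B"
  if "(c, k, a) : patches" for c k a n
  using cell_norms_le[OF U[of n] B[of n] that] by (auto simp: K_def)
 define J where "J = (SIGMA P:patches. SIGMA m:{fst (snd P)..}. cell m ` cell (fst (snd P)) (snd (snd P)))"
 define \<phi> where "\<phi> n j = (case j of (P, m, Q) => 8 ^ m * (LINT y:Q|lborel. U n (chart_inv (fst P) y)))" for n and j :: "'a patch \<times> nat \<times> (real ^ 3) set"
 have \<phi>: "\<phi> n ((c, k, a), m, cell m x) = cell_avg m (U n \<circ> chart_inv c) x" for n c k a m x
  by (simp add: \<phi>_def cell_avg_def o_def)
 have "countable J" unfolding J_def
  using patches_spec(1) finite_cells by (intro countable_SIGMA) (auto simp: countable_finite)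
 moreover have "EX B. ALL n. abs (\<phi> n j) <= B" if j: "j : J" for j
 proof -
  obtain c k a m Q where jj: "j = ((c, k, a), m, Q)" by (metis surj_pair)
  then obtain x where P: "(c, k, a) : patches" and m: "k <= m" and x: "x : cell k a" "Q = cell m x"
   using j by (auto simp: J_def)
  have "abs (\<phi> n j) <= sqrt (8 ^ m * K)" for n
  proof -
   interpret cell_function k a "U n \<circ> chart_inv c" "chart_grad (U n) c" by (rule smooth_cell_function[OF U P])
   have "ennreal ((cell_avg m (U n \<circ> chart_inv c) x)^2) <= ennreal (8 ^ m) * (lint (cell k a) (%y. ennreal (((U n \<circ> chart_inv c) y)^2)))"
    by (rule cell_avg_sq_le[OF m x(1)])
   also have "... <= ennreal (8 ^ m) * ennreal K" by (intro mult_left_mono n(1)[OF P]) auto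
   also have "... = ennreal (8 ^ m * K)" using n(3)[OF P] patches_spec(2) by (intro ennreal_mult[symmetric]) (auto simp: K_def)
   finally have "(cell_avg m (U n \<circ> chart_inv c) x)^2 <= 8 ^ m * K"
    using n(3)[OF P] patches_spec(2) by (simp add: K_def)
   then have "abs (cell_avg m (U n \<circ> chart_inv c) x) <= sqrt (8 ^ m * K)" by (rule real_le_rsqrt[of "abs _", simplified])
   then show ?thesis unfolding jj x(2) \<phi> .
  qed
  then show ?thesis by blast
 qed
 ultimately obtain s where s: "strict_mono s" "!!j. j : J ==> convergent (%n. \<phi> (s n) j)"
  using bounded_diagonal_subsequence[of J \<phi>] by blast
 have "EX N. ALL i>=N. ALL j>=N. (nn_integral vol (%p. ennreal (abs (U (s i) p - U (s j) p) powr r))) <= ennreal eps" if eps: "eps > 0" for eps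
 proof -
  define eps' where "eps' = eps / (distortion * (1 + card patches))"
  have eps': "eps' > 0" using eps patches_spec(2) by (simp add: eps'_def)
  define small where "small P N \<longleftrightarrow> (ALL i>=N. ALL j>=N. (\<integral>\<^sup>+p\<in>region P. ennreal (abs (U (s i) p - U (s j) p) powr r) \<partial>vol)
    <= ennreal (distortion * eps'))" for P and N :: nat
  have "EX N. small P N" if P: "P : patches" for P
  proof -
   obtain c k a where Pe: "P = (c, k, a)" by (cases P)
   have P': "(c, k, a) : patches" using P Pe by simp
   have K0: "0 <= K" using n(3)[OF P'] patches_spec(2) by (simp add: K_def)
   have conv: "convergent (%n. cell_avg m (U (s n) \<circ> chart_inv c) x)" if "k <= m" "x : cell k a" for m x
    using s(2)[of "((c, k, a), m, cell m x)"] that P' unfolding \<phi> by (auto simp: J_def)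
   obtain N where N: "!!i j. i >= N ==> j >= N ==>
    (lint (cell k a) (%x. ennreal (abs ((U (s i) \<circ> chart_inv c) x - (U (s j) \<circ> chart_inv c) x) powr r))) <= ennreal eps'"
    using cell_compactness[OF r smooth_cell_function[OF U P'] n(2)[OF P'] K0 conv eps'] by blast
   have "(\<integral>\<^sup>+p\<in>region P. ennreal (abs (U (s i) p - U (s j) p) powr r) \<partial>vol) <= ennreal (distortion * eps')"
    if ij: "i >= N" "j >= N" for i j
   proof -
    have m: "(%p. ennreal (abs (U (s i) p - U (s j) p) powr r)) : borel_measurable borel"
     using smooth_borel[OF U] by measurable
    have "(\<integral>\<^sup>+p\<in>region P. ennreal (abs (U (s i) p - U (s j) p) powr r) \<partial>vol)
     <= ennreal distortion * (lint (cell k a) (%x. ennreal (abs ((U (s i) \<circ> chart_inv c) x - (U (s j) \<circ> chart_inv c) x) powr r)))"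
     using region_le_cell[OF P' m] by (simp add: o_def Pe)
    also have "... <= ennreal distortion * ennreal eps'" by (intro mult_left_mono N ij) auto
    also have "... = ennreal (distortion * eps')" using patches_spec(2) eps' by (intro ennreal_mult[symmetric]) auto
    finally show ?thesis .
   qed
   then have "small P N" unfolding small_def by blast
   then show ?thesis by blast
  qed
  then obtain N where "!!P. P : patches ==> small P (N P)" by metis
  then have N: "!!P i j. P : patches ==> i >= N P ==> j >= N P ==>
    (\<integral>\<^sup>+p\<in>region P. ennreal (abs (U (s i) p - U (s j) p) powr r) \<partial>vol) <= ennreal (distortion * eps')"
   unfolding small_def by blast
  define M where "M = Max (insert 0 (N ` patches))"
  have NM: "N P <= M" if "P : patches" for P unfolding M_def using that patches_spec(1) by (intro Max_ge) auto
  have "(nn_integral vol (%p. ennreal (abs (U (s i) p - U (s j) p) powr r))) <= ennreal eps" if ij: "i >= M" "j >= M" for i j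
  proof -
   have m: "(%p. ennreal (abs (U (s i) p - U (s j) p) powr r)) : borel_measurable borel"
    using smooth_borel[OF U] by measurable
   have "(nn_integral vol (%p. ennreal (abs (U (s i) p - U (s j) p) powr r)))
    <= (\<Sum>P\<in>patches. \<integral>\<^sup>+p\<in>region P. ennreal (abs (U (s i) p - U (s j) p) powr r) \<partial>vol)"
    by (rule nn_integral_le_regions[OF m])
   also have "... <= (\<Sum>P\<in>patches. ennreal (distortion * eps'))"
    using N NM ij order_trans by (intro sum_mono) blast
   also have "... = ennreal (card patches * (distortion * eps'))"
    using patches_spec(2) eps' by (simp add: ennreal_mult ennreal_of_nat_eq_real_of_nat)
   also have "... <= ennreal eps"
   proof (rule ennreal_leI)
    have "card patches * (distortion * eps') = eps * (card patches / (1 + card patches))"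
     using patches_spec(2) by (simp add: eps'_def)
    also have "... <= eps * 1" using eps by (intro mult_left_mono) (auto simp: divide_le_eq)
    finally show "card patches * (distortion * eps') <= eps" by simp
   qed
   finally show ?thesis .
  qed
  then show ?thesis by blast
 qed
 then show ?thesis using s(1) by blast
qed

lemma sobolev_sq_triangle:
 assumes U: "smooth_fun A U" and u: "pre_sobolev u X"
 shows "sobolev_sq U (gradient g U) <= 2 * sdist U (gradient g U) u X + 2 * sobolev_sq u X"
proof -
 have "sobolev_sq (%p. 1 * (1 * U p + -1 * u p) + 1 * u p) (lincomb 1 (lincomb 1 (gradient g U) (-1) X) 1 X)
  <= 2 * 1^2 * sdist U (gradient g U) u X + 2 * 1^2 * sobolev_sq u X"
  by (intro pre_sobolev_lincomb pre_sobolev_smooth U u)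
 then show ?thesis by simp
qed

text \<open>
  An element of \<open>H1\<close> is the almost everywhere limit of smooth functions along a subsequence, and the
  bound for smooth functions survives by Fatou's lemma.
\<close>

lemma sobolev_embedding:
 assumes r: "2 < r" "r < 6"
 shows "EX C>=0. ALL u X. weak_grad u X --> integrable vol (%p. abs (u p) powr r) &
  (LINT p|vol. abs (u p) powr r) <= C * sobolev_sq u X powr (r / 2)"
proof -
 obtain C where C: "0 <= C" "!!U B. smooth_fun A U ==> sobolev_sq U (gradient g U) <= B ==>
  (nn_integral vol (%p. ennreal (abs (U p) powr r))) <= ennreal (C * B powr (r / 2))"
  using smooth_embedding[OF r] by blast
 have "integrable vol (%p. abs (u p) powr r) & (LINT p|vol. abs (u p) powr r) <= (C * 2 powr (r / 2)) * sobolev_sq u X powr (r / 2)"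
  if u: "weak_grad u X" for u X
 proof -
  note pu = weak_grad_pre[OF u]
  obtain U where U: "!!n. smooth_fun A (U n)"
   "(%n::nat. sdist (U n) (gradient g (U n)) u X) ----> 0"
   using weak_gradE[OF u] by blast
  let ?s = "%n. sdist (U n) (gradient g (U n)) u X"
  have preD: "pre_sobolev (%p. 1 * U n p + -1 * u p) (lincomb 1 (gradient g (U n)) (-1) X)" for n
   by (rule pre_sobolev_lincomb(1)[OF pre_sobolev_smooth[OF U(1)] pu])
  have "(%n. \<integral>p. norm ((1 * U n p + -1 * u p)^2) \<partial>vol) ----> 0"
   by (rule tendsto_sandwich[OF _ _ tendsto_const U(2)])
     (use sobolev_sq_parts_nonneg[OF preD] in \<open>auto simp: sobolev_sq_def intro!: always_eventually\<close>)
  from tendsto_L1_AE_subseq[OF pre_sobolev_borel(4)[OF preD] this]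
  obtain s where s: "strict_mono s" "AE p in vol. (%n. (1 * U (s n) p + -1 * u p)^2) ----> 0" by blast
  have ae: "AE p in vol. (%n. ennreal (abs (U (s n) p) powr r)) ----> ennreal (abs (u p) powr r)"
   using s(2)
  proof eventually_elim
   case (elim p)
   then have "(%n. sqrt ((1 * U (s n) p + -1 * u p)^2)) ----> sqrt 0" by (rule tendsto_real_sqrt)
   then have "(%n. U (s n) p - u p) ----> 0" by (simp add: tendsto_rabs_zero_iff)
   then have "(%n. U (s n) p) ----> u p" by (simp add: LIM_zero_iff)
   then show ?case using r by (intro tendsto_ennrealI tendsto_powr' tendsto_intros) auto
  qed
  define b where "b n = C * (2 * ?s (s n) + 2 * sobolev_sq u X) powr (r / 2)" for n
  have s0: "0 <= ?s n" for n by (rule sobolev_sq_nonneg[OF preD])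
  have u0: "0 <= sobolev_sq u X" by (rule sobolev_sq_nonneg[OF pu])
  have "(%n. ?s (s n)) ----> 0" using LIMSEQ_subseq_LIMSEQ[OF U(2) s(1)] by (simp add: o_def)
  then have "b ----> C * (2 * 0 + 2 * sobolev_sq u X) powr (r / 2)"
   unfolding b_def using r s0 u0 by (intro tendsto_intros tendsto_powr') auto
  then have blim: "(%n. ennreal (b n)) ----> ennreal (C * (2 * sobolev_sq u X) powr (r / 2))"
   by (intro tendsto_ennrealI) simp
  have m: "(%p. ennreal (abs (U n p) powr r)) : borel_measurable vol" for n using smooth_borel[OF U(1)] by measurable
  have "(nn_integral vol (%p. ennreal (abs (u p) powr r))) = (nn_integral vol (%p. liminf (%n. ennreal (abs (U (s n) p) powr r))))"
  proof (rule nn_integral_cong_AE)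
   show "AE p in vol. ennreal (abs (u p) powr r) = liminf (%n. ennreal (abs (U (s n) p) powr r))"
    using ae
   proof eventually_elim
    case (elim p)
    show ?case by (rule lim_imp_Liminf[OF trivial_limit_sequentially elim, symmetric])
   qed
  qed
  also have "... <= liminf (%n. \<integral>\<^sup>+p. ennreal (abs (U (s n) p) powr r) \<partial>vol)"
   by (rule nn_integral_liminf[OF m])
  also have "... <= liminf (%n. ennreal (b n))"
   unfolding b_def by (intro Liminf_mono always_eventually allI C(2) U(1) sobolev_sq_triangle[OF U(1) pu])
  also have "... = ennreal (C * (2 * sobolev_sq u X) powr (r / 2))" by (rule lim_imp_Liminf[OF _ blim]) simp
  also have "C * (2 * sobolev_sq u X) powr (r / 2) = (C * 2 powr (r / 2)) * sobolev_sq u X powr (r / 2)"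
   using u0 by (simp add: powr_mult)
  finally have le: "(nn_integral vol (%p. ennreal (abs (u p) powr r))) <= ennreal ((C * 2 powr (r / 2)) * sobolev_sq u X powr (r / 2))" .
  have [measurable]: "u : borel_measurable borel" using pu unfolding pre_sobolev_def by blast
  have mu: "(%p. abs (u p) powr r) : borel_measurable vol" by measurable
  have int: "integrable vol (%p. abs (u p) powr r)"
   by (rule integrableI_nonneg[OF mu]) (use le in \<open>auto simp: less_top[symmetric] top_unique\<close>)
  then have "ennreal (LINT p|vol. abs (u p) powr r) <= ennreal ((C * 2 powr (r / 2)) * sobolev_sq u X powr (r / 2))"
   using le by (subst (asm) nn_integral_eq_integral) auto
  then show ?thesis using int C(1) by (simp add: ennreal_le_iff)
 qed
 then show ?thesis using C(1) by (intro exI[of _ "C * 2 powr (r / 2)"]) auto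
qed

lemma powr_sum3_le:
 fixes a b c :: real
 assumes "r > 0"
 shows "abs (a + b + c) powr r <= 3 powr r * (abs a powr r + abs b powr r + abs c powr r)"
proof -
 define m where "m = max (abs a) (max (abs b) (abs c))"
 have "abs (a + b + c) <= 3 * m" unfolding m_def by linarith
 then have "abs (a + b + c) powr r <= (3 * m) powr r" using assms by (intro powr_mono2) auto
 also have "... = 3 powr r * m powr r" by (simp add: powr_mult m_def)
 also have "m powr r <= abs a powr r + abs b powr r + abs c powr r" unfolding m_def max_def by auto
 finally show ?thesis by (simp add: mult_left_mono)
qed

text \<open>
  Each \<open>u n\<close> is replaced by a smooth function at Sobolev distance tending to 0, and
  the embedding turns this into closeness in \<open>L\<^sup>r\<close>.
\<close>

lemma sobolev_compactness:
 assumes r: "2 < r" "r < 6" and u: "!!n::nat. weak_grad (u n) (X n)" and B: "!!n. sobolev_sq (u n) (X n) <= B"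
 shows "EX s. strict_mono (s :: nat => nat) &
  (ALL eps>0. EX N. ALL i>=N. ALL j>=N. (LINT p|vol. abs (u (s i) p - u (s j) p) powr r) <= eps)"
proof -
 obtain C where C: "0 <= C" "!!u X. weak_grad u X ==> integrable vol (%p. abs (u p) powr r)"
  "!!u X. weak_grad u X ==> (LINT p|vol. abs (u p) powr r) <= C * sobolev_sq u X powr (r / 2)"
  using sobolev_embedding[OF r] by blast
 have pu: "pre_sobolev (u n) (X n)" for n by (rule weak_grad_pre[OF u])
 define near where "near n U \<longleftrightarrow> smooth_fun A U &
  sdist U (gradient g U) (u n) (X n) <= inverse (real (Suc n))" for n U
 have "EX U. near n U" for n
 proof -
  obtain U where U: "!!k. smooth_fun A (U k)"
   "(%k::nat. sdist (U k) (gradient g (U k)) (u n) (X n)) ----> 0"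
   using weak_gradE[OF u] by blast
  from order_tendstoD(2)[OF U(2), of "inverse (real (Suc n))"]
  obtain k where "sdist (U k) (gradient g (U k)) (u n) (X n) < inverse (real (Suc n))"
   by (auto simp: eventually_sequentially)
  then have "near n (U k)" using U(1) unfolding near_def by (intro conjI less_imp_le)
  then show ?thesis by (rule exI[of "near n"])
 qed
 then obtain U where "!!n. near n (U n)" by metis
 then have U: "!!n. smooth_fun A (U n)"
  "!!n. sdist (U n) (gradient g (U n)) (u n) (X n) <= inverse (real (Suc n))"
  unfolding near_def by blast+
 let ?d = "%n p. 1 * U n p + -1 * u n p"
 have wd: "weak_grad (?d n) (lincomb 1 (gradient g (U n)) (-1) (X n))" for n
  by (rule weak_grad_lincomb[OF weak_grad_smooth[OF U(1)] u])
 have UB: "sobolev_sq (U n) (gradient g (U n)) <= 2 + 2 * B" for n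
 proof -
  have "inverse (real (Suc n)) <= 1" by (simp add: inverse_le_1_iff)
  then show ?thesis using sobolev_sq_triangle[OF U(1) pu, of n n] U(2)[of n] B[of n] by linarith
 qed
 obtain s :: "nat => nat" where s: "strict_mono s" and cauchy: "ALL eps>0.
   EX N. ALL i>=N. ALL j>=N. (nn_integral vol (%p. ennreal (abs (U (s i) p - U (s j) p) powr r))) <= ennreal eps"
  using smooth_compactness[of r U "2 + 2 * B", OF r U(1) UB] by blast
 define D where "D n = (LINT p|vol. abs (?d n p) powr r)" for n
 have D0: "0 <= D n" for n by (simp add: D_def)
 have Dlim: "D ----> 0"
 proof (rule tendsto_sandwich[OF _ _ tendsto_const])
  have "(%n. C * inverse (real (Suc n)) powr (r / 2)) ----> C * 0 powr (r / 2)"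
   using r by (intro tendsto_intros tendsto_powr' LIMSEQ_inverse_real_of_nat) auto
  then show "(%n. C * inverse (real (Suc n)) powr (r / 2)) ----> 0" by simp
  have "D n <= C * inverse (real (Suc n)) powr (r / 2)" for n
  proof -
   have "D n <= C * sobolev_sq (?d n) (lincomb 1 (gradient g (U n)) (-1) (X n)) powr (r / 2)"
    unfolding D_def by (rule C(3)[OF wd])
   also have "... <= C * inverse (real (Suc n)) powr (r / 2)"
    using C(1) r U(2) sobolev_sq_nonneg[OF weak_grad_pre[OF wd]] by (intro mult_left_mono powr_mono2) auto
   finally show ?thesis .
  qed
  then show "\<forall>\<^sub>F n in sequentially. D n <= C * inverse (real (Suc n)) powr (r / 2)" by simp
 qed (use D0 in auto)
 have "EX N. ALL i>=N. ALL j>=N. (LINT p|vol. abs (u (s i) p - u (s j) p) powr r) <= eps" if eps: "eps > 0" for eps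
 proof -
  define eps' where "eps' = eps / (3 * 3 powr r)"
  have eps': "eps' > 0" "3 powr r * (eps' + eps' + eps') = eps" using eps by (auto simp: eps'_def)
  obtain N1 where N1: "!!i j. i >= N1 ==> j >= N1 ==> (nn_integral vol (%p. ennreal (abs (U (s i) p - U (s j) p) powr r))) <= ennreal eps'"
   using cauchy eps'(1) by meson
  obtain N2 where N2: "!!n. n >= N2 ==> D n < eps'"
   using order_tendstoD(2)[OF Dlim eps'(1)] by (auto simp: eventually_sequentially)
  have "(LINT p|vol. abs (u (s i) p - u (s j) p) powr r) <= eps" if ij: "i >= max N1 N2" "j >= max N1 N2" for i j
  proof -
   have si: "s i >= N2" "s j >= N2" using ij seq_suble[OF s, of i] seq_suble[OF s, of j] by auto
   have iU: "integrable vol (%p. abs (U (s i) p - U (s j) p) powr r)"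
    using C(2)[OF weak_grad_lincomb[OF weak_grad_smooth[OF U(1)] weak_grad_smooth[OF U(1)]], of 1 "s i" "-1" "s j"] by simp
   have LU: "(LINT p|vol. abs (U (s i) p - U (s j) p) powr r) <= eps'"
   proof -
    have "ennreal (LINT p|vol. abs (U (s i) p - U (s j) p) powr r) <= ennreal eps'"
     using N1[of i j] ij nn_integral_eq_integral[OF iU] by simp
    then show ?thesis using eps'(1) by simp
   qed
   have iu: "integrable vol (%p. abs (u (s i) p - u (s j) p) powr r)"
    using C(2)[OF weak_grad_lincomb[OF u u], of 1 "s i" "-1" "s j"] by simp
   have iD: "integrable vol (%p. abs (?d n p) powr r)" for n by (rule C(2)[OF wd])
   have "(LINT p|vol. abs (u (s i) p - u (s j) p) powr r)
    <= (LINT p|vol. 3 powr r * (abs (?d (s i) p) powr r + abs (U (s i) p - U (s j) p) powr r + abs (?d (s j) p) powr r))"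
   proof (rule integral_mono[OF iu])
    show "integrable vol (%p. 3 powr r * (abs (?d (s i) p) powr r + abs (U (s i) p - U (s j) p) powr r + abs (?d (s j) p) powr r))"
     by (intro integrable_mult_right Bochner_Integration.integrable_add iD iU)
    fix p
    show "abs (u (s i) p - u (s j) p) powr r <= 3 powr r * (abs (?d (s i) p) powr r + abs (U (s i) p - U (s j) p) powr r + abs (?d (s j) p) powr r)"
     using powr_sum3_le[of r "- ?d (s i) p" "U (s i) p - U (s j) p" "?d (s j) p"] r by (simp add: algebra_simps abs_minus_commute)
   qed
   also have "... = 3 powr r * (D (s i) + (LINT p|vol. abs (U (s i) p - U (s j) p) powr r) + D (s j))"
    unfolding D_def integral_mult_right_zero Bochner_Integration.integral_add[OF Bochner_Integration.integrable_add[OF iD iU] iD]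
     Bochner_Integration.integral_add[OF iD iU] ..
   also have "... <= 3 powr r * (eps' + eps' + eps')"
    using N2[OF si(1)] N2[OF si(2)] LU by (intro mult_left_mono add_mono) auto
   finally show ?thesis using eps'(2) by simp
  qed
  then show ?thesis by blast
 qed
 then show ?thesis using s by blast
qed

end

section \<open>Completeness of H1\<close>

instantiation "fun" :: (type, real_vector) real_vector
begin

text \<open>
  Real functions form a vector space under the pointwise operations.
\<close>

definition scaleR_fun :: "real => ('a => 'b) => 'a => 'b" where
 "scaleR_fun a f = (%x. a *R f x)"

instance
 by standard (simp_all add: scaleR_fun_def fun_eq_iff algebra_simps)

end

lemma scaleR_fun_apply [simp]: "(a *R f) x = a *R f x"
 by (simp add: scaleR_fun_def)

text \<open>
  The Riesz-Fischer theorem for functions with values in a Euclidean space: along a fast Cauchy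
  subsequence the weighted sum of squared increments is integrable, so the subsequence converges almost
  everywhere, and Fatou's lemma bounds the distance to its limit.
\<close>

lemma L2_complete:
 fixes Y :: "nat => 'b => 'e::euclidean_space"
 assumes Y[measurable]: "!!n. Y n : borel_measurable M"
  and cauchy: "!!eps. eps > 0 ==> EX N. ALL m>=N. ALL n>=N. (nn_integral M (%x. ennreal ((norm (Y m x - Y n x))^2))) <= ennreal eps"
 shows "EX Z:borel_measurable M. ALL eps>0. EX N. ALL n>=N. (nn_integral M (%x. ennreal ((norm (Y n x - Z x))^2))) <= ennreal eps"
proof -
 have "ALL k. EX N. ALL m>=N. ALL n>=N. (nn_integral M (%x. ennreal ((norm (Y m x - Y n x))^2))) <= ennreal ((1/8) ^ k)"
  by (intro allI cauchy) simp
 then obtain N where N: "!!k m n. m >= N k ==> n >= N k ==> (nn_integral M (%x. ennreal ((norm (Y m x - Y n x))^2))) <= ennreal ((1/8) ^ k)"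
  by metis
 (* Indices that increase with k and are late enough for the increments to be summable. *)
 define s where "s k = (\<Sum>i\<le>k. N i) + k" for k
 have sN: "N k <= s k" "k <= s k" "s k <= s (Suc k)" for k
  using member_le_sum[of k "{..k}" N] by (auto simp: s_def)
 define \<Delta> where "\<Delta> k x = Y (s (Suc k)) x - Y (s k) x" for k x
 have [measurable]: "\<Delta> k : borel_measurable M" for k unfolding \<Delta>_def by measurable
 have \<Delta>le: "(nn_integral M (%x. ennreal ((norm (\<Delta> k x))^2))) <= ennreal ((1/8) ^ k)" for k
  unfolding \<Delta>_def by (rule N) (use sN[of k] in auto)
 have "(nn_integral M (%x. (\<Sum>k. ennreal (2 ^ k) * ennreal ((norm (\<Delta> k x))^2)))) = (\<Sum>k. ennreal (2 ^ k) * (nn_integral M (%x. ennreal ((norm (\<Delta> k x))^2))))"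
  by (subst nn_integral_suminf) (auto simp: nn_integral_cmult)
 also have "... <= (\<Sum>k. ennreal ((1/4) ^ k))"
 proof (rule suminf_le)
  fix k
  have "ennreal (2 ^ k) * (nn_integral M (%x. ennreal ((norm (\<Delta> k x))^2))) <= ennreal (2 ^ k) * ennreal ((1/8) ^ k)"
   by (intro mult_left_mono \<Delta>le) auto
  also have "... = ennreal ((1/4) ^ k)" by (subst ennreal_mult[symmetric]) (auto simp flip: power_mult_distrib)
  finally show "ennreal (2 ^ k) * (nn_integral M (%x. ennreal ((norm (\<Delta> k x))^2))) <= ennreal ((1/4) ^ k)" .
 qed auto
 also have "... < \<infinity>"
  by (subst suminf_ennreal2) (auto intro: summable_geometric)
 finally have "AE x in M. (\<Sum>k. ennreal (2 ^ k) * ennreal ((norm (\<Delta> k x))^2)) \<noteq> \<infinity>"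
  by (intro nn_integral_noteq_infinite) auto
 then have conv: "AE x in M. convergent (%k. Y (s k) x)"
 proof eventually_elim
  case (elim x)
  then obtain c where c: "(\<Sum>k. ennreal (2 ^ k) * ennreal ((norm (\<Delta> k x))^2)) = ennreal c" "0 <= c"
   by (cases "\<Sum>k. ennreal (2 ^ k) * ennreal ((norm (\<Delta> k x))^2)" rule: ennreal_cases) auto
  have "norm (\<Delta> k x) <= sqrt c * (1 / sqrt 2) ^ k" for k
  proof -
   have "ennreal (2 ^ k * (norm (\<Delta> k x))^2) <= ennreal c"
    using sum_le_suminf[of "%k. ennreal (2 ^ k) * ennreal ((norm (\<Delta> k x))^2)" "{k}"] c(1) by (simp add: ennreal_mult)
   then have "2 ^ k * (norm (\<Delta> k x))^2 <= c" using c(2) by (simp add: ennreal_le_iff)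
   then have "(norm (\<Delta> k x))^2 <= c * (1 / 2) ^ k" by (simp add: power_one_over field_simps)
   then have "norm (\<Delta> k x) <= sqrt (c * (1 / 2) ^ k)" by (rule real_le_rsqrt)
   also have "... = sqrt c * (1 / sqrt 2) ^ k" by (simp add: real_sqrt_mult real_sqrt_power real_sqrt_divide)
   finally show ?thesis .
  qed
  moreover have "summable (%k. sqrt c * (1 / sqrt 2) ^ k)"
   by (intro summable_mult summable_geometric) (simp add: real_less_lsqrt)
  ultimately have "summable (%k. \<Delta> k x)" by (meson summable_comparison_test')
  then have "convergent (%n. \<Sum>k<n. \<Delta> k x)" by (simp add: summable_iff_convergent)
  then have "convergent (%n. Y (s n) x - Y (s 0) x)"
   using sum_lessThan_telescope[of "%k. Y (s k) x"] by (simp add: \<Delta>_def)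
  then show ?case
   using convergent_add_const_iff[of "- Y (s 0) x" "%n. Y (s n) x"] by (simp add: add.commute)
 qed
 define Z where "Z x = lim (%k. Y (s k) x)" for x
 have Zm: "Z : borel_measurable M" unfolding Z_def by (rule borel_measurable_lim_metric) simp
 have "EX N. ALL n>=N. (nn_integral M (%x. ennreal ((norm (Y n x - Z x))^2))) <= ennreal eps" if eps: "eps > 0" for eps
 proof -
  obtain K where K: "!!m n. m >= K ==> n >= K ==> (nn_integral M (%x. ennreal ((norm (Y m x - Y n x))^2))) <= ennreal eps"
   using cauchy[OF eps] by blast
  have "(nn_integral M (%x. ennreal ((norm (Y n x - Z x))^2))) <= ennreal eps" if n: "n >= K" for n
  proof -
   have "(nn_integral M (%x. ennreal ((norm (Y n x - Z x))^2))) = (nn_integral M (%x. liminf (%k. ennreal ((norm (Y n x - Y (s k) x))^2))))"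
   proof (rule nn_integral_cong_AE)
    show "AE x in M. ennreal ((norm (Y n x - Z x))^2) = liminf (%k. ennreal ((norm (Y n x - Y (s k) x))^2))"
     using conv
    proof eventually_elim
     case (elim x)
     then have "(%k. Y (s k) x) ----> Z x" unfolding Z_def by (simp add: convergent_LIMSEQ_iff)
     then have "(%k. ennreal ((norm (Y n x - Y (s k) x))^2)) ----> ennreal ((norm (Y n x - Z x))^2)"
      by (intro tendsto_ennrealI tendsto_intros)
     then show ?case by (rule lim_imp_Liminf[OF trivial_limit_sequentially, symmetric])
    qed
   qed
   also have "... <= liminf (%k. \<integral>\<^sup>+x. ennreal ((norm (Y n x - Y (s k) x))^2) \<partial>M)"
    by (rule nn_integral_liminf) measurable
   also have "... <= ennreal eps"
   proof -
    have "eventually (%k. (nn_integral M (%x. ennreal ((norm (Y n x - Y (s k) x))^2))) <= ennreal eps) sequentially"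
     using eventually_ge_at_top[of K]
    proof eventually_elim
     case (elim k)
     show ?case by (rule K[OF n]) (use elim sN(2)[of k] in simp)
    qed
    then have "liminf (%k. \<integral>\<^sup>+x. ennreal ((norm (Y n x - Y (s k) x))^2) \<partial>M) <= liminf (%k. ennreal eps)" by (rule Liminf_mono)
    then show ?thesis by (simp add: Liminf_const)
   qed
   finally show ?thesis .
  qed
  then show ?thesis by blast
 qed
 then show ?thesis using Zm by blast
qed

context riemannian3 begin

lemma frame_exists:
 "EX fr :: 'a => ('a, 3) chart. (ALL p. EX k a. (fr p, k, a) : patches & p : region (fr p, k, a)) & (ALL c. {p. fr p = c} : sets borel)"
proof -
 obtain Pl :: "nat => 'a patch" and n where Pl: "patches = Pl ` {i. i < n}"
  using finite_imp_nat_seg_image_inj_on[OF patches_spec(1)] by blast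
 have cover: "EX i<n. p : region (Pl i)" for p using UNIV_I[of p] unfolding patches_spec(4)[symmetric] Pl by blast
 define first where "first p = (LEAST i. p : region (Pl i))" for p
 have first: "p : region (Pl (first p))" "first p < n" for p
 proof -
  obtain i where i: "i < n" "p : region (Pl i)" using cover by blast
  show "p : region (Pl (first p))" unfolding first_def by (rule LeastI[of "%i. p : region (Pl i)", OF i(2)])
  have "first p <= i" unfolding first_def by (rule Least_le) (rule i(2))
  then show "first p < n" using i(1) by simp
 qed
 have rb: "region (Pl i) : sets borel" if "i < n" for i by (rule region_borel) (use that Pl in blast)
 have E: "{p. first p = i} : sets borel" if i: "i < n" for i
 proof -
  have "{p. first p = i} = region (Pl i) - (\<Union>j<i. region (Pl j))"
  proof (intro set_eqI iffI)
   fix p assume "p : {p. first p = i}"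
   then have f: "first p = i" by simp
   have "p \<notin> region (Pl j)" if "j < i" for j
    using not_less_Least[of j "%i. p : region (Pl i)"] that f unfolding first_def by blast
   then show "p : region (Pl i) - (\<Union>j<i. region (Pl j))" using first(1)[of p] f by blast
  next
   fix p assume p: "p : region (Pl i) - (\<Union>j<i. region (Pl j))"
   have "first p = i" unfolding first_def
    by (rule Least_equality) (use p in \<open>auto simp: not_less[symmetric]\<close>)
   then show "p : {p. first p = i}" by simp
  qed
  also have "... : sets borel" using rb i by (intro sets.Diff sets.finite_UN) auto
  finally show ?thesis .
 qed
 define fr where "fr p = fst (Pl (first p))" for p
 have "EX k a. (fr p, k, a) : patches & p : region (fr p, k, a)" for p
 proof -
  obtain c k a where P: "Pl (first p) = (c, k, a)" by (cases "Pl (first p)")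
  have "(c, k, a) : patches" using first(2)[of p] Pl unfolding P[symmetric] by blast
  moreover have "p : region (c, k, a)" using first(1)[of p] P by simp
  moreover have "fr p = c" by (simp add: fr_def P)
  ultimately show ?thesis by blast
 qed
 moreover have "{p. fr p = c} : sets borel" for c
 proof -
  have "{p. fr p = c} = (\<Union>i\<in>{i. i < n & fst (Pl i) = c}. {p. first p = i})"
   using first(2) by (auto simp: fr_def)
  also have "... : sets borel" by (intro sets.finite_UN) (use E in auto)
  finally show ?thesis .
 qed
 ultimately show ?thesis by blast
qed

text \<open>
  A measurable choice of a chart around every point, among the finitely many charts of the patches. In this
  frame a vector field is a single function with values in \<open>real ^ 3\<close>, to which \<open>L2_complete\<close> applies.
\<close>

definition frame :: "'a => ('a, 3) chart" where
 "frame = (SOME fr. (ALL p. EX k a. (fr p, k, a) : patches & p : region (fr p, k, a)) & (ALL c. {p. fr p = c} : sets borel))"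

lemma frame_spec: "EX k a. (frame p, k, a) : patches & p : region (frame p, k, a)" "{p. frame p = c} : sets borel"
 using someI_ex[OF frame_exists] unfolding frame_def by blast+

lemma frame_chart: "frame p : A" "p : fst (frame p)" "frame p : fst ` patches"
proof -
 obtain k a where P: "(frame p, k, a) : patches" "p : region (frame p, k, a)" using frame_spec(1) by blast
 show "frame p : A" by (rule patch_chart(1)[OF P(1)])
 show "p : fst (frame p)" using P(2) by (simp add: region_def)
 show "frame p : fst ` patches" using P(1) by force
qed

lemma frame_comparison:
 assumes X: "vector_field A X"
 shows "(norm (X (frame p) p))^2 <= distortion * energy_density X p"
  and "energy_density X p <= (1 + distortion) / 2 * (norm (X (frame p) p))^2"
proof -
 obtain k a where P: "(frame p, k, a) : patches" "p : region (frame p, k, a)" using frame_spec(1) by blast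
 let ?c = "frame p"
 define x where "x = snd ?c p"
 have inv: "chart_inv ?c x = p" using frame_chart by (simp add: x_def)
 have x: "x : closed_cell k a" using P(2) cell_subset_closed_cell[of k a] by (auto simp: region_def x_def)
 note gp = good_patchD(5,6)[OF patches_spec(3)[OF P(1)] x, of "X ?c p", unfolded inv]
 have e: "energy_density X p = X ?c p \<bullet> (g ?c p *v X ?c p)" by (rule riem_inner_eq[OF X X frame_chart(1,2)])
 show "(norm (X ?c p))^2 <= distortion * energy_density X p" unfolding e by (rule gp(1))
 let ?v = "X ?c p" and ?w = "g ?c p *v X ?c p"
 have "?v \<bullet> ?w <= norm ?v * norm ?w" by (rule norm_cauchy_schwarz)
 also have "2 * (norm ?v * norm ?w) <= (norm ?v)^2 + (norm ?w)^2" using sum_squares_bound[of "norm ?v" "norm ?w"] by simp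
 then have "norm ?v * norm ?w <= ((norm ?v)^2 + (norm ?w)^2) / 2" by simp
 also have "... <= (1 + distortion) / 2 * (norm ?v)^2" using gp(2) by (simp add: field_simps)
 finally show "energy_density X p <= (1 + distortion) / 2 * (norm ?v)^2" unfolding e .
qed

lemma countable_frames: "countable ((%c. {p. frame p = c}) ` fst ` patches)"
 using patches_spec(1) by (simp add: countable_finite)

lemma frame_cover: "\<Union> ((%c. {p. frame p = c}) ` fst ` patches) = UNIV"
 using frame_chart(3) by blast

lemma frame_components_measurable:
 assumes X: "measurable_vector_field A X"
 shows "(%p. X (frame p) p) : borel_measurable borel"
proof (rule measurable_piecewise_restrict[OF countable_frames])
 fix \<Omega> assume "\<Omega> : (%c. {p. frame p = c}) ` fst ` patches"
 then obtain c where c: "c : fst ` patches" "\<Omega> = {p. frame p = c}" by blast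
 obtain k a where P: "(c, k, a) : patches" using c(1) by force
 note cA = patch_chart(1)[OF P]
 show "\<Omega> \<inter> space borel : sets borel" using frame_spec(2) c(2) by simp
 have sub: "\<Omega> \<subseteq> fst c" unfolding c(2) using frame_chart(2) by auto
 have "X c : borel_measurable (restrict_space borel (fst c))" using X cA unfolding measurable_vector_field_def by blast
 then have "X c : borel_measurable (restrict_space borel \<Omega>)" by (rule measurable_restrict_mono[OF _ sub])
 moreover have "X c : borel_measurable (restrict_space borel \<Omega>) \<longleftrightarrow> (%p. X (frame p) p) : borel_measurable (restrict_space borel \<Omega>)"
  by (rule measurable_cong) (auto simp: space_restrict_space c(2))
 ultimately show "(%p. X (frame p) p) : borel_measurable (restrict_space borel \<Omega>)" by blast
qed (use frame_cover in auto)

text \<open>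
  Back from components in the frame to components in every chart.
\<close>

definition field_of :: "('a => real ^ 3) => ('a, 3) chart => 'a => real ^ 3" where
 "field_of Y c p = transition_jacobian (frame p) c p *v Y p"

lemma field_of_frame: "field_of Y (frame p) p = Y p"
 unfolding field_of_def by (simp add: jacobian_self[OF frame_chart(1,2)])

lemma field_of_mvf:
 assumes Y: "Y : borel_measurable borel"
 shows "measurable_vector_field A (field_of Y)"
 unfolding measurable_vector_field_def
proof (intro conjI ballI)
 show "vector_field A (field_of Y)"
  unfolding vector_field_def
 proof (intro ballI)
  fix c d p assume c: "c : A" "d : A" and p: "p : fst c \<inter> fst d"
  show "field_of Y d p = transition_jacobian c d p *v field_of Y c p"
   unfolding field_of_def matrix_vector_mul_assoc
    jacobian_chain[OF frame_chart(1) c frame_chart(2) IntD1[OF p] IntD2[OF p]] ..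
 qed
 fix c assume c: "c : A"
 show "field_of Y c : borel_measurable (restrict_space borel (fst c))"
 proof (rule measurable_piecewise_restrict[OF countable_frames])
  fix \<Omega> assume "\<Omega> : (%c. {p. frame p = c}) ` fst ` patches"
  then obtain d where d: "d : fst ` patches" "\<Omega> = {p. frame p = d}" by blast
  obtain k a where P: "(d, k, a) : patches" using d(1) by force
  note dA = patch_chart(1)[OF P]
  have \<Omega>b: "\<Omega> : sets borel" using frame_spec(2) d(2) by simp
  show "\<Omega> \<inter> space (restrict_space borel (fst c)) : sets (restrict_space borel (fst c))"
   using \<Omega>b c by (auto simp: sets_restrict_space_iff space_restrict_space)
  have eq: "restrict_space (restrict_space borel (fst c)) \<Omega> = restrict_space borel (fst c \<inter> \<Omega>)"
   using \<Omega>b c by (intro restrict_restrict_space) auto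
  have sub: "fst c \<inter> \<Omega> \<subseteq> fst d \<inter> fst c" unfolding d(2) using frame_chart(2) by auto
  have J: "transition_jacobian d c : borel_measurable (restrict_space borel (fst c \<inter> \<Omega>))"
   by (rule borel_measurable_continuous_on_restrict[OF continuous_on_subset[OF jacobian_continuous[OF dA c] sub]])
  have "(%p. transition_jacobian d c p *v Y p) : borel_measurable (restrict_space borel (fst c \<inter> \<Omega>))"
   by (rule borel_measurable_matrix_vector[OF J measurable_restrict_space1[OF Y]])
  moreover have "(%p. transition_jacobian d c p *v Y p) : borel_measurable (restrict_space borel (fst c \<inter> \<Omega>))
   \<longleftrightarrow> field_of Y c : borel_measurable (restrict_space borel (fst c \<inter> \<Omega>))"
   by (rule measurable_cong) (auto simp: space_restrict_space d(2) field_of_def)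
  ultimately show "field_of Y c : borel_measurable (restrict_space (restrict_space borel (fst c)) \<Omega>)" unfolding eq by blast
 qed (use frame_cover in auto)
qed

text \<open>
  Functions and framed gradients converge separately in \<open>L\<^sup>2\<close>. The limit is a limit of smooth functions by
  a diagonal choice.
\<close>

lemma sobolev_complete:
 assumes u: "!!n::nat. weak_grad (u n) (X n)"
  and cauchy: "!!eps. eps > 0 ==> EX N. ALL m>=N. ALL n>=N.
   sdist (u m) (X m) (u n) (X n) <= eps"
 shows "EX v Z. weak_grad v Z &
  (%n. sdist (u n) (X n) v Z) ----> 0"
proof -
 note pu = weak_grad_pre[OF u]
 have pd: "pre_sobolev (%p. 1 * u m p + -1 * u n p) (lincomb 1 (X m) (-1) (X n))" for m n
  by (rule pre_sobolev_lincomb(1)[OF pu pu])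
 have ub: "u n : borel_measurable borel" and Xm: "measurable_vector_field A (X n)" for n
  using pu[of n] unfolding pre_sobolev_def by blast+
 let ?\<kappa> = "distortion"
 have \<kappa>: "?\<kappa> > 0" by (rule patches_spec(2))
 have "EX v:borel_measurable vol. ALL eps>0. EX N. ALL n>=N. (nn_integral vol (%p. ennreal ((norm (u n p - v p))^2))) <= ennreal eps"
 proof (rule L2_complete)
  show "u n : borel_measurable vol" for n using ub by simp
  fix eps :: real assume "eps > 0"
  then obtain N where N: "!!m n. m >= N ==> n >= N ==> sdist (u m) (X m) (u n) (X n) <= eps"
   using cauchy by blast
  have "(nn_integral vol (%p. ennreal ((norm (u m p - u n p))^2))) <= ennreal eps" if "m >= N" "n >= N" for m n
  proof -
   have "(nn_integral vol (%p. ennreal ((norm (u m p - u n p))^2))) = ennreal (LINT p|vol. (1 * u m p + -1 * u n p)^2)"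
    using nn_integral_square(1)[OF pd[of m n]] by simp
   also have "... <= ennreal eps"
    using N[OF that] sobolev_sq_parts_nonneg[OF pd[of m n]] unfolding sobolev_sq_def by (intro ennreal_leI) linarith
   finally show ?thesis .
  qed
  then show "EX N. ALL m>=N. ALL n>=N. (nn_integral vol (%p. ennreal ((norm (u m p - u n p))^2))) <= ennreal eps" by blast
 qed
 then obtain v where vm0: "v : borel_measurable vol"
  and v: "ALL eps>0. EX N. ALL n>=N. (nn_integral vol (%p. ennreal ((norm (u n p - v p))^2))) <= ennreal eps" by blast
 have vm: "v : borel_measurable borel" using vm0 measurable_cong_sets[OF sets_vol refl] by blast
 have "EX Y:borel_measurable vol. ALL eps>0. EX N. ALL n>=N. (nn_integral vol (%p. ennreal ((norm (X n (frame p) p - Y p))^2))) <= ennreal eps"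
 proof (rule L2_complete)
  show "(%p. X n (frame p) p) : borel_measurable vol" for n using frame_components_measurable[OF Xm] by simp
  fix eps :: real assume eps: "eps > 0"
  then obtain N where N: "!!m n. m >= N ==> n >= N ==> sdist (u m) (X m) (u n) (X n) <= eps / ?\<kappa>"
   using cauchy[of "eps / ?\<kappa>"] \<kappa> by auto
  have "(nn_integral vol (%p. ennreal ((norm (X m (frame p) p - X n (frame p) p))^2))) <= ennreal eps" if mn: "m >= N" "n >= N" for m n
  proof -
   let ?L = "lincomb 1 (X m) (-1) (X n)"
   have "(nn_integral vol (%p. ennreal ((norm (X m (frame p) p - X n (frame p) p))^2))) <= (nn_integral vol (%p. ennreal (?\<kappa> * energy_density ?L p)))"
    using frame_comparison(1)[OF pre_sobolev_borel(6)[OF pd[of m n]]] by (intro nn_integral_mono ennreal_leI) simp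
   also have "... = ennreal (?\<kappa> * (LINT p|vol. energy_density ?L p))"
    using pre_sobolev_borel(3,5)[OF pd[of m n]] \<kappa> by (subst nn_integral_eq_integral) auto
   also have "... <= ennreal (?\<kappa> * (eps / ?\<kappa>))"
    using N[OF mn] sobolev_sq_parts_nonneg[OF pd[of m n]] \<kappa> unfolding sobolev_sq_def
    by (intro ennreal_leI mult_left_mono) linarith+
   finally show ?thesis using \<kappa> by simp
  qed
  then show "EX N. ALL m>=N. ALL n>=N. (nn_integral vol (%p. ennreal ((norm (X m (frame p) p - X n (frame p) p))^2))) <= ennreal eps" by blast
 qed
 then obtain Y where Ym0: "Y : borel_measurable vol"
  and Y: "ALL eps>0. EX N. ALL n>=N. (nn_integral vol (%p. ennreal ((norm (X n (frame p) p - Y p))^2))) <= ennreal eps" by blast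
 have Ym: "Y : borel_measurable borel" using Ym0 measurable_cong_sets[OF sets_vol refl] by blast
 define Z where "Z = field_of Y"
 have Zm: "measurable_vector_field A Z" unfolding Z_def by (rule field_of_mvf[OF Ym])
 have Lm: "measurable_vector_field A (lincomb 1 (X n) (-1) Z)" for n by (rule measurable_vector_field_lincomb[OF Xm Zm])
 have near: "EX N. ALL n>=N. pre_sobolev (%p. 1 * u n p + -1 * v p) (lincomb 1 (X n) (-1) Z) &
   sdist (u n) (X n) v Z <= eps" if eps: "eps > 0" for eps
 proof -
  define eps' where "eps' = eps / (1 + ?\<kappa>)"
  have eps': "eps' > 0" using eps \<kappa> by (simp add: eps'_def)
  obtain N1 where N1: "!!n. n >= N1 ==> (nn_integral vol (%p. ennreal ((norm (u n p - v p))^2))) <= ennreal (eps / 2)"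
   using v eps half_gt_zero by blast
  obtain N2 where N2: "!!n. n >= N2 ==> (nn_integral vol (%p. ennreal ((norm (X n (frame p) p - Y p))^2))) <= ennreal eps'"
   using Y eps' by blast
  have "pre_sobolev (%p. 1 * u n p + -1 * v p) (lincomb 1 (X n) (-1) Z) &
   sdist (u n) (X n) v Z <= eps" if n: "n >= max N1 N2" for n
  proof -
   let ?d = "%p. 1 * u n p + -1 * v p" and ?L = "lincomb 1 (X n) (-1) Z"
   have db: "?d : borel_measurable borel" using ub[of n] vm by measurable
   have d2: "(nn_integral vol (%p. ennreal ((?d p)^2))) <= ennreal (eps / 2)" using N1[of n] n by simp
   have id: "integrable vol (%p. (?d p)^2)"
    by (rule integrableI_nonneg) (use db d2 in \<open>auto simp: less_top[symmetric] top_unique\<close>)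
   have L2: "(nn_integral vol (%p. ennreal (energy_density ?L p))) <= ennreal (eps / 2)"
   proof -
    have "(nn_integral vol (%p. ennreal (energy_density ?L p))) <= (nn_integral vol (%p. ennreal ((1 + ?\<kappa>) / 2) * ennreal ((norm (X n (frame p) p - Y p))^2)))"
    proof (intro nn_integral_mono)
     fix p
     have "energy_density ?L p <= (1 + ?\<kappa>) / 2 * (norm (X n (frame p) p - Y p))^2"
      using frame_comparison(2)[OF mvf_vf[OF Lm[of n]], of p] by (simp add: Z_def field_of_frame)
     then have "ennreal (energy_density ?L p) <= ennreal ((1 + ?\<kappa>) / 2 * (norm (X n (frame p) p - Y p))^2)" by (rule ennreal_leI)
     then show "ennreal (energy_density ?L p) <= ennreal ((1 + ?\<kappa>) / 2) * ennreal ((norm (X n (frame p) p - Y p))^2)"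
      using \<kappa> by (subst ennreal_mult[symmetric]) auto
    qed
    also have "... = ennreal ((1 + ?\<kappa>) / 2) * (nn_integral vol (%p. ennreal ((norm (X n (frame p) p - Y p))^2)))"
    proof (rule nn_integral_cmult)
     have [measurable]: "(%p. X n (frame p) p) : borel_measurable borel" "Y : borel_measurable borel"
      using frame_components_measurable[OF Xm] Ym by auto
     show "(%p. ennreal ((norm (X n (frame p) p - Y p))^2)) : borel_measurable vol" by measurable
    qed
    also have "... <= ennreal ((1 + ?\<kappa>) / 2) * ennreal eps'" by (intro mult_left_mono N2) (use n in auto)
    also have "... = ennreal (eps / 2)"
    proof -
     have "1 + ?\<kappa> \<noteq> 0" using \<kappa> by linarith
     then have "(1 + ?\<kappa>) / 2 * eps' = eps / 2" unfolding eps'_def by (simp add: divide_simps)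
     then show ?thesis using \<kappa> eps by (subst ennreal_mult[symmetric]) (auto simp: eps'_def)
    qed
    finally show ?thesis .
   qed
   have nnL: "0 <= energy_density ?L p" for p by (rule riem_inner_nonneg[OF mvf_vf[OF Lm]])
   have Lb: "energy_density ?L : borel_measurable vol" using riem_inner_measurable[OF Lm Lm] by simp
   have iL: "integrable vol (energy_density ?L)"
    by (rule integrableI_nonneg[OF Lb]) (use nnL L2 in \<open>auto simp: less_top[symmetric] top_unique\<close>)
   have pre: "pre_sobolev ?d ?L" unfolding pre_sobolev_def using db id Lm iL by blast
   have "ennreal (LINT p|vol. (?d p)^2) <= ennreal (eps / 2)" "ennreal (LINT p|vol. energy_density ?L p) <= ennreal (eps / 2)"
    using nn_integral_square[OF pre] d2 L2 by auto
   then have "(LINT p|vol. (?d p)^2) <= eps / 2" "(LINT p|vol. energy_density ?L p) <= eps / 2"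
    using eps by (auto simp: ennreal_le_iff)
   then have "sobolev_sq ?d ?L <= eps" unfolding sobolev_sq_def by linarith
   then show ?thesis using pre by blast
  qed
  then show ?thesis by blast
 qed
 obtain N0 where N0: "!!n. n >= N0 ==> pre_sobolev (%p. 1 * u n p + -1 * v p) (lincomb 1 (X n) (-1) Z)"
  using near[OF zero_less_one] by blast
 have pv: "pre_sobolev v Z"
 proof -
  have "pre_sobolev (%p. 1 * u N0 p + -1 * (1 * u N0 p + -1 * v p)) (lincomb 1 (X N0) (-1) (lincomb 1 (X N0) (-1) Z))"
   by (rule pre_sobolev_lincomb(1)[OF pu N0[OF order_refl]])
  then show ?thesis by simp
 qed
 let ?s = "%n. sdist (u n) (X n) v Z"
 have pnv: "pre_sobolev (%p. 1 * u n p + -1 * v p) (lincomb 1 (X n) (-1) Z)" for n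
  by (rule pre_sobolev_lincomb(1)[OF pu pv])
 have slim: "?s ----> 0"
 proof (rule LIMSEQ_I)
  fix e :: real assume e: "e > 0"
  then obtain N where N: "!!n. n >= N ==> ?s n <= e / 2" using near[of "e / 2"] half_gt_zero by blast
  have "norm (?s n - 0) < e" if "n >= N" for n
   using N[OF that] sobolev_sq_nonneg[OF pnv[of n]] e by simp
  then show "EX N. ALL n>=N. norm (?s n - 0) < e" by blast
 qed
 define close where "close n U \<longleftrightarrow> smooth_fun A U &
  sdist U (gradient g U) (u n) (X n) <= inverse (real (Suc n))" for n U
 have "EX U. close n U" for n
 proof -
  obtain U where U: "!!k. smooth_fun A (U k)"
   "(%k::nat. sdist (U k) (gradient g (U k)) (u n) (X n)) ----> 0"
   using weak_gradE[OF u] by blast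
  from order_tendstoD(2)[OF U(2), of "inverse (real (Suc n))"]
  obtain k where "sdist (U k) (gradient g (U k)) (u n) (X n) < inverse (real (Suc n))"
   by (auto simp: eventually_sequentially)
  then have "close n (U k)" using U(1) unfolding close_def by (intro conjI less_imp_le)
  then show ?thesis by (rule exI[of "close n"])
 qed
 then obtain U where "!!n. close n (U n)" by metis
 then have U: "!!n. smooth_fun A (U n)"
  "!!n. sdist (U n) (gradient g (U n)) (u n) (X n) <= inverse (real (Suc n))"
  unfolding close_def by blast+
 let ?t = "%n. sdist (U n) (gradient g (U n)) v Z"
 have "?t ----> 0"
 proof (rule tendsto_sandwich[OF _ _ tendsto_const])
  have "(%n. 2 * inverse (real (Suc n)) + 2 * ?s n) ----> 2 * 0 + 2 * 0"
   by (intro tendsto_intros LIMSEQ_inverse_real_of_nat slim)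
  then show "(%n. 2 * inverse (real (Suc n)) + 2 * ?s n) ----> 0" by simp
  have "?t n <= 2 * inverse (real (Suc n)) + 2 * ?s n" for n
  proof -
   let ?d = "%p. 1 * U n p + -1 * u n p" and ?D = "lincomb 1 (gradient g (U n)) (-1) (X n)"
   have pU: "pre_sobolev ?d ?D" by (rule pre_sobolev_lincomb(1)[OF pre_sobolev_smooth[OF U(1)] pu])
   have "sobolev_sq (%p. 1 * ?d p + 1 * (1 * u n p + -1 * v p)) (lincomb 1 ?D 1 (lincomb 1 (X n) (-1) Z))
    <= 2 * 1^2 * sobolev_sq ?d ?D + 2 * 1^2 * ?s n"
    by (rule pre_sobolev_lincomb(2)[OF pU pnv])
   moreover have "(%p. 1 * ?d p + 1 * (1 * u n p + -1 * v p)) = (%p. 1 * U n p + -1 * v p)" by auto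
   moreover have "lincomb 1 ?D 1 (lincomb 1 (X n) (-1) Z) = lincomb 1 (gradient g (U n)) (-1) Z" by auto
   ultimately have "?t n <= 2 * sobolev_sq ?d ?D + 2 * ?s n" by simp
   then show ?thesis using U(2)[of n] by linarith
  qed
  then show "\<forall>\<^sub>F n in sequentially. ?t n <= 2 * inverse (real (Suc n)) + 2 * ?s n" by simp
  show "\<forall>\<^sub>F n in sequentially. 0 <= ?t n"
   by (intro always_eventually allI sobolev_sq_nonneg pre_sobolev_lincomb(1) pre_sobolev_smooth U(1) pv)
 qed
 then have "weak_grad v Z" unfolding weak_grad_iff using pv U(1) by blast
 then show ?thesis using slim by blast
qed

definition sobolev_ip :: "('a => real) => ('a => real) => real" where
 "sobolev_ip u v = (LINT p|vol. riem_inner A g (weak_gradient A g u) (weak_gradient A g v) p + u p * v p)"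

lemma H1_weak_grad: "u : H1 A g ==> weak_grad u (weak_gradient A g u)"
 unfolding H1_def weak_gradient_def by (metis (mono_tags, lifting) mem_Collect_eq someI_ex)

lemma weak_grad_H1: "weak_grad u X ==> u : H1 A g"
 unfolding H1_def by blast

lemma riem_inner_eq_of_energy_zero:
 assumes X: "vector_field A X" "vector_field A Y" "vector_field A Z" and z: "energy_density (lincomb 1 X (-1) Y) p = 0"
 shows "riem_inner A g X Z p = riem_inner A g Y Z p"
proof -
 obtain c where c: "c : A" "p : fst c" using chart_cover by blast
 note L = vector_field_lincomb[OF X(1,2), of 1 "-1"]
 have "(X c p - Y c p) \<bullet> (g c p *v (X c p - Y c p)) = 0"
  using z riem_inner_eq[OF L L c] by simp
 then have "X c p - Y c p = 0" using metric_pos[OF c, of "X c p - Y c p"] by auto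
 then show ?thesis using riem_inner_eq[OF X(1) X(3) c] riem_inner_eq[OF X(2) X(3) c] by simp
qed

text \<open>
  By uniqueness any weak gradients may be used to evaluate the inner product.
\<close>

lemma sobolev_ip_eq:
 assumes u: "weak_grad u X" and v: "weak_grad v Y"
 shows "sobolev_ip u v = (LINT p|vol. riem_inner A g X Y p + u p * v p)"
  and "integrable vol (%p. riem_inner A g X Y p + u p * v p)"
proof -
 define X' where "X' = weak_gradient A g u"
 define Y' where "Y' = weak_gradient A g v"
 have u': "weak_grad u X'" unfolding X'_def by (rule H1_weak_grad[OF weak_grad_H1[OF u]])
 have v': "weak_grad v Y'" unfolding Y'_def by (rule H1_weak_grad[OF weak_grad_H1[OF v]])
 note p = weak_grad_pre[OF u] weak_grad_pre[OF v] weak_grad_pre[OF u'] weak_grad_pre[OF v']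
 note vf = pre_sobolev_borel(6)[OF p(1)] pre_sobolev_borel(6)[OF p(2)] pre_sobolev_borel(6)[OF p(3)] pre_sobolev_borel(6)[OF p(4)]
 have int: "integrable vol (%p. riem_inner A g W Z p + a p * b p)"
  if "pre_sobolev a W" "pre_sobolev b Z" for a b W Z
 proof -
  have m: "a : borel_measurable borel" "integrable vol (%p. (a p)^2)" "measurable_vector_field A W" "integrable vol (energy_density W)"
   "b : borel_measurable borel" "integrable vol (%p. (b p)^2)" "measurable_vector_field A Z" "integrable vol (energy_density Z)"
   using that unfolding pre_sobolev_def by blast+
  show ?thesis
   by (rule Bochner_Integration.integrable_add[OF energy_lincomb_integrable(3)[OF m(3,4,7,8)] square_lincomb_integrable(3)[OF m(1,2,5,6)]])
 qed
 note int' = int[OF p(3,4)] and int = int[OF p(1,2)]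
 have "AE p in vol. riem_inner A g X' Y' p + u p * v p = riem_inner A g X Y p + u p * v p"
  using weak_gradient_unique[OF u' u AE_I2[OF refl]] weak_gradient_unique[OF v' v AE_I2[OF refl]]
 proof eventually_elim
  fix p
  assume z: "energy_density (lincomb 1 X' (-1) X) p = 0" "energy_density (lincomb 1 Y' (-1) Y) p = 0"
  have "riem_inner A g X' Y' p = riem_inner A g X Y' p" by (rule riem_inner_eq_of_energy_zero[OF vf(3,1,4) z(1)])
  also have "... = riem_inner A g Y' X p" by (rule riem_inner_commute[OF vf(1,4)])
  also have "... = riem_inner A g Y X p" by (rule riem_inner_eq_of_energy_zero[OF vf(4,2,1) z(2)])
  also have "... = riem_inner A g X Y p" by (rule riem_inner_commute[OF vf(2,1)])
  finally show "riem_inner A g X' Y' p + u p * v p = riem_inner A g X Y p + u p * v p" by simp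
 qed
 then show "sobolev_ip u v = (LINT p|vol. riem_inner A g X Y p + u p * v p)"
  unfolding sobolev_ip_def X'_def[symmetric] Y'_def[symmetric]
  by (intro integral_cong_AE borel_measurable_integrable int int')
 show "integrable vol (%p. riem_inner A g X Y p + u p * v p)" by (rule int)
qed

lemma sobolev_ip_self:
 assumes u: "weak_grad u X"
 shows "sobolev_ip u u = sobolev_sq u X"
proof -
 note q = weak_grad_pre[OF u, unfolded pre_sobolev_def]
 have "sobolev_ip u u = (LINT p|vol. energy_density X p + (u p)^2)"
  using sobolev_ip_eq(1)[OF u u] by (simp add: power2_eq_square)
 also have "... = sobolev_sq u X" unfolding sobolev_sq_def using q by (subst Bochner_Integration.integral_add) auto
 finally show ?thesis .
qed

lemma H1_lincomb:
 assumes "u : H1 A g" "v : H1 A g"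
 shows "weak_grad (a *R u + b *R v) (lincomb a (weak_gradient A g u) b (weak_gradient A g v))"
 using weak_grad_lincomb[OF H1_weak_grad[OF assms(1)] H1_weak_grad[OF assms(2)], of a b]
 by (simp add: plus_fun_def scaleR_fun_def)

lemma sobolev_ip_commute:
 assumes "u : H1 A g" "v : H1 A g"
 shows "sobolev_ip u v = sobolev_ip v u"
 unfolding sobolev_ip_def
 using riem_inner_commute[OF pre_sobolev_borel(6)[OF weak_grad_pre[OF H1_weak_grad[OF assms(1)]]]
   pre_sobolev_borel(6)[OF weak_grad_pre[OF H1_weak_grad[OF assms(2)]]]]
 by (simp add: mult.commute)

lemma sobolev_ip_lincomb:
 assumes u: "u : H1 A g" and v: "v : H1 A g" and w: "w : H1 A g"
 shows "sobolev_ip (a *R u + b *R v) w = a * sobolev_ip u w + b * sobolev_ip v w"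
proof -
 note wu = H1_weak_grad[OF u] and wv = H1_weak_grad[OF v] and ww = H1_weak_grad[OF w]
 note vf = pre_sobolev_borel(6)[OF weak_grad_pre[OF wu]] pre_sobolev_borel(6)[OF weak_grad_pre[OF wv]]
  pre_sobolev_borel(6)[OF weak_grad_pre[OF ww]]
 have "sobolev_ip (a *R u + b *R v) w
  = (LINT p|vol. riem_inner A g (lincomb a (weak_gradient A g u) b (weak_gradient A g v)) (weak_gradient A g w) p + (a *R u + b *R v) p * w p)"
  by (rule sobolev_ip_eq(1)[OF H1_lincomb[OF u v] ww])
 also have "... = (LINT p|vol. a * (riem_inner A g (weak_gradient A g u) (weak_gradient A g w) p + u p * w p)
   + b * (riem_inner A g (weak_gradient A g v) (weak_gradient A g w) p + v p * w p))"
  by (intro Bochner_Integration.integral_cong refl) (simp add: riem_inner_lincomb[OF vf] algebra_simps)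
 also have "... = a * sobolev_ip u w + b * sobolev_ip v w"
  unfolding sobolev_ip_def using sobolev_ip_eq(2)[OF wu ww] sobolev_ip_eq(2)[OF wv ww]
  by (subst Bochner_Integration.integral_add) auto
 finally show ?thesis .
qed

lemma const_H1: "(%_. a) : H1 A g"
 by (rule weak_grad_H1[OF weak_grad_smooth[OF smooth_fun_const]])

lemma H1_semi_hilbert: "semi_hilbert (H1 A g) sobolev_ip"
proof
 have lc: "a *R u + b *R v : H1 A g" if "u : H1 A g" "v : H1 A g" for a b u v
  by (rule weak_grad_H1[OF H1_lincomb[OF that]])
 show "subspace (H1 A g)"
  unfolding subspace_def
 proof (intro conjI ballI allI)
  show "0 : H1 A g" using const_H1[of 0] by (simp add: zero_fun_def)
  show "u + v : H1 A g" if "u : H1 A g" "v : H1 A g" for u v using lc[OF that, of 1 1] by simp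
  show "a *R u : H1 A g" if "u : H1 A g" for a u using lc[OF that that, of a 0] by simp
 qed
 show "sobolev_ip u v = sobolev_ip v u" if "u : H1 A g" "v : H1 A g" for u v by (rule sobolev_ip_commute[OF that])
 show "sobolev_ip (u + v) w = sobolev_ip u w + sobolev_ip v w" if "u : H1 A g" "v : H1 A g" "w : H1 A g" for u v w
  using sobolev_ip_lincomb[OF that, of 1 1] by simp
 show "sobolev_ip (a *R u) w = a * sobolev_ip u w" if "u : H1 A g" "w : H1 A g" for a u w
  using sobolev_ip_lincomb[OF that(1) that(1) that(2), of a 0] by simp
 show "0 <= sobolev_ip u u" if "u : H1 A g" for u
  unfolding sobolev_ip_self[OF H1_weak_grad[OF that]] by (rule sobolev_sq_nonneg[OF weak_grad_pre[OF H1_weak_grad[OF that]]])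
 have diff_sq: "sobolev_ip (u - v) (u - v) = sdist u X v Y"
  if "weak_grad u X" "weak_grad v Y" for u v X Y
 proof -
  have "u - v = (%p. 1 * u p + -1 * v p)" by (simp add: fun_eq_iff)
  then show ?thesis using sobolev_ip_self[OF weak_grad_lincomb[OF that, of 1 "-1"]] by (simp only:)
 qed
 fix \<sigma> :: "nat => 'a => real"
 assume \<sigma>: "!!n. \<sigma> n : H1 A g"
  and cauchy: "!!e. e > 0 ==> EX N. ALL m>=N. ALL n>=N. sqrt (sobolev_ip (\<sigma> m - \<sigma> n) (\<sigma> m - \<sigma> n)) < e"
 define X where "X n = weak_gradient A g (\<sigma> n)" for n
 have wg: "weak_grad (\<sigma> n) (X n)" for n unfolding X_def by (rule H1_weak_grad[OF \<sigma>])
 have "EX v Z. weak_grad v Z & (%n. sdist (\<sigma> n) (X n) v Z) ----> 0"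
 proof (rule sobolev_complete[OF wg])
  fix eps :: real assume eps: "eps > 0"
  then obtain N where N: "!!m n. m >= N ==> n >= N ==> sqrt (sobolev_ip (\<sigma> m - \<sigma> n) (\<sigma> m - \<sigma> n)) < sqrt eps"
   using cauchy[of "sqrt eps"] by auto
  have "sdist (\<sigma> m) (X m) (\<sigma> n) (X n) <= eps" if "m >= N" "n >= N" for m n
   using N[OF that] unfolding diff_sq[OF wg wg] by simp
  then show "EX N. ALL m>=N. ALL n>=N. sdist (\<sigma> m) (X m) (\<sigma> n) (X n) <= eps" by blast
 qed
 then obtain v Z where v: "weak_grad v Z"
  "(%n. sdist (\<sigma> n) (X n) v Z) ----> 0" by blast
 have "(%n. sqrt (sobolev_ip (\<sigma> n - v) (\<sigma> n - v))) ----> sqrt 0"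
  unfolding diff_sq[OF wg v(1)] by (rule tendsto_real_sqrt[OF v(2)])
 then show "EX l:H1 A g. (%n. sqrt (sobolev_ip (\<sigma> n - l) (\<sigma> n - l))) ----> 0"
  using weak_grad_H1[OF v(1)] by auto
qed

end

section \<open>Compact perturbations of the identity\<close>

text \<open>
  Nonlinear terms of the problem are integrals of \<open>h(a(x), b(x), c(x))\<close>, where \<open>c\<close> is a test function and
  \<open>a\<close> is the quantity that will be small. The growth is measured by the maximum \<open>m\<close> of the arguments and stays below
  the power \<open>r\<close>.
\<close>

definition subcritical :: "real => (real \<times> real \<times> real => real) => bool" where
 "subcritical r h \<longleftrightarrow> continuous_on UNIV h &
   (EX p<r. EX C>=0. ALL a b c m. 1 <= m --> abs a <= m --> abs b <= m --> abs c <= m --> abs (h (a, b, c)) <= C * m powr p)"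

lemma max3_powr_le:
 fixes a b c r :: real
 assumes "0 <= r"
 shows "max 1 (max (abs a) (max (abs b) (abs c))) powr r <= 1 + abs a powr r + abs b powr r + abs c powr r"
 by (auto simp: max_def)

lemma subcritical_bound:
 assumes h: "subcritical r h" and r: "0 <= r"
 shows "EX C>=0. ALL a b c. abs (h (a, b, c)) <= C * (1 + abs a powr r + abs b powr r + abs c powr r)"
proof -
 obtain p C where p: "p < r" and C: "0 <= C"
  "!!a b c m. 1 <= m ==> abs a <= m ==> abs b <= m ==> abs c <= m ==> abs (h (a, b, c)) <= C * m powr p"
  using h unfolding subcritical_def by blast
 have "abs (h (a, b, c)) <= C * (1 + abs a powr r + abs b powr r + abs c powr r)" for a b c
 proof -
  let ?m = "max 1 (max (abs a) (max (abs b) (abs c)))"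
  have "abs (h (a, b, c)) <= C * ?m powr p" by (rule C(2)) (auto simp: le_max_iff_disj)
  also have "... <= C * ?m powr r" using p C(1) by (intro mult_left_mono powr_mono) auto
  also have "... <= C * (1 + abs a powr r + abs b powr r + abs c powr r)"
   by (rule mult_left_mono[OF max3_powr_le[OF r] C(1)])
  finally show ?thesis .
 qed
 then show ?thesis using C(1) by blast
qed

text \<open>
  For large arguments the lower growth makes \<open>h\<close> small compared with \<open>r\<close>-th powers. On a bounded cube
  uniform continuity bounds \<open>h\<close> by \<open>eps\<close> for small \<open>a\<close>, and for the remaining \<open>a\<close> a multiple of \<open>|a|\<^sup>r\<close> dominates a
  constant. This pointwise bound replaces every use of Hoelder's inequality.
\<close>

lemma subcritical_small:
 assumes h: "subcritical r h" and r: "0 <= r" and zero: "!!b c. h (0, b, c) = 0" and eps: "eps > 0"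
 shows "EX D>=0. ALL a b c. abs (h (a, b, c)) <= eps * (1 + abs b powr r + abs c powr r) + D * abs a powr r"
proof -
 obtain p C where p: "p < r" and C: "0 <= C"
  "!!a b c m. 1 <= m ==> abs a <= m ==> abs b <= m ==> abs c <= m ==> abs (h (a, b, c)) <= C * m powr p"
  using h unfolding subcritical_def by blast
 have "((%m::real. C * m powr (p - r)) \<longlongrightarrow> C * 0) at_top"
  using p by (intro tendsto_intros tendsto_neg_powr filterlim_ident) auto
 from order_tendstoD(2)[OF this, of eps] eps obtain K0 where K0: "!!m. m >= K0 ==> C * m powr (p - r) < eps"
  by (auto simp: eventually_at_top_linorder)
 define K where "K = max 1 K0"
 have large: "C * m powr p <= eps * m powr r" if "m >= K" for m
 proof -
  have "C * m powr p = (C * m powr (p - r)) * m powr r" using that by (simp add: K_def powr_add[symmetric])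
  also have "... <= eps * m powr r" using K0[of m] that by (intro mult_right_mono less_imp_le) (auto simp: K_def)
  finally show ?thesis .
 qed
 let ?B = "{-K..K} \<times> {-K..K} \<times> {-K..K}"
 have "uniformly_continuous_on ?B h"
  using h unfolding subcritical_def
  by (intro compact_uniformly_continuous compact_Times compact_Icc) (auto intro: continuous_on_subset)
 then obtain \<delta> where \<delta>: "\<delta> > 0" "!!x y. x : ?B ==> y : ?B ==> dist y x < \<delta> ==> dist (h y) (h x) < eps"
  using eps unfolding uniformly_continuous_on_def by metis
 define D where "D = eps + C * K powr p / \<delta> powr r"
 have D: "0 <= D" "eps <= D" "C * K powr p <= D * \<delta> powr r"
  using eps C(1) \<delta>(1) by (auto simp: D_def field_simps)
 have "abs (h (a, b, c)) <= eps * (1 + abs b powr r + abs c powr r) + D * abs a powr r" for a b c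
 proof -
  let ?m = "max 1 (max (abs a) (max (abs b) (abs c)))"
  have pos: "0 <= eps * (abs b powr r + abs c powr r)" "0 <= D * abs a powr r" "0 <= abs b powr r + abs c powr r" using eps D(1) by auto
  consider "K <= ?m" | "?m <= K" "abs a < \<delta>" | "?m <= K" "\<delta> <= abs a" by linarith
  then show ?thesis
  proof cases
   case 1
   have "abs (h (a, b, c)) <= C * ?m powr p" by (rule C(2)) (auto simp: le_max_iff_disj)
   also have "... <= eps * ?m powr r" by (rule large[OF 1])
   also have "... <= eps * (1 + abs a powr r + abs b powr r + abs c powr r)"
    using max3_powr_le[OF r] eps by (intro mult_left_mono) auto
   also have "... = eps * (1 + abs b powr r + abs c powr r) + eps * abs a powr r" by (simp add: algebra_simps)
   also have "... <= eps * (1 + abs b powr r + abs c powr r) + D * abs a powr r"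
    by (intro add_left_mono mult_right_mono D(2)) auto
   finally show ?thesis .
  next
   case 2
   have "dist (h (a, b, c)) (h (0, b, c)) < eps"
    using 2 by (intro \<delta>(2)) (auto simp: dist_prod_def)
   then have "abs (h (a, b, c)) < eps" by (simp add: zero dist_real_def)
   moreover have "eps * (1 + abs b powr r + abs c powr r) = eps + eps * (abs b powr r + abs c powr r)" by (simp add: algebra_simps)
   ultimately show ?thesis using pos by linarith
  next
   case 3
   have "abs (h (a, b, c)) <= C * K powr p" using 3 by (intro C(2)) auto
   also have "... <= D * \<delta> powr r" by (rule D(3))
   also have "... <= D * abs a powr r" using 3 \<delta>(1) r D(1) by (intro mult_left_mono powr_mono2) auto
   finally have "abs (h (a, b, c)) <= D * abs a powr r" .
   moreover have "0 <= eps * (1 + abs b powr r + abs c powr r)" using eps pos by (intro mult_nonneg_nonneg) auto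
   ultimately show ?thesis by linarith
  qed
 qed
 then show ?thesis using D(1) by blast
qed

lemma subcriticalI:
 assumes "continuous_on UNIV h" "p < r"
  and "!!a b c m. 1 <= m ==> abs a <= m ==> abs b <= m ==> abs c <= m ==> abs (h (a, b, c)) <= C * m powr p"
 shows "subcritical r h"
proof -
 have "0 <= C" using assms(3)[of 1 0 0 0] by simp
 then show ?thesis using assms unfolding subcritical_def by blast
qed

lemma subcritical_mult: "3 < r ==> subcritical r (%(a, b, c). a * b * c)"
proof (rule subcriticalI[where p = 3 and C = 1])
 show "continuous_on UNIV (%(a::real, b::real, c::real). a * b * c)"
  unfolding case_prod_beta by (intro continuous_intros)
 fix a b c m :: real assume m: "1 <= m" "abs a <= m" "abs b <= m" "abs c <= m"
 have "abs a * abs b * abs c <= m * m * m" using m by (intro mult_mono) auto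
 then show "abs (case (a, b, c) of (a, b, c) => a * b * c) <= 1 * m powr 3"
  using m by (simp add: abs_mult power3_eq_cube)
qed

text \<open>
  The properties of \<open>H1\<close> on a closed 3-manifold that the variational argument uses. The exponent exceeds 3 so
  that products of three elements are subcritical.
\<close>

locale sobolev_like = semi_hilbert H ip + finite_measure M
 for H :: "('a => real) set" and ip and M :: "'a measure" +
 fixes r :: real
 assumes r: "3 < r"
  and H_measurable: "u : H ==> u : borel_measurable M"
  and const_H: "(%_. a) : H"
  and M_pos: "0 < measure M (space M)"
  and embedding: "EX C>=0. ALL u:H. integrable M (%x. abs (u x) powr r) &
   (LINT x|M. abs (u x) powr r) <= C * nrm u powr r"
  and compactness: "(!!n::nat. \<sigma> n : H) ==> (!!n. nrm (\<sigma> n) <= B) ==>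
   EX s. strict_mono (s :: nat => nat) &
    (ALL eps>0. EX N. ALL i>=N. ALL j>=N. (LINT x|M. abs (\<sigma> (s i) x - \<sigma> (s j) x) powr r) <= eps)"
begin

definition Lr :: "('a => real) => real" where "Lr u = (LINT x|M. abs (u x) powr r)"

lemma Lr_bound: "EX K>=0. ALL u:H. nrm u <= R --> Lr u <= K"
proof -
 obtain C where C: "C >= 0" "!!u. u : H ==> Lr u <= C * nrm u powr r"
  using embedding unfolding Lr_def by blast
 have "Lr u <= C * R powr r" if "u : H" "nrm u <= R" for u
  using C(2)[OF that(1)] r that nrm_nonneg[OF that(1)] C(1)
  by (elim order_trans) (intro mult_left_mono powr_mono2, auto)
 then show ?thesis using C(1) by (intro exI[of _ "C * R powr r"]) auto
qed

lemma integrable_Lr: "u : H ==> integrable M (%x. abs (u x) powr r)"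
 using embedding by blast

lemma Lr_small: "\<delta> > 0 ==> EX d>0. ALL u:H. nrm u <= d --> Lr u <= \<delta>"
proof -
 assume \<delta>: "\<delta> > 0"
 obtain C where C: "C >= 0" "!!u. u : H ==> Lr u <= C * nrm u powr r"
  using embedding unfolding Lr_def by blast
 define d where "d = (\<delta> / (C + 1)) powr (1 / r)"
 have d: "d powr r = \<delta> / (C + 1)" "d > 0" using \<delta> C(1) r by (auto simp: d_def powr_powr)
 have "Lr u <= \<delta>" if "u : H" "nrm u <= d" for u
 proof -
  have "Lr u <= C * d powr r"
   using C(2)[OF that(1)] r that nrm_nonneg[OF that(1)] C(1)
   by (elim order_trans) (intro mult_left_mono powr_mono2, auto)
  also have "... <= \<delta>" using \<delta> C(1) unfolding d(1) by (simp add: field_simps)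
  finally show ?thesis .
 qed
 then show ?thesis using d(2) by blast
qed

lemma subcritical_integrable:
 assumes h: "subcritical r h" and H: "a : H" "b : H" "c : H"
 shows "integrable M (%x. h (a x, b x, c x))"
proof -
 obtain C where C: "!!a b c. abs (h (a, b, c)) <= C * (1 + abs a powr r + abs b powr r + abs c powr r)"
  using subcritical_bound[OF h] r by auto
 have [measurable]: "a : borel_measurable M" "b : borel_measurable M" "c : borel_measurable M"
  "h : borel_measurable borel"
  using H h by (auto intro: H_measurable borel_measurable_continuous_onI simp: subcritical_def)
 have "(%x. (a x, b x, c x)) : borel_measurable M" by (intro borel_measurable_Pair) measurable
 then have m: "(%x. h (a x, b x, c x)) : borel_measurable M"
  using measurable_compose[of "%x. (a x, b x, c x)" M borel h borel] by simp
 show ?thesis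
 proof (rule Bochner_Integration.integrable_bound)
  show "integrable M (%x. C * (1 + abs (a x) powr r + abs (b x) powr r + abs (c x) powr r))"
   using H by (intro integrable_mult_right Bochner_Integration.integrable_add integrable_Lr integrable_const)
  show "AE x in M. norm (h (a x, b x, c x)) <= norm (C * (1 + abs (a x) powr r + abs (b x) powr r + abs (c x) powr r))"
   using C by (intro always_eventually allI) (metis abs_ge_self order_trans real_norm_def)
 qed (rule m)
qed

lemma subcritical_integral_bounded:
 assumes h: "subcritical r h"
 shows "EX K>=0. ALL a:H. ALL b:H. ALL c:H. nrm a <= R --> nrm b <= R --> nrm c <= R -->
  (LINT x|M. abs (h (a x, b x, c x))) <= K"
proof -
 obtain C where C: "0 <= C" "!!a b c. abs (h (a, b, c)) <= C * (1 + abs a powr r + abs b powr r + abs c powr r)"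
  using subcritical_bound[OF h] r by auto
 obtain B where B: "0 <= B" "!!u. u : H ==> nrm u <= R ==> Lr u <= B" using Lr_bound by blast
 have "(LINT x|M. abs (h (a x, b x, c x))) <= C * (measure M (space M) + 3 * B)"
  if H: "a : H" "b : H" "c : H" and n: "nrm a <= R" "nrm b <= R" "nrm c <= R" for a b c
 proof -
  have "(LINT x|M. abs (h (a x, b x, c x))) <= (LINT x|M. C * (1 + abs (a x) powr r + abs (b x) powr r + abs (c x) powr r))"
   using H C(2) by (intro integral_mono integrable_abs subcritical_integrable[OF h] integrable_mult_right
     Bochner_Integration.integrable_add integrable_Lr integrable_const)
  also have "... = C * (measure M (space M) + Lr a + Lr b + Lr c)"
   unfolding Lr_def using H integrable_Lr by (simp add: Bochner_Integration.integral_add)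
  also have "... <= C * (measure M (space M) + 3 * B)"
   using B(2)[OF H(1) n(1)] B(2)[OF H(2) n(2)] B(2)[OF H(3) n(3)] C(1) by (intro mult_left_mono) auto
  finally show ?thesis .
 qed
 then show ?thesis using B(1) C(1) by (intro exI[of _ "C * (measure M (space M) + 3 * B)"]) auto
qed

lemma subcritical_integral_small:
 assumes h: "subcritical r h" and zero: "!!b c. h (0, b, c) = 0" and eps: "eps > 0"
 shows "EX \<delta>>0. ALL a:H. ALL b:H. ALL c:H. Lr a <= \<delta> --> nrm b <= R --> nrm c <= R -->
  (LINT x|M. abs (h (a x, b x, c x))) <= eps"
proof -
 obtain B where B: "0 <= B" "!!u. u : H ==> nrm u <= R ==> Lr u <= B" using Lr_bound by blast
 define V where "V = measure M (space M) + 2 * B"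
 have V: "V > 0" using B(1) M_pos by (simp add: V_def)
 obtain D where D: "0 <= D" "!!a b c. abs (h (a, b, c)) <= eps / (2 * V) * (1 + abs b powr r + abs c powr r) + D * abs a powr r"
  using subcritical_small[OF h _ zero, of "eps / (2 * V)"] r eps V by auto
 have "(LINT x|M. abs (h (a x, b x, c x))) <= eps"
  if H: "a : H" "b : H" "c : H" and n: "Lr a <= eps / (2 * (D + 1))" "nrm b <= R" "nrm c <= R" for a b c
 proof -
  have "(LINT x|M. abs (h (a x, b x, c x))) <= (LINT x|M. eps / (2 * V) * (1 + abs (b x) powr r + abs (c x) powr r) + D * abs (a x) powr r)"
   using H D(2) by (intro integral_mono integrable_abs subcritical_integrable[OF h] integrable_mult_right
     Bochner_Integration.integrable_add integrable_Lr integrable_const)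
  also have "... = eps / (2 * V) * (measure M (space M) + Lr b + Lr c) + D * Lr a"
   unfolding Lr_def using H integrable_Lr by (simp add: Bochner_Integration.integral_add)
  also have "... <= eps / (2 * V) * V + D * (eps / (2 * (D + 1)))"
   using B(2)[OF H(2) n(2)] B(2)[OF H(3) n(3)] n(1) D(1) eps V
   by (intro add_mono mult_left_mono) (auto simp: V_def)
  also have "... <= eps" using V D(1) eps by (simp add: field_simps)
  finally show ?thesis .
 qed
 then show ?thesis using D(1) eps by (intro exI[of _ "eps / (2 * (D + 1))"]) auto
qed

text \<open>
  Uniformly continuous on bounded sets with respect to the \<open>L\<^sup>r\<close> distance in the source. Such a map turns bounded
  sequences into sequences with convergent subsequences.
\<close>

definition compact_map :: "(('a => real) => 'a => real) => bool" where
 "compact_map N \<longleftrightarrow> (ALL u:H. N u : H) &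
   (ALL R. ALL eps>0. EX \<delta>>0. ALL u:H. ALL w:H. nrm u <= R --> nrm w <= R --> Lr (u - w) <= \<delta> --> nrm (N u - N w) <= eps)"

lemma compact_mapD:
 assumes "compact_map N" "eps > 0"
 obtains \<delta> where "\<delta> > 0"
  "!!u w. u : H ==> w : H ==> nrm u <= R ==> nrm w <= R ==> Lr (u - w) <= \<delta> ==> nrm (N u - N w) <= eps"
 using assms unfolding compact_map_def by blast

lemma compact_map_scale:
 assumes N: "compact_map N"
 shows "compact_map (%u. k *R N u)"
 unfolding compact_map_def
proof (intro conjI allI impI ballI)
 have NH: "N u : H" if "u : H" for u using N that unfolding compact_map_def by blast
 then show "k *R N u : H" if "u : H" for u using that by simp
 fix R eps :: real assume eps: "eps > 0"
 then have "eps / (abs k + 1) > 0" by simp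
 with N obtain \<delta> where \<delta>: "\<delta> > 0"
  "!!u w. u : H ==> w : H ==> nrm u <= R ==> nrm w <= R ==> Lr (u - w) <= \<delta> ==> nrm (N u - N w) <= eps / (abs k + 1)"
  by (rule compact_mapD) blast
 have "nrm (k *R N u - k *R N w) <= eps"
  if "u : H" "w : H" "nrm u <= R" "nrm w <= R" "Lr (u - w) <= \<delta>" for u w
 proof -
  have "nrm (k *R N u - k *R N w) = abs k * nrm (N u - N w)"
   using NH that by (simp add: scaleR_diff_right[symmetric] nrm_scale)
  also have "... <= abs k * (eps / (abs k + 1))" by (intro mult_left_mono \<delta>(2) that) auto
  also have "... <= eps" using eps by (simp add: field_simps)
  finally show ?thesis .
 qed
 then show "EX \<delta>>0. ALL u:H. ALL w:H. nrm u <= R --> nrm w <= R --> Lr (u - w) <= \<delta> -->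
   nrm (k *R N u - k *R N w) <= eps" using \<delta>(1) by blast
qed

lemma compact_map_add:
 assumes N: "compact_map N" "compact_map N'"
 shows "compact_map (%u. N u + N' u)"
 unfolding compact_map_def
proof (intro conjI allI impI ballI)
 have NH: "N u : H" "N' u : H" if "u : H" for u using N that unfolding compact_map_def by blast+
 then show "N u + N' u : H" if "u : H" for u using that by simp
 fix R eps :: real assume eps: "eps > 0"
 then have e2: "eps / 2 > 0" by simp
 obtain \<delta> where \<delta>: "\<delta> > 0"
  "!!u w. u : H ==> w : H ==> nrm u <= R ==> nrm w <= R ==> Lr (u - w) <= \<delta> ==> nrm (N u - N w) <= eps / 2"
  using compact_mapD[OF N(1) e2] by blast
 obtain \<delta>' where \<delta>': "\<delta>' > 0"
  "!!u w. u : H ==> w : H ==> nrm u <= R ==> nrm w <= R ==> Lr (u - w) <= \<delta>' ==> nrm (N' u - N' w) <= eps / 2"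
  using compact_mapD[OF N(2) e2] by blast
 have "nrm ((N u + N' u) - (N w + N' w)) <= eps"
  if H: "u : H" "w : H" and n: "nrm u <= R" "nrm w <= R" "Lr (u - w) <= min \<delta> \<delta>'" for u w
 proof -
  have "nrm ((N u + N' u) - (N w + N' w)) = nrm ((N u - N w) + (N' u - N' w))" by (simp add: algebra_simps)
  also have "... <= nrm (N u - N w) + nrm (N' u - N' w)" using NH H by (intro nrm_triangle) auto
  also have "... <= eps / 2 + eps / 2" using n by (intro add_mono \<delta>(2) \<delta>'(2) H) auto
  finally show ?thesis by simp
 qed
 then show "EX \<delta>>0. ALL u:H. ALL w:H. nrm u <= R --> nrm w <= R --> Lr (u - w) <= \<delta> -->
   nrm ((N u + N' u) - (N w + N' w)) <= eps" using \<delta>(1) \<delta>'(1) by (intro exI[of _ "min \<delta> \<delta>'"]) auto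
qed

lemma compact_map_continuous:
 assumes N: "compact_map N" and \<sigma>: "!!n. \<sigma> n : H" and u: "u : H" and lim: "tends \<sigma> u"
 shows "tends (%n. N (\<sigma> n)) (N u)"
proof (rule LIMSEQ_I)
 fix e :: real assume e: "e > 0"
 have "e / 2 > 0" using e by simp
 with N obtain \<delta> where \<delta>: "\<delta> > 0" "!!v w. v : H ==> w : H ==> nrm v <= nrm u + 1 ==> nrm w <= nrm u + 1 ==>
  Lr (v - w) <= \<delta> ==> nrm (N v - N w) <= e / 2" by (rule compact_mapD) blast
 obtain d where d: "d > 0" "!!u. u : H ==> nrm u <= d ==> Lr u <= \<delta>" using Lr_small[OF \<delta>(1)] by blast
 have NH: "N v : H" if "v : H" for v using N that unfolding compact_map_def by blast
 from order_tendstoD(2)[OF lim, of "min d 1"] d(1) obtain n0 where n0: "!!n. n >= n0 ==> nrm (\<sigma> n - u) < min d 1"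
  by (auto simp: eventually_sequentially)
 have "norm (nrm (N (\<sigma> n) - N u) - 0) < e" if n: "n >= n0" for n
 proof -
  have s: "nrm (\<sigma> n - u) < d" "nrm (\<sigma> n - u) < 1" using n0[OF n] by auto
  have "nrm (\<sigma> n) <= nrm u + 1" using nrm_reverse[OF \<sigma>[of n] u] s(2) by linarith
  then have "nrm (N (\<sigma> n) - N u) <= e / 2"
   using s(1) u by (intro \<delta>(2) \<sigma> d(2)) (auto intro: less_imp_le simp: \<sigma>)
  then show ?thesis using e nrm_nonneg[of "N (\<sigma> n) - N u"] NH u \<sigma> by simp
 qed
 then show "EX no. ALL n>=no. norm (nrm (N (\<sigma> n) - N u) - 0) < e" by (intro exI[of _ n0] allI impI)
qed

text \<open>
  Along a subsequence that is Cauchy in \<open>L\<^sup>r\<close> the values of \<open>N\<close> are Cauchy, and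
  \<open>\<sigma>\<close> differs from \<open>- N\<close> by a null sequence.
\<close>

lemma compact_perturbation_palais_smale:
 assumes N: "compact_map N" and \<sigma>: "!!n. \<sigma> n : H" and B: "!!n. nrm (\<sigma> n) <= B"
  and lim: "(%n. nrm (\<sigma> n + N (\<sigma> n))) ----> 0"
 shows "EX u:H. EX s. strict_mono (s :: nat => nat) & tends (%n. \<sigma> (s n)) u"
proof -
 have "EX s::nat => nat. strict_mono s & (ALL eps>0. EX N. ALL i>=N. ALL j>=N. Lr (\<sigma> (s i) - \<sigma> (s j)) <= eps)"
  using compactness[OF \<sigma> B] by (simp add: Lr_def)
 then obtain s :: "nat => nat" where s: "strict_mono s"
  "ALL eps>0. EX N. ALL i>=N. ALL j>=N. Lr (\<sigma> (s i) - \<sigma> (s j)) <= eps"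
  by (elim exE conjE)
 have NH: "N v : H" if "v : H" for v using N that unfolding compact_map_def by blast
 let ?G = "%u. u + N u"
 have GH: "?G (\<sigma> n) : H" for n using NH \<sigma> by simp
 have "cauchy (%n. \<sigma> (s n))"
 proof (rule cauchyI_le)
  fix e :: real assume e: "e > 0"
  then have e2: "e / 2 > 0" by simp
  with N obtain \<delta> where \<delta>: "\<delta> > 0" "!!v w. v : H ==> w : H ==> nrm v <= B ==> nrm w <= B ==>
   Lr (v - w) <= \<delta> ==> nrm (N v - N w) <= e / 2" by (rule compact_mapD) blast
  obtain n1 where n1: "!!i j. i >= n1 ==> j >= n1 ==> Lr (\<sigma> (s i) - \<sigma> (s j)) <= \<delta>"
   using s(2) \<delta>(1) by meson
  from order_tendstoD(2)[OF lim, of "e / 4"] e obtain n2 where n2: "!!n. n >= n2 ==> nrm (?G (\<sigma> n)) < e / 4"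
   by (auto simp: eventually_sequentially)
  have "nrm (\<sigma> (s m) - \<sigma> (s n)) <= e" if "m >= max n1 n2" "n >= max n1 n2" for m n
  proof -
   have "\<sigma> (s m) - \<sigma> (s n) = (?G (\<sigma> (s m)) - ?G (\<sigma> (s n))) - (N (\<sigma> (s m)) - N (\<sigma> (s n)))" by simp
   then have "nrm (\<sigma> (s m) - \<sigma> (s n)) <= nrm (?G (\<sigma> (s m)) - ?G (\<sigma> (s n))) + nrm (N (\<sigma> (s m)) - N (\<sigma> (s n)))"
    using nrm_diff_le[of "?G (\<sigma> (s m)) - ?G (\<sigma> (s n))" "N (\<sigma> (s m)) - N (\<sigma> (s n))"] GH NH \<sigma> by simp
   moreover have "nrm (?G (\<sigma> (s m)) - ?G (\<sigma> (s n))) <= nrm (?G (\<sigma> (s m))) + nrm (?G (\<sigma> (s n)))"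
    by (rule nrm_diff_le[OF GH GH])
   moreover have "nrm (?G (\<sigma> (s m))) < e / 4" "nrm (?G (\<sigma> (s n))) < e / 4"
    using that seq_suble[OF s(1), of m] seq_suble[OF s(1), of n] by (intro n2; simp)+
   moreover have "nrm (N (\<sigma> (s m)) - N (\<sigma> (s n))) <= e / 2" using that by (intro \<delta>(2) \<sigma> B n1) auto
   ultimately show ?thesis by linarith
  qed
  then show "EX N. ALL m>=N. ALL n>=N. nrm (\<sigma> (s m) - \<sigma> (s n)) <= e" by blast
 qed
 then show ?thesis using cauchy_converges[of "%n. \<sigma> (s n)"] \<sigma> s(1) by blast
qed

text \<open>
  Riesz representatives are unique up to seminorm zero; one is chosen.
\<close>

definition represent :: "(('a => real) => real) => 'a => real" where
 "represent l = (SOME w. w : H & (ALL v:H. ip w v = l v))"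

lemma represent_subcritical:
 assumes h: "subcritical r h" and linear: "!!b c s t. h (b, c, s + t) = h (b, c, s) + h (b, c, t)"
   "!!b c k t. h (b, c, k * t) = k * h (b, c, t)"
  and H: "a : H" "b : H"
 shows "represent (%v. LINT x|M. h (a x, b x, v x)) : H"
  "v : H ==> ip (represent (%v. LINT x|M. h (a x, b x, v x))) v = (LINT x|M. h (a x, b x, v x))"
proof -
 let ?l = "%v. LINT x|M. h (a x, b x, v x)"
 note int = subcritical_integrable[OF h H]
 obtain K where K: "!!v. v : H ==> nrm v <= max (nrm a) (max (nrm b) 1) ==> (LINT x|M. abs (h (a x, b x, v x))) <= K"
  using subcritical_integral_bounded[OF h, of "max (nrm a) (max (nrm b) 1)"] H by (auto simp: le_max_iff_disj)
 have "EX w:H. ALL v:H. ip w v = ?l v"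
 proof (rule riesz[where C = K])
  show "?l (u + v) = ?l u + ?l v" if "u : H" "v : H" for u v
   using int that by (simp add: linear Bochner_Integration.integral_add)
  show "?l (k *R u) = k * ?l u" if "u : H" for k u by (simp add: linear)
  show "abs (?l v) <= K" if "v : H" "nrm v <= 1" for v
   by (rule order_trans[OF integral_abs_bound K[OF that(1)]]) (use that(2) in auto)
 qed
 then have "represent ?l : H & (ALL v:H. ip (represent ?l) v = ?l v)"
  unfolding represent_def by (intro someI_ex[where P = "%w. w : H & (ALL v:H. ip w v = ?l v)"]) blast
 then show "represent ?l : H" "v : H ==> ip (represent ?l) v = ?l v" by blast+
qed

end

section \<open>The reduced energy functional\<close>

context sobolev_like
begin

lemma nrm_cong:
 assumes "x : H" "y : H" "!!v. v : H ==> ip x v = ip y v"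
 shows "nrm x = nrm y"
 using assms ip_commute[of x y] unfolding nrm_def by simp

lemma nrm_le_integral:
 assumes w: "w : H" and eq: "!!v. v : H ==> ip w v = (LINT x|M. k v x)"
  and le: "!!v. v : H ==> nrm v <= 1 ==> (LINT x|M. abs (k v x)) <= C"
 shows "nrm w <= C"
proof (rule nrm_le_by_duality[OF w])
 fix v assume v: "v : H" "nrm v <= 1"
 show "ip w v <= C" using eq[OF v(1)] le[OF v] integral_abs_bound[of M "k v"] by linarith
qed

text \<open>
  The representative of \<open>v \<mapsto> \<integral> a b v\<close>. Both the potential and the coupling term of the system are built from it.
\<close>

definition product :: "('a => real) => ('a => real) => 'a => real" where
 "product a b = represent (%v. LINT x|M. a x * b x * v x)"

lemma product_in: "a : H ==> b : H ==> product a b : H"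
 and product_ip: "a : H ==> b : H ==> v : H ==> ip (product a b) v = (LINT x|M. a x * b x * v x)"
 using represent_subcritical(1)[OF subcritical_mult[OF r], of a b] represent_subcritical(2)[OF subcritical_mult[OF r], of a b v]
 by (simp_all add: product_def algebra_simps)

lemma product_integrable: "a : H ==> b : H ==> c : H ==> integrable M (%x. a x * b x * c x)"
 using subcritical_integrable[OF subcritical_mult[OF r], of a b c] by simp

lemma product_bounded: "EX K>=0. ALL a:H. ALL b:H. nrm a <= R --> nrm b <= R --> nrm (product a b) <= K"
proof -
 obtain K where K: "0 <= K" "!!a b c. a : H ==> b : H ==> c : H ==> nrm a <= max R 1 ==> nrm b <= max R 1 ==>
   nrm c <= max R 1 ==> (LINT x|M. abs (a x * b x * c x)) <= K"
  using subcritical_integral_bounded[OF subcritical_mult[OF r], of "max R 1"] by auto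
 have "nrm (product a b) <= K" if "a : H" "b : H" "nrm a <= R" "nrm b <= R" for a b
  using that by (intro nrm_le_integral[OF product_in product_ip] K(2)) (auto simp: le_max_iff_disj)
 then show ?thesis using K(1) by blast
qed

lemma product_small:
 assumes "eps > 0"
 shows "EX \<delta>>0. ALL a:H. ALL b:H. Lr a <= \<delta> --> nrm b <= R --> nrm (product a b) <= eps"
proof -
 obtain \<delta> where \<delta>: "0 < \<delta>" "!!a b c. a : H ==> b : H ==> c : H ==> Lr a <= \<delta> ==> nrm b <= max R 1 ==>
   nrm c <= max R 1 ==> (LINT x|M. abs (a x * b x * c x)) <= eps"
  using subcritical_integral_small[OF subcritical_mult[OF r] _ assms, of "max R 1"] by auto
 have "nrm (product a b) <= eps" if "a : H" "b : H" "Lr a <= \<delta>" "nrm b <= R" for a b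
  using that by (intro nrm_le_integral[OF product_in product_ip] \<delta>(2)) (auto simp: le_max_iff_disj)
 then show ?thesis using \<delta>(1) by blast
qed

lemma compact_map_square: "compact_map (%u. product u u)"
 unfolding compact_map_def
proof (intro conjI allI impI ballI)
 show "product u u : H" if "u : H" for u using that by (simp add: product_in)
 fix R eps :: real assume "eps > 0"
 from product_small[OF this, of "2 * R"] obtain \<delta> where \<delta>: "0 < \<delta>"
  "!!a b. a : H ==> b : H ==> Lr a <= \<delta> ==> nrm b <= 2 * R ==> nrm (product a b) <= eps" by blast
 have "nrm (product u u - product w w) <= eps"
  if H: "u : H" "w : H" and n: "nrm u <= R" "nrm w <= R" "Lr (u - w) <= \<delta>" for u w
 proof -
  have "nrm (product u u - product w w) = nrm (product (u - w) (u + w))"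
  proof (rule nrm_cong)
   fix v assume v: "v : H"
   have "ip (product u u - product w w) v = (LINT x|M. u x * u x * v x) - (LINT x|M. w x * w x * v x)"
    using H v by (simp add: ip_diff product_in product_ip)
   also have "... = (LINT x|M. u x * u x * v x - w x * w x * v x)"
    by (intro Bochner_Integration.integral_diff[symmetric] product_integrable H v)
   also have "... = (LINT x|M. (u - w) x * (u + w) x * v x)" by (simp add: algebra_simps)
   finally show "ip (product u u - product w w) v = ip (product (u - w) (u + w)) v"
    using H v by (simp add: product_ip)
  qed (use H in \<open>simp_all add: product_in\<close>)
  also have "... <= eps" using H n nrm_triangle[OF H] by (intro \<delta>(2)) auto
  finally show ?thesis .
 qed
 then show "EX \<delta>>0. ALL u:H. ALL w:H. nrm u <= R --> nrm w <= R --> Lr (u - w) <= \<delta> -->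
   nrm (product u u - product w w) <= eps" using \<delta>(1) by blast
qed

lemma compact_map_product:
 assumes N: "compact_map N" and bounded: "!!R. EX K. ALL u:H. nrm u <= R --> nrm (N u) <= K"
 shows "compact_map (%u. product u (N u))"
 unfolding compact_map_def
proof (intro conjI allI impI ballI)
 have NH: "N u : H" if "u : H" for u using N that unfolding compact_map_def by blast
 then show "product u (N u) : H" if "u : H" for u using that by (simp add: product_in)
 fix R eps :: real assume eps: "eps > 0"
 then have e2: "eps / 2 > 0" by simp
 obtain K where K: "!!u. u : H ==> nrm u <= R ==> nrm (N u) <= K" using bounded by blast
 obtain \<delta> where \<delta>: "0 < \<delta>"
  "!!a b. a : H ==> b : H ==> Lr a <= \<delta> ==> nrm b <= max K R ==> nrm (product a b) <= eps / 2"
  using product_small[OF e2, of "max K R"] by blast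
 obtain d where d: "d > 0" "!!u. u : H ==> nrm u <= d ==> Lr u <= \<delta>" using Lr_small[OF \<delta>(1)] by blast
 obtain \<gamma> where \<gamma>: "\<gamma> > 0"
  "!!u w. u : H ==> w : H ==> nrm u <= R ==> nrm w <= R ==> Lr (u - w) <= \<gamma> ==> nrm (N u - N w) <= d"
  using compact_mapD[OF N d(1)] by blast
 have "nrm (product u (N u) - product w (N w)) <= eps"
  if H: "u : H" "w : H" and n: "nrm u <= R" "nrm w <= R" "Lr (u - w) <= min \<delta> \<gamma>" for u w
 proof -
  have "nrm (product u (N u) - product w (N w)) = nrm (product (u - w) (N u) + product (N u - N w) w)"
  proof (rule nrm_cong)
   fix v assume v: "v : H"
   have "ip (product u (N u) - product w (N w)) v = (LINT x|M. u x * N u x * v x) - (LINT x|M. w x * N w x * v x)"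
    using H v by (simp add: ip_diff product_in product_ip NH)
   also have "... = (LINT x|M. u x * N u x * v x - w x * N w x * v x)"
    by (intro Bochner_Integration.integral_diff[symmetric] product_integrable H v NH)
   also have "... = (LINT x|M. (u - w) x * N u x * v x + (N u - N w) x * w x * v x)" by (simp add: algebra_simps)
   also have "... = (LINT x|M. (u - w) x * N u x * v x) + (LINT x|M. (N u - N w) x * w x * v x)"
    by (intro Bochner_Integration.integral_add product_integrable H v NH H_intros(3))
   finally show "ip (product u (N u) - product w (N w)) v = ip (product (u - w) (N u) + product (N u - N w) w) v"
    using H v by (simp add: ip_add product_in product_ip NH)
  qed (use H NH in \<open>simp_all add: product_in\<close>)
  also have "... <= nrm (product (u - w) (N u)) + nrm (product (N u - N w) w)"
   using H NH by (intro nrm_triangle product_in) auto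
  also have "... <= eps / 2 + eps / 2"
  proof (rule add_mono)
   show "nrm (product (u - w) (N u)) <= eps / 2" using H NH n K[OF H(1) n(1)] by (intro \<delta>(2)) auto
   show "nrm (product (N u - N w) w) <= eps / 2" using H NH n by (intro \<delta>(2) d(2) \<gamma>(2)) auto
  qed
  finally show ?thesis by simp
 qed
 then show "EX \<delta>>0. ALL u:H. ALL w:H. nrm u <= R --> nrm w <= R --> Lr (u - w) <= \<delta> -->
   nrm (product u (N u) - product w (N w)) <= eps" using \<delta>(1) \<gamma>(1) by (intro exI[of _ "min \<delta> \<gamma>"]) auto
qed

end

text \<open>
  The hypothesis \<open>ambrosetti_rabinowitz\<close> is superlinearity above the power 4, the degree of the nonlocal term.
\<close>

locale schroedinger_maxwell = sobolev_like H ip M r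
 for H :: "('a => real) set" and ip and M :: "'a measure" and r +
 fixes e q :: real and f F :: "real => real" and p Cf \<eta> \<tau> :: real
 assumes e: "e > 0" and q: "q > 0" and f_continuous: "continuous_on UNIV f"
  and F_deriv: "!!s. (F has_real_derivative f s) (at s)" and F_0: "F 0 = 0"
  and p: "1 < p" "p < r" and growth: "!!s. abs (f s) <= Cf * (1 + abs s powr (p - 1))"
  and \<eta>: "\<eta> > 4" and \<tau>: "\<tau> > 0"
  and ambrosetti_rabinowitz: "!!s. abs s >= \<tau> ==> 0 < F s & \<eta> * F s <= s * f s"
begin

lemma growth_max:
 assumes "1 <= m" "abs s <= k * m" "1 <= k"
 shows "abs (f s) <= 2 * Cf * k powr (p - 1) * m powr (p - 1)"
proof -
 have Cf: "0 <= Cf" using growth[of 0] by simp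
 have 1: "1 <= k powr (p - 1) * m powr (p - 1)" using assms p mult_mono[OF ge_one_powr_ge_zero[of k "p - 1"] ge_one_powr_ge_zero[of m "p - 1"]] by simp
 have "abs s powr (p - 1) <= (k * m) powr (p - 1)" using assms p by (intro powr_mono2) auto
 also have "... = k powr (p - 1) * m powr (p - 1)" using assms by (simp add: powr_mult)
 finally have "1 + abs s powr (p - 1) <= 2 * (k powr (p - 1) * m powr (p - 1))" using 1 by linarith
 then have "Cf * (1 + abs s powr (p - 1)) <= Cf * (2 * (k powr (p - 1) * m powr (p - 1)))" by (rule mult_left_mono[OF _ Cf])
 then show ?thesis using growth[of s] by (simp add: mult.assoc mult.left_commute)
qed

lemma m_powr_p: "1 <= m ==> m powr (p - 1) * m = m powr p"
 by (simp add: powr_diff)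

lemma subcritical_f: "subcritical r (%(a, b, c). f b * c)"
proof (rule subcriticalI[OF _ p(2), where C = "2 * Cf"])
 show "continuous_on UNIV (%(a::real, b, c). f b * c)"
  unfolding case_prod_beta
  by (intro continuous_intros continuous_on_compose2[OF f_continuous]) auto
 fix a b c m :: real assume m: "1 <= m" "abs a <= m" "abs b <= m" "abs c <= m"
 have "abs (f b) * abs c <= (2 * Cf * m powr (p - 1)) * m" using m growth_max[of m b 1] by (intro mult_mono) auto
 then show "abs (case (a, b, c) of (a, b, c) => f b * c) <= 2 * Cf * m powr p"
  using m_powr_p[OF m(1)] by (simp add: abs_mult mult.assoc)
qed

lemma subcritical_f_diff: "subcritical r (%(a, b, c). (f b - f (b - a)) * c)"
proof (rule subcriticalI[OF _ p(2), where C = "2 * Cf + 2 * Cf * 2 powr (p - 1)"])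
 show "continuous_on UNIV (%(a::real, b, c). (f b - f (b - a)) * c)"
  unfolding case_prod_beta
  by (intro continuous_intros continuous_on_compose2[OF f_continuous]) auto
 fix a b c m :: real assume m: "1 <= m" "abs a <= m" "abs b <= m" "abs c <= m"
 have "abs (f b - f (b - a)) <= (2 * Cf + 2 * Cf * 2 powr (p - 1)) * m powr (p - 1)"
 proof -
  have "abs (b - a) <= 2 * m" using m by linarith
  then have "abs (f (b - a)) <= 2 * Cf * 2 powr (p - 1) * m powr (p - 1)" using m(1) by (intro growth_max) auto
  moreover have "abs (f b) <= 2 * Cf * m powr (p - 1)" using growth_max[of m b 1] m by simp
  ultimately show ?thesis by (simp add: distrib_right)
 qed
 then have "abs (f b - f (b - a)) * abs c <= ((2 * Cf + 2 * Cf * 2 powr (p - 1)) * m powr (p - 1)) * m"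
  using m by (intro mult_mono) auto
 then show "abs (case (a, b, c) of (a, b, c) => (f b - f (b - a)) * c) <= (2 * Cf + 2 * Cf * 2 powr (p - 1)) * m powr p"
  using m_powr_p[OF m(1)] by (simp add: abs_mult mult.assoc)
qed

lemma F_mean_value: "\<exists>\<theta>. 0 <= \<theta> & \<theta> <= 1 & F (s + t) - F s = t * f (s + \<theta> * t)"
proof -
 have "((%z. F (s + z * t)) has_real_derivative f (s + z * t) * t) (at z)" for z
  by (rule DERIV_chain2[OF F_deriv]) (auto intro!: derivative_eq_intros)
 then obtain z where "0 < z" "z < 1" "F (s + 1 * t) - F (s + 0 * t) = (1 - 0) * (f (s + z * t) * t)"
  using MVT2[of 0 1 "%z. F (s + z * t)" "%z. f (s + z * t) * t"] by auto
 then show ?thesis by (intro exI[of _ z]) (auto simp: mult.commute)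
qed

lemma F_continuous: "continuous_on UNIV F"
 using F_deriv by (intro DERIV_continuous_on) (auto intro: has_field_derivative_at_within)

lemma subcritical_F: "subcritical r (%(a, b, c). F b)"
proof (rule subcriticalI[OF _ p(2), where C = "2 * Cf"])
 show "continuous_on UNIV (%(a::real, b, c::real). F b)"
  unfolding case_prod_beta
  by (intro continuous_intros continuous_on_compose2[OF F_continuous]) auto
 fix a b c m :: real assume m: "1 <= m" "abs a <= m" "abs b <= m" "abs c <= m"
 obtain \<theta> where \<theta>: "0 <= \<theta>" "\<theta> <= 1" "F b = b * f (\<theta> * b)" using F_mean_value[of 0 b] F_0 by auto
 have "abs (\<theta> * b) <= 1 * abs b" using \<theta> unfolding abs_mult by (intro mult_right_mono) auto
 then have "abs (f (\<theta> * b)) * abs b <= (2 * Cf * m powr (p - 1)) * m" using m growth_max[of m "\<theta> * b" 1] by (intro mult_mono) auto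
 then show "abs (case (a, b, c) of (a, b, c) => F b) <= 2 * Cf * m powr p"
  unfolding mult.assoc m_powr_p[OF m(1)] by (simp add: \<theta>(3) abs_mult mult.commute[of "abs b"])
qed

lemma f_integrable: "u : H ==> v : H ==> integrable M (%x. f (u x) * v x)"
 using subcritical_integrable[OF subcritical_f, of u u v] by simp

lemma F_integrable: "u : H ==> integrable M (%x. F (u x))"
 using subcritical_integrable[OF subcritical_F, of u u u] by simp

lemma F_bounded: "EX K>=0. ALL u:H. nrm u <= R --> abs (LINT x|M. F (u x)) <= K"
proof -
 obtain K where K: "0 <= K" "!!u. u : H ==> nrm u <= R ==> (LINT x|M. abs (F (u x))) <= K"
  using subcritical_integral_bounded[OF subcritical_F, of R] by auto
 then show ?thesis using integral_abs_bound[of M] by (intro exI[of _ K]) (blast intro: order_trans)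
qed

text \<open>
  The gradient of \<open>u \<mapsto> \<integral> F(u)\<close>.
\<close>

definition reaction :: "('a => real) => 'a => real" where
 "reaction u = represent (%v. LINT x|M. f (u x) * v x)"

lemma reaction_in: "u : H ==> reaction u : H"
 and reaction_ip: "u : H ==> v : H ==> ip (reaction u) v = (LINT x|M. f (u x) * v x)"
 using represent_subcritical(1)[OF subcritical_f, of u u] represent_subcritical(2)[OF subcritical_f, of u u v] by (simp_all add: reaction_def algebra_simps)

lemma compact_map_reaction: "compact_map reaction"
 unfolding compact_map_def
proof (intro conjI allI impI ballI)
 show "reaction u : H" if "u : H" for u using that by (rule reaction_in)
 fix R eps :: real assume eps: "eps > 0"
 obtain \<delta> where \<delta>: "0 < \<delta>" "!!a b c. a : H ==> b : H ==> c : H ==> Lr a <= \<delta> ==> nrm b <= max R 1 ==>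
   nrm c <= max R 1 ==> (LINT x|M. abs ((f (b x) - f (b x - a x)) * c x)) <= eps"
  using subcritical_integral_small[OF subcritical_f_diff _ eps, of "max R 1"] by auto
 have "nrm (reaction u - reaction w) <= eps"
  if H: "u : H" "w : H" and n: "nrm u <= R" "nrm w <= R" "Lr (u - w) <= \<delta>" for u w
 proof (rule nrm_le_integral)
  show "reaction u - reaction w : H" using H by (simp add: reaction_in)
  show "ip (reaction u - reaction w) v = (LINT x|M. (f (u x) - f (u x - (u - w) x)) * v x)" if v: "v : H" for v
  proof -
   have "ip (reaction u - reaction w) v = (LINT x|M. f (u x) * v x) - (LINT x|M. f (w x) * v x)"
    using H v by (simp add: ip_diff reaction_in reaction_ip)
   also have "... = (LINT x|M. f (u x) * v x - f (w x) * v x)"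
    using H v by (intro Bochner_Integration.integral_diff[symmetric] f_integrable)
   finally show ?thesis by (simp add: algebra_simps)
  qed
  show "(LINT x|M. abs ((f (u x) - f (u x - (u - w) x)) * v x)) <= eps" if "v : H" "nrm v <= 1" for v
   using \<delta>(2)[of "u - w" u v] H n that by (simp add: le_max_iff_disj)
 qed
 then show "EX \<delta>>0. ALL u:H. ALL w:H. nrm u <= R --> nrm w <= R --> Lr (u - w) <= \<delta> -->
   nrm (reaction u - reaction w) <= eps" using \<delta>(1) by blast
qed

text \<open>
  The solution of the second equation for given \<open>u\<close>.
\<close>

definition potential :: "('a => real) => 'a => real" where
 "potential u = q *R product u u"

lemma potential_in: "u : H ==> potential u : H"
 by (simp add: potential_def product_in)

lemma potential_ip: "u : H ==> v : H ==> ip (potential u) v = q * (LINT x|M. u x * u x * v x)"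
 by (simp add: potential_def product_in product_ip ip_scale)

definition coupling :: "('a => real) => 'a => real" where
 "coupling u = product u (potential u)"

lemma coupling_in: "u : H ==> coupling u : H"
 by (simp add: coupling_def product_in potential_in)

lemma coupling_ip: "u : H ==> v : H ==> ip (coupling u) v = (LINT x|M. u x * potential u x * v x)"
 by (simp add: coupling_def product_ip potential_in)

lemma compact_map_coupling: "compact_map coupling"
 unfolding coupling_def[abs_def]
proof (rule compact_map_product)
 show "compact_map potential" unfolding potential_def[abs_def] by (rule compact_map_scale[OF compact_map_square])
 fix R
 obtain K where K: "!!a b. a : H ==> b : H ==> nrm a <= R ==> nrm b <= R ==> nrm (product a b) <= K"
  using product_bounded[of R] by blast
 have "nrm (potential u) <= q * K" if "u : H" "nrm u <= R" for u
  using q K[OF that(1,1,2,2)] product_in[OF that(1,1)] by (simp add: potential_def nrm_scale)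
 then show "EX K. ALL u:H. nrm u <= R --> nrm (potential u) <= K" by blast
qed

text \<open>
  The functional obtained by eliminating the potential. Since \<open>ip (potential u) (potential u)\<close> equals
  \<open>q \<integral> u\<^sup>2 \<Phi>\<close> and is of degree 4 in \<open>u\<close>, the factor \<open>e / (4 q)\<close> makes its derivative \<open>e \<integral> u \<Phi> v\<close>.
\<close>

definition energy :: "real => ('a => real) => real" where
 "energy lam u = ip u u / 2 + e / (4 * q) * ip (potential u) (potential u) - lam * (LINT x|M. F (u x))"

definition force :: "real => ('a => real) => 'a => real" where
 "force lam u = e *R coupling u + (- lam) *R reaction u"

lemma compact_map_force: "compact_map (force lam)"
 unfolding force_def[abs_def]
 by (intro compact_map_add compact_map_scale compact_map_coupling compact_map_reaction)

lemma force_in: "u : H ==> force lam u : H"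
 by (simp add: force_def coupling_in reaction_in)

lemma gradient_ip: "u : H ==> v : H ==> ip (u + force lam u) v
  = ip u v + e * (LINT x|M. u x * potential u x * v x) - lam * (LINT x|M. f (u x) * v x)"
 by (simp add: force_def ip_simps coupling_in reaction_in coupling_ip reaction_ip del: scaleR_minus_left)

text \<open>
  By the mean value theorem the error of the linear approximation is \<open>|t|\<close> times a subcritical expression in
  \<open>t w\<close>, to which \<open>subcritical_small\<close> applies.
\<close>

lemma F_functional_deriv:
 assumes u: "u : H" and w: "w : H"
 shows "((%t. LINT x|M. F (u x + t * w x)) has_real_derivative (LINT x|M. f (u x) * w x)) (at 0)"
 unfolding DERIV_def
proof (rule LIM_I)
 fix eps :: real assume eps: "eps > 0"
 define K where "K = measure M (space M) + Lr u + Lr w"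
 have L: "0 <= Lr u" "0 <= Lr w" unfolding Lr_def by (simp_all add: integral_nonneg_AE)
 then have K: "K > 0" using M_pos by (simp add: K_def)
 obtain D where D: "0 <= D" "!!a b c. abs ((f b - f (b - a)) * c) <= eps / (4 * K) * (1 + abs b powr r + abs c powr r) + D * abs a powr r"
  using subcritical_small[OF subcritical_f_diff, of "eps / (4 * K)"] r eps K by auto
 define d where "d = (eps / (4 * (D * K + 1))) powr (1 / r)"
 have DK: "D * K + 1 > 0" using D(1) K by (simp add: add_nonneg_pos)
 have d: "d > 0" "d powr r = eps / (4 * (D * K + 1))" using eps DK r by (auto simp: d_def powr_powr)
 have "norm (((LINT x|M. F (u x + (0 + t) * w x)) - (LINT x|M. F (u x + 0 * w x))) / t - (LINT x|M. f (u x) * w x)) < eps"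
  if t: "t \<noteq> 0" "norm (t - 0) < d" for t
 proof -
  have tw: "(%x. u x + t * w x) : H"
  proof -
   have "u + t *R w : H" using u w by simp
   then show ?thesis by (simp add: plus_fun_def scaleR_fun_def)
  qed
  have pw: "abs (F (u x + t * w x) - F (u x) - t * (f (u x) * w x))
    <= abs t * (eps / (4 * K) * (1 + abs (u x) powr r + abs (w x) powr r) + D * (d powr r * abs (w x) powr r))" for x
  proof -
   obtain \<theta> where \<theta>: "0 <= \<theta>" "\<theta> <= 1" "F (u x + t * w x) - F (u x) = t * w x * f (u x + \<theta> * (t * w x))"
    using F_mean_value by blast
   have "F (u x + t * w x) - F (u x) - t * (f (u x) * w x) = - t * ((f (u x) - f (u x - - (\<theta> * (t * w x)))) * w x)"
    unfolding \<theta>(3) by (simp add: algebra_simps)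
   then have "abs (F (u x + t * w x) - F (u x) - t * (f (u x) * w x)) = abs t * abs ((f (u x) - f (u x - - (\<theta> * (t * w x)))) * w x)"
    by (simp only: abs_mult abs_minus)
   also have "... <= abs t * (eps / (4 * K) * (1 + abs (u x) powr r + abs (w x) powr r) + D * abs (- (\<theta> * (t * w x))) powr r)"
    by (intro mult_left_mono D(2)) auto
   also have "abs (- (\<theta> * (t * w x))) powr r <= (d * abs (w x)) powr r"
   proof (rule powr_mono2)
    have "\<theta> * (abs t * abs (w x)) <= 1 * (d * abs (w x))" using \<theta> t(2) by (intro mult_mono) auto
    then show "abs (- (\<theta> * (t * w x))) <= d * abs (w x)" using \<theta> by (simp add: abs_mult)
   qed (use r in auto)
   also have "(d * abs (w x)) powr r = d powr r * abs (w x) powr r" using d(1) by (simp add: powr_mult)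
   finally show ?thesis using D(1) by (simp add: mult_left_mono)
  qed
  have i: "integrable M (%x. F (u x + t * w x))" "integrable M (%x. F (u x))" "integrable M (%x. t * (f (u x) * w x))"
   using F_integrable[OF tw] F_integrable[OF u] f_integrable[OF u w] by auto
  have "abs ((LINT x|M. F (u x + t * w x)) - (LINT x|M. F (u x)) - t * (LINT x|M. f (u x) * w x))
    = abs (LINT x|M. F (u x + t * w x) - F (u x) - t * (f (u x) * w x))"
   using i f_integrable[OF u w] by simp
  also have "... <= (LINT x|M. abs (F (u x + t * w x) - F (u x) - t * (f (u x) * w x)))" by (rule integral_abs_bound)
  also have "... <= (LINT x|M. abs t * (eps / (4 * K) * (1 + abs (u x) powr r + abs (w x) powr r) + D * (d powr r * abs (w x) powr r)))"
   using i u w f_integrable[OF u w] by (intro integral_mono integrable_abs Bochner_Integration.integrable_diff Bochner_Integration.integrable_add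
     integrable_mult_right integrable_Lr integrable_const pw)
  also have "... = abs t * (eps / (4 * K) * K + D * (d powr r * Lr w))"
   unfolding K_def Lr_def using u w integrable_Lr by (simp add: Bochner_Integration.integral_add)
  finally have le: "abs ((LINT x|M. F (u x + t * w x)) - (LINT x|M. F (u x)) - t * (LINT x|M. f (u x) * w x))
    <= abs t * (eps / (4 * K) * K + D * (d powr r * Lr w))" .
  have "D * (d powr r * Lr w) <= D * (d powr r * K)"
   using D(1) L M_pos by (intro mult_left_mono) (auto simp: K_def)
  also have "... = eps / 4 * (D * K / (D * K + 1))" unfolding d(2) by (simp add: field_simps)
  also have "... <= eps / 4 * 1" using DK eps by (intro mult_left_mono) auto
  finally have "eps / (4 * K) * K + D * (d powr r * Lr w) < eps" using K eps by simp
  then have "abs t * (eps / (4 * K) * K + D * (d powr r * Lr w)) < abs t * eps" using t(1) by simp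
  with le have "abs ((LINT x|M. F (u x + t * w x)) - (LINT x|M. F (u x)) - t * (LINT x|M. f (u x) * w x)) < abs t * eps" by linarith
  moreover have "((LINT x|M. F (u x + t * w x)) - (LINT x|M. F (u x))) / t - (LINT x|M. f (u x) * w x)
    = ((LINT x|M. F (u x + t * w x)) - (LINT x|M. F (u x)) - t * (LINT x|M. f (u x) * w x)) / t"
   using t(1) by (simp add: field_simps)
  ultimately show ?thesis using t(1) by (simp add: abs_divide divide_less_eq mult.commute)
 qed
 then show "EX s>0. ALL t. t \<noteq> 0 & norm (t - 0) < s -->
   norm (((LINT x|M. F (u x + (0 + t) * w x)) - (LINT x|M. F (u x + 0 * w x))) / t - (LINT x|M. f (u x) * w x)) < eps"
  using d(1) by blast
qed

text \<open>
  The potential is quadratic in \<open>u\<close> up to seminorm zero.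
\<close>

lemma potential_energy_polynomial:
 assumes u: "u : H" and w: "w : H"
 shows "ip (potential (u + t *R w)) (potential (u + t *R w)) =
  (let P = potential u; A = product u w; B = product w w
   in ip P P + 4 * q * t * ip P A + t^2 * (4 * q^2 * ip A A + 2 * q * ip P B) + 4 * q^2 * t ^ 3 * ip A B + q^2 * t ^ 4 * ip B B)"
proof -
 define P A B where "P = potential u" and "A = product u w" and "B = product w w"
 have H: "P : H" "A : H" "B : H" using u w by (simp_all add: P_def A_def B_def product_in potential_in)
 define X where "X = P + (2 * q * t) *R A + (q * t^2) *R B"
 have X: "X : H" using H by (simp add: X_def)
 let ?u = "u + t *R w"
 have "nrm (potential ?u) = nrm X"
 proof (rule nrm_cong)
  fix v assume v: "v : H"
  have i: "integrable M (%x. u x * u x * v x)" "integrable M (%x. u x * w x * v x)" "integrable M (%x. w x * w x * v x)"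
   using u w v by (auto intro: product_integrable)
  have "ip (potential ?u) v = q * (LINT x|M. u x * u x * v x + 2 * t * (u x * w x * v x) + t^2 * (w x * w x * v x))"
   using u w v by (simp add: potential_ip algebra_simps power2_eq_square)
  also have "... = q * ((LINT x|M. u x * u x * v x) + 2 * t * (LINT x|M. u x * w x * v x) + t^2 * (LINT x|M. w x * w x * v x))"
   using i by simp
  also have "... = ip X v"
   using H u w v by (simp add: X_def ip_simps) (simp add: P_def A_def B_def potential_ip product_ip algebra_simps)
  finally show "ip (potential ?u) v = ip X v" .
 qed (use u w X in \<open>simp_all add: potential_in\<close>)
 then have "ip (potential ?u) (potential ?u) = ip X X"
  using X u w by (metis nrm_sq potential_in H_intros(2,4))
 also have "... = ip P P + 4 * q * t * ip P A + t^2 * (4 * q^2 * ip A A + 2 * q * ip P B) + 4 * q^2 * t ^ 3 * ip A B + q^2 * t ^ 4 * ip B B"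
  using H ip_commute[OF H(1,2)] ip_commute[OF H(1,3)] ip_commute[OF H(2,3)]
  by (simp add: X_def ip_simps algebra_simps power2_eq_square power3_eq_cube power4_eq_xxxx)
 finally show ?thesis by (simp add: Let_def P_def A_def B_def)
qed

lemma energy_deriv_0:
 assumes u: "u : H" and w: "w : H"
 shows "((%t. energy lam (u + t *R w)) has_real_derivative ip (u + force lam u) w) (at 0)"
proof -
 have 1: "ip (u + t *R w) (u + t *R w) = ip u u + 2 * t * ip u w + t^2 * ip w w" for t
  using u w ip_commute[OF u w] by (simp add: ip_simps algebra_simps power2_eq_square)
 (* Symmetry of the triple integral: the potential may be paired with u w or multiplied into u. *)
 have 2: "ip (potential u) (product u w) = (LINT x|M. u x * potential u x * w x)"
  using u w ip_commute[of "potential u" "product u w"] by (simp add: product_ip product_in potential_in algebra_simps)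
 have "((%t. ip (u + t *R w) (u + t *R w) / 2 + e / (4 * q) * ip (potential (u + t *R w)) (potential (u + t *R w))
   - lam * (LINT x|M. F (u x + t * w x))) has_real_derivative
   ip u w + e / (4 * q) * (4 * q * ip (potential u) (product u w)) - lam * (LINT x|M. f (u x) * w x)) (at 0)"
  unfolding 1 potential_energy_polynomial[OF u w] Let_def
  by (rule derivative_eq_intros F_functional_deriv[OF u w] refl | simp)+
 then show ?thesis using q u w unfolding gradient_ip[OF u w] energy_def 2 by simp
qed

lemma energy_deriv:
 assumes u: "u : H" and w: "w : H"
 shows "((%t. energy lam (u + t *R w)) has_real_derivative ip ((u + s *R w) + force lam (u + s *R w)) w) (at s)"
proof -
 have "u + s *R w : H" using u w by simp
 from energy_deriv_0[OF this w]
 have "((%t. energy lam (u + (t + s) *R w)) has_real_derivative ip ((u + s *R w) + force lam (u + s *R w)) w) (at 0)"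
  by (simp add: scaleR_add_left add.assoc add.commute add.left_commute)
 then show ?thesis using DERIV_shift[of "%t. energy lam (u + t *R w)" _ 0 s] by simp
qed

lemma coupling_potential:
 assumes u: "u : H"
 shows "ip (potential u) (potential u) = q * ip (coupling u) u" "0 <= ip (potential u) (potential u)"
 using u ip_nonneg[OF potential_in[OF u]] by (simp_all add: coupling_ip potential_ip potential_in algebra_simps)

lemma ambrosetti_rabinowitz_all: "EX K>=0. ALL s. F s <= f s * s / \<eta> + K"
proof -
 have "continuous_on {-\<tau>..\<tau>} (%s. F s - f s * s / \<eta>)"
  using \<eta> by (intro continuous_intros continuous_on_subset[OF F_continuous] continuous_on_subset[OF f_continuous]) auto
 then have "bounded ((%s. F s - f s * s / \<eta>) ` {-\<tau>..\<tau>})" by (intro compact_imp_bounded compact_continuous_image) auto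
 then obtain K where K: "ALL s:{-\<tau>..\<tau>}. abs (F s - f s * s / \<eta>) <= K" unfolding bounded_iff by auto
 have "F s <= f s * s / \<eta> + max K 0" for s
 proof (cases "abs s >= \<tau>")
  case True
  then have "F s <= f s * s / \<eta>" using ambrosetti_rabinowitz[OF True] \<eta> by (simp add: field_simps)
  then show ?thesis by simp
 next
  case False
  then have "s : {-\<tau>..\<tau>}" by auto
  with K have "abs (F s - f s * s / \<eta>) <= K" by blast
  then show ?thesis by linarith
 qed
 then show ?thesis by (intro exI[of _ "max K 0"]) auto
qed

text \<open>
  In \<open>J(u) - (1/\<eta>) ip (J'(u)) u\<close> the nonlinear terms are bounded below: the nonlocal one has the factor
  \<open>1/4 - 1/\<eta> > 0\<close>, and the reaction term is controlled by \<open>ambrosetti_rabinowitz_all\<close>. What remains is at least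
  \<open>|u|\<^sup>2 / 4\<close> up to a constant, while the left side grows at most linearly in \<open>|u|\<close>.
\<close>

lemma palais_smale_bounded:
 assumes lam: "lam >= 0" and \<sigma>: "!!n::nat. \<sigma> n : H" and c: "!!n. abs (energy lam (\<sigma> n)) <= c"
  and lim: "(%n. nrm (\<sigma> n + force lam (\<sigma> n))) ----> 0"
 shows "EX B. ALL n. nrm (\<sigma> n) <= B"
proof -
 obtain K where K: "0 <= K" "!!s. F s <= f s * s / \<eta> + K" using ambrosetti_rabinowitz_all by blast
 have "Bseq (%n. nrm (\<sigma> n + force lam (\<sigma> n)))" using lim by (intro convergent_imp_Bseq convergentI)
 then obtain B where B: "0 < B" "!!n. norm (nrm (\<sigma> n + force lam (\<sigma> n))) <= B" unfolding Bseq_def by blast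
 (* L collects the constants of the inequality x^2 / 4 <= L + B x, which bounds x = nrm u. *)
  define L where "L = c + lam * K * measure M (space M)"
 have "nrm (\<sigma> n) <= 4 * B + 4 * L + 4" for n
 proof -
  define u where "u = \<sigma> n"
  have u: "u : H" and eu: "energy lam u <= c" using \<sigma> c[of n] by (auto simp: u_def abs_le_iff)
  define x where "x = nrm u"
  define Q where "Q = ip (coupling u) u"
  define D where "D = ip (u + force lam u) u"
  have x: "0 <= x" "ip u u = x^2" using u by (auto simp: x_def nrm_sq)
  have Q: "0 <= Q" using coupling_potential[OF u] q unfolding Q_def by (simp add: zero_le_mult_iff)
  have D: "D = x^2 + e * Q - lam * (LINT y|M. f (u y) * u y)"
   unfolding D_def gradient_ip[OF u u] x(2) Q_def coupling_ip[OF u u] ..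
  have E: "energy lam u = x^2 / 2 + e / 4 * Q - lam * (LINT y|M. F (u y))"
   unfolding energy_def coupling_potential(1)[OF u] x(2) Q_def using q by simp
  have "(LINT y|M. F (u y)) <= (LINT y|M. f (u y) * u y / \<eta> + K)"
   using K(2) u by (intro integral_mono F_integrable Bochner_Integration.integrable_add integrable_divide f_integrable integrable_const)
  also have "... = (LINT y|M. f (u y) * u y) / \<eta> + K * measure M (space M)"
   using f_integrable[OF u u] by (simp add: Bochner_Integration.integral_add)
  finally have "lam * (LINT y|M. F (u y)) <= lam * ((LINT y|M. f (u y) * u y) / \<eta> + K * measure M (space M))"
   by (rule mult_left_mono[OF _ lam])
  moreover have "D / \<eta> = x^2 / \<eta> + e * Q / \<eta> - lam * (LINT y|M. f (u y) * u y) / \<eta>"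
   unfolding D by (simp add: add_divide_distrib diff_divide_distrib)
  ultimately have "x^2 / 2 + e / 4 * Q - x^2 / \<eta> - e * Q / \<eta> <= L - D / \<eta>"
   using eu E by (simp add: L_def algebra_simps)
  moreover have "e * Q / \<eta> <= e * Q / 4" "x^2 / \<eta> <= x^2 / 4"
   using \<eta> e Q by (intro divide_left_mono; simp)+
  ultimately have 1: "x^2 / 4 <= L - D / \<eta>" by linarith
  have "abs D <= nrm (u + force lam u) * x"
   unfolding D_def x_def using u by (intro cauchy_schwarz) (auto simp: force_in)
  also have "... <= B * x" using B(2)[of n] x(1) by (intro mult_right_mono) (auto simp: u_def)
  finally have "abs D / \<eta> <= B * x / 1" using \<eta> B(1) x(1) by (intro frac_le) auto
  moreover have "- (D / \<eta>) <= abs D / \<eta>" using divide_right_mono[of "- D" "abs D" \<eta>] \<eta> by simp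
  ultimately have 2: "x^2 / 4 <= L + B * x" using 1 by linarith
  have L: "0 <= L" using c[of 0] lam K(1) by (auto simp: L_def intro!: add_nonneg_nonneg)
  show ?thesis
  proof (rule ccontr)
   assume "\<not> nrm (\<sigma> n) <= 4 * B + 4 * L + 4"
   then have big: "x > 4 * B + 4 * L + 4" by (simp add: x_def u_def)
   then have "x * (4 * B + 4 * L + 4) <= x * x" using x(1) by (intro mult_left_mono) auto
   then have "x * (4 * L + 4) <= 4 * L" using 2 by (simp add: power2_eq_square algebra_simps)
   moreover have "1 * (4 * L + 4) <= x * (4 * L + 4)" using big B(1) L by (intro mult_right_mono) auto
   ultimately show False by simp
  qed
 qed
 then show ?thesis by blast
qed

lemma energy_ps_functional:
 assumes "lam >= 0"
 shows "ps_functional H ip (energy lam) (%u. u + force lam u)"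
proof unfold_locales
 show "u + force lam u : H" if "u : H" for u using that by (simp add: force_in)
 show "((%s. energy lam (u + s *R w)) has_real_derivative ip (u + s *R w + force lam (u + s *R w)) w) (at s)"
  if "u : H" "w : H" for u w s using energy_deriv[OF that] .
 show "tends (%n. \<sigma> n + force lam (\<sigma> n)) (u + force lam u)"
  if "!!n::nat. \<sigma> n : H" "u : H" "tends \<sigma> u" for \<sigma> u
  using that by (intro tends_add compact_map_continuous[OF compact_map_force]) (auto simp: force_in)
 show "EX u:H. EX s. strict_mono (s :: nat => nat) & tends (%n. \<sigma> (s n)) u"
  if \<sigma>: "!!n::nat. \<sigma> n : H" and c: "!!n. abs (energy lam (\<sigma> n)) <= c"
   and lim: "(%n. nrm (\<sigma> n + force lam (\<sigma> n))) ----> 0" for \<sigma> c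
 proof -
  obtain B where "!!n. nrm (\<sigma> n) <= B" using palais_smale_bounded[OF assms \<sigma> c lim] by blast
  then show ?thesis by (rule compact_perturbation_palais_smale[OF compact_map_force \<sigma> _ lim])
 qed
qed

text \<open>
  The quotient of \<open>F s\<close> by \<open>s powr \<eta>\<close> is nondecreasing, because its derivative has the sign of \<open>s f(s) - \<eta> F(s)\<close>.
\<close>

lemma F_superquartic: "s >= \<tau> ==> F s >= F \<tau> / \<tau> powr \<eta> * s powr \<eta>"
proof -
 assume s: "s >= \<tau>"
 have "F \<tau> * \<tau> powr (- \<eta>) <= F s * s powr (- \<eta>)"
 proof (rule DERIV_nonneg_imp_nondecreasing[OF s])
  fix t assume t: "\<tau> <= t" "t <= s"
  have t0: "0 < t" using t \<tau> by simp
  have "((%t. F t * t powr (- \<eta>)) has_real_derivative f t * t powr (- \<eta>) + F t * (- \<eta> * t powr (- \<eta> - 1))) (at t)"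
   using t0 by (auto intro!: derivative_eq_intros F_deriv simp: powr_diff)
  moreover have "f t * t powr (- \<eta>) + F t * (- \<eta> * t powr (- \<eta> - 1)) = (t * f t - \<eta> * F t) * t powr (- \<eta> - 1)"
   using t0 by (simp add: powr_diff field_simps)
  moreover have "0 <= (t * f t - \<eta> * F t) * t powr (- \<eta> - 1)" using ambrosetti_rabinowitz[of t] t \<tau> by simp
  ultimately show "EX y. ((%t. F t * t powr (- \<eta>)) has_real_derivative y) (at t) & 0 <= y" by metis
 qed
 then show ?thesis using s \<tau> by (simp add: powr_minus field_simps)
qed

lemma nrm_const_pos: "0 < nrm (%_. 1)"
proof -
 obtain C where "!!u. u : H ==> Lr u <= C * nrm u powr r" using embedding unfolding Lr_def by blast
 note C = this[OF const_H[of 1]]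
 have "Lr (%_. 1) = measure M (space M)" by (simp add: Lr_def)
 then have "nrm (%_. 1) \<noteq> 0" using C M_pos by auto
 then show ?thesis using nrm_nonneg[OF const_H[of 1]] by simp
qed

text \<open>
  Constants: there the first two terms grow at most like the fourth power.
\<close>

lemma energy_negative_far:
 assumes lam: "lam > 0"
 shows "EX b:H. 1 < nrm b & energy lam b <= 0"
proof -
 let ?o = "(%_. 1) :: 'a => real"
 have o: "?o : H" by (rule const_H)
 define K where "K = ip ?o ?o + e / (4 * q) * ip (potential ?o) (potential ?o)"
 define k where "k = lam * measure M (space M) * (F \<tau> / \<tau> powr \<eta>)"
 have k: "k > 0" using lam M_pos ambrosetti_rabinowitz[of \<tau>] \<tau> by (simp add: k_def)
 define T0 where "T0 = max 1 (K / k) powr (1 / (\<eta> - 4))"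
 have T0: "K / k <= T powr (\<eta> - 4)" if "T >= T0" for T
 proof -
  have "K / k <= T0 powr (\<eta> - 4)" using \<eta> by (simp add: T0_def powr_powr)
  also have "... <= T powr (\<eta> - 4)" using \<eta> that by (intro powr_mono2) (auto simp: T0_def)
  finally show ?thesis .
 qed
 (* T is large enough for the growth of F, for the superlinear term to win, and to leave the unit ball. *)
  define T where "T = max (max T0 \<tau>) (max 1 (2 / nrm ?o))"
 have T: "T >= T0" "T >= \<tau>" "T >= 1" "T >= 2 / nrm ?o" by (auto simp: T_def)
 let ?b = "T *R ?o"
 have b: "?b : H" using o by simp
 have "2 <= T * nrm ?o" using T(4) nrm_const_pos by (simp add: field_simps)
 then have "1 < nrm ?b" using T(3) o by (simp add: nrm_scale)
 moreover have "energy lam ?b <= 0"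
 proof -
  have "nrm (potential ?b) = nrm (T^2 *R potential ?o)"
   using o b by (intro nrm_cong) (simp_all add: potential_in potential_ip ip_scale power2_eq_square)
  also have "... = T^2 * nrm (potential ?o)" using o by (simp add: nrm_scale potential_in)
  finally have "(nrm (potential ?b))^2 = T ^ 4 * (nrm (potential ?o))^2" by (simp add: power_mult_distrib)
  then have Q: "ip (potential ?b) (potential ?b) = T ^ 4 * ip (potential ?o) (potential ?o)"
   using b o by (simp add: nrm_sq potential_in)
  have I: "ip ?b ?b = T^2 * ip ?o ?o" using o by (simp add: ip_simps power2_eq_square)
  have "T^2 * ip ?o ?o / 2 <= T ^ 4 * ip ?o ?o"
  proof -
   have "T^2 * ip ?o ?o <= T ^ 4 * ip ?o ?o" using T(3) ip_nonneg[OF o] by (intro mult_right_mono power_increasing) auto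
   moreover have "0 <= T^2 * ip ?o ?o" using ip_nonneg[OF o] by simp
   ultimately show ?thesis by linarith
  qed
  moreover have "(LINT x|M. F (?b x)) = measure M (space M) * F T" by simp
  moreover have "lam * measure M (space M) * F T >= k * T powr \<eta>"
   using mult_left_mono[OF F_superquartic[OF T(2)], of "lam * measure M (space M)"] lam M_pos
   unfolding k_def by (simp only: mult.assoc) simp
  ultimately have "energy lam ?b <= T ^ 4 * K - k * T powr \<eta>"
   unfolding energy_def Q I K_def by (simp add: algebra_simps)
  also have "T powr \<eta> = T ^ 4 * T powr (\<eta> - 4)"
   using T(3) by (simp add: powr_diff powr_numeral)
  also have "T ^ 4 * K - k * (T ^ 4 * T powr (\<eta> - 4)) = T ^ 4 * (K - k * T powr (\<eta> - 4))" by (simp add: algebra_simps)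
  also have "... <= 0" using T0[OF T(1)] k T(3) by (simp add: mult_le_0_iff field_simps)
  finally show ?thesis .
 qed
 ultimately show ?thesis using b by blast
qed

text \<open>
  The threshold makes \<open>lam \<integral> F(u)\<close> at most \<open>1/4\<close> on the unit ball, whereas \<open>|u|\<^sup>2 / 2\<close> is \<open>1/2\<close> on the
  sphere.
\<close>

theorem two_critical_points:
 "EX lam0>0. ALL lam. 0 < lam & lam < lam0 -->
  (EX u:H. EX w:H. nrm (u + force lam u) = 0 & energy lam u <= 0 &
    nrm (w + force lam w) = 0 & 0 < energy lam w)"
proof -
 obtain K where K: "0 <= K" "!!u. u : H ==> nrm u <= 1 ==> abs (LINT x|M. F (u x)) <= K" using F_bounded by blast
 have "EX u:H. EX w:H. nrm (u + force lam u) = 0 & energy lam u <= 0 & nrm (w + force lam w) = 0 & 0 < energy lam w"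
  if lam: "0 < lam" "lam < 1 / (4 * K + 1)" for lam
 proof -
  interpret J: ps_functional H ip "energy lam" "%u. u + force lam u" by (rule energy_ps_functional) (use lam in simp)
  (* The threshold is chosen for this bound. *)
  have lamK: "lam * K <= 1 / 4" using lam K(1) by (simp add: field_simps)
  have below: "(nrm u)^2 / 2 - 1 / 4 <= energy lam u" if u: "u : H" "nrm u <= 1" for u
  proof -
   have "lam * (LINT x|M. F (u x)) <= lam * K" using K(2)[OF u] lam(1) by (intro mult_left_mono) auto
   moreover have "0 <= e / (4 * q) * ip (potential u) (potential u)" using coupling_potential(2)[OF u(1)] e q by simp
   ultimately show ?thesis using lamK unfolding energy_def nrm_sq[OF u(1)] by linarith
  qed
  have sphere: "1 / 4 <= energy lam u" if "u : H" "nrm u = 1" for u using below[of u] that by simp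
  have 0: "energy lam 0 <= 0"
  proof -
   have "nrm (potential 0) = nrm 0" by (rule nrm_cong) (simp_all add: potential_in potential_ip)
   then have "ip (potential 0) (potential 0) = 0" using nrm_sq[OF potential_in[of 0]] by simp
   then show ?thesis by (simp add: energy_def F_0)
  qed
  have "EX u:H. nrm (u + force lam u) = 0 & energy lam u <= 0"
  proof (rule J.local_minimum[where a = 0 and \<rho> = 1 and \<alpha> = "1 / 4" and b = "- 1 / 4"])
   show "- 1 / 4 <= energy lam u" if "u : H" "nrm u <= 1" for u using below[OF that] by (simp add: field_simps) (smt (verit) zero_le_power2)
  qed (use 0 sphere in auto)
  moreover obtain b where "b : H" "1 < nrm b" "energy lam b <= 0" using energy_negative_far[OF lam(1)] by blast
  then have "EX w:H. nrm (w + force lam w) = 0 & 1 / 4 <= energy lam w"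
   using 0 sphere by (intro J.mountain_pass[where a = 0 and \<rho> = 1 and b = b]) auto
  ultimately show ?thesis by force
 qed
 then show ?thesis using K(1) by (intro exI[of _ "1 / (4 * K + 1)"]) auto
qed

lemma critical_point_equations:
 assumes u: "u : H" and v: "v : H" and crit: "nrm (u + force lam u) = 0"
 shows "ip u v + e * (LINT x|M. u x * potential u x * v x) = lam * (LINT x|M. f (u x) * v x)"
 using cauchy_schwarz[of "u + force lam u" v] crit gradient_ip[OF u v, of lam] u v by (simp add: force_in)

text \<open>
  Testing the first equation with \<open>u\<close> expresses \<open>ip u u\<close> by integrals of \<open>u\<close> and its potential, which do
  not see null sets.
\<close>

lemma critical_energy_cong_AE:
 assumes H: "u : H" "w : H" and crit: "nrm (u + force lam u) = 0" "nrm (w + force lam w) = 0"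
  and AE: "AE x in M. u x = w x & potential u x = potential w x"
 shows "energy lam u = energy lam w"
proof -
 have m: "k : borel_measurable M" if "integrable M k" for k :: "'a => real" using that by (rule borel_measurable_integrable)
 have 1: "(LINT x|M. F (u x)) = (LINT x|M. F (w x))"
  using AE by (intro integral_cong_AE m F_integrable H) (auto elim: eventually_mono)
 have 2: "(LINT x|M. f (u x) * u x) = (LINT x|M. f (w x) * w x)"
  using AE by (intro integral_cong_AE m f_integrable H) (auto elim: eventually_mono)
 have 3: "(LINT x|M. u x * potential u x * u x) = (LINT x|M. w x * potential w x * w x)"
  using AE by (intro integral_cong_AE m product_integrable potential_in H) (auto elim: eventually_mono)
 have 4: "ip (potential u) (potential u) = ip (potential w) (potential w)"
  using H 3 by (simp add: coupling_potential(1) coupling_ip)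
 have "ip u u = ip w w"
  using critical_point_equations[OF H(1,1) crit(1)] critical_point_equations[OF H(2,2) crit(2)] 2 3 by simp
 then show ?thesis using 1 4 by (simp add: energy_def)
qed

end

section \<open>Two weak solutions\<close>

context riemannian3
begin

text \<open>
  The only passage between the analysis on the manifold and the variational argument.
\<close>

lemma sobolev_like_H1:
 assumes r: "3 < r" "r < 6"
 shows "sobolev_like (H1 A g) sobolev_ip vol r"
proof -
 interpret semi_hilbert "H1 A g" sobolev_ip by (rule H1_semi_hilbert)
 interpret finite_measure vol by (rule vol_finite)
 have r2: "2 < r" using r(1) by simp
 have nrm: "(nrm u)^2 = sobolev_sq u (weak_gradient A g u)" if "u : H1 A g" for u
  using nrm_sq[OF that] sobolev_ip_self[OF H1_weak_grad[OF that]] by simp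
 have powr: "sobolev_sq u (weak_gradient A g u) powr (r / 2) = nrm u powr r" if "u : H1 A g" for u
  using nrm_nonneg[OF that] by (cases "nrm u = 0") (auto simp: nrm[OF that, symmetric] powr_powr simp flip: powr_numeral)
 show ?thesis
 proof unfold_locales
  show "3 < r" by (rule r(1))
  show "u : borel_measurable vol" if "u : H1 A g" for u
   using weak_grad_pre[OF H1_weak_grad[OF that]] measurable_cong_sets[OF sets_vol refl] unfolding pre_sobolev_def by blast
  show "(%_. a) : H1 A g" for a by (rule const_H1)
  show "0 < measure vol (space vol)" by (rule vol_pos)
  obtain C where C: "0 <= C" "!!u X. weak_grad u X ==> integrable vol (%p. abs (u p) powr r)"
   "!!u X. weak_grad u X ==> (LINT p|vol. abs (u p) powr r) <= C * sobolev_sq u X powr (r / 2)"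
   using sobolev_embedding[OF r2 r(2)] by blast
  have "integrable vol (%p. abs (u p) powr r) & (LINT p|vol. abs (u p) powr r) <= C * nrm u powr r" if "u : H1 A g" for u
   using C(2,3)[OF H1_weak_grad[OF that]] unfolding powr[OF that] by blast
  then show "EX C>=0. ALL u:H1 A g. integrable vol (%p. abs (u p) powr r) & (LINT p|vol. abs (u p) powr r) <= C * nrm u powr r"
   using C(1) by (intro exI[of _ C]) (rule conjI, assumption, rule ballI)
  fix \<sigma> :: "nat => 'a => real" and B
  assume \<sigma>: "!!n. \<sigma> n : H1 A g" and B: "!!n. nrm (\<sigma> n) <= B"
  show "EX s. strict_mono (s :: nat => nat) &
   (ALL eps>0. EX N. ALL i>=N. ALL j>=N. (LINT p|vol. abs (\<sigma> (s i) p - \<sigma> (s j) p) powr r) <= eps)"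
  proof (rule sobolev_compactness[OF r2 r(2) H1_weak_grad[OF \<sigma>]])
   show "sobolev_sq (\<sigma> n) (weak_gradient A g (\<sigma> n)) <= B^2" for n
    unfolding nrm[OF \<sigma>, symmetric] by (intro power_mono B nrm_nonneg \<sigma>)
  qed
 qed
qed

end

text \<open>
  The fundamental theorem of calculus for the interval integral that defines \<open>F\<close>.
\<close>

lemma antiderivative:
 fixes f F :: "real => real"
 assumes f: "continuous_on UNIV f" and F: "!!s. F s = (LBINT t=0..ereal s. f t)"
 shows "(F has_real_derivative f s) (at s)" "F 0 = 0"
proof -
 have c: "abs s + 1 > 0" by simp
 have "((%u. LBINT y=0..u. f y) has_vector_derivative f s) (at s within {-(abs s + 1)..abs s + 1})"
  using interval_integral_FTC2[of "-(abs s + 1)" 0 "abs s + 1" f s] continuous_on_subset[OF f, of "{-(abs s + 1)..abs s + 1}"]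
  by (simp add: zero_ereal_def)
 moreover have "s : interior {-(abs s + 1)..abs s + 1}" by (simp add: abs_if)
 ultimately have "((%u. LBINT y=0..u. f y) has_vector_derivative f s) (at s)"
  by (metis at_within_interior)
 then show "(F has_real_derivative f s) (at s)"
  unfolding F[abs_def] has_real_derivative_iff_has_vector_derivative by simp
 show "F 0 = 0" unfolding F by (simp add: zero_ereal_def)
qed

theorem theorem1p3:
  fixes A :: "('a::{t2_space, second_countable_topology}, 3) chart set"
    and g :: "('a, 3) chart \<Rightarrow> 'a \<Rightarrow> real ^ 3 ^ 3"
    and e q :: real
    and f F :: "real \<Rightarrow> real"
  assumes "compact_riemannian_manifold A g"
    and "e > 0" and "q > 0"
    and "continuous_on UNIV f"
    and "\<And>s. F s = (LBINT t=0..ereal s. f t)"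
    and "\<exists>C>0. \<exists>p. 2 < p \<and> p < 6 \<and> (\<forall>s. \<bar>f s\<bar> \<le> C * (1 + \<bar>s\<bar> powr (p - 1)))"
    and "\<exists>\<eta>>4. \<exists>\<tau>0>0. \<forall>s. \<bar>s\<bar> \<ge> \<tau>0 \<longrightarrow> 0 < \<eta> * F s \<and> \<eta> * F s \<le> s * f s"
  shows "\<exists>lam0>0. \<forall>lam. 0 < lam \<and> lam < lam0 \<longrightarrow>
    (\<exists>u1 \<phi>1 u2 \<phi>2.
       weak_solution A g e q f lam u1 \<phi>1 \<and> weak_solution A g e q f lam u2 \<phi>2 \<and>
       \<not> (AE x in volume_measure A g. u1 x = u2 x \<and> \<phi>1 x = \<phi>2 x))"
proof -
  interpret riemannian3 A g using assms(1) by (simp add: riemannian3_def)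
  obtain C p where p: "2 < p" "p < 6" "\<And>s. \<bar>f s\<bar> \<le> C * (1 + \<bar>s\<bar> powr (p - 1))" using assms(6) by blast
  obtain \<eta> \<tau> where AR: "\<eta> > 4" "\<tau> > 0" "\<And>s. \<bar>s\<bar> \<ge> \<tau> \<Longrightarrow> 0 < \<eta> * F s \<and> \<eta> * F s \<le> s * f s" using assms(7) by blast
  (* Any exponent between max p 5 and 6 exceeds 3 as well as p. *)
  define r where "r = (max p 5 + 6) / 2"
  have r: "3 < r" "r < 6" "p < r" using p(2) by (auto simp: r_def)
  interpret S: sobolev_like "H1 A g" sobolev_ip vol r by (rule sobolev_like_H1[OF r(1,2)])
  interpret S: schroedinger_maxwell "H1 A g" sobolev_ip vol r e q f F p C \<eta> \<tau>
  proof
    show "1 < p" using p(1) by simp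
    show "0 < F s \<and> \<eta> * F s \<le> s * f s" if "\<tau> \<le> \<bar>s\<bar>" for s using AR(3)[OF that] AR(1) by (simp add: zero_less_mult_iff)
  qed (use assms(2-4) antiderivative[OF assms(4,5)] r(3) p(3) AR(1,2) in auto)
  have sol: "weak_solution A g e q f lam u (S.potential u)"
    if u: "u \<in> H1 A g" and crit: "S.nrm (u + S.force lam u) = 0" for lam u
    unfolding weak_solution_def
  proof (intro conjI ballI u S.potential_in)
    let ?P = "S.potential u"
    fix v assume v: "v \<in> H1 A g"
    let ?w = "weak_gradient A g"
    note i = sobolev_ip_eq(2)[OF H1_weak_grad[OF u] H1_weak_grad[OF v]]
    have "(LINT p|vol. riem_inner A g (?w u) (?w v) p + u p * v p + e * u p * ?P p * v p)
      = (LINT p|vol. (riem_inner A g (?w u) (?w v) p + u p * v p) + e * (u p * ?P p * v p))"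
      by (simp add: mult.assoc)
    also have "\<dots> = sobolev_ip u v + e * (LINT p|vol. u p * ?P p * v p)"
      unfolding sobolev_ip_def[of u v] using i S.product_integrable[OF u S.potential_in[OF u] v]
      by (subst Bochner_Integration.integral_add) simp_all
    also have "\<dots> = lam * (LINT p|vol. f (u p) * v p)" by (rule S.critical_point_equations[OF u v crit])
    also have "\<dots> = (LINT p|vol. lam * f (u p) * v p)" by (simp add: mult.assoc)
    finally show "(LINT p|vol. riem_inner A g (?w u) (?w v) p + u p * v p + e * u p * ?P p * v p) = (LINT p|vol. lam * f (u p) * v p)" .
    show "(LINT p|vol. riem_inner A g (?w ?P) (?w v) p + ?P p * v p) = q * (LINT p|vol. (u p)\<^sup>2 * v p)"
      using S.potential_ip[OF u v] by (simp add: sobolev_ip_def[of ?P v] power2_eq_square)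
  qed
  obtain lam0 where lam0: "lam0 > 0" "\<And>lam. 0 < lam \<Longrightarrow> lam < lam0 \<Longrightarrow>
    \<exists>u\<in>H1 A g. \<exists>w\<in>H1 A g. S.nrm (u + S.force lam u) = 0 \<and> S.energy lam u \<le> 0 \<and>
       S.nrm (w + S.force lam w) = 0 \<and> 0 < S.energy lam w"
    using S.two_critical_points by blast
  have "\<exists>u1 \<phi>1 u2 \<phi>2. weak_solution A g e q f lam u1 \<phi>1 \<and> weak_solution A g e q f lam u2 \<phi>2 \<and>
       \<not> (AE x in vol. u1 x = u2 x \<and> \<phi>1 x = \<phi>2 x)" if lam: "0 < lam" "lam < lam0" for lam
  proof -
    obtain u w where u: "u \<in> H1 A g" "S.nrm (u + S.force lam u) = 0" "S.energy lam u \<le> 0"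
      and w: "w \<in> H1 A g" "S.nrm (w + S.force lam w) = 0" "0 < S.energy lam w"
      using lam0(2)[OF lam] by blast
    have "\<not> (AE x in vol. u x = w x \<and> S.potential u x = S.potential w x)"
      using S.critical_energy_cong_AE[OF u(1) w(1) u(2) w(2)] u(3) w(3) by linarith
    then show ?thesis using sol[OF u(1,2)] sol[OF w(1,2)] by blast
  qed
  then show ?thesis using lam0(1) by blast
qed

end
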